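(* Let $n\in\mathbb N$, $n\ge1$, and let $\Sigma=(\sigma_i\colon\mathbb F_n\to S_{d_i})_i$ be a sofic approximation of the free group $\mathbb F_n$ on $n$ letters. (a) The $\ell^p$-cohomology spaces of $\mathbb F_n$ satisfy $$\dim_{\Sigma,\ell^p}(H^1_{\ell^p}(\mathbb F_n),\mathbb F_n)=\underline{\dim}_{\Sigma,\ell^p}(H^1_{\ell^p}(\mathbb F_n),\mathbb F_n)=n-1\quad\text{for }1\le p\le2,$$ and $H^m_{\ell^p}(\mathbb F_n)=\{0\}$ for $m\ge2$. (b) The $\ell^p$-homology spaces of $\mathbb F_n$ satisfy $$\dim_{\Sigma,\ell^p}(H_1^{\ell^p}(\mathbb F_n),\mathbb F_n)=\underline{\dim}_{\Sigma,\ell^p}(H_1^{\ell^p}(\mathbb F_n),\mathbb F_n)=n-1\quad\text{for }1<p<2,$$ $$H_1^{\ell^1}(\mathbb F_n)=\ker(\partial)\cap\ell^1(E(\mathbb F_n))=\{0\},$$ and $H_m^{\ell^p}(\mathbb F_n)=\{0\}$ for $m\ge2$.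
   Context: All vector spaces are complex. Homology and cohomology: Let $a_1,\dots,a_n$ be free generators of $\mathbb F_n$ and let $G$ be the Cayley graph, a tree with vertex set $\mathbb F_n$ and edges joining $x$ and $xa_j$; $E(\mathbb F_n)$ is the set of ordered pairs $(x,y)$ of adjacent vertices. $G$ is viewed as a contractible $1$-dimensional complex $X$. $\ell^p(E(\mathbb F_n))$ is the space of $f\colon E(\mathbb F_n)\to\mathbb C$ with $f(x,y)=-f(y,x)$ and $\|f\|_p^p=\sum_{j=1}^n\sum_{x\in\mathbb F_n}|f(x,xa_j)|^p<\infty$ (sup norm if $p=\infty$). Define $\delta\colon\ell^p(\mathbb F_n)\to\ell^p(E(\mathbb F_n))$ by $(\delta f)(x,y)=f(y)-f(x)$ and $\partial\colon\ell^p(E(\mathbb F_n))\to\ell^p(\mathbb F_n)$ by $(\partial f)(x)=\sum_{j=1}^nf(x,xa_j)-\sum_{j=1}^nf(xa_j^{-1},x)$. In general, for a simplicial complex, $\ell^p(\Delta_m(X))$ is the space of antisymmetric $\ell^p$ functions on ordered $m$-simplices, $H^m_{\ell^p}$ is the kernel of the coboundary $\delta$ on $\ell^p(\Delta_m(X))$ modulo the closure of $\delta(\ell^p(\Delta_{m-1}(X)))$, and $H_m^{\ell^p}$ is the kernel of the boundary $\partial$ on $\ell^p(\Delta_m(X))$ modulo the closure of $\partial(\ell^p(\Delta_{m+1}(X)))$. Here $\Delta_m(X)=\emptyset$ for $m\ge2$, so $H^1_{\ell^p}(\mathbb F_n)=\ell^p(E(\mathbb F_n))/\overline{\delta(\ell^p(\mathbb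 F_n))}$ and $H_1^{\ell^p}(\mathbb F_n)=\ker(\partial)\cap\ell^p(E(\mathbb F_n))$. $\mathbb F_n$ acts isometrically by left translation, $(gf)(x,y)=f(g^{-1}x,g^{-1}y)$, hence on these spaces (with quotient and subspace norms). Sofic approximation of a countable group $\Gamma$: $d_{\mathrm{Hamm}}(\sigma,\tau)=\frac1d|\{j:\sigma(j)\ne\tau(j)\}|$ on $S_d$; a sofic approximation is a sequence of functions $\sigma_i\colon\Gamma\to S_{d_i}$ with $\sigma_i(e)=1$, $d_{\mathrm{Hamm}}(\sigma_i(gh),\sigma_i(g)\sigma_i(h))\to0$ for all $g,h$, and $d_{\mathrm{Hamm}}(\sigma_i(g),\sigma_i(h))\to1$ for $g\ne h$. Dimension: Put $V_i=\ell^p(\{1,\dots,d_i\})$ with $S_{d_i}$ acting by permutations, $(\sigma f)(j)=f(\sigma^{-1}(j))$. Let $\Gamma$ act on a separable Banach space $V$ by uniformly bounded linear operators. Let $S=(x_j)_{j=1}^\infty$ be a bounded sequence in $V$ with $\overline{\mathrm{span}}\{gx_j\}=V$. For $F\subseteq\Gamma$ finite with $e\in F$, $m\in\mathbb N$, $\delta>0$ let $V_{F,m}=\mathrm{span}\{g_1\cdots g_kx_j: g_1,\dots,g_k\in F,\ 1\le j,k\le m\}$ and let $\mathrm{Hom}_\Gamma(S,F,m,\delta,\sigma_i)$ be the set of linear maps $T\colon V_{F,m}\to V_i$ with $\|T\|\le1$ and $\|T(g_1\cdots g_kx_j)-\sigma_i(g_1)\cdots\sigma_i(g_k)T(x_j)\|<\delta$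 for all $g_1,\dots,g_k\in F$, $1\le j,k\le m$. Define $\alpha_S(T)\in\ell^\infty(\mathbb N,V_i)$ by $\alpha_S(T)(l)=T(x_l)$ for $l\le m$ and $0$ for $l>m$. A product norm is a norm $\rho$ on $\ell^\infty(\mathbb N)$ with $\rho(f)\le\rho(g)$ whenever $|f|\le|g|$ and which induces the topology of pointwise convergence on the $\|\cdot\|_\infty$-unit ball; $\rho_{V_i}(f)=\rho((\|f(l)\|)_l)$. $d_\varepsilon(A,\rho)$ is the smallest dimension of a linear subspace $W$ such that every $x\in A$ has some $w\in W$ with $\rho(x-w)<\varepsilon$. Then $$\dim_{\Sigma,\ell^p}(V,\Gamma)=\sup_{\varepsilon>0}\limsup_{(F,m,\delta)}\limsup_{i\to\infty}\frac1{d_i}d_\varepsilon\big(\alpha_S(\mathrm{Hom}_\Gamma(S,F,m,\delta,\sigma_i)),\rho_{V_i}\big),$$ and $\underline{\dim}_{\Sigma,\ell^p}(V,\Gamma)$ is the same with $\liminf_{i\to\infty}$ in place of $\limsup_{i\to\infty}$. Triples are directed by $(F,m,\delta)\le(F',m',\delta')$ iff $F\subseteq F'$, $m\le m'$, $\delta'\le\delta$, and $\limsup$ over the directed set means the infimum over $t_0$ of the supremum over $t\ge t_0$. It is known that both are independent of $S$ and $\rho$. *)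

theory Defs
  imports
    "HOL-Analysis.Analysis"
    "HOL-Algebra.Generated_Groups"
    "HOL-Combinatorics.Combinatorics"
    "HOL-Library.Function_Algebras"
begin

section \<open>Complex normed spaces on a carrier\<close>

text \<open>
  The spaces below depend on the parameter \<open>p\<close>, and some of them are quotients, so normed spaces
  are records on a carrier rather than types. Vectors outside the carrier are meaningless.
\<close>

record 'v cspace =
  vcarrier :: "'v set"
  vzero :: 'v
  vadd :: "'v \<Rightarrow> 'v \<Rightarrow> 'v"
  vscale :: "complex \<Rightarrow> 'v \<Rightarrow> 'v"
  vnorm :: "'v \<Rightarrow> real"

definition vdist :: "('v, 'z) cspace_scheme \<Rightarrow> 'v \<Rightarrow> 'v \<Rightarrow> real" where
  "vdist V u v = vnorm V (vadd V u (vscale V (-1) v))"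

inductive_set vspan :: "('v, 'z) cspace_scheme \<Rightarrow> 'v set \<Rightarrow> 'v set"
  for V :: "('v, 'z) cspace_scheme" and A :: "'v set" where
  zero: "vzero V \<in> vspan V A"
| step: "x \<in> A \<Longrightarrow> v \<in> vspan V A \<Longrightarrow> vadd V (vscale V c x) v \<in> vspan V A"

definition vclosure :: "('v, 'z) cspace_scheme \<Rightarrow> 'v set \<Rightarrow> 'v set" where
  "vclosure V A = {v \<in> vcarrier V. \<forall>e>0. \<exists>u\<in>A. vdist V v u < e}"

definition vcoset :: "('v, 'z) cspace_scheme \<Rightarrow> 'v set \<Rightarrow> 'v \<Rightarrow> 'v set" where
  "vcoset V N v = vadd V v ` N"

text \<open>
  The normed quotient by a closed subspace \<open>N\<close>. In the scalar multiplication \<open>N\<close> is added again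
  because \<open>0 * A\<close>, taken elementwise, would be \<open>{0}\<close> instead of \<open>N\<close>.
\<close>

definition vquotient :: "('v, 'z) cspace_scheme \<Rightarrow> 'v set \<Rightarrow> 'v set cspace" where
  "vquotient V N =
    \<lparr>vcarrier = vcoset V N ` vcarrier V,
     vzero = vcoset V N (vzero V),
     vadd = (\<lambda>A B. {vadd V a b | a b. a \<in> A \<and> b \<in> B}),
     vscale = (\<lambda>c A. {vadd V (vscale V c a) b | a b. a \<in> A \<and> b \<in> N}),
     vnorm = (\<lambda>A. Inf (vnorm V ` A))\<rparr>"

definition lp_summable :: "ereal \<Rightarrow> 'x set \<Rightarrow> ('x \<Rightarrow> complex) \<Rightarrow> bool" where
  "lp_summable p X f \<longleftrightarrow>
    (if p = \<infinity> then bdd_above ((\<lambda>x. cmod (f x)) ` X)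
     else (\<lambda>x. cmod (f x) powr real_of_ereal p) summable_on X)"

text \<open>The value \<open>0\<close> is inserted into the supremum only to cover \<open>X = {}\<close>.\<close>

definition lp_norm :: "ereal \<Rightarrow> 'x set \<Rightarrow> ('x \<Rightarrow> complex) \<Rightarrow> real" where
  "lp_norm p X f =
    (if p = \<infinity> then Sup (insert 0 ((\<lambda>x. cmod (f x)) ` X))
     else (\<Sum>\<^sub>\<infinity>x\<in>X. cmod (f x) powr real_of_ereal p) powr (1 / real_of_ereal p))"


section \<open>Simplicial chains and cochains\<close>

text \<open>
  A simplicial complex is given by its set \<open>K\<close> of nonempty finite simplices. The index \<open>k\<close> below
  is the number of vertices, so that ordered \<open>m\<close>-simplices are lists of length \<open>m + 1\<close>
  and \<open>k = 0\<close> gives no simplices at all. (Co)chains vanish outside the ordered simplices.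
\<close>

definition osimp :: "'x set set \<Rightarrow> nat \<Rightarrow> 'x list set" where
  "osimp K k = {xs. length xs = k \<and> distinct xs \<and> set xs \<in> K}"

definition antisymmetric :: "'x set set \<Rightarrow> nat \<Rightarrow> ('x list \<Rightarrow> complex) \<Rightarrow> bool" where
  "antisymmetric K k f \<longleftrightarrow>
    (\<forall>xs\<in>osimp K k. \<forall>q. q permutes {..<k} \<longrightarrow> f (permute_list q xs) = of_int (sign q) * f xs)"

text \<open>
  Each of the \<open>fact k\<close> orderings of a simplex contributes equally to the sum over
  \<open>osimp K k\<close>; dividing by \<open>fact k powr (1/p)\<close> counts every simplex once. For \<open>p = \<infinity>\<close> the
  divisor is \<open>fact k powr (1/0) = 1\<close>.
\<close>

definition lp_chains :: "ereal \<Rightarrow> 'x set set \<Rightarrow> nat \<Rightarrow> ('x list \<Rightarrow> complex) cspace" where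
  "lp_chains p K k =
    \<lparr>vcarrier = {f. (\<forall>xs. xs \<notin> osimp K k \<longrightarrow> f xs = 0) \<and> antisymmetric K k f
                  \<and> lp_summable p (osimp K k) f},
     vzero = (\<lambda>_. 0),
     vadd = (\<lambda>f g xs. f xs + g xs),
     vscale = (\<lambda>c f xs. c * f xs),
     vnorm = (\<lambda>f. lp_norm p (osimp K k) f / fact k powr (1 / real_of_ereal p))\<rparr>"

definition coboundary :: "'x set set \<Rightarrow> nat \<Rightarrow> ('x list \<Rightarrow> complex) \<Rightarrow> 'x list \<Rightarrow> complex" where
  "coboundary K k f xs =
    (if xs \<in> osimp K (Suc k)
     then \<Sum>i<Suc k. (-1) ^ i * f (take i xs @ drop (Suc i) xs) else 0)"

text \<open>
  The new vertex is put last. For graphs this is the sum of the outgoing minus the sum of the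
  incoming values; putting it first changes the sign by \<open>(-1) ^ k\<close> only.
\<close>

definition boundary :: "'x set set \<Rightarrow> nat \<Rightarrow> ('x list \<Rightarrow> complex) \<Rightarrow> 'x list \<Rightarrow> complex" where
  "boundary K k f xs =
    (if xs \<in> osimp K k
     then \<Sum>y | xs @ [y] \<in> osimp K (Suc k). f (xs @ [y]) else 0)"

definition cocycles :: "ereal \<Rightarrow> 'x set set \<Rightarrow> nat \<Rightarrow> ('x list \<Rightarrow> complex) set" where
  "cocycles p K m = {f \<in> vcarrier (lp_chains p K (Suc m)). coboundary K (Suc m) f = (\<lambda>_. 0)}"

definition cycles :: "ereal \<Rightarrow> 'x set set \<Rightarrow> nat \<Rightarrow> ('x list \<Rightarrow> complex) set" where
  "cycles p K m = {f \<in> vcarrier (lp_chains p K (Suc m)). boundary K m f = (\<lambda>_. 0)}"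

definition lp_cohomology :: "ereal \<Rightarrow> 'x set set \<Rightarrow> nat \<Rightarrow> ('x list \<Rightarrow> complex) set cspace" where
  "lp_cohomology p K m =
    vquotient ((lp_chains p K (Suc m))\<lparr>vcarrier := cocycles p K m\<rparr>)
      (vclosure (lp_chains p K (Suc m)) (coboundary K m ` vcarrier (lp_chains p K m)))"

definition lp_homology :: "ereal \<Rightarrow> 'x set set \<Rightarrow> nat \<Rightarrow> ('x list \<Rightarrow> complex) set cspace" where
  "lp_homology p K m =
    vquotient ((lp_chains p K (Suc m))\<lparr>vcarrier := cycles p K m\<rparr>)
      (vclosure (lp_chains p K (Suc m))
        (boundary K (Suc m) ` vcarrier (lp_chains p K (Suc (Suc m)))))"


section \<open>Free groups and their Cayley trees\<close>

text \<open>Words are lists of letters; \<open>(j, True)\<close> stands for \<open>a\<^sub>j\<close> and \<open>(j, False)\<close> for its inverse.\<close>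

definition word_value :: "('g, 'b) monoid_scheme \<Rightarrow> (nat \<Rightarrow> 'g) \<Rightarrow> (nat \<times> bool) list \<Rightarrow> 'g" where
  "word_value G a w =
    foldr (\<lambda>(j, b) x. (if b then a j else inv\<^bsub>G\<^esub> a j) \<otimes>\<^bsub>G\<^esub> x) w \<one>\<^bsub>G\<^esub>"

definition reduced_word :: "(nat \<times> bool) list \<Rightarrow> bool" where
  "reduced_word w \<longleftrightarrow> successively (\<lambda>(i, b) (j, c). i = j \<longrightarrow> b = c) w"

definition free_generators :: "('g, 'b) monoid_scheme \<Rightarrow> nat \<Rightarrow> (nat \<Rightarrow> 'g) \<Rightarrow> bool" where
  "free_generators G n a \<longleftrightarrow>
    group G \<and> a ` {1..n} \<subseteq> carrier G \<and> generate G (a ` {1..n}) = carrier G \<and>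
    (\<forall>w. w \<noteq> [] \<and> fst ` set w \<subseteq> {1..n} \<and> reduced_word w \<longrightarrow> word_value G a w \<noteq> \<one>\<^bsub>G\<^esub>)"

definition cayley_complex :: "('g, 'b) monoid_scheme \<Rightarrow> nat \<Rightarrow> (nat \<Rightarrow> 'g) \<Rightarrow> 'g set set" where
  "cayley_complex G n a =
    {{x} | x. x \<in> carrier G} \<union> {{x, x \<otimes>\<^bsub>G\<^esub> a j} | x j. x \<in> carrier G \<and> j \<in> {1..n}}"

definition chain_act ::
    "('g, 'b) monoid_scheme \<Rightarrow> 'g \<Rightarrow> ('g list \<Rightarrow> complex) \<Rightarrow> 'g list \<Rightarrow> complex" where
  "chain_act G g f xs =
    (if set xs \<subseteq> carrier G then f (map (\<lambda>x. inv\<^bsub>G\<^esub> g \<otimes>\<^bsub>G\<^esub> x) xs) else 0)"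

definition quotient_act :: "('g \<Rightarrow> 'v \<Rightarrow> 'v) \<Rightarrow> 'g \<Rightarrow> 'v set \<Rightarrow> 'v set" where
  "quotient_act act g A = act g ` A"


text \<open>
  In degree one the definitions specialise to the usual formulas on the edges \<open>(x, x a\<^sub>j)\<close>, and
  the cycles need no quotient: the classes in \<open>lp_homology p (cayley_complex G n a) 1\<close> are the
  singletons of cycles.
\<close>

lemma free_generators_distinct:
  assumes "free_generators G n a" "i \<in> {1..n}" "j \<in> {1..n}"
  shows "a i \<noteq> \<one>\<^bsub>G\<^esub>" and "a i \<noteq> inv\<^bsub>G\<^esub> a j" and "a i = a j \<Longrightarrow> i = j"
proof -
  interpret group G using assms(1) by (simp add: free_generators_def)
  have c: "a i \<in> carrier G" "a j \<in> carrier G"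
    using assms by (auto simp: free_generators_def)
  have w: "word_value G a w \<noteq> \<one>\<^bsub>G\<^esub>"
    if "w \<noteq> []" "fst ` set w \<subseteq> {1..n}" "reduced_word w" for w
    using assms(1) that by (simp add: free_generators_def)
  show "a i \<noteq> \<one>\<^bsub>G\<^esub>"
    using w[of "[(i, True)]"] c assms by (auto simp: word_value_def reduced_word_def)
  show "a i \<noteq> inv\<^bsub>G\<^esub> a j"
    using w[of "[(i, True), (j, True)]"] c assms
    by (auto simp: word_value_def reduced_word_def l_inv)
  show "i = j" if "a i = a j"
    using w[of "[(i, True), (j, False)]"] c assms that
    by (auto simp: word_value_def reduced_word_def)
qed

lemma osimp_cayley_2:
  assumes "free_generators G n a"
  shows "osimp (cayley_complex G n a) 2 =
    (\<lambda>(x, j). [x, x \<otimes>\<^bsub>G\<^esub> a j]) ` (carrier G \<times> {1..n}) \<union>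
    (\<lambda>(x, j). [x \<otimes>\<^bsub>G\<^esub> a j, x]) ` (carrier G \<times> {1..n})"
    (is "?L = ?R")
proof -
  interpret group G using assms by (simp add: free_generators_def)
  have c: "a j \<in> carrier G" if "j \<in> {1..n}" for j
    using assms that by (auto simp: free_generators_def)
  show ?thesis
  proof
    show "?R \<subseteq> ?L"
      using free_generators_distinct(1)[OF assms] c
      by (auto simp: osimp_def cayley_complex_def insert_commute numeral_2_eq_2)
    show "?L \<subseteq> ?R"
    proof
      fix xs assume "xs \<in> ?L"
      then obtain u v where xs: "xs = [u, v]" "u \<noteq> v" "{u, v} \<in> cayley_complex G n a"
        by (auto simp: osimp_def numeral_2_eq_2 length_Suc_conv)
      then obtain x j where "x \<in> carrier G" "j \<in> {1..n}" "{u, v} = {x, x \<otimes>\<^bsub>G\<^esub> a j}"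
        by (auto simp: cayley_complex_def doubleton_eq_iff)
      then show "xs \<in> ?R"
        using xs by (force simp: doubleton_eq_iff)
    qed
  qed
qed

lemma osimp_cayley_empty:
  assumes "3 \<le> k"
  shows "osimp (cayley_complex G n a) k = {}"
proof -
  have "card s \<le> 2" if "s \<in> cayley_complex G n a" for s
    using that by (auto simp: cayley_complex_def card_insert_if)
  then show ?thesis
    using assms by (fastforce simp: osimp_def dest: distinct_card)
qed

lemma antisymmetric_swap:
  assumes "antisymmetric K 2 f" "[x, y] \<in> osimp K 2"
  shows "f [y, x] = - f [x, y]"
proof -
  have "Transposition.transpose 0 1 permutes {..<2::nat}" by (intro permutes_swap_id) auto
  then have "f (permute_list (Transposition.transpose 0 1) [x, y]) = of_int (sign (Transposition.transpose 0 (1::nat))) * f [x, y]"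
    using assms unfolding antisymmetric_def by blast
  then show ?thesis
    by (simp add: permute_list_def sign_swap_id upt_rec Transposition.transpose_def)
qed

lemma coboundary_edge:
  "[x, y] \<in> osimp K 2 \<Longrightarrow> coboundary K 1 f [x, y] = f [y] - f [x]"
  by (simp add: coboundary_def numeral_2_eq_2)

lemma boundary_vertex:
  assumes "free_generators G n a" "antisymmetric (cayley_complex G n a) 2 f" "x \<in> carrier G"
  shows "boundary (cayley_complex G n a) 1 f [x] =
    (\<Sum>j=1..n. f [x, x \<otimes>\<^bsub>G\<^esub> a j]) - (\<Sum>j=1..n. f [x \<otimes>\<^bsub>G\<^esub> inv\<^bsub>G\<^esub> a j, x])"
proof -
  interpret group G using assms by (simp add: free_generators_def)
  note d = free_generators_distinct[OF assms(1)]
  let ?K = "cayley_complex G n a"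
  have c: "a j \<in> carrier G" if "j \<in> {1..n}" for j
    using assms that by (auto simp: free_generators_def)
  let ?A = "(\<lambda>j. x \<otimes>\<^bsub>G\<^esub> a j) ` {1..n}" and ?B = "(\<lambda>j. x \<otimes>\<^bsub>G\<^esub> inv\<^bsub>G\<^esub> a j) ` {1..n}"
  have in2: "[x \<otimes>\<^bsub>G\<^esub> inv\<^bsub>G\<^esub> a j, x] \<in> osimp ?K 2" if "j \<in> {1..n}" for j
  proof -
    have "x = (x \<otimes>\<^bsub>G\<^esub> inv\<^bsub>G\<^esub> a j) \<otimes>\<^bsub>G\<^esub> a j" "x \<otimes>\<^bsub>G\<^esub> inv\<^bsub>G\<^esub> a j \<in> carrier G"
      using c[OF that] assms(3) by (auto simp: m_assoc)
    then show ?thesis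
      unfolding osimp_cayley_2[OF assms(1)] using that by (force simp: image_iff)
  qed
  have "{y. [x, y] \<in> osimp ?K 2} = ?A \<union> ?B"
  proof (intro equalityI subsetI)
    fix y assume "y \<in> {y. [x, y] \<in> osimp ?K 2}"
    then consider j where "j \<in> {1..n}" "y = x \<otimes>\<^bsub>G\<^esub> a j"
      | j where "j \<in> {1..n}" "x = y \<otimes>\<^bsub>G\<^esub> a j" "y \<in> carrier G"
      unfolding osimp_cayley_2[OF assms(1)] by auto
    then show "y \<in> ?A \<union> ?B"
    proof cases
      case 2
      then have "y = x \<otimes>\<^bsub>G\<^esub> inv\<^bsub>G\<^esub> a j" using c by (simp add: m_assoc)
      then show ?thesis using 2 by blast
    qed auto
  next
    fix y assume "y \<in> ?A \<union> ?B"
    then show "y \<in> {y. [x, y] \<in> osimp ?K 2}"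
    proof
      assume "y \<in> ?A" then show ?thesis
        unfolding osimp_cayley_2[OF assms(1)] using assms(3) by auto
    next
      assume "y \<in> ?B"
      then obtain j where j: "j \<in> {1..n}" "y = x \<otimes>\<^bsub>G\<^esub> inv\<^bsub>G\<^esub> a j" by blast
      show ?thesis using in2[OF j(1)] unfolding j(2)[symmetric]
        by (auto simp: osimp_def insert_commute)
    qed
  qed
  moreover have "?A \<inter> ?B = {}" using d(2) c assms(3) by auto
  moreover have "inj_on (\<lambda>j. x \<otimes>\<^bsub>G\<^esub> a j) {1..n}"
    using d(3) c assms(3) by (auto simp: inj_on_def)
  moreover have "inj_on (\<lambda>j. x \<otimes>\<^bsub>G\<^esub> inv\<^bsub>G\<^esub> a j) {1..n}"
    using d(3) c assms(3) by (auto simp: inj_on_def inj_on_eq_iff[OF inv_inj])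
  ultimately have "(\<Sum>y | [x, y] \<in> osimp ?K 2. f [x, y]) =
      (\<Sum>j=1..n. f [x, x \<otimes>\<^bsub>G\<^esub> a j]) + (\<Sum>j=1..n. f [x, x \<otimes>\<^bsub>G\<^esub> inv\<^bsub>G\<^esub> a j])"
    by (simp add: sum.union_disjoint sum.reindex)
  also have "(\<Sum>j=1..n. f [x, x \<otimes>\<^bsub>G\<^esub> inv\<^bsub>G\<^esub> a j]) = - (\<Sum>j=1..n. f [x \<otimes>\<^bsub>G\<^esub> inv\<^bsub>G\<^esub> a j, x])"
    unfolding sum_negf[symmetric]
    by (intro sum.cong refl antisymmetric_swap[OF assms(2)] in2)
  finally show ?thesis
    using assms(3) by (auto simp: boundary_def numeral_2_eq_2 osimp_def cayley_complex_def)
qed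

lemma edge_norm:
  assumes "free_generators G n a" "1 \<le> p" "p < \<infinity>"
    and "f \<in> vcarrier (lp_chains p (cayley_complex G n a) 2)"
  shows "vnorm (lp_chains p (cayley_complex G n a) 2) f =
    (\<Sum>\<^sub>\<infinity>(x, j)\<in>carrier G \<times> {1..n}. cmod (f [x, x \<otimes>\<^bsub>G\<^esub> a j]) powr real_of_ereal p)
      powr (1 / real_of_ereal p)"
proof -
  interpret group G using assms by (simp add: free_generators_def)
  note d = free_generators_distinct[OF assms(1)]
  let ?K = "cayley_complex G n a" and ?I = "carrier G \<times> {1..n}"
  let ?h = "\<lambda>xs. cmod (f xs) powr real_of_ereal p"
  let ?e = "\<lambda>(x, j). [x, x \<otimes>\<^bsub>G\<^esub> a j]" and ?e' = "\<lambda>(x, j). [x \<otimes>\<^bsub>G\<^esub> a j, x]"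
  have c: "a j \<in> carrier G" if "j \<in> {1..n}" for j
    using assms that by (auto simp: free_generators_def)
  have inj: "inj_on ?e ?I" "inj_on ?e' ?I"
    using d(3) c by (auto simp: inj_on_def)
  have disj: "?e ` ?I \<inter> ?e' ` ?I = {}"
  proof -
    have False if x: "x \<in> carrier G" and ij: "i \<in> {1..n}" "j \<in> {1..n}"
      and e: "x = (x \<otimes>\<^bsub>G\<^esub> a i) \<otimes>\<^bsub>G\<^esub> a j" for x i j
    proof -
      have "a i \<otimes>\<^bsub>G\<^esub> a j = \<one>\<^bsub>G\<^esub>"
        using e x c[OF ij(1)] c[OF ij(2)] by (metis m_assoc m_closed l_cancel_one')
      then have "a i = inv\<^bsub>G\<^esub> a j"
        using c[OF ij(1)] c[OF ij(2)] by (simp add: inv_equality)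
      then show False using d(2)[OF ij] by simp
    qed
    then show ?thesis by fastforce
  qed
  have sum: "?h summable_on (?e ` ?I \<union> ?e' ` ?I)"
    using assms by (auto simp: lp_chains_def lp_summable_def osimp_cayley_2[OF assms(1)])
  have sym: "?h (?e' t) = ?h (?e t)" if "t \<in> ?I" for t
  proof -
    obtain x j where t: "t = (x, j)" by (cases t)
    have "[x, x \<otimes>\<^bsub>G\<^esub> a j] \<in> osimp ?K 2"
      using that t unfolding osimp_cayley_2[OF assms(1)] by auto
    then show ?thesis
      using antisymmetric_swap[of ?K f] assms(4) t by (simp add: lp_chains_def)
  qed
  have "infsum ?h (osimp ?K 2) = infsum ?h (?e ` ?I) + infsum ?h (?e' ` ?I)"
    unfolding osimp_cayley_2[OF assms(1)]
    by (intro infsum_Un_disjoint disj summable_on_subset_banach[OF sum]) auto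
  also have "infsum ?h (?e' ` ?I) = infsum ?h (?e ` ?I)"
    unfolding infsum_reindex[OF inj(1)] infsum_reindex[OF inj(2)]
    by (intro infsum_cong) (simp add: sym)
  finally have "infsum ?h (osimp ?K 2) = 2 * infsum (?h \<circ> ?e) ?I"
    unfolding infsum_reindex[OF inj(1)] by linarith
  moreover have "0 \<le> infsum (?h \<circ> ?e) ?I" by (intro infsum_nonneg) auto
  ultimately show ?thesis
    using assms(3) by (simp add: lp_chains_def lp_norm_def powr_mult o_def case_prod_unfold)
qed

lemma lp_norm_eq_0:
  assumes "1 \<le> p" "lp_summable p X f" "lp_norm p X f = 0" "x \<in> X"
  shows "f x = 0"
proof (cases "p = \<infinity>")
  case True
  then have "cmod (f x) \<le> lp_norm p X f"
    using assms(2,4) unfolding lp_norm_def lp_summable_def by (auto intro!: cSup_upper)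
  then show ?thesis using assms by simp
next
  case False
  let ?h = "\<lambda>x. cmod (f x) powr real_of_ereal p"
  have "?h summable_on X" "infsum ?h X = 0"
    using assms False by (auto simp: lp_norm_def lp_summable_def)
  then have "?h x = 0" using nonneg_infsum_le_0D[of ?h X x] assms(4) by simp
  then show ?thesis by simp
qed

lemma lp_homology_cayley_1:
  assumes "1 \<le> p"
  shows "vcarrier (lp_homology p (cayley_complex G n a) 1) = (\<lambda>f. {f}) ` cycles p (cayley_complex G n a) 1"
    and "vnorm (lp_homology p (cayley_complex G n a) 1) {f} = vnorm (lp_chains p (cayley_complex G n a) 2) f"
proof -
  let ?K = "cayley_complex G n a"
  let ?C = "lp_chains p ?K 2"
  have "vcarrier (lp_chains p ?K 3) = {\<lambda>_. 0}"
    by (auto simp: lp_chains_def osimp_cayley_empty antisymmetric_def lp_summable_def)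
  moreover have "boundary ?K 2 (\<lambda>_. 0) = (\<lambda>_. 0)"
    by (auto simp: boundary_def)
  moreover have "vclosure ?C {\<lambda>_. 0} = {\<lambda>_. 0}"
  proof -
    have 1: "f = (\<lambda>_. 0)" if f: "f \<in> vcarrier ?C" "\<forall>e>0. vnorm ?C f < e" for f
    proof
      fix xs
      have "bdd_above ((\<lambda>x. cmod (f x)) ` osimp ?K 2)" if "p = \<infinity>"
        using f(1) that by (simp add: lp_chains_def lp_summable_def)
      then have "0 \<le> lp_norm p (osimp ?K 2) f"
        unfolding lp_norm_def by (auto intro!: cSup_upper)
      then have "0 \<le> vnorm ?C f" by (simp add: lp_chains_def)
      then have "vnorm ?C f = 0"
        using f(2)[rule_format, of "vnorm ?C f"] by linarith
      then have "lp_norm p (osimp ?K 2) f = 0" by (simp add: lp_chains_def)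
      then show "f xs = 0"
        using f(1) lp_norm_eq_0[OF assms, of "osimp ?K 2" f xs]
        by (cases "xs \<in> osimp ?K 2") (auto simp: lp_chains_def)
    qed
    have 2: "(\<lambda>_. 0) \<in> vcarrier ?C"
      by (auto simp: lp_chains_def antisymmetric_def lp_summable_def)
    have 3: "vnorm ?C (\<lambda>_. 0) = 0"
      by (auto simp: lp_chains_def lp_norm_def image_constant_conv)
    have 4: "vdist ?C f (\<lambda>_. 0) = vnorm ?C f" for f
      by (simp add: vdist_def) (simp add: lp_chains_def)
    show ?thesis
    proof (intro equalityI subsetI)
      fix f assume "f \<in> vclosure ?C {\<lambda>_. 0}"
      then have "f \<in> vcarrier ?C" "\<forall>e>0. vnorm ?C f < e"
        unfolding vclosure_def mem_Collect_eq bex_simps 4 by simp_all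
      then show "f \<in> {\<lambda>_. 0}" using 1 by blast
    next
      fix f :: "'a list \<Rightarrow> complex" assume "f \<in> {\<lambda>_. 0}"
      then have f: "f = (\<lambda>_. 0)" by simp
      show "f \<in> vclosure ?C {\<lambda>_. 0}"
        unfolding vclosure_def mem_Collect_eq f using 2 3 4 by (metis insertI1)
    qed
  qed
  ultimately have N: "vclosure (lp_chains p ?K 2) (boundary ?K 2 ` vcarrier (lp_chains p ?K 3)) = {\<lambda>_. 0}"
    by simp
  have H: "lp_homology p ?K 1 = vquotient (?C\<lparr>vcarrier := cycles p ?K 1\<rparr>) {\<lambda>_. 0}"
    using N unfolding lp_homology_def by (simp only: One_nat_def numeral_2_eq_2 numeral_3_eq_3)
  have co: "vcoset (?C\<lparr>vcarrier := cycles p ?K 1\<rparr>) {\<lambda>_. 0} f = {f}" for f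
    by (simp add: vcoset_def lp_chains_def)
  show "vcarrier (lp_homology p ?K 1) = (\<lambda>f. {f}) ` cycles p ?K 1"
    unfolding H vquotient_def by (simp add: co[simplified])
  show "vnorm (lp_homology p ?K 1) {f} = vnorm ?C f"
    unfolding H vquotient_def by simp
qed


section \<open>Sofic approximations\<close>

definition hamming :: "nat \<Rightarrow> (nat \<Rightarrow> nat) \<Rightarrow> (nat \<Rightarrow> nat) \<Rightarrow> real" where
  "hamming d s t = real (card {j \<in> {1..d}. s j \<noteq> t j}) / real d"

definition sofic_approximation ::
    "('g, 'b) monoid_scheme \<Rightarrow> (nat \<Rightarrow> nat) \<Rightarrow> (nat \<Rightarrow> 'g \<Rightarrow> nat \<Rightarrow> nat) \<Rightarrow> bool" where
  "sofic_approximation G d \<sigma> \<longleftrightarrow>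
    (\<forall>i. \<forall>g\<in>carrier G. \<sigma> i g permutes {1..d i}) \<and>
    (\<forall>i. \<sigma> i \<one>\<^bsub>G\<^esub> = id) \<and>
    (\<forall>g\<in>carrier G. \<forall>h\<in>carrier G.
      (\<lambda>i. hamming (d i) (\<sigma> i (g \<otimes>\<^bsub>G\<^esub> h)) (\<sigma> i g \<circ> \<sigma> i h)) \<longlonglongrightarrow> 0) \<and>
    (\<forall>g\<in>carrier G. \<forall>h\<in>carrier G. g \<noteq> h \<longrightarrow>
      (\<lambda>i. hamming (d i) (\<sigma> i g) (\<sigma> i h)) \<longlonglongrightarrow> 1)"


section \<open>The dimension\<close>

text \<open>
  Vectors in \<open>V\<^sub>i = \<ell>\<^sup>p({1,\<dots>,d})\<close> are functions on \<open>nat\<close> vanishing outside \<open>{1..d}\<close>. The index set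
  of the sequences \<open>(x\<^sub>j)\<close> and of \<open>\<ell>\<^sup>\<infinity>(\<nat>)\<close> is shifted by one: \<open>1 \<le> j \<le> m\<close> becomes \<open>j < m\<close>.
\<close>

definition fin_carrier :: "nat \<Rightarrow> (nat \<Rightarrow> complex) set" where
  "fin_carrier d = {v. \<forall>j. j \<notin> {1..d} \<longrightarrow> v j = 0}"

definition perm_act :: "(nat \<Rightarrow> nat) \<Rightarrow> (nat \<Rightarrow> complex) \<Rightarrow> nat \<Rightarrow> complex" where
  "perm_act s v = (\<lambda>j. v (inv_into UNIV s j))"

definition linf_seqs :: "ereal \<Rightarrow> nat \<Rightarrow> (nat \<Rightarrow> nat \<Rightarrow> complex) set" where
  "linf_seqs p d =
    {f. (\<forall>l. f l \<in> fin_carrier d) \<and> (\<exists>C. \<forall>l. lp_norm p {1..d} (f l) \<le> C)}"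

definition product_norm :: "((nat \<Rightarrow> complex) \<Rightarrow> real) \<Rightarrow> bool" where
  "product_norm \<rho> \<longleftrightarrow>
    (let L = {f. bounded (range f)}; B = {f. \<forall>l. cmod (f l) \<le> 1} in
      (\<forall>f\<in>L. 0 \<le> \<rho> f \<and> (\<rho> f = 0 \<longleftrightarrow> f = (\<lambda>_. 0))) \<and>
      (\<forall>f\<in>L. \<forall>c. \<rho> (\<lambda>l. c * f l) = cmod c * \<rho> f) \<and>
      (\<forall>f\<in>L. \<forall>g\<in>L. \<rho> (\<lambda>l. f l + g l) \<le> \<rho> f + \<rho> g) \<and>
      (\<forall>f\<in>L. \<forall>g\<in>L. (\<forall>l. cmod (f l) \<le> cmod (g l)) \<longrightarrow> \<rho> f \<le> \<rho> g) \<and>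
      (\<forall>U. openin (top_of_set B) U \<longleftrightarrow>
        U \<subseteq> B \<and> (\<forall>f\<in>U. \<exists>e>0. \<forall>g\<in>B. \<rho> (\<lambda>l. g l - f l) < e \<longrightarrow> g \<in> U)))"

text \<open>
  In \<open>product_norm\<close> the topology on \<open>nat \<Rightarrow> complex\<close> is the product topology, i.e.
  pointwise convergence.
\<close>

definition seq_norm ::
    "ereal \<Rightarrow> nat \<Rightarrow> ((nat \<Rightarrow> complex) \<Rightarrow> real) \<Rightarrow> (nat \<Rightarrow> nat \<Rightarrow> complex) \<Rightarrow> real" where
  "seq_norm p d \<rho> f = \<rho> (\<lambda>l. complex_of_real (lp_norm p {1..d} (f l)))"

definition seq_scale :: "complex \<Rightarrow> (nat \<Rightarrow> nat \<Rightarrow> complex) \<Rightarrow> nat \<Rightarrow> nat \<Rightarrow> complex" where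
  "seq_scale c f = (\<lambda>l j. c * f l j)"

interpretation seq: vector_space seq_scale
  by unfold_locales (auto simp: seq_scale_def fun_eq_iff algebra_simps)

text \<open>
  The finite spanning set is required since \<open>seq.dim\<close> is \<open>0\<close> on infinite-dimensional spaces.
\<close>

definition eps_dim :: "ereal \<Rightarrow> nat \<Rightarrow> ((nat \<Rightarrow> complex) \<Rightarrow> real) \<Rightarrow> real \<Rightarrow>
    (nat \<Rightarrow> nat \<Rightarrow> complex) set \<Rightarrow> ereal" where
  "eps_dim p d \<rho> \<epsilon> A =
    (INF W \<in> {W. seq.subspace W \<and> W \<subseteq> linf_seqs p d \<and> (\<exists>B. finite B \<and> seq.span B = W) \<and>
                 (\<forall>x\<in>A. \<exists>w\<in>W. seq_norm p d \<rho> (x - w) < \<epsilon>)}.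
      ereal (real (seq.dim W)))"

definition generating_sequence ::
    "('g, 'b) monoid_scheme \<Rightarrow> 'v cspace \<Rightarrow> ('g \<Rightarrow> 'v \<Rightarrow> 'v) \<Rightarrow> (nat \<Rightarrow> 'v) \<Rightarrow> bool" where
  "generating_sequence G V act S \<longleftrightarrow>
    range S \<subseteq> vcarrier V \<and> (\<exists>C. \<forall>j. vnorm V (S j) \<le> C) \<and>
    vclosure V (vspan V {act g (S j) | g j. g \<in> carrier G}) = vcarrier V"

definition orbit_span ::
    "'v cspace \<Rightarrow> ('g \<Rightarrow> 'v \<Rightarrow> 'v) \<Rightarrow> (nat \<Rightarrow> 'v) \<Rightarrow> 'g set \<Rightarrow> nat \<Rightarrow> 'v set" where
  "orbit_span V act S F m =
    vspan V {foldr act gs (S j) | gs j. set gs \<subseteq> F \<and> length gs \<in> {1..m} \<and> j < m}"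

text \<open>
  An operator is represented by a function on all of \<open>'v\<close>, but only its values on
  \<open>orbit_span V act S F m\<close> matter.
\<close>

definition almost_hom :: "ereal \<Rightarrow> 'v cspace \<Rightarrow> ('g \<Rightarrow> 'v \<Rightarrow> 'v) \<Rightarrow> nat \<Rightarrow> ('g \<Rightarrow> nat \<Rightarrow> nat) \<Rightarrow>
    (nat \<Rightarrow> 'v) \<Rightarrow> 'g set \<Rightarrow> nat \<Rightarrow> real \<Rightarrow> ('v \<Rightarrow> nat \<Rightarrow> complex) set" where
  "almost_hom p V act d \<tau> S F m \<delta> =
    {T. (\<forall>u \<in> orbit_span V act S F m.
           T u \<in> fin_carrier d \<and> lp_norm p {1..d} (T u) \<le> vnorm V u \<and>
           (\<forall>c. T (vscale V c u) = (\<lambda>j. c * T u j)) \<and>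
           (\<forall>v \<in> orbit_span V act S F m. T (vadd V u v) = T u + T v)) \<and>
        (\<forall>gs j. set gs \<subseteq> F \<and> length gs \<in> {1..m} \<and> j < m \<longrightarrow>
           lp_norm p {1..d}
             (T (foldr act gs (S j)) - foldr (\<lambda>g. perm_act (\<tau> g)) gs (T (S j))) < \<delta>)}"

definition alpha :: "(nat \<Rightarrow> 'v) \<Rightarrow> nat \<Rightarrow> ('v \<Rightarrow> nat \<Rightarrow> complex) \<Rightarrow> nat \<Rightarrow> nat \<Rightarrow> complex" where
  "alpha S m T = (\<lambda>l. if l < m then T (S l) else (\<lambda>_. 0))"

definition sofic_triples :: "('g, 'b) monoid_scheme \<Rightarrow> ('g set \<times> nat \<times> real) set" where
  "sofic_triples G =
    {(F, m, \<delta>). finite F \<and> F \<subseteq> carrier G \<and> \<one>\<^bsub>G\<^esub> \<in> F \<and> 0 < \<delta>}"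

definition triple_le :: "'g set \<times> nat \<times> real \<Rightarrow> 'g set \<times> nat \<times> real \<Rightarrow> bool" where
  "triple_le = (\<lambda>(F, m, \<delta>) (F', m', \<delta>'). F \<subseteq> F' \<and> m \<le> m' \<and> \<delta>' \<le> \<delta>)"

definition triples_limsup ::
    "('g, 'b) monoid_scheme \<Rightarrow> ('g set \<times> nat \<times> real \<Rightarrow> ereal) \<Rightarrow> ereal" where
  "triples_limsup G h =
    (INF t\<^sub>0 \<in> sofic_triples G. SUP t \<in> {t \<in> sofic_triples G. triple_le t\<^sub>0 t}. h t)"

definition norm_eps_dim :: "ereal \<Rightarrow> 'v cspace \<Rightarrow> ('g \<Rightarrow> 'v \<Rightarrow> 'v) \<Rightarrow> (nat \<Rightarrow> nat) \<Rightarrow>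
    (nat \<Rightarrow> 'g \<Rightarrow> nat \<Rightarrow> nat) \<Rightarrow> (nat \<Rightarrow> 'v) \<Rightarrow> ((nat \<Rightarrow> complex) \<Rightarrow> real) \<Rightarrow> real \<Rightarrow>
    'g set \<times> nat \<times> real \<Rightarrow> nat \<Rightarrow> ereal" where
  "norm_eps_dim p V act d \<sigma> S \<rho> \<epsilon> = (\<lambda>(F, m, \<delta>) i.
     ereal (1 / real (d i)) *
     eps_dim p (d i) \<rho> \<epsilon> (alpha S m ` almost_hom p V act (d i) (\<sigma> i) S F m \<delta>))"

text \<open>
  The upper and the lower dimension of \<open>V\<close>, computed with the generating sequence \<open>S\<close> and the
  product norm \<open>\<rho>\<close>.
\<close>

definition sofic_dim :: "ereal \<Rightarrow> ('g, 'b) monoid_scheme \<Rightarrow> 'v cspace \<Rightarrow> ('g \<Rightarrow> 'v \<Rightarrow> 'v) \<Rightarrow>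
    (nat \<Rightarrow> nat) \<Rightarrow> (nat \<Rightarrow> 'g \<Rightarrow> nat \<Rightarrow> nat) \<Rightarrow> (nat \<Rightarrow> 'v) \<Rightarrow> ((nat \<Rightarrow> complex) \<Rightarrow> real) \<Rightarrow> ereal" where
  "sofic_dim p G V act d \<sigma> S \<rho> =
    (SUP \<epsilon>\<in>{0<..}. triples_limsup G (\<lambda>t. limsup (norm_eps_dim p V act d \<sigma> S \<rho> \<epsilon> t)))"

definition lower_sofic_dim :: "ereal \<Rightarrow> ('g, 'b) monoid_scheme \<Rightarrow> 'v cspace \<Rightarrow> ('g \<Rightarrow> 'v \<Rightarrow> 'v) \<Rightarrow>
    (nat \<Rightarrow> nat) \<Rightarrow> (nat \<Rightarrow> 'g \<Rightarrow> nat \<Rightarrow> nat) \<Rightarrow> (nat \<Rightarrow> 'v) \<Rightarrow> ((nat \<Rightarrow> complex) \<Rightarrow> real) \<Rightarrow> ereal" where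
  "lower_sofic_dim p G V act d \<sigma> S \<rho> =
    (SUP \<epsilon>\<in>{0<..}. triples_limsup G (\<lambda>t. liminf (norm_eps_dim p V act d \<sigma> S \<rho> \<epsilon> t)))"

end

theory Submission
  imports Defs
begin

text \<open>
  Upper bound: the space is generated by one element per generator of the group, and these satisfy one
  linear relation over the group, coming from the coboundary of a point mass. An approximately
  equivariant map therefore almost satisfies the same relation in \<open>\<ell>\<^sup>p({1,\<dots>,d})\<close>, and since almost all
  cycles of the permutation assigned to \<open>a\<^sub>n\<close> are long, the relation determines the image of the last
  generator up to \<open>o(d)\<close> dimensions.

  Lower bound for \<open>p > 1\<close>: on the tree the Green function gives a bounded equivariant projection of
  \<open>\<ell>\<^sup>p(E)\<close> onto the cycles, which vanishes on coboundaries and whose trace per vertex is \<open>n - 1\<close>. Its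
  columns, transplanted to \<open>{1,\<dots>,d}\<close> along the sofic approximation, form a matrix that has trace and
  squared Hilbert--Schmidt norm both close to \<open>(n - 1) d\<close> up to the same scaling, and such a matrix is not
  close to one of rank smaller than about \<open>(n - 1) d\<close>.

  Lower bound for \<open>p = 1\<close>: the permutations assigned to the generators define a genuine action of the free group,
  and every flow on the finite Schreier graph that vanishes at the bad points yields an almost
  equivariant operator of norm at most the \<open>\<ell>\<^sup>1\<close> norm of the flow. The flows form the kernel of an
  integer matrix; counting points of their unit ball by volume shows that this ball is not approximated by a
  subspace of dimension noticeably smaller than \<open>(n - 1) d\<close>.
\<close>

text \<open>The kernel \<open>gam\<close> of the Green function is not in l1, so convolution by it
  cannot be estimated by its l1 norm. The estimate comes from the equation that it solves:
  \<open>adj\<close> has norm at most \<mu> on lp, and with q = 2n - 1 the gap q + 1 - \<mu> to the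
  degree 2n is (q^(1/p) - 1)(q^(1-1/p) - 1). The gap closes at p = 1, which is why p = 1 takes
  another route. In the trace argument only |trace|^2 divided by the squared Hilbert-Schmidt norm
  matters, so the norm of the projection, by which all maps are divided to become contractions,
  cancels. The quotient is sharp because the projection is orthogonal in l2: the squared norm of a
  column is its diagonal entry. At p = 1 the maps must annihilate coboundaries exactly, since
  contractivity for the quotient norm has no tolerance, while equivariance has. Hence an exact
  action replaces the approximate one, and the whole defect is moved into equivariance. The counting
  bounds carry constants that depend on the dimension, whereas only the exponential rate may enter
  the result. Applying them to m-digit expansions and letting m grow removes the constants.\<close>

abbreviation lpn :: "real \<Rightarrow> 'x set \<Rightarrow> ('x \<Rightarrow> complex) \<Rightarrow> real" where "lpn r \<equiv> lp_norm (ereal r)"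
abbreviation lps :: "real \<Rightarrow> 'x set \<Rightarrow> ('x \<Rightarrow> complex) \<Rightarrow> bool" where "lps r \<equiv> lp_summable (ereal r)"

section \<open>Norms and summability in lp over arbitrary sets\<close>

lemma ereal_p_conv [simp]: "real_of_ereal (ereal r) = r" by simp

lemma lp_norm_ereal: "lpn r X f = (\<Sum>\<^sub>\<infinity>x\<in>X. cmod (f x) powr r) powr (1 / r)"
 by (simp add: lp_norm_def)

lemma lp_summable_ereal: "lps r X f \<longleftrightarrow> (%x. cmod (f x) powr r) summable_on X"
 by (simp add: lp_summable_def)

lemma lp_summable_finite [simp]: "finite X ==> lps r X f"
 by (simp add: lp_summable_ereal)

lemma lp_norm_nonneg [simp]: "0 <= lpn r X f"
 by (simp add: lp_norm_ereal)

lemma lp_norm_powr: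
 assumes "1 <= r"
 shows "lpn r X f powr r = (\<Sum>\<^sub>\<infinity>x\<in>X. cmod (f x) powr r)"
 using assms by (simp add: lp_norm_ereal powr_powr infsum_nonneg)

lemma lp_norm_zero [simp]: "lpn r X (%_. 0) = 0"
 by (simp add: lp_norm_ereal)

lemma lp_norm_cong: "(!!x. x \<in> X ==> cmod (f x) = cmod (g x)) ==> lpn r X f = lpn r X g"
 unfolding lp_norm_ereal by (metis (mono_tags, lifting) infsum_cong)

lemma lp_summable_cong:
 "(!!x. x \<in> X ==> cmod (f x) = cmod (g x)) ==> lps r X f \<longleftrightarrow> lps r X g"
 unfolding lp_summable_ereal by (intro summable_on_cong) simp

lemma lp_norm_le_iff_powr:
 assumes "1 <= r" "0 <= C"
 shows "lpn r X f <= C \<longleftrightarrow> (\<Sum>\<^sub>\<infinity>x\<in>X. cmod (f x) powr r) <= C powr r"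
proof -
 have "lpn r X f <= C \<longleftrightarrow> lpn r X f powr r <= C powr r"
  using assms powr_less_mono2[of r C "lpn r X f"] powr_mono2[of r "lpn r X f" C]
  by (smt (verit) lp_norm_nonneg)
 then show ?thesis using assms by (simp add: lp_norm_powr)
qed

lemma lp_summable_subset: "lps r X f ==> Y \<subseteq> X ==> lps r Y f"
 unfolding lp_summable_ereal by (rule summable_on_subset_banach)

lemma lp_norm_mono_set:
 assumes "1 <= r" "lps r X f" "Y \<subseteq> X"
 shows "lpn r Y f <= lpn r X f"
 unfolding lp_norm_ereal
proof (rule powr_mono2)
 show "(\<Sum>\<^sub>\<infinity>x\<in>Y. cmod (f x) powr r) <= (\<Sum>\<^sub>\<infinity>x\<in>X. cmod (f x) powr r)"
  using assms lp_summable_subset[OF assms(2,3)]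
  by (intro infsum_mono_neutral) (auto simp: lp_summable_ereal)
qed (use assms in \<open>auto intro: infsum_nonneg\<close>)

text \<open>Summability and norm of a nonnegative series are determined by finite subsets. Estimates
  on infinite sets are proved on finite ones and lifted through this lemma.\<close>

lemma lp_finite_bound:
 assumes "1 <= r" "0 <= C" "!!F. finite F ==> F \<subseteq> X ==> lpn r F f <= C"
 shows "lps r X f" "lpn r X f <= C"
proof -
 have b: "(\<Sum>x\<in>F. cmod (f x) powr r) <= C powr r" if "finite F" "F \<subseteq> X" for F
  using assms(3)[OF that] that(1) assms by (simp add: lp_norm_le_iff_powr)
 show s: "lps r X f"
  unfolding lp_summable_ereal
 proof (rule nonneg_bdd_above_summable_on)
  show "bdd_above (sum (%x. cmod (f x) powr r) ` {F. F \<subseteq> X & finite F})"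
   using b by (intro bdd_aboveI2[of _ _ "C powr r"]) auto
 qed auto
 show "lpn r X f <= C"
  unfolding lp_norm_le_iff_powr[OF assms(1,2)]
  using s b by (intro infsum_le_finite_sums) (auto simp: lp_summable_ereal)
qed

text \<open>Convexity of the r-th power with the endpoint 0 included: if one of the two terms
  vanishes, the claim reduces to t^r <= t on [0,1].\<close>

lemma powr_convex_nonneg:
 fixes a b :: real
 assumes "1 <= r" "0 <= a" "0 <= b" "0 <= s" "0 <= t" "s + t = 1"
 shows "(s * a + t * b) powr r <= s * a powr r + t * b powr r"
proof (cases "a = 0 \<or> b = 0")
 case False
 have t: "t <= 1" "s = 1 - t" using assms by auto
 show ?thesis
  using convex_onD[OF powr_convex[OF assms(1)], of t a b] assms False t by simp
next
 case True
 have "t powr r <= t" "s powr r <= s"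
  using assms powr_mono'[of 1 r t] powr_mono'[of 1 r s] by auto
 then show ?thesis using True assms by (auto simp: powr_mult mult_right_mono)
qed

text \<open>Minkowski's inequality from convexity: (f + g)/(a + b) is the convex combination of f/a
  and g/b with weights a/(a + b) and b/(a + b), and both have r-th power sum 1. The cases a = 0 and
  b = 0 are split off because of the division.\<close>

lemma lp_norm_finite_triangle:
 assumes r: "1 <= r" and F: "finite F"
 shows "lpn r F (%x. f x + g x) <= lpn r F f + lpn r F g"
proof -
 define a b where "a = lpn r F f" and "b = lpn r F g"
 have ab: "0 <= a" "0 <= b" by (simp_all add: a_def b_def)
 have pa: "a powr r = (\<Sum>x\<in>F. cmod (f x) powr r)" and pb: "b powr r = (\<Sum>x\<in>F. cmod (g x) powr r)"
  using F r by (simp_all add: a_def b_def lp_norm_powr)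
 have zero: "\<forall>x\<in>F. h x = 0" if "lpn r F h = 0" for h :: "'a => complex"
  using lp_norm_eq_0[of "ereal r" F h] that r F by auto
 consider "a = 0" | "b = 0" | "0 < a" "0 < b" using ab by linarith
 then show ?thesis
 proof cases
  case 1
  then have "lpn r F (%x. f x + g x) = b"
   unfolding b_def using zero[of f] by (intro lp_norm_cong) (auto simp: a_def)
  then show ?thesis using 1 by (simp add: a_def b_def)
 next
  case 2
  then have "lpn r F (%x. f x + g x) = a"
   unfolding a_def using zero[of g] by (intro lp_norm_cong) (auto simp: b_def)
  then show ?thesis using 2 by (simp add: a_def b_def)
 next
  case 3
  have pt: "cmod (f x + g x) powr r <=
   (a + b) powr r * (a / (a + b) * (cmod (f x) powr r / a powr r) + b / (a + b) * (cmod (g x) powr r / b powr r))" for x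
  proof -
   have "cmod (f x + g x) powr r <= (cmod (f x) + cmod (g x)) powr r"
    using r by (intro powr_mono2 norm_triangle_ineq) auto
   also have "\<dots> = ((a + b) * (a / (a + b) * (cmod (f x) / a) + b / (a + b) * (cmod (g x) / b))) powr r"
    using 3 by (simp add: distrib_left)
   also have "\<dots> = (a + b) powr r * (a / (a + b) * (cmod (f x) / a) + b / (a + b) * (cmod (g x) / b)) powr r"
    by (rule powr_mult)
   also have "\<dots> <= (a + b) powr r * (a / (a + b) * (cmod (f x) / a) powr r + b / (a + b) * (cmod (g x) / b) powr r)"
    using 3 r by (intro mult_left_mono powr_convex_nonneg) (auto simp: add_divide_distrib[symmetric])
   finally show ?thesis using 3 by (simp add: powr_divide)
  qed
  have "(\<Sum>x\<in>F. cmod (f x + g x) powr r) <= (\<Sum>x\<in>F. (a + b) powr r * (a / (a + b) * (cmod (f x) powr r / a powr r) + b / (a + b) * (cmod (g x) powr r / b powr r)))"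
   by (intro sum_mono pt)
  also have "\<dots> = (a + b) powr r * (a / (a + b) * ((\<Sum>x\<in>F. cmod (f x) powr r) / a powr r) + b / (a + b) * ((\<Sum>x\<in>F. cmod (g x) powr r) / b powr r))"
   by (simp only: sum_distrib_left sum.distrib sum_divide_distrib flip: sum_distrib_left)
  also have "\<dots> = (a + b) powr r"
   using 3 unfolding pa[symmetric] pb[symmetric] by (simp add: add_divide_distrib[symmetric])
  finally show ?thesis
   using 3 r F by (subst lp_norm_le_iff_powr) (auto simp flip: a_def b_def)
 qed
qed

lemma lp_triangle:
 assumes r: "1 <= r" and f: "lps r X f" and g: "lps r X g"
 shows "lps r X (%x. f x + g x)"
  "lpn r X (%x. f x + g x) <= lpn r X f + lpn r X g"
proof -
 have "lpn r F (%x. f x + g x) <= lpn r X f + lpn r X g"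
  if "finite F" "F \<subseteq> X" for F
  using lp_norm_finite_triangle[OF r that(1), of f g] lp_norm_mono_set[OF r f that(2)]
   lp_norm_mono_set[OF r g that(2)] by linarith
 then show "lps r X (%x. f x + g x)"
  "lpn r X (%x. f x + g x) <= lpn r X f + lpn r X g"
  using lp_finite_bound[OF r, of "lpn r X f + lpn r X g" X "%x. f x + g x"]
  by auto
qed

lemma lp_scale:
 assumes r: "1 <= r"
 shows "lps r X f ==> lps r X (%x. c * f x)"
  "lpn r X (%x. c * f x) = cmod c * lpn r X f"
proof -
 show "lps r X f ==> lps r X (%x. c * f x)"
  by (simp add: lp_summable_ereal norm_mult powr_mult summable_on_cmult_right)
 show "lpn r X (%x. c * f x) = cmod c * lpn r X f"
  using r by (simp add: lp_norm_ereal norm_mult powr_mult infsum_cmult_right' powr_powr infsum_nonneg)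
qed

lemma lp_minus:
 assumes r: "1 <= r" and f: "lps r X f" and g: "lps r X g"
 shows "lps r X (%x. f x - g x)"
  "lpn r X (%x. f x - g x) <= lpn r X f + lpn r X g"
 using lp_triangle[OF r f lp_scale(1)[OF r g, of "-1"]] lp_scale(2)[OF r, of X "-1" g] by simp_all

lemma lp_mono:
 assumes r: "1 <= r" and g: "lps r X g" and le: "!!x. x \<in> X ==> cmod (f x) <= cmod (g x)"
 shows "lps r X f" "lpn r X f <= lpn r X g"
proof -
 have "lpn r F f <= lpn r X g" if F: "finite F" "F \<subseteq> X" for F
 proof -
  have "(\<Sum>x\<in>F. cmod (f x) powr r) <= (\<Sum>x\<in>F. cmod (g x) powr r)"
   using le F r by (intro sum_mono powr_mono2) auto
  then have "lpn r F f <= lpn r F g"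
   using F r by (simp add: lp_norm_ereal powr_mono2 sum_nonneg)
  then show ?thesis using lp_norm_mono_set[OF r g F(2)] by linarith
 qed
 from lp_finite_bound[OF r _ this] show "lps r X f" "lpn r X f <= lpn r X g"
  by auto
qed

lemma lp_norm_sum_le:
 assumes r: "1 <= r" and I: "finite I" and f: "!!i. i \<in> I ==> lps r X (f i)"
 shows "lps r X (%x. \<Sum>i\<in>I. f i x) &
  lpn r X (%x. \<Sum>i\<in>I. f i x) <= (\<Sum>i\<in>I. lpn r X (f i))"
 using I f
proof (induction I)
 case empty
 then show ?case by (simp add: lp_summable_ereal)
next
 case (insert i I)
 then show ?case
  using lp_triangle[OF r, of X "f i" "%x. \<Sum>i\<in>I. f i x"] by fastforce
qed

lemma lp_norm_point:
 assumes "1 <= r" "lps r X f" "x \<in> X"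
 shows "cmod (f x) <= lpn r X f"
proof -
 have "lpn r {x} f <= lpn r X f"
  using assms by (intro lp_norm_mono_set) auto
 then show ?thesis using assms(1) by (simp add: lp_norm_ereal powr_powr)
qed

lemma lp_reindex:
 assumes "bij_betw h X Y"
 shows "lps r X (%x. f (h x)) \<longleftrightarrow> lps r Y f"
  "lpn r X (%x. f (h x)) = lpn r Y f"
 using summable_on_reindex_bij_betw[OF assms, of "%x. cmod (f x) powr r"]
  infsum_reindex_bij_betw[OF assms, of "%x. cmod (f x) powr r"]
 by (simp_all add: lp_summable_ereal lp_norm_ereal)

text \<open>One finite set serves all \<open>Y\<close> that avoid it. It provides the finite
  supports outside of which a vector may be neglected.\<close>

lemma lp_tail:
 assumes r: "1 <= r" and f: "lps r X f" and e: "0 < e"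
 obtains K where "finite K" "K \<subseteq> X" "!!Y. Y \<subseteq> X ==> Y \<inter> K = {} ==> lpn r Y f <= e"
proof -
 let ?h = "%x. cmod (f x) powr r"
 obtain K where K: "finite K" "K \<subseteq> X" "dist (sum ?h K) (infsum ?h X) <= e powr r"
  using infsum_finite_approximation[of ?h X "e powr r"] f e by (auto simp: lp_summable_ereal)
 show thesis
 proof (rule that[OF K(1,2)])
  fix Y assume Y: "Y \<subseteq> X" "Y \<inter> K = {}"
  have sY: "?h summable_on Y" using f Y lp_summable_subset lp_summable_ereal by blast
  have "sum ?h K + infsum ?h Y = infsum ?h (K \<union> Y)"
   using infsum_Un_disjoint[of ?h K Y] Y sY K(1) by (simp add: Int_commute)
  also have "\<dots> <= infsum ?h X"
   using K Y f by (intro infsum_mono_neutral) (auto simp: lp_summable_ereal intro: summable_on_subset_banach)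
  finally have "infsum ?h Y <= e powr r" using K(3) by (auto simp: dist_real_def)
  then show "lpn r Y f <= e" using r e by (simp add: lp_norm_le_iff_powr)
 qed
qed

text \<open>No value exceeds the norm c, so |f|^2 <= c^(2-r) |f|^r. This is where r \<le> 2 enters:
  lp vectors become square summable, and Hilbert-Schmidt sums are bounded by lp norms.\<close>

lemma l2_le_lp:
 assumes r: "1 <= r" "r <= 2" and f: "lps r X f"
 shows "(%x. (cmod (f x))\<^sup>2) summable_on X" "(\<Sum>\<^sub>\<infinity>x\<in>X. (cmod (f x))\<^sup>2) <= (lpn r X f)\<^sup>2"
proof -
 define c where "c = lpn r X f"
 have pt: "(cmod (f x))\<^sup>2 <= c powr (2 - r) * cmod (f x) powr r" if "x \<in> X" for x
 proof (cases "f x = 0")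
  case False
  have "(cmod (f x))\<^sup>2 = cmod (f x) powr (2 - r) * cmod (f x) powr r"
   using False by (simp flip: powr_add)
  also have "\<dots> <= c powr (2 - r) * cmod (f x) powr r"
   using lp_norm_point[OF r(1) f that] r by (intro mult_right_mono powr_mono2) (auto simp: c_def)
  finally show ?thesis .
 qed simp
 have s: "(%x. c powr (2 - r) * cmod (f x) powr r) summable_on X"
  using f by (intro summable_on_cmult_right) (simp add: lp_summable_ereal)
 show s2: "(%x. (cmod (f x))\<^sup>2) summable_on X"
  by (rule summable_on_comparison_test[OF s]) (use pt in auto)
 have "(\<Sum>\<^sub>\<infinity>x\<in>X. (cmod (f x))\<^sup>2) <= (\<Sum>\<^sub>\<infinity>x\<in>X. c powr (2 - r) * cmod (f x) powr r)"
  by (intro infsum_mono s s2 pt)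
 also have "\<dots> = c powr (2 - r) * c powr r"
  using r by (simp add: infsum_cmult_right' c_def lp_norm_powr)
 also have "\<dots> = c\<^sup>2"
  by (cases "c = 0") (simp_all add: c_def flip: powr_add)
 finally show "(\<Sum>\<^sub>\<infinity>x\<in>X. (cmod (f x))\<^sup>2) <= (lpn r X f)\<^sup>2" by (simp add: c_def)
qed

section \<open>Product norms on bounded sequences\<close>

lemma product_normD:
 assumes "product_norm \<rho>"
 shows "bounded (range f) ==> 0 <= \<rho> f"
  and "bounded (range f) ==> \<rho> f = 0 \<longleftrightarrow> f = (%_. 0)"
  and "bounded (range f) ==> \<rho> (%l. c * f l) = cmod c * \<rho> f"
  and "bounded (range f) ==> bounded (range g) ==> \<rho> (%l. f l + g l) <= \<rho> f + \<rho> g"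
  and "bounded (range f) ==> bounded (range g) ==> (!!l. cmod (f l) <= cmod (g l)) ==> \<rho> f <= \<rho> g"
  and "U \<subseteq> {f. ALL l. cmod (f l) <= 1} ==>
   (!!f. f \<in> U ==> \<exists>e>0. \<forall>g\<in>{f. ALL l. cmod (f l) <= 1}. \<rho> (%l. g l - f l) < e --> g \<in> U) ==>
   openin (top_of_set {f. ALL l. cmod (f l) <= 1}) U"
proof -
 note A = assms[unfolded product_norm_def Let_def mem_Collect_eq]
 note A1 = A[THEN conjunct1] and A2 = A[THEN conjunct2, THEN conjunct1]
  and A3 = A[THEN conjunct2, THEN conjunct2, THEN conjunct1]
  and A4 = A[THEN conjunct2, THEN conjunct2, THEN conjunct2, THEN conjunct1]
  and A5 = A[THEN conjunct2, THEN conjunct2, THEN conjunct2, THEN conjunct2]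
 show "bounded (range f) ==> 0 <= \<rho> f" "bounded (range f) ==> \<rho> f = 0 \<longleftrightarrow> f = (%_. 0)"
  using A1 by simp_all
 show "bounded (range f) ==> \<rho> (%l. c * f l) = cmod c * \<rho> f"
  using A2 by simp
 show "bounded (range f) ==> bounded (range g) ==> \<rho> (%l. f l + g l) <= \<rho> f + \<rho> g"
  using A3 by simp
 show "bounded (range f) ==> bounded (range g) ==> (!!l. cmod (f l) <= cmod (g l)) ==> \<rho> f <= \<rho> g"
  using A4 by simp
 show "U \<subseteq> {f. ALL l. cmod (f l) <= 1} ==>
   (!!f. f \<in> U ==> \<exists>e>0. \<forall>g\<in>{f. ALL l. cmod (f l) <= 1}. \<rho> (%l. g l - f l) < e --> g \<in> U) ==>
   openin (top_of_set {f. ALL l. cmod (f l) <= 1}) U"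
  using A5[rule_format, of U] by (intro iffD2[OF A5[rule_format, of U]]) blast
qed

text \<open>Monotonicity compares f with the multiple f l of a unit vector, so \<rho> f controls
  each of finitely many coordinates.\<close>

lemma product_norm_coord:
 assumes "product_norm \<rho>" "0 < \<eta>"
 obtains \<epsilon> where "0 < \<epsilon>" "!!f. bounded (range f) ==> \<rho> f < \<epsilon> ==> \<forall>l<L. cmod (f l) < \<eta>"
proof -
 define u where "u = (%(l::nat) (k::nat). if k = l then 1 else 0 :: complex)"
 note P = product_normD[OF assms(1)]
 have bu: "bounded (range (u l))" for l
  by (rule boundedI[of _ 1]) (auto simp: u_def)
 have pos: "0 < \<rho> (u l)" for l :: nat
 proof -
  have "u l ~= (%_. 0)" by (auto simp: u_def fun_eq_iff)
  then show ?thesis using P(1,2)[OF bu[of l]] by linarith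
 qed
 \<comment> \<open>The inserted 1 keeps \<open>Min\<close> meaningful when L = 0.\<close>
 define \<epsilon> where "\<epsilon> = \<eta> * Min (insert 1 ((%l. \<rho> (u l)) ` {..<L}))"
 show thesis
 proof
  show "0 < \<epsilon>" using pos assms(2) by (auto simp: \<epsilon>_def)
  fix f :: "nat => complex" assume f: "bounded (range f)" "\<rho> f < \<epsilon>"
  show "\<forall>l<L. cmod (f l) < \<eta>"
  proof (intro allI impI)
   fix l assume l: "l < L"
   have b: "bounded (range (%k. f l * u l k))"
    by (rule boundedI[of _ "cmod (f l)"]) (auto simp: u_def)
   have "cmod (f l) * \<rho> (u l) = \<rho> (%k. f l * u l k)" using P(3)[OF bu[of l]] by simp
   also have "\<dots> <= \<rho> f" by (rule P(5)[OF b f(1)]) (simp add: u_def)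
   also have "\<dots> < \<epsilon>" by fact
   also have "\<dots> <= \<eta> * \<rho> (u l)" unfolding \<epsilon>_def using assms(2) l
    by (intro mult_left_mono Min_le) auto
   finally show "cmod (f l) < \<eta>" using pos[of l] by simp
  qed
 qed
qed

text \<open>An open \<rho>-ball around 0 is a pointwise neighbourhood of 0 in the unit ball, so it
  contains a basic one, which restricts finitely many coordinates. Scaling by \<open>B\<close>
  covers sequences bounded by \<open>B\<close>.\<close>

lemma product_norm_tail:
 assumes "product_norm \<rho>" "0 < \<epsilon>" "0 < B"
 obtains L \<kappa> where "0 < \<kappa>" "!!f. (!!l. cmod (f l) <= B) ==> (!!l. l < L ==> cmod (f l) <= \<kappa>) ==> \<rho> f < \<epsilon>"
proof -
 note P = product_normD[OF assms(1)]
 let ?B = "{f :: nat => complex. ALL l. cmod (f l) <= 1}"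
 have bB: "bounded (range f)" if "f \<in> ?B" for f using that by (intro boundedI[of _ 1]) auto
 define U where "U = {f \<in> ?B. \<rho> f < \<epsilon> / B}"
 have "openin (top_of_set ?B) U"
 proof -
  have "\<exists>e>0. \<forall>g\<in>?B. \<rho> (%l. g l - f l) < e --> g \<in> U" if f: "f \<in> U" for f
  proof (intro exI[of _ "\<epsilon> / B - \<rho> f"] conjI ballI impI)
   show "0 < \<epsilon> / B - \<rho> f" using f by (simp add: U_def)
   fix g assume g: "g \<in> ?B" "\<rho> (%l. g l - f l) < \<epsilon> / B - \<rho> f"
   have f': "f \<in> ?B" using f by (simp add: U_def)
   have "bounded (range (%l. g l - f l))"
   proof (rule boundedI[of _ 2])
    fix x assume "x \<in> range (%l. g l - f l)"
    then obtain l where "x = g l - f l" by auto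
    then show "cmod x <= 2" using norm_triangle_ineq4[of "g l" "f l"] g(1) f'
     by (smt (verit) mem_Collect_eq)
   qed
   then have "\<rho> (%l. (g l - f l) + f l) <= \<rho> (%l. g l - f l) + \<rho> f"
    using P(4) bB[OF f'] by blast
   then show "g \<in> U" using g by (simp add: U_def)
  qed
  moreover have "U \<subseteq> ?B" by (auto simp: U_def)
  ultimately show ?thesis by (intro P(6)) blast+
 qed
 then obtain T where T: "open T" "U = ?B \<inter> T" by (auto simp: openin_open)
 have "(%_. 0) \<in> U"
  using P(2)[of "%_. 0"] bB[of "%_. 0"] assms(2,3) by (simp add: U_def)
 then have "(%_. 0) \<in> T" using T by auto
 then obtain X where X: "(%_. 0) \<in> (\<Pi>\<^sub>E i\<in>UNIV. X i)" "!!i. open (X i)" "finite {i. X i ~= UNIV}" "(\<Pi>\<^sub>E i\<in>UNIV. X i) \<subseteq> T"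
  using product_topology_open_contains_basis[of "%_. euclidean" UNIV T "%_. 0"] T(1)
  by (auto simp: open_fun_def)
 \<comment> \<open>The coordinates that the basic neighbourhood restricts; L will lie beyond all of
   them.\<close>
 define J where "J = {i. X i ~= UNIV}"
 have "\<exists>e>0. ball 0 e \<subseteq> X i" for i
  using X(1,2) by (meson PiE_mem UNIV_I open_contains_ball)
 then obtain e where e: "!!i. 0 < e i" "!!i. ball 0 (e i) \<subseteq> X i" by metis
 define \<kappa> where "\<kappa> = Min (insert 1 (e ` J)) / 2"
 have k: "0 < \<kappa>" and ke: "!!i. i \<in> J ==> \<kappa> < e i"
 proof -
  have "0 < Min (insert 1 (e ` J))" using e X(3) by (auto simp: J_def)
  then show "0 < \<kappa>" by (simp add: \<kappa>_def)
  show "\<kappa> < e i" if "i \<in> J" for i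
  proof -
   have "Min (insert 1 (e ` J)) <= e i" using that X(3) by (auto simp: J_def)
   then show ?thesis using e(1)[of i] by (simp add: \<kappa>_def)
  qed
 qed
 obtain L where L: "!!i. i \<in> J ==> i < L"
  using X(3) by (metis J_def finite_nat_bounded lessThan_iff subset_iff)
 show thesis
 proof (rule that[of "\<kappa> * B" L])
  show "0 < \<kappa> * B" using k assms(3) by simp
  fix f :: "nat => complex" assume f: "!!l. cmod (f l) <= B" "!!l. l < L ==> cmod (f l) <= \<kappa> * B"
  define g where "g = (%l. f l / of_real B)"
  have gB: "g \<in> ?B" using f(1) assms(3) by (simp add: g_def norm_divide)
  have "g i \<in> X i" for i
  proof (cases "i \<in> J")
   case True
   have "cmod (g i) <= \<kappa>" using f(2)[OF L[OF True]] assms(3) by (simp add: g_def norm_divide field_simps)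
   then show ?thesis using ke[OF True] e(2)[of i] by auto
  qed (auto simp: J_def)
  then have "g \<in> U" using X(4) T(2) gB by blast
  then have r: "\<rho> g < \<epsilon> / B" by (simp add: U_def)
  have "\<rho> f = \<rho> (%l. of_real B * g l)" using assms(3) by (simp add: g_def)
  also have "\<dots> = B * \<rho> g" using P(3)[OF bB[OF gB], of "of_real B"] assms(3) by simp
  finally show "\<rho> f < \<epsilon>" using r assms(3) by (simp add: field_simps)
 qed
qed

section \<open>Limits over the directed set of triples\<close>

lemma triples_limsup_le:
 assumes "t0 \<in> sofic_triples G" "!!t. t \<in> sofic_triples G ==> triple_le t0 t ==> h t <= c"
 shows "triples_limsup G h <= c"
 unfolding triples_limsup_def
 by (rule INF_lower2[OF assms(1)]) (auto intro!: SUP_least assms(2))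

lemma le_triples_limsup:
 assumes "!!t0. t0 \<in> sofic_triples G ==> \<exists>t\<in>sofic_triples G. triple_le t0 t & c <= h t"
 shows "c <= triples_limsup G h"
 unfolding triples_limsup_def
proof (rule INF_greatest)
 fix t0 assume "t0 \<in> sofic_triples G"
 with assms obtain t where "t \<in> sofic_triples G" "triple_le t0 t" "c <= h t" by blast
 then show "c <= (SUP t\<in>{t \<in> sofic_triples G. triple_le t0 t}. h t)"
  by (intro SUP_upper2[of t]) auto
qed

lemma lower_le_sofic_dim: "lower_sofic_dim p G V act d \<sigma> S \<rho> <= sofic_dim p G V act d \<sigma> S \<rho>"
 unfolding lower_sofic_dim_def sofic_dim_def triples_limsup_def
 by (intro SUP_mono' INF_mono' Liminf_le_Limsup) simp

text \<open>The slack \<eta> is removed after the infimum over triples is taken, so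
  \<open>t0\<close> may depend on it.\<close>

lemma sofic_dim_le:
 assumes "!!\<epsilon> \<eta>. 0 < \<epsilon> ==> 0 < \<eta> ==> \<exists>t0\<in>sofic_triples G. \<forall>t\<in>sofic_triples G. triple_le t0 t -->
  (\<forall>\<^sub>F i in sequentially. norm_eps_dim p V act d \<sigma> S \<rho> \<epsilon> t i <= ereal (c + \<eta>))"
 shows "sofic_dim p G V act d \<sigma> S \<rho> <= ereal c"
 unfolding sofic_dim_def
proof (rule SUP_least)
 fix \<epsilon> :: real assume "\<epsilon> \<in> {0<..}"
 then have e: "0 < \<epsilon>" by simp
 show "triples_limsup G (%t. limsup (norm_eps_dim p V act d \<sigma> S \<rho> \<epsilon> t)) <= ereal c"
 proof (rule ereal_le_epsilon2)
  fix \<eta> :: real assume "0 < \<eta>"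
  from assms[OF e this] obtain t0 where t0: "t0 \<in> sofic_triples G"
   "!!t. t \<in> sofic_triples G ==> triple_le t0 t ==> \<forall>\<^sub>F i in sequentially. norm_eps_dim p V act d \<sigma> S \<rho> \<epsilon> t i <= ereal (c + \<eta>)"
   by blast
  have "triples_limsup G (%t. limsup (norm_eps_dim p V act d \<sigma> S \<rho> \<epsilon> t)) <= ereal (c + \<eta>)"
   by (rule triples_limsup_le[OF t0(1)]) (intro Limsup_bounded t0(2))
  then show "triples_limsup G (%t. limsup (norm_eps_dim p V act d \<sigma> S \<rho> \<epsilon> t)) <= ereal c + ereal \<eta>" by simp
 qed
qed

text \<open>The outer supremum allows one \<epsilon> for each \<eta>, and the supremum inside
  \<open>triples_limsup\<close> asks for a single good triple above each \<open>t0\<close>.\<close>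

lemma le_lower_sofic_dim:
 assumes "!!\<eta>. 0 < \<eta> ==> \<exists>\<epsilon>>0. \<forall>t0\<in>sofic_triples G. \<exists>t\<in>sofic_triples G. triple_le t0 t &
  (\<forall>\<^sub>F i in sequentially. ereal (c - \<eta>) <= norm_eps_dim p V act d \<sigma> S \<rho> \<epsilon> t i)"
 shows "ereal c <= lower_sofic_dim p G V act d \<sigma> S \<rho>"
proof (rule ereal_le_epsilon2)
 fix \<eta> :: real assume "0 < \<eta>"
 from assms[OF this] obtain \<epsilon> where e: "0 < \<epsilon>" "!!t0. t0\<in>sofic_triples G ==> \<exists>t\<in>sofic_triples G. triple_le t0 t &
  (\<forall>\<^sub>F i in sequentially. ereal (c - \<eta>) <= norm_eps_dim p V act d \<sigma> S \<rho> \<epsilon> t i)" by blast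
 have "ereal (c - \<eta>) <= triples_limsup G (%t. liminf (norm_eps_dim p V act d \<sigma> S \<rho> \<epsilon> t))"
  by (rule le_triples_limsup) (use e(2) in \<open>blast intro: Liminf_bounded\<close>)
 also have "\<dots> <= lower_sofic_dim p G V act d \<sigma> S \<rho>"
  unfolding lower_sofic_dim_def using e(1) by (intro SUP_upper) auto
 finally have "ereal (c - \<eta>) + ereal \<eta> <= lower_sofic_dim p G V act d \<sigma> S \<rho> + ereal \<eta>"
  by (rule add_right_mono)
 then show "ereal c <= lower_sofic_dim p G V act d \<sigma> S \<rho> + ereal \<eta>" by simp
qed

section \<open>Orthonormal systems, trace and rank\<close>

lemma gram_schmidt:
 fixes v :: "'b => 'i => complex"
 assumes I: "finite I" and B: "finite B"
 shows "EX r U c. r <= card B &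
  (\<forall>a<r. \<forall>a'<r. (\<Sum>i\<in>I. U a i * cnj (U a' i)) = (if a = a' then 1 else 0)) &
  (\<forall>b\<in>B. \<forall>i\<in>I. v b i = (\<Sum>a<r. c b a * U a i))"
 using B
proof (induction B)
 case empty
 then show ?case by (intro exI[of _ "0::nat"]) auto
next
 case (insert b B)
 from insert.IH obtain r U c where r: "r <= card B"
  and on: "!!a a'. a < r ==> a' < r ==> (\<Sum>i\<in>I. U a i * cnj (U a' i)) = (if a = a' then 1 else 0)"
  and sp: "!!b i. b \<in> B ==> i \<in> I ==> v b i = (\<Sum>a<r. c b a * U a i)"
  by (elim exE conjE) (rule that, simp_all)
 define k where "k = (%a. \<Sum>i\<in>I. v b i * cnj (U a i))"
 define w where "w = (%i. v b i - (\<Sum>a<r. k a * U a i))"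
 define s where "s = (\<Sum>i\<in>I. (cmod (w i))\<^sup>2)"
 \<comment> \<open>A vector that already lies in the span adds no new member, so r may stay below
   the number of vectors.\<close>
 show ?case
 proof (cases "s = 0")
  case True
  then have "!!i. i \<in> I ==> w i = 0" using I by (simp add: s_def sum_nonneg_eq_0_iff)
  then have "!!i. i \<in> I ==> v b i = (\<Sum>a<r. k a * U a i)" by (simp add: w_def)
  then show ?thesis using on sp r insert
   by (intro exI[of _ r] exI[of _ U] exI[of _ "c(b := k)"]) (auto simp: card_insert_if)
 next
  case False
  then have s: "0 < s" by (simp add: s_def sum_nonneg order_less_le)
  define U' where "U' = U(r := (%i. w i / complex_of_real (sqrt s)))"
  have orth: "(\<Sum>i\<in>I. w i * cnj (U a' i)) = 0" if "a' < r" for a'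
  proof -
   have "(\<Sum>i\<in>I. w i * cnj (U a' i)) = k a' - (\<Sum>i\<in>I. \<Sum>a<r. k a * (U a i * cnj (U a' i)))"
    by (simp add: w_def k_def left_diff_distrib sum_subtractf sum_distrib_right mult.assoc)
   also have "(\<Sum>i\<in>I. \<Sum>a<r. k a * (U a i * cnj (U a' i))) = (\<Sum>a<r. k a * (\<Sum>i\<in>I. U a i * cnj (U a' i)))"
    by (subst sum.swap) (simp add: sum_distrib_left)
   also have "\<dots> = (\<Sum>a<r. if a = a' then k a else 0)"
    using on that by (intro sum.cong) auto
   also have "\<dots> = k a'" using that by (simp add: sum.delta)
   finally show ?thesis by simp
  qed
  have orth': "(\<Sum>i\<in>I. U a' i * cnj (w i)) = 0" if "a' < r" for a'
   using arg_cong[OF orth[OF that], of cnj] by (simp add: mult.commute)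
  have ss: "complex_of_real (sqrt s) * complex_of_real (sqrt s) = complex_of_real s"
   using s by (simp flip: of_real_mult)
  have ww: "(\<Sum>i\<in>I. w i * cnj (w i)) = complex_of_real s"
   unfolding s_def of_real_sum complex_norm_square ..
  have on': "(\<Sum>i\<in>I. U' a i * cnj (U' a' i)) = (if a = a' then 1 else 0)" if aa: "a < Suc r" "a' < Suc r" for a a'
  proof -
   consider "a < r" "a' < r" | "a = r" "a' = r" | "a < r" "a' = r" | "a = r" "a' < r"
    using aa by (auto simp: less_Suc_eq)
   then show ?thesis
   proof cases
    case 1 then show ?thesis using on by (simp add: U'_def)
   next
    case 2 then show ?thesis using ww ss s by (simp add: U'_def flip: sum_divide_distrib)
   next
    case 3 then show ?thesis using orth'[of a] by (simp add: U'_def flip: sum_divide_distrib)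
   next
    case 4 then show ?thesis using orth[of a'] by (simp add: U'_def flip: sum_divide_distrib)
   qed
  qed
  define c' where "c' = (%b'. if b' = b then k(r := complex_of_real (sqrt s)) else (c b')(r := 0))"
  have "v b' i = (\<Sum>a<Suc r. c' b' a * U' a i)" if "b' \<in> insert b B" "i \<in> I" for b' i
  proof -
   have u: "(\<Sum>a<r. c' b' a * U' a i) = (\<Sum>a<r. (if b' = b then k a else c b' a) * U a i)"
    by (intro sum.cong) (auto simp: c'_def U'_def)
   show ?thesis
    using sp that s unfolding lessThan_Suc
    by (cases "b' = b") (auto simp: u, auto simp: c'_def U'_def w_def)
  qed
  then show ?thesis using on' r insert
   by (intro exI[of _ "Suc r"] exI[of _ U'] exI[of _ c']) auto
 qed
qed

lemma norm_orthonormal_sum: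
 fixes U :: "nat => 'i => complex"
 assumes I: "finite I"
  and on: "!!a a'. a < r ==> a' < r ==> (\<Sum>i\<in>I. U a i * cnj (U a' i)) = (if a = a' then 1 else 0)"
 shows "(\<Sum>i\<in>I. (cmod (\<Sum>a<r. e a * U a i))\<^sup>2) = (\<Sum>a<r. (cmod (e a))\<^sup>2)"
proof -
 have "complex_of_real (\<Sum>i\<in>I. (cmod (\<Sum>a<r. e a * U a i))\<^sup>2)
  = (\<Sum>i\<in>I. \<Sum>a<r. \<Sum>a'<r. e a * cnj (e a') * (U a i * cnj (U a' i)))"
  unfolding of_real_sum complex_norm_square cnj_sum sum_product complex_cnj_mult
  by (intro sum.cong refl) simp
 also have "\<dots> = (\<Sum>a<r. \<Sum>a'<r. e a * cnj (e a') * (\<Sum>i\<in>I. U a i * cnj (U a' i)))"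
  by (subst sum.swap, rule sum.cong[OF refl], subst sum.swap) (simp add: sum_distrib_left)
 also have "\<dots> = (\<Sum>a<r. \<Sum>a'<r. if a' = a then e a * cnj (e a') else 0)"
  using on by (intro sum.cong refl) auto
 also have "\<dots> = (\<Sum>a<r. e a * cnj (e a))" by (intro sum.cong) (simp_all add: sum.delta)
 also have "\<dots> = complex_of_real (\<Sum>a<r. (cmod (e a))\<^sup>2)"
  unfolding of_real_sum complex_norm_square ..
 finally show ?thesis using of_real_eq_iff by blast
qed

text \<open>Factor M as e U with orthonormal rows of U. The trace is the sum of e i a times U a i,
  and Cauchy-Schwarz splits it into the Hilbert-Schmidt norm of e, which equals that of M, and that
  of U, whose square is the number of rows.\<close>

lemma trace_le_rank:
 fixes M :: "'i => 'i => complex"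
 assumes I: "finite I" and B: "finite B"
  and M: "!!i. i \<in> I ==> EX c. \<forall>i'\<in>I. M i i' = (\<Sum>b\<in>B. c b * v b i')"
 shows "(cmod (\<Sum>i\<in>I. M i i))\<^sup>2 <= card B * (\<Sum>i\<in>I. \<Sum>i'\<in>I. (cmod (M i i'))\<^sup>2)"
proof -
 obtain r U c where r: "r <= card B"
  and on: "!!a a'. a < r ==> a' < r ==> (\<Sum>i\<in>I. U a i * cnj (U a' i)) = (if a = a' then 1 else 0)"
  and sp: "!!b i. b \<in> B ==> i \<in> I ==> v b i = (\<Sum>a<r. c b a * U a i)"
  using gram_schmidt[OF I B, of v] by (elim exE conjE) (rule that, simp_all)
 obtain m where m: "!!i i'. i \<in> I ==> i' \<in> I ==> M i i' = (\<Sum>b\<in>B. m i b * v b i')"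
  using M by metis
 define e where "e = (%i a. \<Sum>b\<in>B. m i b * c b a)"
 have Me: "M i i' = (\<Sum>a<r. e i a * U a i')" if "i \<in> I" "i' \<in> I" for i i'
 proof -
  have "M i i' = (\<Sum>b\<in>B. \<Sum>a<r. m i b * c b a * U a i')"
   using m[OF that] sp that by (simp add: sum_distrib_left mult.assoc)
  also have "\<dots> = (\<Sum>a<r. e i a * U a i')"
   by (subst sum.swap) (simp add: e_def sum_distrib_right)
  finally show ?thesis .
 qed
 have HS: "(\<Sum>i'\<in>I. (cmod (M i i'))\<^sup>2) = (\<Sum>a<r. (cmod (e i a))\<^sup>2)" if "i \<in> I" for i
  using norm_orthonormal_sum[OF I on, of r "e i"] Me[OF that] by simp
 let ?P = "I \<times> {..<r}"
 have "cmod (\<Sum>i\<in>I. M i i) = cmod (\<Sum>(i,a)\<in>?P. e i a * U a i)"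
  using Me by (simp add: sum.cartesian_product[symmetric])
 also have "\<dots> <= (\<Sum>(i,a)\<in>?P. cmod (e i a) * cmod (U a i))"
  by (rule order_trans[OF norm_sum]) (simp add: case_prod_unfold norm_mult)
 finally have "(cmod (\<Sum>i\<in>I. M i i))\<^sup>2 <= (\<Sum>(i,a)\<in>?P. cmod (e i a) * cmod (U a i))\<^sup>2"
  by (intro power_mono) auto
 also have "\<dots> <= (\<Sum>(i,a)\<in>?P. (cmod (e i a))\<^sup>2) * (\<Sum>(i,a)\<in>?P. (cmod (U a i))\<^sup>2)"
  using Cauchy_Schwarz_ineq_sum[of "%(i,a). cmod (e i a)" "%(i,a). cmod (U a i)" ?P]
  by (simp add: case_prod_unfold)
 also have "(\<Sum>(i,a)\<in>?P. (cmod (e i a))\<^sup>2) = (\<Sum>i\<in>I. \<Sum>i'\<in>I. (cmod (M i i'))\<^sup>2)"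
  using HS by (simp add: sum.cartesian_product[symmetric])
 also have "(\<Sum>(i,a)\<in>?P. (cmod (U a i))\<^sup>2) = (\<Sum>a<r. \<Sum>i\<in>I. (cmod (U a i))\<^sup>2)"
  by (simp add: sum.cartesian_product[symmetric]) (rule sum.swap)
 also have "\<dots> = r"
 proof -
  have "(\<Sum>i\<in>I. (cmod (U a i))\<^sup>2) = 1" if "a < r" for a
  proof -
   have "complex_of_real (\<Sum>i\<in>I. (cmod (U a i))\<^sup>2) = 1"
    using on[OF that that] unfolding of_real_sum complex_norm_square by simp
   then show ?thesis using of_real_eq_1_iff by blast
  qed
  then show ?thesis by simp
 qed
 also have "(\<Sum>i\<in>I. \<Sum>i'\<in>I. (cmod (M i i'))\<^sup>2) * real r <= (\<Sum>i\<in>I. \<Sum>i'\<in>I. (cmod (M i i'))\<^sup>2) * card B"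
  using r by (intro mult_left_mono sum_nonneg) auto
 finally show ?thesis by (simp add: mult.commute)
qed

section \<open>Counting separated points in balls of subspaces and of kernels\<close>

text \<open>The power trick: a constant factor \<open>K\<close> disappears once the inequality holds
  for all large powers. It frees the counting bounds below of their dimension-dependent
  constants.\<close>

lemma power_growth_le:
 fixes a b K :: real
 assumes "!!m. m \<ge> m0 ==> a ^ m <= K * b ^ m" "0 < b" "0 <= a"
 shows "a <= b"
proof (rule ccontr)
 assume "\<not> a <= b"
 then have "1 < a / b" using assms by simp
 then obtain N where "K < (a / b) ^ N" using real_arch_pow by blast
 moreover have "(a / b) ^ N <= (a / b) ^ (N + m0)"
  using \<open>1 < a / b\<close> by (intro power_increasing) auto
 moreover have "(a / b) ^ (N + m0) <= K"
  using assms(1)[of "N + m0"] assms(2) by (simp add: power_divide field_simps)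
 ultimately show False by linarith
qed

text \<open>The l1 norm without real powers, so that the counting works with plain finite
  sums.\<close>

definition l1n :: "'i set => ('i => complex) => real" where
 "l1n I f = (\<Sum>i\<in>I. cmod (f i))"

lemma l1n_nonneg [simp]: "0 <= l1n I f" by (simp add: l1n_def sum_nonneg)

lemma l1n_add: "l1n I (%i. f i + g i) <= l1n I f + l1n I g"
 by (simp add: l1n_def sum.distrib[symmetric] sum_mono norm_triangle_ineq)

lemma l1n_diff: "l1n I (%i. f i - g i) <= l1n I f + l1n I g"
 by (simp add: l1n_def sum.distrib[symmetric] sum_mono norm_triangle_ineq4)

lemma l1n_diff_triangle: "l1n I (%i. f i - h i) <= l1n I (%i. f i - g i) + l1n I (%i. g i - h i)"
 using l1n_add[of I "%i. f i - g i" "%i. g i - h i"] by simp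

lemma l1n_commute: "l1n I (%i. f i - g i) = l1n I (%i. g i - f i)"
 by (simp add: l1n_def norm_minus_commute)

lemma l1n_scale: "l1n I (%i. c * f i) = cmod c * l1n I f"
 by (simp add: l1n_def norm_mult sum_distrib_left)

text \<open>Cut the coordinates with respect to an orthonormal basis of the span into squares;
  separated points lie in different cells. The constant depends badly on the dimension, but on
  neither \<kappa> nor \<open>Y\<close>.\<close>

lemma span_packing_crude:
 fixes v :: "'b => 'i => complex"
 assumes I: "finite I" and B: "finite B"
 obtains C where "0 < C"
  "!!\<kappa> Y. 0 < \<kappa> ==> \<kappa> <= 1 ==> finite Y ==>
   (!!y. y \<in> Y ==> EX c. \<forall>i\<in>I. y i = (\<Sum>b\<in>B. c b * v b i)) ==>
   (!!y. y \<in> Y ==> l1n I y <= 4) ==>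
   (!!y y'. y \<in> Y ==> y' \<in> Y ==> y ~= y' ==> \<kappa> <= l1n I (%i. y i - y' i)) ==>
   real (card Y) <= (C / \<kappa>) ^ (2 * card B)"
proof -
 obtain r U c where r: "r <= card B"
  and on: "!!a a'. a < r ==> a' < r ==> (\<Sum>i\<in>I. U a i * cnj (U a' i)) = (if a = a' then 1 else 0)"
  and sp: "!!b i. b \<in> B ==> i \<in> I ==> v b i = (\<Sum>a<r. c b a * U a i)"
  using gram_schmidt[OF I B, of v] by (elim exE conjE) (rule that, simp_all)
 have U1: "cmod (U a i) <= 1" if "a < r" "i \<in> I" for a i
 proof -
  have "complex_of_real (\<Sum>i\<in>I. (cmod (U a i))\<^sup>2) = 1"
   using on[OF that(1) that(1)] unfolding of_real_sum complex_norm_square by simp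
  then have "(\<Sum>i\<in>I. (cmod (U a i))\<^sup>2) = 1" using of_real_eq_1_iff by blast
  moreover have "(cmod (U a i))\<^sup>2 <= (\<Sum>i\<in>I. (cmod (U a i))\<^sup>2)"
   using I that by (intro member_le_sum) auto
  ultimately show ?thesis by (simp add: power2_le_imp_le abs_square_le_1)
 qed
 \<comment> \<open>Chosen for the mesh h = 11 \<kappa> / C below. Two points of one cell are at
   distance less than 2 h (r + 1)(card I + 1) = \<kappa>, and a real coordinate meets at most 8 / h
   + 3 <= 11 / h = C / \<kappa> intervals.\<close>
 define C where "C = 22 * (real r + 1) * (real (card I) + 1)"
 have C: "22 <= C"
 proof -
  have "1 * 1 <= (real r + 1) * (real (card I) + 1)" by (intro mult_mono) auto
  then show ?thesis unfolding C_def by linarith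
 qed
 show thesis
 proof (rule that[of C])
  show "0 < C" using C by simp
  fix \<kappa> :: real and Y
  assume k: "0 < \<kappa>" "\<kappa> <= 1" and Y: "finite Y"
   and Ysp: "!!y. y \<in> Y ==> EX c. \<forall>i\<in>I. y i = (\<Sum>b\<in>B. c b * v b i)"
   and Yn: "!!y. y \<in> Y ==> l1n I y <= 4"
   and Ysep: "!!y y'. y \<in> Y ==> y' \<in> Y ==> y ~= y' ==> \<kappa> <= l1n I (%i. y i - y' i)"
  define h where "h = 11 * \<kappa> / C"
  have h: "0 < h" "h <= 1" using k C by (auto simp: h_def field_simps)
  have "EX e. \<forall>i\<in>I. y i = (\<Sum>a<r. e a * U a i)" if yY: "y \<in> Y" for y
  proof -
   obtain m where m: "!!i. i \<in> I ==> y i = (\<Sum>b\<in>B. m b * v b i)" using Ysp[OF yY] by metis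
   have "y i = (\<Sum>a<r. (\<Sum>b\<in>B. m b * c b a) * U a i)" if "i \<in> I" for i
   proof -
    have "y i = (\<Sum>b\<in>B. \<Sum>a<r. m b * c b a * U a i)"
     using m[OF that] sp that by (simp add: sum_distrib_left mult.assoc)
    also have "\<dots> = (\<Sum>a<r. (\<Sum>b\<in>B. m b * c b a) * U a i)"
     by (subst sum.swap) (simp add: sum_distrib_right)
    finally show ?thesis .
   qed
   then show ?thesis by (intro exI[of _ "%a. \<Sum>b\<in>B. m b * c b a"]) simp
  qed
  then obtain e where e: "!!y i. y \<in> Y ==> i \<in> I ==> y i = (\<Sum>a<r. e y a * U a i)" by metis
  \<comment> \<open>The coefficient is an inner product with \<open>U a\<close>, whose entries have
    modulus at most 1, so the l1 norm bounds it.\<close>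
  have e4: "cmod (e y a) <= 4" if y: "y \<in> Y" and a: "a < r" for y a
  proof -
   have "(\<Sum>i\<in>I. y i * cnj (U a i)) = (\<Sum>i\<in>I. \<Sum>a'<r. e y a' * (U a' i * cnj (U a i)))"
    using e[OF y] by (simp add: sum_distrib_right mult.assoc)
   also have "\<dots> = (\<Sum>a'<r. e y a' * (\<Sum>i\<in>I. U a' i * cnj (U a i)))"
    by (subst sum.swap) (simp add: sum_distrib_left)
   also have "\<dots> = (\<Sum>a'<r. if a' = a then e y a' else 0)"
    using on a by (intro sum.cong) auto
   also have "\<dots> = e y a" using a by (simp add: sum.delta)
   finally have "cmod (e y a) = cmod (\<Sum>i\<in>I. y i * cnj (U a i))" by simp
   also have "\<dots> <= (\<Sum>i\<in>I. cmod (y i * cnj (U a i)))" by (rule norm_sum)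
   also have "\<dots> <= (\<Sum>i\<in>I. cmod (y i))"
    using U1[OF a] by (intro sum_mono) (simp add: norm_mult mult_left_le)
   also have "\<dots> <= 4" using Yn[OF y] by (simp add: l1n_def)
   finally show ?thesis .
  qed
  \<comment> \<open>One integer each for the real and the imaginary part of a coefficient; hence the
    factor 2 in the exponent.\<close>
  define cell where "cell = (%y. restrict (%a. (\<lfloor>Re (e y a) / h\<rfloor>, \<lfloor>Im (e y a) / h\<rfloor>)) {..<r})"
  define m where "m = \<lfloor>4 / h\<rfloor> + 1"
  define T where "T = (\<Pi>\<^sub>E a\<in>{..<r}. {-m..m} \<times> {-m..m})"
  have m: "0 <= m" using h by (simp add: m_def)
  have fl: "\<lfloor>x / h\<rfloor> \<in> {-m..m}" if "\<bar>x\<bar> <= 4" for x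
  proof -
   have "x / h <= 4 / h" "- (4 / h) <= x / h" using that h by (auto simp: field_simps)
   then show ?thesis unfolding m_def by simp linarith
  qed
  have "cell ` Y \<subseteq> T"
  proof
   fix t assume "t \<in> cell ` Y"
   then obtain y where y: "y \<in> Y" "t = cell y" by blast
   have "\<bar>Re (e y a)\<bar> <= 4 & \<bar>Im (e y a)\<bar> <= 4" if "a < r" for a
    using e4[OF y(1) that] abs_Re_le_cmod[of "e y a"] abs_Im_le_cmod[of "e y a"] by linarith
   then show "t \<in> T" using fl by (auto simp: y(2) cell_def T_def)
  qed
  moreover have "inj_on cell Y"
  proof (rule inj_onI, rule ccontr)
   fix y y' assume y: "y \<in> Y" "y' \<in> Y" "cell y = cell y'" "y ~= y'"
   have d: "cmod (e y a - e y' a) <= 2 * h" if a: "a < r" for a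
   proof -
    have "cell y a = cell y' a" using y by simp
    then have fe: "\<lfloor>Re (e y a) / h\<rfloor> = \<lfloor>Re (e y' a) / h\<rfloor>" "\<lfloor>Im (e y a) / h\<rfloor> = \<lfloor>Im (e y' a) / h\<rfloor>"
     using a by (simp_all add: cell_def)
    have fd: "\<bar>x - x'\<bar> <= h" if "\<lfloor>x / h\<rfloor> = \<lfloor>x' / h\<rfloor>" for x x'
    proof -
     have "\<bar>x / h - x' / h\<bar> <= 1" using that by linarith
     then show ?thesis using h by (simp add: field_simps abs_div flip: diff_divide_distrib)
    qed
    have "cmod (e y a - e y' a) <= \<bar>Re (e y a - e y' a)\<bar> + \<bar>Im (e y a - e y' a)\<bar>" by (rule cmod_le)
    then show ?thesis using fd[OF fe(1)] fd[OF fe(2)] by simp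
   qed
   have "l1n I (%i. y i - y' i) = (\<Sum>i\<in>I. cmod (\<Sum>a<r. (e y a - e y' a) * U a i))"
    using e y by (simp add: l1n_def left_diff_distrib sum_subtractf)
   also have "\<dots> <= (\<Sum>i\<in>I. \<Sum>a<r. 2 * h)"
   proof (intro sum_mono order_trans[OF norm_sum])
    fix i a assume "i \<in> I" "a \<in> {..<r}"
    then have "cmod (e y a - e y' a) * cmod (U a i) <= (2 * h) * 1"
     using d U1 h by (intro mult_mono) auto
    then show "cmod ((e y a - e y' a) * U a i) <= 2 * h" by (simp add: norm_mult)
   qed
   also have "\<dots> = (real (card I) * real r) * (2 * h)" by simp
   also have "\<dots> < ((real (card I) + 1) * (real r + 1)) * (2 * h)"
    using h by (intro mult_strict_right_mono) (auto simp: field_simps intro: add_nonneg_pos)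
   also have "\<dots> = \<kappa>"
   proof -
    have "C * h = 11 * \<kappa>" using C by (simp add: h_def)
    then show ?thesis unfolding C_def by (simp add: algebra_simps)
   qed
   finally show False using Ysep[OF y(1,2,4)] by simp
  qed
  moreover have fT: "finite T" by (simp add: T_def finite_PiE)
  ultimately have "card Y <= card T" by (metis card_inj_on_le)
  also have "card T = (nat (2 * m + 1) * nat (2 * m + 1)) ^ r"
   by (simp add: T_def card_PiE card_cartesian_product algebra_simps)
  finally have "real (card Y) <= (real (nat (2 * m + 1))) ^ (2 * r)"
   by (simp add: power_mult power2_eq_square flip: of_nat_mult of_nat_power)
  also have "\<dots> <= (C / \<kappa>) ^ (2 * r)"
  proof (intro power_mono)
   have "real (nat (2 * m + 1)) = 2 * of_int m + 1" using m by simp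
   also have "\<dots> <= 8 / h + 3" unfolding m_def by simp linarith
   also have "\<dots> <= 11 / h" using h by (simp add: field_simps)
   also have "\<dots> = C / \<kappa>" using k C by (simp add: h_def)
   finally show "real (nat (2 * m + 1)) <= C / \<kappa>" .
  qed simp
  also have "\<dots> <= (C / \<kappa>) ^ (2 * card B)"
   using r C k by (intro power_increasing) (auto simp: field_simps)
  finally show "real (card Y) <= (C / \<kappa>) ^ (2 * card B)" .
 qed
qed

text \<open>The m-digit sums y0 + \<kappa> y1 + \<kappa>^2 y2 + ... over \<open>Y\<close> are card Y
  ^ m points of the same span, and they are \<kappa>^m-separated. The crude bound for them contains
  its constant only once, and \<open>power_growth_le\<close> removes it.\<close>

lemma span_packing:
 fixes v :: "'b => 'i => complex"
 assumes I: "finite I" and B: "finite B" and e: "0 < \<epsilon>" "\<epsilon> <= 1" and Y: "finite Y"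
  and Ysp: "!!y. y \<in> Y ==> EX c. \<forall>i\<in>I. y i = (\<Sum>b\<in>B. c b * v b i)"
  and Yn: "!!y. y \<in> Y ==> l1n I y <= 2"
  and Ysep: "!!y y'. y \<in> Y ==> y' \<in> Y ==> y ~= y' ==> \<epsilon> <= l1n I (%i. y i - y' i)"
 shows "real (card Y) <= (16 / \<epsilon>) ^ (2 * card B)"
proof -
 \<comment> \<open>Tails have norm at most 4, so a pair of them changes the distance between
   different leading digits by at most 8 \<kappa> = \<epsilon> / 2. Also 2 + 4 \<kappa> <= 4
   preserves the norm bound.\<close>
 define \<kappa> where "\<kappa> = \<epsilon> / 16"
 have k: "0 < \<kappa>" "\<kappa> <= 1" using e by (auto simp: \<kappa>_def)
 let ?sp = "%y. EX c. \<forall>i\<in>I. y i = (\<Sum>b\<in>B. c b * v b i)"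
 have ex: "EX X. finite X & card X = card Y ^ m & (\<forall>x\<in>X. ?sp x & l1n I x <= 4) &
  (\<forall>x\<in>X. \<forall>x'\<in>X. x ~= x' --> \<kappa> ^ m <= l1n I (%i. x i - x' i))" for m
 proof (induction m)
  case 0
  show ?case by (rule exI[of _ "{%_. 0}"]) (auto simp: l1n_def intro!: exI[of _ "%_. 0"])
 next
  case (Suc m)
  from Suc obtain X where X0: "finite X" "card X = card Y ^ m" "\<forall>x\<in>X. ?sp x & l1n I x <= 4"
   "\<forall>x\<in>X. \<forall>x'\<in>X. x ~= x' --> \<kappa> ^ m <= l1n I (%i. x i - x' i)"
   by (elim exE conjE) (rule that, assumption+)
  note X = X0(1,2) X0(3)[THEN bspec, THEN conjunct1] X0(3)[THEN bspec, THEN conjunct2] X0(4)[rule_format]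
  \<comment> \<open>Puts a new leading digit in front; the old points become the scaled
    tail.\<close>
  define f where "f = (%(y, x) (i::'i). y i + of_real \<kappa> * x i :: complex)"
  have sep: "\<kappa> ^ Suc m <= l1n I (%i. f (y, x) i - f (y', x') i)"
   if yx: "y \<in> Y" "x \<in> X" "y' \<in> Y" "x' \<in> X" "(y, x) ~= (y', x')" for y x y' x'
  proof (cases "y = y'")
   case True
   then have "l1n I (%i. f (y, x) i - f (y', x') i) = l1n I (%i. of_real \<kappa> * (x i - x' i))"
    by (simp add: f_def algebra_simps)
   also have "\<dots> = \<kappa> * l1n I (%i. x i - x' i)" using k by (simp add: l1n_scale)
   also have "\<dots> \<ge> \<kappa> * \<kappa> ^ m" using X(5)[of x x'] yx True k by (intro mult_left_mono) auto
   finally show ?thesis by simp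
  next
   case False
   have "\<epsilon> <= l1n I (%i. y i - y' i)" using Ysep yx False by blast
   also have "\<dots> = l1n I (%i. (f (y, x) i - f (y', x') i) - of_real \<kappa> * (x i - x' i))"
    by (simp add: f_def algebra_simps)
   also have "\<dots> <= l1n I (%i. f (y, x) i - f (y', x') i) + l1n I (%i. of_real \<kappa> * (x i - x' i))"
    by (rule l1n_diff)
   also have "l1n I (%i. of_real \<kappa> * (x i - x' i)) = \<kappa> * l1n I (%i. x i - x' i)" using k by (simp add: l1n_scale)
   also have "\<dots> <= \<kappa> * 8"
    using l1n_diff[of I x x'] X(4)[OF yx(2)] X(4)[OF yx(4)] k by (intro mult_left_mono) auto
   finally have "8 * \<kappa> <= l1n I (%i. f (y, x) i - f (y', x') i)" by (simp add: \<kappa>_def)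
   moreover have "\<kappa> ^ Suc m <= \<kappa>" using k by (simp add: mult_left_le power_le_one)
   ultimately show ?thesis using k by linarith
  qed
  have inj: "inj_on f (Y \<times> X)"
  proof (rule inj_onI, rule ccontr)
   fix a a' assume a: "a \<in> Y \<times> X" "a' \<in> Y \<times> X" "f a = f a'" "a ~= a'"
   then obtain y x y' x' where aa: "a = (y, x)" "a' = (y', x')" by (metis surj_pair)
   have "\<kappa> ^ Suc m <= l1n I (%i. f a i - f a' i)"
    unfolding aa by (rule sep) (use a aa in auto)
   also have "\<dots> = 0" using a by (simp add: l1n_def)
   finally show False using k zero_less_power[of \<kappa> "Suc m"] by linarith
  qed
  show ?case
  proof (intro exI[of _ "f ` (Y \<times> X)"] conjI ballI impI)
   show "finite (f ` (Y \<times> X))" using Y X by simp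
   show "card (f ` (Y \<times> X)) = card Y ^ Suc m" using card_image[OF inj] X by (simp add: card_cartesian_product)
  next
   fix z assume "z \<in> f ` (Y \<times> X)"
   then obtain y x where z: "y \<in> Y" "x \<in> X" "z = f (y, x)" by auto
   obtain c c' where c: "\<forall>i\<in>I. y i = (\<Sum>b\<in>B. c b * v b i)" "\<forall>i\<in>I. x i = (\<Sum>b\<in>B. c' b * v b i)"
    using Ysp[OF z(1)] X(3)[OF z(2)] by blast
   show "?sp z"
    by (rule exI[of _ "%b. c b + of_real \<kappa> * c' b"])
     (use c in \<open>simp add: z f_def sum.distrib distrib_right sum_distrib_left mult.assoc\<close>)
   have "l1n I z <= l1n I y + l1n I (%i. of_real \<kappa> * x i)" unfolding z f_def by simp (rule l1n_add)
   also have "\<dots> <= 2 + \<kappa> * 4"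
    unfolding l1n_scale using Yn[OF z(1)] X(4)[OF z(2)] k by (intro add_mono) (auto intro: mult_left_mono)
   also have "\<dots> <= 4" using e by (simp add: \<kappa>_def)
   finally show "l1n I z <= 4" .
   fix z' assume "z' \<in> f ` (Y \<times> X)" "z ~= z'"
   then obtain y' x' where z': "y' \<in> Y" "x' \<in> X" "z' = f (y', x')" "(y, x) ~= (y', x')" using z by auto
   show "\<kappa> ^ Suc m <= l1n I (%i. z i - z' i)" using sep[of y x y' x'] z z' by simp
  qed
 qed
 have bound: "real (card Y) ^ m <= C ^ (2 * card B) * ((16 / \<epsilon>) ^ (2 * card B)) ^ m"
  if C: "0 < C" "!!\<kappa> Y. 0 < \<kappa> ==> \<kappa> <= 1 ==> finite Y ==>
   (!!y. y \<in> Y ==> ?sp y) ==> (!!y. y \<in> Y ==> l1n I y <= 4) ==>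
   (!!y y'. y \<in> Y ==> y' \<in> Y ==> y ~= y' ==> \<kappa> <= l1n I (%i. y i - y' i)) ==>
   real (card Y) <= (C / \<kappa>) ^ (2 * card B)" for C m
 proof -
  from ex[of m] obtain X where X0: "finite X" "card X = card Y ^ m" "\<forall>x\<in>X. ?sp x & l1n I x <= 4"
   "\<forall>x\<in>X. \<forall>x'\<in>X. x ~= x' --> \<kappa> ^ m <= l1n I (%i. x i - x' i)"
   by (elim exE conjE) (rule that, assumption+)
  note X = X0(1,2) X0(3)[THEN bspec, THEN conjunct1] X0(3)[THEN bspec, THEN conjunct2] X0(4)[rule_format]
  have "real (card X) <= (C / \<kappa> ^ m) ^ (2 * card B)"
   using X k by (intro C(2)) (auto simp: power_le_one)
  also have "\<dots> = C ^ (2 * card B) * ((1 / \<kappa>) ^ (2 * card B)) ^ m"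
   by (simp add: power_divide power_mult[symmetric] mult.commute)
  finally show ?thesis using X by (simp add: \<kappa>_def)
 qed
 show ?thesis
 proof (rule span_packing_crude[OF I B, of v], goal_cases)
  case (1 C)
  show ?thesis
   by (rule power_growth_le[of 0 "real (card Y)" "C ^ (2 * card B)"], rule bound) (use e 1 in auto)
 qed
qed

text \<open>Cover \<open>Y\<close> by the balls of radius r around the net. Each piece, recentred at
  its net point and divided by r, lies again in the unit ball of \<open>Z\<close>, and its
  separation grows from 2 r^(m+1) to 2 r^m. So each further power of r costs one factor card
  D.\<close>

lemma separated_card_le_net_power:
 fixes Z :: "('i => complex) set"
 assumes D: "finite D" "D \<subseteq> Z" and r: "0 < r"
  and Zd: "!!y d. y \<in> Z ==> d \<in> Z ==> (%i. (y i - d i) / of_real r) \<in> Z"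
  and net: "!!y. y \<in> Z ==> l1n I y <= 1 ==> \<exists>d\<in>D. l1n I (%i. y i - d i) <= r"
 shows "finite Y ==> Y \<subseteq> Z ==> (!!y. y \<in> Y ==> l1n I y <= 1) ==>
  (!!y y'. y \<in> Y ==> y' \<in> Y ==> y ~= y' ==> 2 * r ^ m < l1n I (%i. y i - y' i)) ==> card Y <= card D ^ m"
proof (induction m arbitrary: Y)
 case 0
 have "y = y'" if "y \<in> Y" "y' \<in> Y" for y y'
  using 0(4)[OF that] 0(3)[OF that(1)] 0(3)[OF that(2)] l1n_diff[of I y y'] by force
 then show ?case using 0(1) by (simp add: card_le_Suc0_iff_eq)
next
 case (Suc m)
 define A where "A = (%d. {y \<in> Y. l1n I (%i. y i - d i) <= r})"
 define f where "f = (%d y (i :: 'i). (y i - d i :: complex) / of_real r)"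
 have A: "card (A d) <= card D ^ m" if d: "d \<in> D" for d
 proof -
  have diff: "f d y i - f d y' i = of_real (1 / r) * (y i - y' i)" for y y' i
   using r by (simp add: f_def field_simps)
  have "inj_on (f d) (A d)"
  proof (rule inj_onI)
   fix y y' assume "f d y = f d y'"
   then have "y i = y' i" for i using diff[of y i y'] r by simp
   then show "y = y'" by blast
  qed
  then have "card (A d) = card (f d ` A d)" by (simp add: card_image)
  also have "\<dots> <= card D ^ m"
  proof (rule Suc.IH)
   show "finite (f d ` A d)" using Suc.prems(1) by (simp add: A_def)
   show "f d ` A d \<subseteq> Z" using Zd d D(2) Suc.prems(2) by (auto simp: f_def A_def)
   show "l1n I z <= 1" if zf: "z \<in> f d ` A d" for z
   proof -
    obtain y where y: "y \<in> A d" "z = f d y" using zf by blast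
    have "l1n I z = (1 / r) * l1n I (%i. y i - d i)"
     using r l1n_scale[of I "of_real (1 / r)" "%i. y i - d i"] by (simp add: y f_def norm_divide)
    then show ?thesis using y r by (simp add: A_def)
   qed
   show "2 * r ^ m < l1n I (%i. z i - z' i)" if z: "z \<in> f d ` A d" "z' \<in> f d ` A d" "z ~= z'" for z z'
   proof -
    obtain y y' where y: "y \<in> Y" "y' \<in> Y" "z = f d y" "z' = f d y'" using z by (auto simp: A_def)
    have "2 * r ^ Suc m < l1n I (%i. y i - y' i)" using y z by (intro Suc.prems(4)) auto
    moreover have "l1n I (%i. z i - z' i) = (1 / r) * l1n I (%i. y i - y' i)"
     unfolding y diff l1n_scale using r by (simp add: norm_divide)
    ultimately have "r * (2 * r ^ m) < r * l1n I (%i. z i - z' i)" using r by simp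
    then show ?thesis using r by (simp only: mult_less_cancel_left_pos)
   qed
  qed
  finally show ?thesis .
 qed
 have "Y \<subseteq> (\<Union>d\<in>D. A d)" using Suc.prems(2,3) net unfolding A_def by blast
 then have "card Y <= card (\<Union>d\<in>D. A d)" using D(1) Suc.prems(1) by (intro card_mono) (auto simp: A_def)
 also have "\<dots> <= (\<Sum>d\<in>D. card (A d))" by (rule card_UN_le[OF D(1)])
 also have "\<dots> <= card D * card D ^ m" using sum_bounded_above[of D "%d. card (A d)" "card D ^ m"] A by simp
 finally show ?case by simp
qed

text \<open>Pigeonhole, as in Siegel's lemma: of the vectors whose entries are Gaussian integers
  with parts in 0..H, many share their image under the integer matrix \<open>k\<close>, and
  differences within one fibre lie in the kernel. Integrality keeps distinct points at distance at
  least 1.\<close>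

lemma kernel_lattice_points:
 fixes k :: "'e => 'i => int"
 assumes I: "finite I" and E: "finite E"
 obtains K where "1 <= K" "!!H. 1 <= H ==> EX Y. finite Y & H ^ (2 * card I) <= card Y * (K * H) ^ (2 * card E) &
  (\<forall>y\<in>Y. \<forall>e\<in>E. (\<Sum>i\<in>I. of_int (k e i) * y i :: complex) = 0) & (\<forall>y\<in>Y. l1n I y <= 2 * H * card I) &
  (\<forall>y\<in>Y. \<forall>y'\<in>Y. y ~= y' --> 1 <= l1n I (%i. y i - y' i))"
proof -
 \<comment> \<open>On the box every linear form is bounded by \<open>K0\<close> H in its real and
   its imaginary part, so it takes at most (2 \<open>K0\<close> H + 1)^2 values.\<close>
 define K0 where "K0 = (\<Sum>e\<in>E. \<Sum>i\<in>I. nat \<bar>k e i\<bar>)"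
 show thesis
 proof (rule that[of "2 * K0 + 1"])
  show "1 <= 2 * K0 + 1" by simp
  fix H :: nat assume H: "1 <= H"
  define P where "P = (\<Pi>\<^sub>E i\<in>I. {0..int H} \<times> {0..int H})"
  define \<psi> where "\<psi> = (%p. restrict (%e. (\<Sum>i\<in>I. k e i * fst (p i), \<Sum>i\<in>I. k e i * snd (p i))) E)"
  define N where "N = int (K0 * H)"
  define T where "T = (\<Pi>\<^sub>E e\<in>E. {-N..N} \<times> {-N..N})"
  have fP: "finite P" and fT: "finite T" using I E by (auto simp: P_def T_def intro: finite_PiE)
  have H1: "nat (int H + 1) = H + 1" by linarith
  have cP: "card P = (H + 1) ^ (2 * card I)"
   by (simp add: P_def card_PiE card_cartesian_product I power_mult power2_eq_square H1 del: Suc_eq_plus1)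
  have N1: "card {-N..N} = 2 * K0 * H + 1"
  proof -
   have "int (card {-N..N}) = int (2 * K0 * H + 1)" by (simp add: N_def)
   then show ?thesis by linarith
  qed
  have cT: "card T = (2 * K0 * H + 1) ^ (2 * card E)"
   by (simp only: T_def card_PiE[OF E] card_cartesian_product N1 prod_constant power_mult power2_eq_square)
  have bnd: "(\<Sum>i\<in>I. k e i * x i) \<in> {-N..N}" if e: "e \<in> E" and x: "!!i. i \<in> I ==> x i \<in> {0..int H}" for e x
  proof -
   have "\<bar>\<Sum>i\<in>I. k e i * x i\<bar> <= (\<Sum>i\<in>I. \<bar>k e i * x i\<bar>)" by (rule sum_abs)
   also have "\<dots> <= (\<Sum>i\<in>I. \<bar>k e i\<bar> * int H)"
    using x by (intro sum_mono) (auto simp: abs_mult intro!: mult_left_mono)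
   also have "\<dots> = (\<Sum>i\<in>I. \<bar>k e i\<bar>) * int H" by (simp add: sum_distrib_right)
   also have "\<dots> <= int K0 * int H"
   proof (rule mult_right_mono)
    have "(\<Sum>i\<in>I. nat \<bar>k e i\<bar>) <= K0" unfolding K0_def using e E by (intro member_le_sum) auto
    then have "int (\<Sum>i\<in>I. nat \<bar>k e i\<bar>) <= int K0" by linarith
    then show "(\<Sum>i\<in>I. \<bar>k e i\<bar>) <= int K0" by simp
   qed simp
   finally show ?thesis by (auto simp: N_def)
  qed
  have psi: "\<psi> p \<in> T" if "p \<in> P" for p
  proof -
   have "fst (p i) \<in> {0..int H}" "snd (p i) \<in> {0..int H}" if "i \<in> I" for i
    using \<open>p \<in> P\<close> that by (auto simp: P_def PiE_iff mem_Times_iff)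
   then show ?thesis unfolding T_def \<psi>_def using bnd by simp
  qed
  have "0 < card P" by (simp add: cP)
  then obtain p1 where p1: "p1 \<in> P" by (metis card_gt_0_iff ex_in_conv)
  define A where "A = (%t. {p \<in> P. \<psi> p = t})"
  \<comment> \<open>The size of the fullest fibre, which is at least card P / card T.\<close>
  define M where "M = Max ((%t. card (A t)) ` T)"
  have Tne: "T ~= {}" using psi[OF p1] by blast
  have "M \<in> (%t. card (A t)) ` T" unfolding M_def using fT Tne by (intro Max_in) auto
  then obtain t where t: "t \<in> T" "M = card (A t)" by blast
  have "card P <= card (\<Union>t\<in>T. A t)" using psi fT fP by (intro card_mono) (auto simp: A_def)
  also have "\<dots> <= (\<Sum>t\<in>T. card (A t))" by (rule card_UN_le[OF fT])
  also have "\<dots> <= card T * M" using sum_bounded_above[of T "%t. card (A t)" M] fT by (simp add: M_def)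
  finally have PT: "card P <= card T * card (A t)" using t by simp
  then have "card (A t) ~= 0" using \<open>0 < card P\<close> by (intro notI) simp
  then obtain p0 where p0: "p0 \<in> A t" by (metis card.empty ex_in_conv)
  \<comment> \<open>Subtracting the fixed member \<open>p0\<close> of the fibre lands in the
    kernel.\<close>
  define f where "f = (%p i. if i \<in> I then Complex (of_int (fst (p i) - fst (p0 i))) (of_int (snd (p i) - snd (p0 i))) else 0)"
  have fA: "finite (A t)" using fP by (simp add: A_def)
  have sep: "1 <= l1n I (%i. f p i - f p' i)" if p: "p \<in> A t" "p' \<in> A t" "p ~= p'" for p p'
  proof -
   have "p \<in> P" "p' \<in> P" using p by (auto simp: A_def)
   then have "\<exists>i\<in>I. p i ~= p' i" using p(3) unfolding P_def by (metis PiE_ext)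
   then obtain i where i: "i \<in> I" "p i ~= p' i" by blast
   have d: "f p i - f p' i = Complex (of_int (fst (p i) - fst (p' i))) (of_int (snd (p i) - snd (p' i)))"
    using i by (simp add: f_def complex_eq_iff)
   have "1 <= \<bar>fst (p i) - fst (p' i)\<bar> \<or> 1 <= \<bar>snd (p i) - snd (p' i)\<bar>"
    using i(2) by (auto simp: prod_eq_iff)
   then have "1 <= \<bar>Re (f p i - f p' i)\<bar> \<or> 1 <= \<bar>Im (f p i - f p' i)\<bar>"
    unfolding d complex.sel by (metis of_int_1_le_iff of_int_abs)
   then have "1 <= cmod (f p i - f p' i)"
    using abs_Re_le_cmod[of "f p i - f p' i"] abs_Im_le_cmod[of "f p i - f p' i"] by linarith
   also have "\<dots> <= l1n I (%i. f p i - f p' i)" unfolding l1n_def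
    using i I by (intro member_le_sum) auto
   finally show ?thesis .
  qed
  have inj: "inj_on f (A t)"
  proof (rule inj_onI, rule ccontr)
   fix p p' assume "p \<in> A t" "p' \<in> A t" "f p = f p'" "p ~= p'"
   with sep[of p p'] show False by (simp add: l1n_def)
  qed
  show "EX Y. finite Y & H ^ (2 * card I) <= card Y * ((2 * K0 + 1) * H) ^ (2 * card E) &
   (\<forall>y\<in>Y. \<forall>e\<in>E. (\<Sum>i\<in>I. of_int (k e i) * y i :: complex) = 0) & (\<forall>y\<in>Y. l1n I y <= 2 * H * card I) &
   (\<forall>y\<in>Y. \<forall>y'\<in>Y. y ~= y' --> 1 <= l1n I (%i. y i - y' i))"
  proof (intro exI[of _ "f ` A t"] conjI ballI impI)
   show "finite (f ` A t)" using fA by simp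
   have "H ^ (2 * card I) <= card P" unfolding cP by (intro power_mono) auto
   also have "\<dots> <= card T * card (A t)" by (rule PT)
   also have "\<dots> <= ((2 * K0 + 1) * H) ^ (2 * card E) * card (A t)"
    unfolding cT using H by (intro mult_right_mono power_mono) (auto simp: algebra_simps)
   finally show "H ^ (2 * card I) <= card (f ` A t) * ((2 * K0 + 1) * H) ^ (2 * card E)"
    using card_image[OF inj] by (simp add: mult.commute)
  next
   fix y e assume "y \<in> f ` A t" "e \<in> E"
   then obtain p where p: "p \<in> A t" "y = f p" by blast
   have "\<psi> p e = \<psi> p0 e" using p p0 by (simp add: A_def)
   then have "(\<Sum>i\<in>I. k e i * fst (p i)) = (\<Sum>i\<in>I. k e i * fst (p0 i))" "(\<Sum>i\<in>I. k e i * snd (p i)) = (\<Sum>i\<in>I. k e i * snd (p0 i))"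
    using \<open>e \<in> E\<close> by (simp_all add: \<psi>_def)
   then have z: "(\<Sum>i\<in>I. k e i * (fst (p i) - fst (p0 i))) = 0" "(\<Sum>i\<in>I. k e i * (snd (p i) - snd (p0 i))) = 0"
    by (simp_all add: right_diff_distrib sum_subtractf)
   have "Re (\<Sum>i\<in>I. of_int (k e i) * y i) = of_int (\<Sum>i\<in>I. k e i * (fst (p i) - fst (p0 i)))"
    "Im (\<Sum>i\<in>I. of_int (k e i) * y i) = of_int (\<Sum>i\<in>I. k e i * (snd (p i) - snd (p0 i)))"
    unfolding p f_def Re_sum Im_sum of_int_sum by (auto intro!: sum.cong)
   then show "(\<Sum>i\<in>I. of_int (k e i) * y i) = 0" unfolding z by (simp add: complex_eq_iff)
  next
   fix y assume "y \<in> f ` A t"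
   then obtain p where p: "p \<in> A t" "y = f p" by blast
   have "l1n I y <= (\<Sum>i\<in>I. 2 * real H)" unfolding l1n_def
   proof (intro sum_mono)
    fix i assume i: "i \<in> I"
    have "p i \<in> {0..int H} \<times> {0..int H}" "p0 i \<in> {0..int H} \<times> {0..int H}"
     using p p0 i by (auto simp: A_def P_def PiE_iff)
    then have "\<bar>fst (p i) - fst (p0 i)\<bar> <= int H" "\<bar>snd (p i) - snd (p0 i)\<bar> <= int H"
     by (auto simp: mem_Times_iff)
    then have "\<bar>Re (y i)\<bar> <= real H" "\<bar>Im (y i)\<bar> <= real H"
     using i unfolding p f_def by simp_all
    then show "cmod (y i) <= 2 * real H" using cmod_le[of "y i"] by linarith
   qed
   then show "l1n I y <= 2 * H * card I" by (simp add: mult.commute)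
  next
   fix y y' assume "y \<in> f ` A t" "y' \<in> f ` A t" "y ~= y'"
   then show "1 <= l1n I (%i. y i - y' i)" using sep by blast
  qed
 qed
qed

text \<open>Kernel lattice points of height H, scaled into the unit ball, are separated by about 1 /
  H. For H of order r^(-m) there are at least about r^(-2 m (card I - card E)) of them, whereas
  \<open>separated_card_le_net_power\<close> allows card D ^ m. The constants vanish as m
  grows.\<close>

lemma net_card_lower:
 fixes k :: "'e => 'i => int"
 assumes I: "finite I" and E: "finite E" "card E <= card I"
 defines "Z \<equiv> {z :: 'i => complex. \<forall>e\<in>E. (\<Sum>i\<in>I. of_int (k e i) * z i) = 0}"
 assumes D: "finite D" "D \<subseteq> Z" and r: "0 < r" "r < 1"
  and net: "!!y. y \<in> Z ==> l1n I y <= 1 ==> \<exists>d\<in>D. l1n I (%i. y i - d i) <= r"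
 shows "(1 / r) ^ (2 * (card I - card E)) <= card D"
proof -
 obtain K where K: "1 <= K" "!!H. 1 <= H ==> EX Y. finite Y & H ^ (2 * card I) <= card Y * (K * H) ^ (2 * card E) &
  (\<forall>y\<in>Y. \<forall>e\<in>E. (\<Sum>i\<in>I. of_int (k e i) * y i :: complex) = 0) & (\<forall>y\<in>Y. l1n I y <= 2 * H * card I) &
  (\<forall>y\<in>Y. \<forall>y'\<in>Y. y ~= y' --> 1 <= l1n I (%i. y i - y' i))"
  by (rule kernel_lattice_points[OF I E(1), of k]) (rule that, assumption, blast)
 \<comment> \<open>The points will be divided by b = 2 H (card I + 1), where H <= 2 c / r^m. This c
   makes 2 r^m b <= 8 c (card I + 1) = 1 / 2, so that the scaled points are more than 2 r^m
   apart.\<close>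
 define c where "c = 1 / (16 * (real (card I) + 1))"
 have c: "0 < c" by (simp add: c_def)
 define q where "q = 2 * (card I - card E)"
 obtain m0 where m0: "r ^ m0 < c" using real_arch_pow_inv[OF c r(2)] by blast
 have "((1 / r) ^ q) ^ m <= (real K ^ (2 * card E) * (1 / c) ^ q) * real (card D) ^ m" if m: "m0 <= m" for m
 proof -
  have rm: "r ^ m < c" using m0 power_decreasing[OF m, of r] r by linarith
  \<comment> \<open>As r^m < c, the argument is at least 2 and rounding down loses at most half: H
    lies between c / r^m and 2 c / r^m.\<close>
  define H where "H = nat \<lfloor>2 * c / r ^ m\<rfloor>"
  have g2: "2 <= 2 * c / r ^ m" using rm r by (simp add: field_simps)
  then have H1: "1 <= H" unfolding H_def by linarith
  have Hu: "real H <= 2 * c / r ^ m" unfolding H_def using g2 by linarith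
  have Hl: "c / r ^ m <= real H" unfolding H_def using g2 by linarith
  obtain Y where Y: "finite Y" "H ^ (2 * card I) <= card Y * (K * H) ^ (2 * card E)"
   "!!y. y \<in> Y ==> y \<in> Z" "!!y. y \<in> Y ==> l1n I y <= 2 * H * card I"
   "!!y y'. y \<in> Y ==> y' \<in> Y ==> y ~= y' ==> 1 <= l1n I (%i. y i - y' i)"
   using K(2)[OF H1] by (elim exE conjE) (rule that, auto simp: Z_def)
  define b where "b = 2 * real H * (real (card I) + 1)"
  have b: "0 < b" using H1 by (simp add: b_def)
  have br: "b * (2 * r ^ m) < 1"
  proof -
   have "b * (2 * r ^ m) <= 2 * (2 * c / r ^ m) * (real (card I) + 1) * (2 * r ^ m)"
    unfolding b_def using Hu r by (intro mult_right_mono mult_left_mono) auto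
   also have "\<dots> = 8 * (c * (real (card I) + 1))" using r by simp
   also have "\<dots> = 1 / 2" by (simp add: c_def)
   finally show ?thesis by simp
  qed
  define f where "f = (%y :: 'i => complex. %i. of_real (1 / b) * y i)"
  have inj: "inj_on f Y" using b by (auto simp: inj_on_def f_def fun_eq_iff)
  have "card (f ` Y) <= card D ^ m"
  proof (rule separated_card_le_net_power[OF D r(1) _ net])
   show "(%i. (y i - d i) / of_real r) \<in> Z" if "y \<in> Z" "d \<in> Z" for y d
    using that by (simp add: Z_def right_diff_distrib sum_subtractf flip: sum_divide_distrib)
   show "finite (f ` Y)" using Y by simp
   show "f ` Y \<subseteq> Z"
   proof
    fix z assume "z \<in> f ` Y"
    then obtain y where y: "y \<in> Y" "z = f y" by blast
    have "(\<Sum>i\<in>I. of_int (k e i) * z i) = of_real (1 / b) * (\<Sum>i\<in>I. of_int (k e i) * y i)" for e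
     by (simp add: y f_def sum_distrib_left mult.left_commute)
    then show "z \<in> Z" using Y(3)[OF y(1)] by (simp add: Z_def)
   qed
   show "l1n I z <= 1" if z: "z \<in> f ` Y" for z
   proof -
    obtain y where y: "y \<in> Y" "z = f y" using z by blast
    have "l1n I z = l1n I y / b" using b l1n_scale[of I "of_real (1 / b)" y] by (simp add: y(2) f_def norm_divide)
    moreover have "l1n I y <= b" using Y(4)[OF y(1)] by (simp add: b_def algebra_simps)
    ultimately show ?thesis using b by simp
   qed
   show "2 * r ^ m < l1n I (%i. z i - z' i)" if z: "z \<in> f ` Y" "z' \<in> f ` Y" "z ~= z'" for z z'
   proof -
    obtain y y' where y: "y \<in> Y" "y' \<in> Y" "z = f y" "z' = f y'" using z by blast
    have "l1n I (%i. z i - z' i) = l1n I (%i. of_real (1 / b) * (y i - y' i))"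
     by (simp add: y f_def right_diff_distrib diff_divide_distrib)
    also have "\<dots> = l1n I (%i. y i - y' i) / b" unfolding l1n_scale using b by (simp add: norm_divide)
    also have "\<dots> \<ge> 1 / b" using Y(5)[of y y'] y z b by (intro divide_right_mono) auto
    moreover have "2 * r ^ m < 1 / b" using br b by (simp add: field_simps)
    ultimately show ?thesis by linarith
   qed
  qed
  then have cY: "card Y <= card D ^ m" using card_image[OF inj] by simp
  have "real H ^ q * real H ^ (2 * card E) = real (H ^ (2 * card I))"
   using E(2) unfolding q_def power_add[symmetric] of_nat_power by (intro arg_cong2[of _ _ _ _ power]) auto
  also have "\<dots> <= real (card Y * (K * H) ^ (2 * card E))" using Y(2) by linarith
  also have "\<dots> = real (card Y) * real K ^ (2 * card E) * real H ^ (2 * card E)"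
   by (simp add: power_mult_distrib)
  finally have "real H ^ q <= real (card Y) * real K ^ (2 * card E)" using H1 by simp
  also have "\<dots> <= real (card D ^ m) * real K ^ (2 * card E)"
   using cY by (intro mult_right_mono) auto
  finally have 1: "real H ^ q <= real (card D) ^ m * real K ^ (2 * card E)" by simp
  have "((1 / r) ^ q) ^ m = (1 / c) ^ q * (c / r ^ m) ^ q"
   using c by (simp add: power_divide power_mult[symmetric] mult.commute)
  also have "\<dots> <= (1 / c) ^ q * real H ^ q"
   using Hl c r by (intro mult_left_mono power_mono) auto
  also have "\<dots> <= (1 / c) ^ q * (real (card D) ^ m * real K ^ (2 * card E))"
   using 1 c by (intro mult_left_mono) auto
  finally show ?thesis by (simp add: algebra_simps)
 qed
 moreover have "0 < real (card D)" using net[of "%_. 0"] D(1) by (auto simp: Z_def l1n_def card_gt_0_iff)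
 ultimately show ?thesis
  unfolding q_def[symmetric]
  by (rule power_growth_le[of m0 "(1 / r) ^ q" "real K ^ (2 * card E) * (1 / c) ^ q"]) (use r in auto)
qed

text \<open>Take a largest set of kernel points in the unit ball whose approximants are
  \<epsilon>-separated. The approximants lie in a span of card B vectors, which bounds the set from
  above; by maximality it is a 3 \<epsilon>-net of the ball, which bounds it from below. Real
  dimensions double both exponents, hence the square root at the end.\<close>

lemma kernel_width_lower:
 fixes k :: "'e => 'i => int" and v :: "'b => 'i => complex"
 assumes I: "finite I" and E: "finite E" "card E <= card I" and B: "finite B"
  and e: "0 < \<epsilon>" "3 * \<epsilon> < 1"
  and approx: "!!z. (\<forall>e\<in>E. (\<Sum>i\<in>I. of_int (k e i) * z i) = 0) ==> l1n I z <= 1 ==>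
   EX c. l1n I (%i. z i - (\<Sum>b\<in>B. c b * v b i)) <= \<epsilon>"
 shows "(1 / (3 * \<epsilon>)) ^ (card I - card E) <= (16 / \<epsilon>) ^ card B"
proof -
 define Z where "Z = {z :: 'i => complex. \<forall>e\<in>E. (\<Sum>i\<in>I. of_int (k e i) * z i) = 0}"
 obtain c where c: "!!z. z \<in> Z ==> l1n I z <= 1 ==> l1n I (%i. z i - (\<Sum>b\<in>B. c z b * v b i)) <= \<epsilon>"
  using approx unfolding Z_def mem_Collect_eq by metis
 define \<phi> where "\<phi> = (%z i. \<Sum>b\<in>B. c z b * v b i)"
 have phi: "l1n I (%i. z i - \<phi> z i) <= \<epsilon>" if "z \<in> Z" "l1n I z <= 1" for z
  using c[OF that] by (simp add: \<phi>_def)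
 define sepd where "sepd = (%D. finite D & D \<subseteq> {z \<in> Z. l1n I z <= 1} &
  (\<forall>d\<in>D. \<forall>d'\<in>D. d ~= d' --> \<epsilon> <= l1n I (%i. \<phi> d i - \<phi> d' i)))"
 have bnd: "real (card D) <= (16 / \<epsilon>) ^ (2 * card B)" if D: "sepd D" for D
 proof -
  have sep: "\<epsilon> <= l1n I (%i. \<phi> d i - \<phi> d' i)" if "d \<in> D" "d' \<in> D" "d ~= d'" for d d'
   using D that by (auto simp: sepd_def)
  have "inj_on \<phi> D"
  proof (rule inj_onI, rule ccontr)
   fix d d' assume "d \<in> D" "d' \<in> D" "\<phi> d = \<phi> d'" "d ~= d'"
   then show False using sep[of d d'] e by (simp add: l1n_def)
  qed
  then have "card D = card (\<phi> ` D)" by (simp add: card_image)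
  moreover have "real (card (\<phi> ` D)) <= (16 / \<epsilon>) ^ (2 * card B)"
  proof (rule span_packing[OF I B e(1), of _ v])
   show "\<epsilon> <= 1" using e by simp
   show "finite (\<phi> ` D)" using D by (simp add: sepd_def)
   show "EX c. \<forall>i\<in>I. y i = (\<Sum>b\<in>B. c b * v b i)" if "y \<in> \<phi> ` D" for y
    using that by (auto simp: \<phi>_def)
   show "l1n I y <= 2" if yD: "y \<in> \<phi> ` D" for y
   proof -
    obtain d where d: "d \<in> Z" "l1n I d <= 1" "y = \<phi> d" using yD D by (auto simp: sepd_def)
    have "l1n I y <= l1n I d + l1n I (%i. d i - y i)"
     using l1n_diff[of I d "%i. d i - y i"] by simp
    then show ?thesis using phi[OF d(1,2)] d e by simp
   qed
   show "\<epsilon> <= l1n I (%i. y i - y' i)" if "y \<in> \<phi> ` D" "y' \<in> \<phi> ` D" "y ~= y'" for y y'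
    using that sep by blast
  qed
  ultimately show ?thesis by simp
 qed
 define N where "N = nat \<lfloor>(16 / \<epsilon>) ^ (2 * card B)\<rfloor>"
 have "ALL D. sepd D --> card D <= N" using bnd unfolding N_def by (simp add: le_nat_floor)
 moreover have "sepd {}" by (simp add: sepd_def)
 ultimately obtain D where D: "sepd D" "!!D'. sepd D' ==> card D' <= card D"
  using ex_has_greatest_nat[of sepd "{}" card "Suc N"] by (auto simp: less_Suc_eq_le)
 have "(1 / (3 * \<epsilon>)) ^ (2 * (card I - card E)) <= card D"
 proof (rule net_card_lower[OF I E, of D k])
  show "finite D" "D \<subseteq> {z. \<forall>e\<in>E. (\<Sum>i\<in>I. of_int (k e i) * z i) = 0}"
   using D(1) by (auto simp: sepd_def Z_def)
  show "0 < 3 * \<epsilon>" "3 * \<epsilon> < 1" using e by auto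
  fix y assume "y \<in> {z. \<forall>e\<in>E. (\<Sum>i\<in>I. of_int (k e i) * z i) = 0}" "l1n I y <= 1"
  then have y: "y \<in> Z" "l1n I y <= 1" by (auto simp: Z_def)
  have "\<exists>d\<in>D. l1n I (%i. \<phi> y i - \<phi> d i) < \<epsilon>"
  proof (rule ccontr)
   assume "\<not> ?thesis"
   then have far: "!!d. d \<in> D ==> \<epsilon> <= l1n I (%i. \<phi> y i - \<phi> d i)" by force
   have "y \<notin> D" using far[of y] e by (auto simp: l1n_def)
   moreover have "sepd (insert y D)"
    using D(1) y far l1n_commute[of I "\<phi> y"] by (auto simp: sepd_def)
   ultimately show False using D(2)[of "insert y D"] D(1) by (simp add: sepd_def)
  qed
  then obtain d where d: "d \<in> D" "l1n I (%i. \<phi> y i - \<phi> d i) < \<epsilon>" by blast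
  have dZ: "d \<in> Z" "l1n I d <= 1" using d D(1) by (auto simp: sepd_def)
  \<comment> \<open>One \<epsilon> for each of the two approximations and one for the distance
    between the approximants.\<close>
  have "l1n I (%i. y i - d i) <= l1n I (%i. y i - \<phi> y i) + (l1n I (%i. \<phi> y i - \<phi> d i) + l1n I (%i. \<phi> d i - d i))"
   using l1n_diff_triangle[of I y d "\<phi> y"] l1n_diff_triangle[of I "\<phi> y" d "\<phi> d"] by linarith
  also have "\<dots> <= 3 * \<epsilon>"
   using phi[OF y] phi[OF dZ] d(2) l1n_commute[of I d "\<phi> d"] by linarith
  finally show "\<exists>d\<in>D. l1n I (%i. y i - d i) <= 3 * \<epsilon>" using d by blast
 qed
 also have "\<dots> <= (16 / \<epsilon>) ^ (2 * card B)" by (rule bnd[OF D(1)])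
 finally have "((1 / (3 * \<epsilon>)) ^ (card I - card E))\<^sup>2 <= ((16 / \<epsilon>) ^ card B)\<^sup>2"
  unfolding power_mult by (simp only: power_mult[symmetric] mult.commute)
 then show ?thesis by (rule power2_le_imp_le) (use e in simp)
qed

section \<open>Markers on the cycles of a permutation\<close>

lemma permutes_funpow_in: "s permutes X ==> (s ^^ k) x \<in> X \<longleftrightarrow> x \<in> X"
 by (rule permutes_in_image[OF permutes_funpow])

text \<open>Take a maximal family of good points whose forward segments of length L are pairwise
  disjoint. Without short cycles each segment has L distinct points, which bounds the number of
  markers; by maximality the segment of every good point meets that of a marker.\<close>

lemma orbit_markers:
 fixes s :: "'a => 'a"
 assumes s: "s permutes X" and X: "finite X"
  and bad: "!!x k. x \<in> X ==> 0 < k ==> k < L ==> (s ^^ k) x = x ==> x \<in> bad"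
 obtains B where "B \<subseteq> X" "card B * L <= card X"
  "!!x. x \<in> X - bad ==> 0 < L ==> \<exists>b\<in>B. \<exists>k<L. \<exists>k'<L. (s ^^ k) x = (s ^^ k') b"
proof -
 define P where "P = (%B. B \<subseteq> X - bad & (\<forall>b\<in>B. \<forall>b'\<in>B. b ~= b' --> (\<forall>k<L. \<forall>k'<L. (s ^^ k) b ~= (s ^^ k') b')))"
 have "P {}" by (simp add: P_def)
 moreover have "card B < Suc (card X)" if "P B" for B
  using that X by (auto simp: P_def less_Suc_eq_le intro!: card_mono)
 ultimately obtain B where B: "P B" "!!B'. P B' ==> card B' <= card B"
  using ex_has_greatest_nat[of P "{}" card "Suc (card X)"] by blast
 have BX: "B \<subseteq> X - bad" using B(1) by (simp add: P_def)
 have sinj: "inj (s ^^ k)" for k using permutes_inj[OF permutes_funpow[OF s]] .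
 have inj: "inj_on (%(b, k). (s ^^ k) b) (B \<times> {..<L})"
 proof -
  \<comment> \<open>A repetition inside one segment would close a cycle shorter than L through
    b.\<close>
  have aux: "k = k'" if b: "b \<in> B" and kk: "k < L" "k' < L" "(s ^^ k) b = (s ^^ k') b" "k <= k'" for b k k'
  proof (rule ccontr)
   assume "k ~= k'"
   have "(s ^^ k) ((s ^^ (k' - k)) b) = (s ^^ k) b"
    using kk by (simp flip: comp_apply[of "s ^^ k"] funpow_add)
   then have "(s ^^ (k' - k)) b = b" using sinj[of k] by (simp add: inj_eq)
   then have "b \<in> bad" using b BX kk \<open>k ~= k'\<close>
    by (intro bad[of b "k' - k"]) auto
   then show False using b BX by blast
  qed
  have aux': "k = k'" if "b \<in> B" "k < L" "k' < L" "(s ^^ k) b = (s ^^ k') b" for b k k'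
   using aux[of b k k'] aux[of b k' k] that by (metis nat_le_linear)
  have auxB: "b = b'" if "b \<in> B" "b' \<in> B" "k < L" "k' < L" "(s ^^ k) b = (s ^^ k') b'" for b b' k k'
   using B(1) that unfolding P_def by blast
  show ?thesis
  proof (rule inj_onI)
   fix p p' assume p: "p \<in> B \<times> {..<L}" "p' \<in> B \<times> {..<L}" "(case p of (b, k) => (s ^^ k) b) = (case p' of (b, k) => (s ^^ k) b)"
   obtain b k b' k' where pp: "p = (b, k)" "p' = (b', k')" by (metis surj_pair)
   have "b = b'" by (rule auxB[of b b' k k']) (use p pp in auto)
   moreover have "k = k'" by (rule aux'[of b]) (use p pp calculation in auto)
   ultimately show "p = p'" using pp by simp
  qed
 qed
 have fB: "finite B" using BX X by (meson finite_Diff finite_subset)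
 show thesis
 proof (rule that)
  show "B \<subseteq> X" using BX by blast
  have "card B * L = card ((%(b, k). (s ^^ k) b) ` (B \<times> {..<L}))"
   using card_image[OF inj] by (simp add: card_cartesian_product)
  also have "\<dots> <= card X"
   using X BX by (intro card_mono) (auto simp: permutes_funpow_in[OF s])
  finally show "card B * L <= card X" .
  fix x assume x: "x \<in> X - bad" and L: "0 < L"
  show "\<exists>b\<in>B. \<exists>k<L. \<exists>k'<L. (s ^^ k) x = (s ^^ k') b"
  proof (rule ccontr)
   assume n: "\<not> ?thesis"
   then have "x \<notin> B" using L by blast
   moreover have "P (insert x B)"
   proof -
    have "(s ^^ k) b ~= (s ^^ k') b'" if "b \<in> insert x B" "b' \<in> insert x B" "b ~= b'" "k < L" "k' < L" for b b' k k'
    proof (cases "b = x \<or> b' = x")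
     case True
     then show ?thesis using n that by (metis insertE)
    next
     case False
     then show ?thesis using B(1) that by (auto simp: P_def)
    qed
    then show ?thesis using x BX unfolding P_def by blast
   qed
   ultimately show False using B(2)[of "insert x B"] fB by simp
  qed
 qed
qed

text \<open>A good point reaches a marker in fewer than L steps, forwards or backwards along its
  cycle. Telescoping the increments of \<zeta> on this path recovers \<zeta> x from the value at the
  marker, and \<open>Q\<close> is this sum of increments. Its norm bound involves L but not
  d.\<close>

lemma orbit_decomposition:
 fixes s :: "nat => nat"
 assumes s: "s permutes {1..d}" and L: "0 < L"
  and bad: "!!x k. x \<in> {1..d} ==> 0 < k ==> k < L ==> (s ^^ k) x = x ==> x \<in> bad"
 obtains B m and Q :: "(nat => complex) => nat => complex" where
  "B \<subseteq> {1..d}" "card B * L <= d" "!!x. x \<in> {1..d} - bad ==> m x \<in> B"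
  "!!u v. Q (u + v) = Q u + Q v" "!!c u. Q (%x. c * u x) = (%x. c * Q u x)"
  "!!u. Q u \<in> fin_carrier d"
  "!!r u. 1 <= r ==> lpn r {1..d} (Q u) <= 2 * real L * lpn r {1..d} u"
  "!!\<zeta> x. x \<in> {1..d} - bad ==> \<zeta> x = \<zeta> (m x) + Q (%x. \<zeta> (s x) - \<zeta> x) x"
  "!!u x. x \<in> bad ==> Q u x = 0"
proof -
 obtain B where B: "B \<subseteq> {1..d}" "card B * L <= d"
  "!!x. x \<in> {1..d} - bad ==> \<exists>b\<in>B. \<exists>k<L. \<exists>k'<L. (s ^^ k) x = (s ^^ k') b"
 proof (rule orbit_markers[OF s finite_atLeastAtMost, of L bad], goal_cases)
  case (1 x k)
  show ?case by (rule bad[OF 1(2) 1(3) 1(4) 1(5)])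
 next
  case (2 B)
  show ?case by (rule that[of B]) (use 2(2-4) L in \<open>simp_all\<close>)
 qed
 define t where "t = inv_into UNIV s"
 have t: "t permutes {1..d}" unfolding t_def by (rule permutes_inv[OF s])
 have st: "s (t x) = x" and ts: "t (s x) = x" for x
  using permutes_inverses[OF s] by (simp_all add: t_def)
 have tsk: "(t ^^ k) ((s ^^ k) x) = x" for k x
 proof (induction k arbitrary: x)
  case (Suc k)
  have "(t ^^ Suc k) y = (t ^^ k) (t y)" for y by (simp add: funpow_swap1)
  then show ?case using ts Suc by simp
 qed simp
 have "\<exists>b\<in>B. \<exists>j<L. b = (s ^^ j) x \<or> b = (t ^^ j) x" if x: "x \<in> {1..d} - bad" for x
 proof -
  obtain b k k' where b: "b \<in> B" "k < L" "k' < L" "(s ^^ k) x = (s ^^ k') b" using B(3)[OF x] by blast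
  show ?thesis
  proof (cases "k' <= k")
   case True
   have "(s ^^ k) x = (s ^^ k') ((s ^^ (k - k')) x)"
    using True by (simp flip: comp_apply[of "s ^^ k'"] funpow_add)
   then have "b = (s ^^ (k - k')) x" using b(4) tsk by metis
   then show ?thesis using b by (intro bexI[of _ b] exI[of _ "k - k'"]) auto
  next
   case False
   have "(s ^^ k') b = (s ^^ k) ((s ^^ (k' - k)) b)"
    using False by (simp flip: comp_apply[of "s ^^ k"] funpow_add)
   then have "x = (s ^^ (k' - k)) b" using b(4) tsk by metis
   then have "b = (t ^^ (k' - k)) x" using tsk by simp
   then show ?thesis using b by (intro bexI[of _ b] exI[of _ "k' - k"]) auto
  qed
 qed
 then obtain m j where m: "!!x. x \<in> {1..d} - bad ==> m x \<in> B" "!!x. x \<in> {1..d} - bad ==> j x < L"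
  "!!x. x \<in> {1..d} - bad ==> m x = (s ^^ j x) x \<or> m x = (t ^^ j x) x" by metis
 \<comment> \<open>Increments are subtracted on the way forwards and added on the way backwards. At
   bad points the value is 0; they will be carried as free coordinates.\<close>
 define Q where "Q = (%(u :: nat => complex) x. if x \<in> {1..d} - bad then
  (if m x = (s ^^ j x) x then - (\<Sum>i<j x. u ((s ^^ i) x)) else (\<Sum>i<j x. u ((t ^^ Suc i) x))) else 0)"
 have fwd: "\<zeta> ((s ^^ k) x) = \<zeta> x + (\<Sum>i<k. \<zeta> (s ((s ^^ i) x)) - \<zeta> ((s ^^ i) x))" for \<zeta> :: "nat => complex" and k x
  by (induction k) auto
 have bwd: "\<zeta> x = \<zeta> ((t ^^ k) x) + (\<Sum>i<k. \<zeta> (s ((t ^^ Suc i) x)) - \<zeta> ((t ^^ Suc i) x))" for \<zeta> :: "nat => complex" and k x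
  by (induction k) (auto simp: st)
 show thesis
 proof (rule that[of B m Q])
  show "B \<subseteq> {1..d}" "card B * L <= d" by (rule B)+
  show "!!x. x \<in> {1..d} - bad ==> m x \<in> B" by (rule m(1))
  show "Q (u + v) = Q u + Q v" for u v
   by (auto simp: Q_def fun_eq_iff sum.distrib)
  show "Q (%x. c * u x) = (%x. c * Q u x)" for c u
   by (auto simp: Q_def fun_eq_iff sum_distrib_left)
  show "Q u \<in> fin_carrier d" for u by (simp add: fin_carrier_def Q_def)
  show "Q u x = 0" if "x \<in> bad" for u x using that by (simp add: Q_def)
  show "\<zeta> x = \<zeta> (m x) + Q (%x. \<zeta> (s x) - \<zeta> x) x" if x: "x \<in> {1..d} - bad" for \<zeta> x
  proof (cases "m x = (s ^^ j x) x")
   case True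
   then show ?thesis using x fwd[of \<zeta> "j x" x] by (simp add: Q_def)
  next
   case False
   then show ?thesis using x bwd[of \<zeta> x "j x"] m(3)[OF x] by (simp add: Q_def)
  qed
  show "lpn r {1..d} (Q u) <= 2 * real L * lpn r {1..d} u" if r: "1 <= r" for r u
  proof -
   \<comment> \<open>Pointwise, |Q u| is at most the sum of |u| over L forward and L backward
     shifts, each of the same norm as u.\<close>
   define v where "v = (%i x. complex_of_real (cmod (u ((s ^^ i) x))))"
   define w where "w = (%i x. complex_of_real (cmod (u ((t ^^ Suc i) x))))"
   have nv: "lpn r {1..d} (v i) = lpn r {1..d} u" for i
    using lp_reindex(2)[OF permutes_imp_bij[OF permutes_funpow[OF s]], of r u i]
    by (metis (no_types, lifting) lp_norm_cong norm_of_real abs_norm_cancel v_def)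
   have nw: "lpn r {1..d} (w i) = lpn r {1..d} u" for i
    using lp_reindex(2)[OF permutes_imp_bij[OF permutes_funpow[OF t]], of r u "Suc i"]
    by (metis (no_types, lifting) lp_norm_cong norm_of_real abs_norm_cancel w_def)
   have le: "cmod (Q u x) <= cmod ((\<Sum>i<L. v i x) + (\<Sum>i<L. w i x))" for x
   proof -
    have e: "cmod ((\<Sum>i<L. v i x) + (\<Sum>i<L. w i x)) = (\<Sum>i<L. cmod (u ((s ^^ i) x))) + (\<Sum>i<L. cmod (u ((t ^^ Suc i) x)))"
     unfolding v_def w_def of_real_sum[symmetric] of_real_add[symmetric] norm_of_real
     by (intro abs_of_nonneg add_nonneg_nonneg sum_nonneg) auto
    show ?thesis
    proof (cases "x \<in> {1..d} - bad")
     case True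
     then have sub: "{..<j x} \<subseteq> {..<L}" using m(2) by fastforce
     have "cmod (Q u x) <= (\<Sum>i<j x. cmod (u ((s ^^ i) x))) \<or> cmod (Q u x) <= (\<Sum>i<j x. cmod (u ((t ^^ Suc i) x)))"
      using True by (auto simp: Q_def norm_sum simp del: funpow.simps)
     moreover have mono: "(\<Sum>i<j x. cmod (f i)) <= (\<Sum>i<L. cmod (f i))" "0 <= (\<Sum>i<L. cmod (f i))"
      for f :: "nat => complex"
      using sub by (auto intro: sum_mono2 sum_nonneg)
     ultimately show ?thesis unfolding e
      using mono[of "%i. u ((s ^^ i) x)"] mono[of "%i. u ((t ^^ Suc i) x)"] by argo
    next
     case False
     then have "Q u x = 0" by (simp only: Q_def if_False)
     then show ?thesis by simp
    qed
   qed
   have "lpn r {1..d} (Q u) <= lpn r {1..d} (%x. (\<Sum>i<L. v i x) + (\<Sum>i<L. w i x))"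
    by (intro lp_mono(2)[OF r] lp_summable_finite le) auto
   also have "\<dots> <= lpn r {1..d} (%x. \<Sum>i<L. v i x) + lpn r {1..d} (%x. \<Sum>i<L. w i x)"
    by (intro lp_norm_finite_triangle[OF r]) auto
   also have "\<dots> <= (\<Sum>i<L. lpn r {1..d} (v i)) + (\<Sum>i<L. lpn r {1..d} (w i))"
    using lp_norm_sum_le[OF r, of "{..<L}" "{1..d}"] by (intro add_mono) auto
   also have "\<dots> = 2 * real L * lpn r {1..d} u" by (simp only: nv nw) simp
   finally show ?thesis .
  qed
 qed
qed

section \<open>Reduced words, normal forms and the Cayley tree\<close>

definition flip :: "nat \<times> bool => nat \<times> bool" where "flip l = (fst l, \<not> snd l)"

lemma flip_flip [simp]: "flip (flip l) = l" by (simp add: flip_def)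
lemma fst_flip [simp]: "fst (flip l) = fst l" by (simp add: flip_def)
lemma flip_neq [simp]: "flip l ~= l" "l ~= flip l" by (cases l; simp add: flip_def)+
lemma flip_eq_iff: "flip l = l' \<longleftrightarrow> l = flip l'" by (cases l; cases l') (auto simp: flip_def)

lemma reduced_word_Cons:
 "reduced_word (l # w) \<longleftrightarrow> (w = [] \<or> hd w ~= flip l) & reduced_word w"
proof (cases w)
 case (Cons m v)
 then show ?thesis by (cases l; cases m) (auto simp: reduced_word_def flip_def)
qed (simp add: reduced_word_def)

lemma reduced_word_rev: "reduced_word (rev w) \<longleftrightarrow> reduced_word w"
 unfolding reduced_word_def successively_rev
 by (rule arg_cong2[of _ _ _ _ successively]) (auto simp: fun_eq_iff)

lemma reduced_word_map_flip: "reduced_word (map flip w) \<longleftrightarrow> reduced_word w"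
 by (induction w) (auto simp: reduced_word_Cons hd_map flip_eq_iff)

lemma reduced_word_rev_append:
 "reduced_word u ==> reduced_word v ==> u = [] \<or> v = [] \<or> hd u ~= flip (hd v) ==> reduced_word (rev u @ v)"
proof (induction u arbitrary: v)
 case (Cons l u)
 have "reduced_word (rev u @ (l # v))"
  by (rule Cons.IH) (use Cons.prems in \<open>auto simp: reduced_word_Cons flip_eq_iff\<close>)
 then show ?case by simp
qed simp

locale free_gens = group G for G (structure) +
 fixes n :: nat and a :: "nat => 'a"
 assumes n_pos: "1 <= n" and free: "free_generators G n a"
begin

definition letters :: "(nat \<times> bool) set" where "letters = {1..n} \<times> UNIV"

definition lt :: "nat \<times> bool => 'a" where "lt l = (if snd l then a (fst l) else inv (a (fst l)))"

text \<open>Words are read from right to left, so that right multiplication acts on the head.\<close>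

fun val :: "(nat \<times> bool) list => 'a" where
 "val [] = \<one>"
| "val (l # w) = val w \<otimes> lt l"

definition rwords :: "(nat \<times> bool) list set" where
 "rwords = {w. set w \<subseteq> letters & reduced_word w}"

definition nf :: "'a => (nat \<times> bool) list" where "nf = inv_into rwords val"

definition len :: "'a => nat" where "len x = length (nf x)"

lemma finite_letters [simp]: "finite letters" by (simp add: letters_def)
lemma card_letters: "card letters = 2 * n" by (simp add: letters_def card_cartesian_product)
lemma flip_letters [simp]: "flip l \<in> letters \<longleftrightarrow> l \<in> letters" by (cases l) (auto simp: letters_def flip_def)

lemma a_closed [simp]: "j \<in> {1..n} ==> a j \<in> carrier G"
 using free by (auto simp: free_generators_def)

lemma lt_closed [simp]: "l \<in> letters ==> lt l \<in> carrier G"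
 by (cases l) (auto simp: lt_def letters_def)

lemma lt_flip: "l \<in> letters ==> lt (flip l) = inv (lt l)"
 by (cases l) (auto simp: lt_def letters_def flip_def)

lemma lt_cancel [simp]:
 "l \<in> letters ==> x \<in> carrier G ==> x \<otimes> lt l \<otimes> lt (flip l) = x"
 "l \<in> letters ==> x \<in> carrier G ==> x \<otimes> lt (flip l) \<otimes> lt l = x"
 by (simp_all add: lt_flip m_assoc)

lemma val_closed [simp]: "set w \<subseteq> letters ==> val w \<in> carrier G"
 by (induction w) auto

lemma word_value_Cons: "word_value G a (l # w) = lt l \<otimes> word_value G a w"
 by (cases l) (simp add: word_value_def lt_def)

lemma word_value_closed [simp]: "set w \<subseteq> letters ==> word_value G a w \<in> carrier G"
 by (induction w) (auto simp: word_value_Cons, simp add: word_value_def)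

lemma word_value_append:
 "set u \<subseteq> letters ==> set v \<subseteq> letters ==> word_value G a (u @ v) = word_value G a u \<otimes> word_value G a v"
 by (induction u) (auto simp: word_value_Cons m_assoc, simp add: word_value_def)

lemma val_word_value: "set w \<subseteq> letters ==> val w = word_value G a (rev w)"
 by (induction w) (auto simp: word_value_append word_value_Cons, simp_all add: word_value_def)

lemma inv_val: "set w \<subseteq> letters ==> inv (val w) = word_value G a (map flip w)"
 by (induction w) (auto simp: word_value_Cons inv_mult_group lt_flip, simp_all add: word_value_def)

lemma word_value_neq_one:
 "w ~= [] ==> set w \<subseteq> letters ==> reduced_word w ==> word_value G a w ~= \<one>"
 using free unfolding free_generators_def letters_def by fastforce

text \<open>If the heads differ, the word for val (l # w) followed by the one for the inverse of val
  w' does not cancel at the junction; it is a nonempty reduced word of value \<one>, against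
  freeness. Equal heads are cancelled and the induction continues.\<close>

lemma val_inj: "w \<in> rwords ==> w' \<in> rwords ==> val w = val w' ==> w = w'"
proof (induction w arbitrary: w')
 case Nil
 then have s: "set w' \<subseteq> letters" "reduced_word (rev w')" by (auto simp: rwords_def reduced_word_rev)
 then show ?case using word_value_neq_one[of "rev w'"] Nil val_word_value[OF s(1)] by (metis rev_is_Nil_conv set_rev val.simps(1))
next
 case (Cons l w)
 have s: "set (l # w) \<subseteq> letters" "set w' \<subseteq> letters" "reduced_word (l # w)" "reduced_word w'"
  using Cons.prems by (auto simp: rwords_def)
 have one: "word_value G a (rev (l # w) @ map flip w') = \<one>"
 proof -
  have "word_value G a (rev (l # w) @ map flip w') = val (l # w) \<otimes> inv (val w')"
   using s by (subst word_value_append) (auto simp: val_word_value[OF s(1)] inv_val simp del: val.simps)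
  then show ?thesis using Cons.prems(3) s by (metis r_inv val_closed)
 qed
 have "w' ~= [] & hd w' = l"
 proof (rule ccontr)
  assume n: "\<not> ?thesis"
  then have "reduced_word (rev (l # w) @ map flip w')"
   using s by (intro reduced_word_rev_append) (auto simp: reduced_word_map_flip hd_map)
  moreover have "set (rev (l # w) @ map flip w') \<subseteq> letters" using s by auto
  ultimately show False using word_value_neq_one one by blast
 qed
 then obtain v where v: "w' = l # v" by (metis list.collapse)
 have "val w = val v" using Cons.prems(3) s v by (simp add: right_cancel)
 then have "w = v" using Cons s v by (auto simp: rwords_def reduced_word_Cons)
 then show ?case using v by simp
qed

text \<open>Right multiplication by a letter, seen on normal forms.\<close>

definition push :: "nat \<times> bool => (nat \<times> bool) list => (nat \<times> bool) list" where
 "push l w = (if w ~= [] & hd w = flip l then tl w else l # w)"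

lemma push_rwords: "w \<in> rwords ==> l \<in> letters ==> push l w \<in> rwords"
 by (cases w) (auto simp: push_def rwords_def reduced_word_Cons)

lemma val_push: "w \<in> rwords ==> l \<in> letters ==> val (push l w) = val w \<otimes> lt l"
 by (cases w) (auto simp: push_def rwords_def)

lemma Nil_rwords [simp]: "[] \<in> rwords" by (simp add: rwords_def reduced_word_def)

text \<open>The image contains \<one> and is closed under right multiplication by letters, thanks to
  \<open>push\<close>. The induction over \<open>generate\<close> carries this closure to all group
  elements.\<close>

lemma val_surj: "val ` rwords = carrier G"
proof
 show "val ` rwords \<subseteq> carrier G" by (auto simp: rwords_def)
 have step: "x \<otimes> lt l \<in> val ` rwords" if xl: "x \<in> val ` rwords" "l \<in> letters" for x l
 proof -
  obtain w where w: "w \<in> rwords" "x = val w" using xl by blast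
  then have "x \<otimes> lt l = val (push l w)" using val_push xl by simp
  then show ?thesis using push_rwords[OF w(1) xl(2)] by blast
 qed
 have gen: "(\<forall>x \<in> val ` rwords. x \<otimes> g \<in> val ` rwords) & g \<in> carrier G"
  if "g \<in> generate G (a ` {1..n})" for g
  using that
 proof (induction rule: generate.induct)
  case one
  then show ?case by (auto simp: rwords_def)
 next
  case (incl h)
  then obtain j where j: "j \<in> {1..n}" "h = a j" by blast
  then have "(j, True) \<in> letters" "lt (j, True) = h" by (simp_all add: letters_def lt_def)
  then show ?case using step[of _ "(j, True)"] j by auto
 next
  case (inv h)
  then obtain j where j: "j \<in> {1..n}" "h = a j" by blast
  then have "(j, False) \<in> letters" "lt (j, False) = inv h" by (simp_all add: letters_def lt_def)
  then show ?case using step[of _ "(j, False)"] j by auto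
 next
  case (eng h1 h2)
  have "x \<otimes> (h1 \<otimes> h2) \<in> val ` rwords" if x: "x \<in> val ` rwords" for x
  proof -
   have "x \<in> carrier G" using x by (auto simp: rwords_def)
   then have "x \<otimes> (h1 \<otimes> h2) = x \<otimes> h1 \<otimes> h2" using eng by (simp add: m_assoc)
   moreover have "x \<otimes> h1 \<otimes> h2 \<in> val ` rwords" using eng.IH x by blast
   ultimately show ?thesis by simp
  qed
  then show ?case using eng.IH by blast
 qed
 have one: "\<one> \<in> val ` rwords" using Nil_rwords val.simps(1) by (metis imageI)
 show "carrier G \<subseteq> val ` rwords"
 proof
  fix g assume "g \<in> carrier G"
  then have "g \<in> generate G (a ` {1..n})" using free by (simp add: free_generators_def)
  then have "\<one> \<otimes> g \<in> val ` rwords" "g \<in> carrier G" using gen one by blast+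
  then show "g \<in> val ` rwords" by simp
 qed
qed

lemma nf_rwords [simp]: "x \<in> carrier G ==> nf x \<in> rwords"
 unfolding nf_def using val_surj by (metis inv_into_into)

lemma val_nf [simp]: "x \<in> carrier G ==> val (nf x) = x"
 unfolding nf_def using val_surj by (metis f_inv_into_f)

lemma nf_val: "w \<in> rwords ==> nf (val w) = w"
 by (rule val_inj) (auto simp: rwords_def intro!: nf_rwords[unfolded rwords_def mem_Collect_eq])

lemma nf_mult: "x \<in> carrier G ==> l \<in> letters ==> nf (x \<otimes> lt l) = push l (nf x)"
 using val_push[of "nf x" l] push_rwords[of "nf x" l] nf_val by (metis nf_rwords val_nf)

lemma nf_one [simp]: "nf \<one> = []"
 using nf_val[of "[]"] by simp

lemma nf_Nil_iff: "x \<in> carrier G ==> nf x = [] \<longleftrightarrow> x = \<one>"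
 using val_nf by fastforce

lemma len_one [simp]: "len \<one> = 0" by (simp add: len_def)

lemma len_0_iff: "x \<in> carrier G ==> len x = 0 \<longleftrightarrow> x = \<one>"
 by (simp add: len_def nf_Nil_iff)

text \<open>The letter that leads one step towards the root \<one>. At \<one> itself
  \<open>hd\<close> is applied to the empty list, so \<one> is always treated apart.\<close>

definition up :: "'a => nat \<times> bool" where "up x = flip (hd (nf x))"

lemma up_letters: "x \<in> carrier G ==> x ~= \<one> ==> up x \<in> letters"
 using nf_rwords[of x] nf_Nil_iff[of x] by (auto simp: up_def rwords_def dest: hd_in_set)

lemma len_up: "x \<in> carrier G ==> x ~= \<one> ==> Suc (len (x \<otimes> lt (up x))) = len x"
 using up_letters[of x] nf_Nil_iff[of x] by (auto simp: len_def nf_mult push_def up_def)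

lemma len_not_up: "x \<in> carrier G ==> l \<in> letters ==> x = \<one> \<or> l ~= up x ==> len (x \<otimes> lt l) = Suc (len x)"
 by (auto simp: len_def nf_mult push_def up_def flip_eq_iff)

lemma up_mult: "x \<in> carrier G ==> l \<in> letters ==> x = \<one> \<or> l ~= up x ==> up (x \<otimes> lt l) = flip l"
 by (auto simp: up_def nf_mult push_def flip_eq_iff)

lemma sum_letters: "(\<Sum>l\<in>letters. f (lt l)) = (\<Sum>j=1..n. f (a j)) + (\<Sum>j=1..n. f (inv (a j)))"
proof -
 have "(\<Sum>l\<in>letters. f (lt l)) = (\<Sum>j=1..n. \<Sum>b\<in>UNIV. f (lt (j, b)))"
  by (simp add: letters_def sum.cartesian_product)
 then show ?thesis by (simp add: UNIV_bool lt_def sum.distrib add.commute)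
qed

text \<open>The root has 2n children; every other vertex has one parent and 2n - 1 children.\<close>

lemma sum_letters_len:
 assumes "x \<in> carrier G"
 shows "(\<Sum>l\<in>letters. f (len (x \<otimes> lt l)) :: real) =
  (if x = \<one> then 2 * real n * f 1 else f (len x - 1) + (2 * real n - 1) * f (len x + 1))"
proof (cases "x = \<one>")
 case True
 have "len (lt l) = 1" if "l \<in> letters" for l using len_not_up[of \<one> l] that by simp
 then show ?thesis using True by (simp add: card_letters)
next
 case False
 have "(\<Sum>l\<in>letters. f (len (x \<otimes> lt l))) = f (len (x \<otimes> lt (up x))) + (\<Sum>l\<in>letters - {up x}. f (len (x \<otimes> lt l)))"
  using up_letters[OF assms False] by (intro sum.remove) auto
 also have "len (x \<otimes> lt (up x)) = len x - 1" using len_up[OF assms False] by simp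
 also have "(\<Sum>l\<in>letters - {up x}. f (len (x \<otimes> lt l))) = (\<Sum>l\<in>letters - {up x}. f (len x + 1))"
  using len_not_up[OF assms] by (intro sum.cong) auto
 also have "\<dots> = (2 * real n - 1) * f (len x + 1)"
  using up_letters[OF assms False] n_pos by (simp add: card_letters of_nat_diff)
 finally show ?thesis using False by simp
qed

text \<open>A nonempty reduced word can be extended by every letter except the inverse of its head.
  The bound serves the summability of \<open>gam\<close>.\<close>

lemma rwords_length_card:
 "finite {w \<in> rwords. length w = Suc k} & card {w \<in> rwords. length w = Suc k} <= 2 * n * (2 * n - 1) ^ k"
proof (induction k)
 case 0
 have "{w \<in> rwords. length w = Suc 0} \<subseteq> (%l. [l]) ` letters"
  by (auto simp: rwords_def length_Suc_conv)
 moreover have "card ((%l. [l]) ` letters) = 2 * n" by (simp add: card_image inj_on_def card_letters)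
 ultimately show ?case by (metis (no_types, lifting) card_mono finite_imageI finite_letters finite_subset mult.right_neutral power_0)
next
 case (Suc k)
 let ?R = "{w \<in> rwords. length w = Suc k}"
 have sub: "{w \<in> rwords. length w = Suc (Suc k)} \<subseteq> (\<Union>w\<in>?R. (%l. l # w) ` (letters - {flip (hd w)}))"
 proof
  fix w assume w: "w \<in> {w \<in> rwords. length w = Suc (Suc k)}"
  then obtain l v where v: "w = l # v" "length v = Suc k" by (auto simp: length_Suc_conv)
  then have "v \<in> ?R" "l \<in> letters - {flip (hd v)}"
   using w by (auto simp: rwords_def reduced_word_Cons)
  then show "w \<in> (\<Union>w\<in>?R. (%l. l # w) ` (letters - {flip (hd w)}))" using v by blast
 qed
 have fin: "finite (\<Union>w\<in>?R. (%l. l # w) ` (letters - {flip (hd w)}))" using Suc by auto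
 have "card (\<Union>w\<in>?R. (%l. l # w) ` (letters - {flip (hd w)})) <= (\<Sum>w\<in>?R. card ((%l. l # w) ` (letters - {flip (hd w)})))"
  using Suc by (intro card_UN_le) auto
 also have "\<dots> <= (\<Sum>w\<in>?R. 2 * n - 1)"
 proof (rule sum_mono)
  fix w assume w: "w \<in> ?R"
  then have "hd w \<in> letters" by (cases w) (auto simp: rwords_def)
  then show "card ((%l. l # w) ` (letters - {flip (hd w)})) <= 2 * n - 1"
   by (subst card_image) (auto simp: inj_on_def card_letters)
 qed
 also have "\<dots> <= 2 * n * (2 * n - 1) ^ k * (2 * n - 1)" using Suc by simp
 finally show ?case using card_mono[OF fin sub] finite_subset[OF sub fin] by (simp add: mult_ac)
qed

lemma finite_ball: "finite {x \<in> carrier G. len x <= R}"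
proof -
 have "{x \<in> carrier G. len x <= R} \<subseteq> val ` {w. set w \<subseteq> letters & length w <= R}"
 proof
  fix x assume x: "x \<in> {x \<in> carrier G. len x <= R}"
  then have "nf x \<in> {w. set w \<subseteq> letters & length w <= R}"
   using nf_rwords[of x] by (auto simp: len_def rwords_def)
  then show "x \<in> val ` {w. set w \<subseteq> letters & length w <= R}" using val_nf[of x] x by (metis (mono_tags) imageI mem_Collect_eq)
 qed
 then show ?thesis using finite_lists_length_le[OF finite_letters, of R] by (meson finite_imageI finite_subset)
qed

lemma len_power: "len (a 1 [^] k) = k"
proof -
 have "replicate k (1, True) \<in> rwords" using n_pos
  by (induction k) (auto simp: rwords_def reduced_word_Cons letters_def, simp add: reduced_word_def)
 moreover have "val (replicate k (1, True)) = a 1 [^] k"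
  by (induction k) (auto simp: lt_def)
 ultimately show ?thesis by (metis len_def length_replicate nf_val)
qed

text \<open>The powers of one generator have unbounded length. Infinitude allows a finite set to be
  translated away from any ball.\<close>

lemma infinite_carrier: "infinite (carrier G)"
proof
 assume f: "finite (carrier G)"
 have "a 1 [^] k \<in> carrier G" for k :: nat using n_pos by (intro nat_pow_closed) simp
 then have "k <= Max (len ` carrier G)" for k using f len_power[of k] by (metis Max_ge finite_imageI imageI)
 then show False by (metis not_less_eq_eq)
qed

text \<open>The adjacency operator of the Cayley tree.\<close>

definition adj :: "('a => complex) => 'a => complex" where
 "adj f x = (\<Sum>l\<in>letters. f (x \<otimes> lt l))"

section \<open>The adjacency operator on lp\<close>

text \<open>The power mean inequality, by induction with the convex weights 1/(m + 1) and m/(m +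
  1).\<close>

lemma sum_powr_le:
 assumes r: "1 <= r" and I: "finite I" and c: "!!i. i \<in> I ==> 0 <= c i"
 shows "(\<Sum>i\<in>I. c i) powr r <= real (card I) powr (r - 1) * (\<Sum>i\<in>I. c i powr r)"
 using I c
proof (induction I)
 case (insert i I)
 show ?case
 proof (cases "I = {}")
  case False
  define m where "m = real (card I)"
  have m: "0 < m" using False insert by (simp add: m_def card_gt_0_iff)
  define s where "s = (\<Sum>i\<in>I. c i)"
  have s: "0 <= s" using insert by (auto simp: s_def intro: sum_nonneg)
  have "(\<Sum>i\<in>insert i I. c i) = (m + 1) * (1 / (m + 1) * c i + m / (m + 1) * (s / m))"
   using insert m by (simp add: s_def distrib_left)
  then have "(\<Sum>i\<in>insert i I. c i) powr r = (m + 1) powr r * (1 / (m + 1) * c i + m / (m + 1) * (s / m)) powr r"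
   by (simp only: powr_mult)
  also have "\<dots> <= (m + 1) powr r * (1 / (m + 1) * c i powr r + m / (m + 1) * (s / m) powr r)"
   using m s insert.prems r by (intro mult_left_mono powr_convex_nonneg) (auto simp: add_divide_distrib[symmetric])
  also have "\<dots> = (m + 1) powr (r - 1) * (c i powr r + m * (s / m) powr r)"
  proof -
   have "(m + 1) powr r = (m + 1) powr (r - 1) * (m + 1)"
    using m by (simp add: powr_diff)
   moreover have "(m + 1) * (1 / (m + 1) * A + m / (m + 1) * B) = A + m * B" for A B
    using m by (simp add: distrib_left)
   ultimately show ?thesis by (simp only: mult.assoc)
  qed
  also have "\<dots> <= (m + 1) powr (r - 1) * (c i powr r + (\<Sum>i\<in>I. c i powr r))"
  proof (intro mult_left_mono add_left_mono)
   have "s powr r <= m powr (r - 1) * (\<Sum>i\<in>I. c i powr r)"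
    unfolding s_def m_def using insert by auto
   then have "s powr r <= m powr r / m * (\<Sum>i\<in>I. c i powr r)" using m by (simp add: powr_diff)
   then show "m * (s / m) powr r <= (\<Sum>i\<in>I. c i powr r)"
    using m s by (simp add: powr_divide field_simps)
  qed auto
  finally show ?thesis using insert by (simp add: m_def add.commute)
 qed simp
qed simp

text \<open>\<open>adj f\<close> is the value at the parent plus the sum over the q = 2n - 1
  children, and the two parts are bounded separately. Support at length at least 2 makes everything
  vanish at the root, the one vertex with q + 1 children.\<close>

lemma adj_bound_far:
 assumes r: "1 <= r" and S: "finite S" "S \<subseteq> carrier G" "!!x. x \<in> S ==> 2 <= len x"
  and f: "!!x. x \<in> carrier G - S ==> f x = 0"
 shows "lpn r (carrier G) (adj f) <=
  (real (2 * n - 1) powr (1 / r) + real (2 * n - 1) powr ((r - 1) / r)) * lpn r (carrier G) f"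
  "lps r (carrier G) (adj f)"
proof -
 define q where "q = 2 * n - 1"
 define h where "h = (%x. cmod (f x) powr r)"
 define N where "N = lpn r (carrier G) f"
 have lf: "lps r (carrier G) f"
 proof (rule lp_finite_bound(1)[OF r, of "lpn r S f"])
  fix F assume F: "finite F" "F \<subseteq> carrier G"
  have "(\<Sum>x\<in>F. h x) = (\<Sum>x\<in>F \<inter> S. h x)"
   using F f r by (intro sum.mono_neutral_right) (auto simp: h_def)
  also have "\<dots> <= (\<Sum>x\<in>S. h x)" using S by (intro sum_mono2) (auto simp: h_def)
  finally show "lpn r F f <= lpn r S f"
   using r F S by (simp add: lp_norm_ereal h_def powr_mono2 sum_nonneg)
 qed simp
 have hS: "(\<Sum>x\<in>S. h x) <= N powr r"
 proof -
  have "lpn r S f <= N" unfolding N_def by (rule lp_norm_mono_set[OF r lf S(2)])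
  then show ?thesis using S r by (simp add: lp_norm_le_iff_powr N_def h_def)
 qed
 have h0: "h x = 0" if "x \<in> carrier G - S" for x using f[OF that] r by (simp add: h_def)
 have N0: "0 <= N" by (simp add: N_def)
 define par where "par = (%x. if x = \<one> then 0 else f (x \<otimes> lt (up x)))"
 define chl where "chl = (%x. if x = \<one> then 0 else \<Sum>l\<in>letters - {up x}. f (x \<otimes> lt l))"
 have adj: "adj f x = par x + chl x" if x: "x \<in> carrier G" for x
 proof (cases "x = \<one>")
  case True
  have "f (lt l) = 0" if l: "l \<in> letters" for l
  proof -
   have "len (lt l) = 1" using len_not_up[of \<one> l] l by simp
   then show ?thesis using S(3)[of "lt l"] f[of "lt l"] l by auto
  qed
  then show ?thesis using True by (simp add: adj_def par_def chl_def)
 next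
  case False
  then show ?thesis using up_letters[OF x False] by (simp add: adj_def par_def chl_def sum.remove)
 qed
 \<comment> \<open>Each vertex of the support is the parent of q vertices, so its r-th power is
   counted q times.\<close>
 have par: "lpn r K par <= real q powr (1 / r) * N" if K: "finite K" "K \<subseteq> carrier G" for K
 proof -
  define K' where "K' = {x \<in> K. x ~= \<one> & x \<otimes> lt (up x) \<in> S}"
  define T where "T = (SIGMA y:S. letters - {up y})"
  have inG: "x \<otimes> lt (up x) \<in> carrier G" if "x \<in> K" "x ~= \<one>" for x
   by (intro m_closed lt_closed up_letters) (use that K in auto)
  have "(\<Sum>x\<in>K. cmod (par x) powr r) = (\<Sum>x\<in>K'. h (x \<otimes> lt (up x)))"
   using K r f inG by (intro sum.mono_neutral_cong_right) (auto simp: K'_def par_def h_def)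
  also have "\<dots> = (\<Sum>(y, l)\<in>(%x. (x \<otimes> lt (up x), flip (up x))) ` K'. h y)"
  proof (subst sum.reindex)
   show "inj_on (%x. (x \<otimes> lt (up x), flip (up x))) K'"
   proof (rule inj_onI)
    fix x y assume xy: "x \<in> K'" "y \<in> K'" "(x \<otimes> lt (up x), flip (up x)) = (y \<otimes> lt (up y), flip (up y))"
    then have "up x = up y" by (metis flip_flip prod.inject)
    then show "x = y" using xy K up_letters[of x] right_cancel[of "lt (up x)" x y] by (auto simp: K'_def)
   qed
  qed simp
  also have "\<dots> <= (\<Sum>(y, l)\<in>T. h y)"
  proof (rule sum_mono2)
   show "finite T" using S by (simp add: T_def)
   show "(%x. (x \<otimes> lt (up x), flip (up x))) ` K' \<subseteq> T"
   proof
    fix t assume "t \<in> (%x. (x \<otimes> lt (up x), flip (up x))) ` K'"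
    then obtain x where x: "x \<in> K'" "t = (x \<otimes> lt (up x), flip (up x))" by blast
    then have xG: "x \<in> carrier G" "x ~= \<one>" using K by (auto simp: K'_def)
    have "flip (up x) ~= up (x \<otimes> lt (up x))"
    proof
     assume e: "flip (up x) = up (x \<otimes> lt (up x))"
     have y: "x \<otimes> lt (up x) \<in> S" using x by (simp add: K'_def)
     then have yG: "x \<otimes> lt (up x) \<in> carrier G" "x \<otimes> lt (up x) ~= \<one>" using S(2) S(3)[OF y] by auto
     have "Suc (len x) = len (x \<otimes> lt (up x))"
      using len_up[OF yG] e xG up_letters by (metis lt_cancel(1))
     then show False using len_up[OF xG] by simp
    qed
    then show "t \<in> T" using x xG up_letters by (auto simp: T_def K'_def)
   qed
  qed (auto simp: h_def)
  also have "\<dots> = (\<Sum>y\<in>S. real q * h y)"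
  proof -
   have "card (letters - {up y}) = q" if "y \<in> S" for y
   proof -
    have "y \<in> carrier G" "y ~= \<one>" using S(2) S(3)[OF that] that by auto
    then show ?thesis using up_letters[of y] by (simp add: card_letters q_def)
   qed
   then show ?thesis unfolding T_def by (subst sum.Sigma[symmetric]) (use S in auto)
  qed
  also have "\<dots> <= real q * N powr r" using hS by (simp add: sum_distrib_left[symmetric] mult_left_mono)
  also have "\<dots> = (real q powr (1 / r) * N) powr r" using r N0 by (simp add: powr_mult powr_powr)
  finally show ?thesis using r K N0 by (simp add: lp_norm_le_iff_powr)
 qed
 \<comment> \<open>The power mean over q children costs the factor q^(r-1), and no vertex is a child
   twice.\<close>
 have chl: "lpn r K chl <= real q powr ((r - 1) / r) * N" if K: "finite K" "K \<subseteq> carrier G" for K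
 proof -
  define K' where "K' = K - {\<one>}"
  define T where "T = (SIGMA x:K'. letters - {up x})"
  have cq: "card (letters - {up x}) = q" if "x \<in> K'" for x
  proof -
   have "x \<in> carrier G" "x ~= \<one>" using that K by (auto simp: K'_def)
   then show ?thesis using up_letters[of x] by (simp add: card_letters q_def)
  qed
  have "(\<Sum>x\<in>K. cmod (chl x) powr r) = (\<Sum>x\<in>K'. cmod (chl x) powr r)"
   using K r by (intro sum.mono_neutral_right) (auto simp: K'_def chl_def)
  also have "\<dots> <= (\<Sum>x\<in>K'. real q powr (r - 1) * (\<Sum>l\<in>letters - {up x}. h (x \<otimes> lt l)))"
  proof (rule sum_mono)
   fix x assume x: "x \<in> K'"
   have "cmod (chl x) powr r <= (\<Sum>l\<in>letters - {up x}. cmod (f (x \<otimes> lt l))) powr r"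
    using x r by (intro powr_mono2) (auto simp: chl_def K'_def norm_sum)
   also have "\<dots> <= real q powr (r - 1) * (\<Sum>l\<in>letters - {up x}. h (x \<otimes> lt l))"
    using sum_powr_le[OF r, of "letters - {up x}" "%l. cmod (f (x \<otimes> lt l))"] cq[OF x] by (simp add: h_def)
   finally show "cmod (chl x) powr r <= real q powr (r - 1) * (\<Sum>l\<in>letters - {up x}. h (x \<otimes> lt l))" .
  qed
  also have "\<dots> = real q powr (r - 1) * (\<Sum>(x, l)\<in>T. h (x \<otimes> lt l))"
   unfolding T_def sum_distrib_left[symmetric] by (subst sum.Sigma) (use K in \<open>auto simp: K'_def\<close>)
  also have "(\<Sum>(x, l)\<in>T. h (x \<otimes> lt l)) = (\<Sum>y\<in>(%(x, l). x \<otimes> lt l) ` T. h y)"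
  proof (subst sum.reindex)
   show "inj_on (%(x, l). x \<otimes> lt l) T"
   proof (rule inj_onI)
    fix s t assume st: "s \<in> T" "t \<in> T" "(case s of (x, l) => x \<otimes> lt l) = (case t of (x, l) => x \<otimes> lt l)"
    obtain x l y m where p: "s = (x, l)" "t = (y, m)" by (metis surj_pair)
    have x: "x \<in> carrier G" "l \<in> letters" "l ~= up x" and y: "y \<in> carrier G" "m \<in> letters" "m ~= up y"
     using st p K by (auto simp: T_def K'_def)
    have "flip l = flip m" using up_mult[OF x(1,2)] up_mult[OF y(1,2)] x y st p by simp
    then have "l = m" by (metis flip_flip)
    then show "s = t" using st p x y by (simp add: right_cancel)
   qed
  qed (simp add: case_prod_unfold)
  also have "\<dots> <= (\<Sum>y\<in>S. h y)"
  proof -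
   have sub: "(%(x, l). x \<otimes> lt l) ` T \<subseteq> carrier G" using K by (auto simp: T_def K'_def)
   have fT: "finite T" using K by (simp add: T_def K'_def)
   have "(\<Sum>y\<in>(%(x, l). x \<otimes> lt l) ` T. h y) = (\<Sum>y\<in>(%(x, l). x \<otimes> lt l) ` T \<inter> S. h y)"
    using sub h0 fT by (intro sum.mono_neutral_right) auto
   also have "\<dots> <= (\<Sum>y\<in>S. h y)" using S by (intro sum_mono2) (auto simp: h_def)
   finally show ?thesis .
  qed
  finally have "(\<Sum>x\<in>K. cmod (chl x) powr r) <= real q powr (r - 1) * (\<Sum>y\<in>S. h y)"
   by (simp add: mult_left_mono)
  also have "\<dots> <= real q powr (r - 1) * N powr r" using hS by (simp add: mult_left_mono)
  also have "\<dots> = (real q powr ((r - 1) / r) * N) powr r" using r N0 by (simp add: powr_mult powr_powr)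
  finally show ?thesis using r K N0 by (simp add: lp_norm_le_iff_powr)
 qed
 have "lpn r K (adj f) <= (real q powr (1 / r) + real q powr ((r - 1) / r)) * N"
  if K: "finite K" "K \<subseteq> carrier G" for K
 proof -
  have "lpn r K (adj f) = lpn r K (%x. par x + chl x)"
   using adj K by (intro lp_norm_cong) auto
  also have "\<dots> <= lpn r K par + lpn r K chl"
   by (rule lp_norm_finite_triangle[OF r K(1)])
  finally show ?thesis using par[OF K] chl[OF K] by (simp add: distrib_right)
 qed
 from lp_finite_bound[OF r _ this] show "lpn r (carrier G) (adj f) <=
  (real (2 * n - 1) powr (1 / r) + real (2 * n - 1) powr ((r - 1) / r)) * lpn r (carrier G) f"
  "lps r (carrier G) (adj f)"
  by (auto simp: q_def N_def)
qed

lemma translate_bij: "g \<in> carrier G ==> bij_betw (%x. g \<otimes> x) (carrier G) (carrier G)"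
 by (rule bij_betw_byWitness[of _ "%x. inv g \<otimes> x"]) (auto simp: m_assoc[symmetric])

text \<open>On a finite set \<open>adj f\<close> depends on finitely many values of f, and
  \<open>adj\<close> commutes with left translations; so the case of remote support gives the same
  constant for all f.\<close>

lemma adj_bound:
 assumes r: "1 <= r" and f: "lps r (carrier G) f"
 shows "lpn r (carrier G) (adj f) <=
  (real (2 * n - 1) powr (1 / r) + real (2 * n - 1) powr ((r - 1) / r)) * lpn r (carrier G) f"
  "lps r (carrier G) (adj f)"
proof -
 define \<mu> where "\<mu> = real (2 * n - 1) powr (1 / r) + real (2 * n - 1) powr ((r - 1) / r)"
 have mu: "0 <= \<mu>" by (simp add: \<mu>_def)
 have fin: "lpn r K (adj f) <= \<mu> * lpn r (carrier G) f"
  if K: "finite K" "K \<subseteq> carrier G" for K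
 proof -
  define S where "S = (%(x, l). x \<otimes> lt l) ` (K \<times> letters)"
  have S: "finite S" "S \<subseteq> carrier G" using K by (auto simp: S_def)
  \<comment> \<open>Translate the support away from the root, where the tree has one child too many.\<close>
  define Bad where "Bad = (%(y, x). y \<otimes> inv x) ` ({y \<in> carrier G. len y <= 1} \<times> S)"
  have "finite Bad" unfolding Bad_def using finite_ball S by auto
  then obtain g where g: "g \<in> carrier G" "g \<notin> Bad" using infinite_carrier by (metis finite_subset subsetI)
  define f' where "f' = (%x. if inv g \<otimes> x \<in> S then f (inv g \<otimes> x) else 0)"
  define S' where "S' = (%x. g \<otimes> x) ` S"
  have S': "finite S'" "S' \<subseteq> carrier G" using S g by (auto simp: S'_def)
  have far: "2 <= len x" if xS: "x \<in> S'" for x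
  proof (rule ccontr)
   assume "\<not> ?thesis"
   then have l: "len x <= 1" by simp
   obtain s where s: "s \<in> S" "x = g \<otimes> s" using xS by (auto simp: S'_def)
   have "g = x \<otimes> inv s" using s g S by (auto simp: m_assoc)
   moreover have "x \<in> carrier G" using s g S by auto
   then have "(%(y, x). y \<otimes> inv x) (x, s) \<in> Bad"
    unfolding Bad_def by (intro imageI) (use l s in auto)
   ultimately show False using g(2) by simp
  qed
  have zero: "f' x = 0" if "x \<in> carrier G - S'" for x
  proof -
   have "inv g \<otimes> x \<notin> S"
   proof
    assume "inv g \<otimes> x \<in> S"
    then have "g \<otimes> (inv g \<otimes> x) \<in> S'" by (auto simp: S'_def)
    then show False using that g by (simp add: m_assoc[symmetric])
   qed
   then show ?thesis by (simp add: f'_def)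
  qed
  have nf': "lpn r (carrier G) f' <= lpn r (carrier G) f"
  proof -
   have "lpn r (carrier G) f' = lpn r (carrier G) (%x. f' (g \<otimes> x))"
    by (rule lp_reindex(2)[OF translate_bij[OF g(1)], symmetric])
   also have "\<dots> <= lpn r (carrier G) f"
    using g by (intro lp_mono(2)[OF r f]) (auto simp: f'_def m_assoc[symmetric])
   finally show ?thesis .
  qed
  have "lpn r K (adj f) = lpn r K (%x. adj f' (g \<otimes> x))"
  proof (rule lp_norm_cong)
   fix x assume x: "x \<in> K"
   have "adj f' (g \<otimes> x) = adj f x" unfolding adj_def
   proof (intro sum.cong refl)
    fix l assume l: "l \<in> letters"
    have "x \<otimes> lt l \<in> S" using x l by (auto simp: S_def)
    then show "f' (g \<otimes> x \<otimes> lt l) = f (x \<otimes> lt l)"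
     using g x K l by (auto simp: f'_def m_assoc[symmetric])
   qed
   then show "cmod (adj f x) = cmod (adj f' (g \<otimes> x))" by simp
  qed
  also have "\<dots> <= lpn r (carrier G) (%x. adj f' (g \<otimes> x))"
   using adj_bound_far(2)[OF r S' far zero] K
   by (intro lp_norm_mono_set[OF r]) (auto simp: lp_reindex(1)[OF translate_bij[OF g(1)]])
  also have "\<dots> = lpn r (carrier G) (adj f')"
   by (rule lp_reindex(2)[OF translate_bij[OF g(1)]])
  also have "\<dots> <= \<mu> * lpn r (carrier G) f'"
   unfolding \<mu>_def by (rule adj_bound_far(1)[OF r S' far zero])
  also have "\<dots> <= \<mu> * lpn r (carrier G) f" by (intro mult_left_mono nf' mu)
  finally show ?thesis .
 qed
 from lp_finite_bound[OF r _ fin] show "lpn r (carrier G) (adj f) <=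
  (real (2 * n - 1) powr (1 / r) + real (2 * n - 1) powr ((r - 1) / r)) * lpn r (carrier G) f"
  "lps r (carrier G) (adj f)"
  using mu by (auto simp: \<mu>_def)
qed

end

section \<open>Infinite sums; coboundary and boundary on oriented edges\<close>

lemma infsum_minus:
 fixes f g :: "'x => 'c :: banach"
 assumes "f summable_on A" "g summable_on A"
 shows "infsum (%x. f x - g x) A = infsum f A - infsum g A"
 using infsum_add[OF assms(1), of "%x. - g x"] assms(2) by (simp add: infsum_uminus summable_on_uminus)

lemma infsum_finite_sum:
 fixes f :: "'i => 'x => 'c :: banach"
 assumes "finite I" "!!i. i \<in> I ==> f i summable_on A"
 shows "(%x. \<Sum>i\<in>I. f i x) summable_on A"
  "infsum (%x. \<Sum>i\<in>I. f i x) A = (\<Sum>i\<in>I. infsum (f i) A)"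
proof -
 have "(%x. \<Sum>i\<in>I. f i x) summable_on A & infsum (%x. \<Sum>i\<in>I. f i x) A = (\<Sum>i\<in>I. infsum (f i) A)"
  using assms by (induction I) (auto simp: infsum_add summable_on_add)
 then show "(%x. \<Sum>i\<in>I. f i x) summable_on A"
  "infsum (%x. \<Sum>i\<in>I. f i x) A = (\<Sum>i\<in>I. infsum (f i) A)" by auto
qed

lemma infsum_Times_finite:
 fixes F :: "'x \<times> 'y => 'c :: banach"
 assumes "finite B" "F summable_on A \<times> B"
 shows "infsum F (A \<times> B) = (\<Sum>b\<in>B. infsum (%x. F (x, b)) A)"
  "b \<in> B ==> (%x. F (x, b)) summable_on A"
proof -
 have re: "bij_betw (%x. (x, b)) A (A \<times> {b})" for b :: 'y
  by (rule bij_betw_byWitness[of _ fst]) auto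
 show "(%x. F (x, b)) summable_on A" if "b \<in> B" for b
  using summable_on_subset_banach[OF assms(2), of "A \<times> {b}"] that summable_on_reindex_bij_betw[OF re, of F b]
  by auto
 show "infsum F (A \<times> B) = (\<Sum>b\<in>B. infsum (%x. F (x, b)) A)"
  using assms
 proof (induction B)
  case (insert b B)
  have s: "F summable_on A \<times> {b}" "F summable_on A \<times> B"
   by (auto intro: summable_on_subset_banach[OF insert.prems])
  have "infsum F (A \<times> insert b B) = infsum F (A \<times> {b} \<union> A \<times> B)"
   by (intro arg_cong2[of _ _ _ _ infsum]) auto
  also have "\<dots> = infsum F (A \<times> {b}) + infsum F (A \<times> B)"
   using insert.hyps by (intro infsum_Un_disjoint s) auto
  also have "infsum F (A \<times> {b}) = infsum (%x. F (x, b)) A"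
   using infsum_reindex_bij_betw[OF re, of F b] by simp
  finally show ?case using insert s by simp
 qed simp
qed

text \<open>Edge functions are treated as n-tuples of vertex functions; each slice is compared with
  its extension by zero.\<close>

lemma lp_slices:
 assumes r: "1 <= r" and B: "finite B"
 shows "lps r (A \<times> B) h \<longleftrightarrow> (\<forall>b\<in>B. lps r A (%x. h (x, b)))"
  "lps r (A \<times> B) h ==> b \<in> B ==> lpn r A (%x. h (x, b)) <= lpn r (A \<times> B) h"
  "lps r (A \<times> B) h ==> lpn r (A \<times> B) h <= (\<Sum>b\<in>B. lpn r A (%x. h (x, b)))"
proof -
 have re: "bij_betw (%x. (x, b)) A (A \<times> {b})" for b
  by (rule bij_betw_byWitness[of _ fst]) auto
 define g where "g = (%b y. if snd y = b then h y else 0)"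
 have g: "(lps r (A \<times> B) (g b) \<longleftrightarrow> lps r A (%x. h (x, b))) &
  lpn r (A \<times> B) (g b) = lpn r A (%x. h (x, b))" if b: "b \<in> B" for b
 proof -
  have "((%y. cmod (g b y) powr r) summable_on A \<times> B) = ((%y. cmod (h y) powr r) summable_on A \<times> {b})"
   using b r by (intro summable_on_cong_neutral) (auto simp: g_def)
  moreover have "infsum (%y. cmod (g b y) powr r) (A \<times> B) = infsum (%y. cmod (h y) powr r) (A \<times> {b})"
   using b r by (intro infsum_cong_neutral) (auto simp: g_def)
  ultimately show ?thesis using lp_reindex[OF re, of r h b]
   by (simp add: lp_summable_ereal lp_norm_ereal)
 qed
 have hg: "h y = (\<Sum>b\<in>B. g b y)" if "y \<in> A \<times> B" for y
  using that B by (auto simp: g_def sum.delta)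
 have 1: "lps r A (%x. h (x, b))" if "lps r (A \<times> B) h" "b \<in> B" for b
  using lp_summable_subset[OF that(1), of "A \<times> {b}"] that(2) lp_reindex(1)[OF re, of r h b] by auto
 show "lpn r A (%x. h (x, b)) <= lpn r (A \<times> B) h" if "lps r (A \<times> B) h" "b \<in> B" for b
  using lp_norm_mono_set[OF r that(1), of "A \<times> {b}"] that(2) lp_reindex(2)[OF re, of r h b] by auto
 have 2: "lps r (A \<times> B) h & lpn r (A \<times> B) h <= (\<Sum>b\<in>B. lpn r A (%x. h (x, b)))"
  if "\<forall>b\<in>B. lps r A (%x. h (x, b))"
 proof -
  have "lps r (A \<times> B) (%y. \<Sum>b\<in>B. g b y) &
   lpn r (A \<times> B) (%y. \<Sum>b\<in>B. g b y) <= (\<Sum>b\<in>B. lpn r (A \<times> B) (g b))"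
   using g that by (intro lp_norm_sum_le[OF r B]) auto
  moreover have "lps r (A \<times> B) (%y. \<Sum>b\<in>B. g b y) = lps r (A \<times> B) h"
   by (rule lp_summable_cong) (use hg in simp)
  moreover have "lpn r (A \<times> B) (%y. \<Sum>b\<in>B. g b y) = lpn r (A \<times> B) h"
   by (rule lp_norm_cong) (use hg in simp)
  ultimately show ?thesis using g by simp
 qed
 show "lps r (A \<times> B) h \<longleftrightarrow> (\<forall>b\<in>B. lps r A (%x. h (x, b)))" using 1 2 by blast
 show "lps r (A \<times> B) h ==> lpn r (A \<times> B) h <= (\<Sum>b\<in>B. lpn r A (%x. h (x, b)))"
  using 1 2 by blast
qed

context free_gens begin

abbreviation edges :: "('a \<times> nat) set" where "edges \<equiv> carrier G \<times> {1..n}"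

text \<open>The pair (x, j) stands for the edge from x to x a_j. Each geometric edge occurs once, so
  antisymmetry disappears from the formulas.\<close>

definition dl :: "('a => complex) => 'a \<times> nat => complex" where
 "dl f = (%(x, j). if (x, j) \<in> edges then f (x \<otimes> a j) - f x else 0)"

definition bd :: "('a \<times> nat => complex) => 'a => complex" where
 "bd h x = (if x \<in> carrier G then (\<Sum>j=1..n. h (x, j)) - (\<Sum>j=1..n. h (x \<otimes> inv (a j), j)) else 0)"

definition shift :: "'a => ('a \<times> nat => complex) => 'a \<times> nat => complex" where
 "shift g h = (%(x, j). if x \<in> carrier G then h (inv g \<otimes> x, j) else 0)"

definition edge :: "nat => 'a \<times> nat => complex" where
 "edge k = (%(x, j). if x = \<one> & j = k then 1 else 0)"

lemma right_bij: "g \<in> carrier G ==> bij_betw (%x. x \<otimes> g) (carrier G) (carrier G)"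
 by (rule bij_betw_byWitness[of _ "%x. x \<otimes> inv g"]) (auto simp: m_assoc)

text \<open>Up to sign the Laplacian of the 2n-regular tree. It connects the edge operators with the
  adjacency operator and its Green function.\<close>

lemma bd_dl: "x \<in> carrier G ==> bd (dl f) x = adj f x - 2 * of_nat n * f x"
proof -
 assume x: "x \<in> carrier G"
 have "(\<Sum>j=1..n. dl f (x, j)) = (\<Sum>j=1..n. f (x \<otimes> a j)) - of_nat n * f x"
  using x by (simp add: dl_def sum_subtractf)
 moreover have "(\<Sum>j=1..n. dl f (x \<otimes> inv (a j), j)) = of_nat n * f x - (\<Sum>j=1..n. f (x \<otimes> inv (a j)))"
 proof -
  have "dl f (x \<otimes> inv (a j), j) = f x - f (x \<otimes> inv (a j))" if "j \<in> {1..n}" for j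
   using x that a_closed[OF that] by (simp add: dl_def m_assoc)
  then show ?thesis by (simp add: sum_subtractf)
 qed
 ultimately show ?thesis using x sum_letters[of "%y. f (x \<otimes> y)"] by (simp add: bd_def adj_def)
qed

lemma dl_bound:
 assumes r: "1 <= r" and f: "lps r (carrier G) f"
 shows "lps r edges (dl f)"
  "lpn r edges (dl f) <= 2 * real n * lpn r (carrier G) f"
proof -
 have s: "lps r (carrier G) (%x. dl f (x, j)) &
   lpn r (carrier G) (%x. dl f (x, j)) <= 2 * lpn r (carrier G) f" if j: "j \<in> {1..n}" for j
 proof -
  have f': "lps r (carrier G) (%x. f (x \<otimes> a j))"
   "lpn r (carrier G) (%x. f (x \<otimes> a j)) = lpn r (carrier G) f"
   using lp_reindex[OF right_bij[OF a_closed[OF j]], of r f] f by auto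
  have "lps r (carrier G) (%x. dl f (x, j)) = lps r (carrier G) (%x. f (x \<otimes> a j) - f x)"
   by (rule lp_summable_cong) (use j in \<open>simp add: dl_def\<close>)
  moreover have "lpn r (carrier G) (%x. dl f (x, j)) = lpn r (carrier G) (%x. f (x \<otimes> a j) - f x)"
   by (rule lp_norm_cong) (use j in \<open>simp add: dl_def\<close>)
  ultimately show ?thesis using lp_minus[OF r f'(1) f] f'(2) by simp
 qed
 show sm: "lps r edges (dl f)"
  using s by (simp add: lp_slices(1)[OF r])
 have "lpn r edges (dl f) <= (\<Sum>j=1..n. lpn r (carrier G) (%x. dl f (x, j)))"
  using lp_slices(3)[OF r _ sm] by simp
 also have "\<dots> <= (\<Sum>j=1..n. 2 * lpn r (carrier G) f)" using s by (intro sum_mono) blast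
 finally show "lpn r edges (dl f) <= 2 * real n * lpn r (carrier G) f" by simp
qed

lemma bd_bound:
 assumes r: "1 <= r" and h: "lps r edges h"
 shows "lps r (carrier G) (bd h)"
  "lpn r (carrier G) (bd h) <= 2 * real n * lpn r edges h"
proof -
 have s1: "lps r (carrier G) (%x. h (x, j))"
  "lpn r (carrier G) (%x. h (x, j)) <= lpn r edges h" if "j \<in> {1..n}" for j
  using lp_slices(1,2)[OF r, of "{1..n}" "carrier G" h] h that by auto
 have s2: "lps r (carrier G) (%x. h (x \<otimes> inv (a j), j))"
  "lpn r (carrier G) (%x. h (x \<otimes> inv (a j), j)) <= lpn r edges h" if "j \<in> {1..n}" for j
  using lp_reindex[OF right_bij[of "inv (a j)"], of r "%x. h (x, j)"] s1[OF that] that by auto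
 have t1: "lps r (carrier G) (%x. \<Sum>j=1..n. h (x, j))"
  "lpn r (carrier G) (%x. \<Sum>j=1..n. h (x, j)) <= real n * lpn r edges h"
  using lp_norm_sum_le[OF r, of "{1..n}" "carrier G" "%j x. h (x, j)"] s1
   sum_bounded_above[of "{1..n}" "%j. lpn r (carrier G) (%x. h (x, j))" "lpn r edges h"] by auto
 have t2: "lps r (carrier G) (%x. \<Sum>j=1..n. h (x \<otimes> inv (a j), j))"
  "lpn r (carrier G) (%x. \<Sum>j=1..n. h (x \<otimes> inv (a j), j)) <= real n * lpn r edges h"
  using lp_norm_sum_le[OF r, of "{1..n}" "carrier G" "%j x. h (x \<otimes> inv (a j), j)"] s2
   sum_bounded_above[of "{1..n}" "%j. lpn r (carrier G) (%x. h (x \<otimes> inv (a j), j))" "lpn r edges h"] by auto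
 have "lps r (carrier G) (bd h) = lps r (carrier G) (%x. (\<Sum>j=1..n. h (x, j)) - (\<Sum>j=1..n. h (x \<otimes> inv (a j), j)))"
  by (rule lp_summable_cong) (simp add: bd_def)
 moreover have "lpn r (carrier G) (bd h) = lpn r (carrier G) (%x. (\<Sum>j=1..n. h (x, j)) - (\<Sum>j=1..n. h (x \<otimes> inv (a j), j)))"
  by (rule lp_norm_cong) (simp add: bd_def)
 ultimately show "lps r (carrier G) (bd h)"
  "lpn r (carrier G) (bd h) <= 2 * real n * lpn r edges h"
  using lp_minus[OF r t1(1) t2(1)] t1(2) t2(2) by simp_all
qed

lemma bd_shift:
 assumes "g \<in> carrier G"
 shows "bd (shift g h) x = (if x \<in> carrier G then bd h (inv g \<otimes> x) else 0)"
 using assms by (auto simp: bd_def shift_def m_assoc intro!: sum.cong arg_cong2[of _ _ _ _ "(-)"])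

lemma shift_norm:
 assumes r: "1 <= r" and g: "g \<in> carrier G"
 shows "lps r edges (shift g h) \<longleftrightarrow> lps r edges h"
  "lpn r edges (shift g h) = lpn r edges h"
proof -
 have b: "bij_betw (%(x, j). (g \<otimes> x, j)) edges edges"
  by (rule bij_betw_byWitness[of _ "%(x, j). (inv g \<otimes> x, j)"]) (use g in \<open>auto simp: m_assoc[symmetric]\<close>)
 have e: "shift g h ((%(x, j). (g \<otimes> x, j)) y) = h y" if "y \<in> edges" for y
  using that g by (auto simp: shift_def m_assoc[symmetric])
 show "lps r edges (shift g h) \<longleftrightarrow> lps r edges h"
  using lp_reindex(1)[OF b, of r "shift g h"] lp_summable_cong[of edges "%y. shift g h ((%(x, j). (g \<otimes> x, j)) y)" h r] e by simp
 show "lpn r edges (shift g h) = lpn r edges h"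
  using lp_reindex(2)[OF b, of r "shift g h"] lp_norm_cong[of edges "%y. shift g h ((%(x, j). (g \<otimes> x, j)) y)" h r] e by simp
qed

text \<open>For the bilinear pairing \<open>bd\<close> is minus the adjoint of \<open>dl\<close>.
  The two halves of the coboundary are assumed summable separately because one of them is reindexed
  by a right translation.\<close>

lemma summation_by_parts:
 assumes s1: "(%(x, j). w (x, j) * u x) summable_on edges"
  and s2: "(%(x, j). w (x, j) * u (x \<otimes> a j)) summable_on edges"
 shows "(\<Sum>\<^sub>\<infinity>e\<in>edges. w e * dl u e) = - (\<Sum>\<^sub>\<infinity>x\<in>carrier G. bd w x * u x)"
proof -
 have t1: "(%x. w (x, j) * u x) summable_on carrier G" if "j \<in> {1..n}" for j
  using infsum_Times_finite(2)[OF _ s1 that] by simp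
 have t2: "(%x. w (x, j) * u (x \<otimes> a j)) summable_on carrier G" if "j \<in> {1..n}" for j
  using infsum_Times_finite(2)[OF _ s2 that] by simp
 have re: "(%x. w (x \<otimes> inv (a j), j) * u x) summable_on carrier G &
  (\<Sum>\<^sub>\<infinity>x\<in>carrier G. w (x \<otimes> inv (a j), j) * u x) = (\<Sum>\<^sub>\<infinity>x\<in>carrier G. w (x, j) * u (x \<otimes> a j))" if j: "j \<in> {1..n}" for j
 proof -
  have e: "w (x, j) * u (x \<otimes> a j) = (%x. w (x \<otimes> inv (a j), j) * u x) (x \<otimes> a j)" if "x \<in> carrier G" for x
   using that j a_closed[OF j] by (simp add: m_assoc)
  have "(%x. (%x. w (x \<otimes> inv (a j), j) * u x) (x \<otimes> a j)) summable_on carrier G"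
   using t2[OF j] e by (simp cong: summable_on_cong)
  moreover have "(\<Sum>\<^sub>\<infinity>x\<in>carrier G. w (x, j) * u (x \<otimes> a j)) = (\<Sum>\<^sub>\<infinity>x\<in>carrier G. (%x. w (x \<otimes> inv (a j), j) * u x) (x \<otimes> a j))"
   by (rule infsum_cong) (rule e)
  ultimately show ?thesis
   using summable_on_reindex_bij_betw[OF right_bij[OF a_closed[OF j]], of "%x. w (x \<otimes> inv (a j), j) * u x"]
    infsum_reindex_bij_betw[OF right_bij[OF a_closed[OF j]], of "%x. w (x \<otimes> inv (a j), j) * u x"] by simp
 qed
 have "(\<Sum>\<^sub>\<infinity>e\<in>edges. w e * dl u e) = (\<Sum>\<^sub>\<infinity>e\<in>edges. (%(x, j). w (x, j) * u (x \<otimes> a j)) e - (%(x, j). w (x, j) * u x) e)"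
  by (intro infsum_cong) (auto simp: dl_def right_diff_distrib)
 also have "\<dots> = (\<Sum>\<^sub>\<infinity>(x, j)\<in>edges. w (x, j) * u (x \<otimes> a j)) - (\<Sum>\<^sub>\<infinity>(x, j)\<in>edges. w (x, j) * u x)"
  by (rule infsum_minus[OF s2 s1])
 also have "\<dots> = (\<Sum>j=1..n. \<Sum>\<^sub>\<infinity>x\<in>carrier G. w (x \<otimes> inv (a j), j) * u x) - (\<Sum>j=1..n. \<Sum>\<^sub>\<infinity>x\<in>carrier G. w (x, j) * u x)"
  using infsum_Times_finite(1)[OF _ s1] infsum_Times_finite(1)[OF _ s2] re by simp
 also have "\<dots> = (\<Sum>\<^sub>\<infinity>x\<in>carrier G. \<Sum>j=1..n. w (x \<otimes> inv (a j), j) * u x) - (\<Sum>\<^sub>\<infinity>x\<in>carrier G. \<Sum>j=1..n. w (x, j) * u x)"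
  by (subst (1 2) infsum_finite_sum(2)) (use re t1 in auto)
 also have "\<dots> = (\<Sum>\<^sub>\<infinity>x\<in>carrier G. (\<Sum>j=1..n. w (x \<otimes> inv (a j), j) * u x) - (\<Sum>j=1..n. w (x, j) * u x))"
  using re t1 by (intro infsum_minus[symmetric] infsum_finite_sum(1)) auto
 also have "\<dots> = (\<Sum>\<^sub>\<infinity>x\<in>carrier G. - (bd w x * u x))"
  by (intro infsum_cong) (simp add: bd_def sum_distrib_right left_diff_distrib)
 finally show ?thesis by (simp add: infsum_uminus)
qed

text \<open>Summability allows an l1 cycle to be paired with the coboundary of any bounded function,
  with result 0. A half tree has a coboundary supported on a single edge, and left translation moves
  every edge to \<one>.\<close>

lemma l1_cycle_zero:
 assumes h: "lp_summable (ereal 1) edges h" and bd0: "!!x. x \<in> carrier G ==> bd h x = 0" and e: "e \<in> edges"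
 shows "h e = 0"
proof -
 \<comment> \<open>Test with the indicator of the half tree behind an edge at the root.\<close>
 have root: "h (\<one>, k) = 0" if h: "lp_summable (ereal 1) edges h" and bd0: "!!x. x \<in> carrier G ==> bd h x = 0"
  and k: "k \<in> {1..n}" for h k
 proof -
  \<comment> \<open>Normal forms grow at the head, so \<open>last\<close> is the first step away
    from \<one>.\<close>
  define u where "u = (%x. if nf x ~= [] & last (nf x) = (k, True) then 1 else 0 :: complex)"
  have hs: "(%e. cmod (h e)) summable_on edges" using h by (simp add: lp_summable_ereal)
  have "(%(x, j). h (x, j) * u x) summable_on edges"
   by (rule abs_summable_summable, rule summable_on_comparison_test[OF hs]) (auto simp: u_def)
  moreover have "(%(x, j). h (x, j) * u (x \<otimes> a j)) summable_on edges"
   by (rule abs_summable_summable, rule summable_on_comparison_test[OF hs]) (auto simp: u_def)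
  ultimately have "(\<Sum>\<^sub>\<infinity>e\<in>edges. h e * dl u e) = - (\<Sum>\<^sub>\<infinity>x\<in>carrier G. bd h x * u x)"
   by (rule summation_by_parts)
  also have "(\<Sum>\<^sub>\<infinity>x\<in>carrier G. bd h x * u x) = 0" using bd0 by (intro infsum_0) simp
  also have "(\<Sum>\<^sub>\<infinity>e\<in>edges. h e * dl u e) = (\<Sum>\<^sub>\<infinity>e\<in>{(\<one>, k)}. h e)"
  proof (rule infsum_cong_neutral)
   have dlu: "dl u (x, j) = (if x = \<one> & j = k then 1 else 0)" if x: "x \<in> carrier G" and j: "j \<in> {1..n}" for x j
   proof -
    have l: "(j, True) \<in> letters" "lt (j, True) = a j" using j by (auto simp: letters_def lt_def)
    have nfa: "nf (x \<otimes> a j) = push (j, True) (nf x)" using nf_mult[OF x l(1)] l(2) by simp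
    show ?thesis
    proof (cases "nf x")
     case Nil
     then have "x = \<one>" using x nf_Nil_iff by blast
     then show ?thesis using nfa Nil x j by (auto simp: dl_def u_def push_def)
    next
     case (Cons l w)
     then have "x ~= \<one>" by auto
     then show ?thesis using nfa Cons x j by (auto simp: dl_def u_def push_def flip_def)
    qed
   qed
   have dlu': "dl u e = (if e = (\<one>, k) then 1 else 0)" if "e \<in> edges" for e
    using that dlu[of "fst e" "snd e"] by (cases e) auto
   show "h e * dl u e = 0" if "e \<in> edges - {(\<one>, k)}" for e using that dlu'[of e] k by simp
   show "h e * dl u e = h e" if "e \<in> edges \<inter> {(\<one>, k)}" for e using that dlu'[of e] k by simp
  qed (use k in auto)
  finally show ?thesis by simp
 qed
 obtain x k where xk: "e = (x, k)" "x \<in> carrier G" "k \<in> {1..n}" using e by auto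
 have "shift (inv x) h (\<one>, k) = 0"
 proof (rule root)
  show "lp_summable (ereal 1) edges (shift (inv x) h)"
   by (rule shift_norm(1)[THEN iffD2, OF _ _ h]) (use xk in auto)
 qed (use xk bd0 in \<open>simp_all add: bd_shift\<close>)
 then show ?thesis using xk by (simp add: shift_def)
qed

end

section \<open>The Green function and the projection onto the cycles\<close>

locale green = free_gens +
 fixes r :: real
 assumes n2: "2 <= n" and r: "1 < r" "r <= 2"
begin

definition q :: real where "q = 2 * real n - 1"
text \<open>The defect of the equation for \<open>gam\<close> at the root, (q + 1) - (q + 1) /
  q.\<close>

definition \<kappa> :: real where "\<kappa> = (q + 1) * (q - 1) / q"
definition \<mu> :: real where "\<mu> = q powr (1 / r) + q powr ((r - 1) / r)"
text \<open>The fundamental solution of (q + 1) - \<open>adj\<close>, up to the factor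
  \<kappa>.\<close>

definition gam :: "'a => complex" where "gam x = of_real ((1 / q) ^ len x)"

lemma r1: "1 <= r" using r by simp

lemma q3: "3 <= q" using n2 by (simp add: q_def)

lemma kappa_pos: "0 < \<kappa>" using q3 by (simp add: \<kappa>_def)

text \<open>The numbers q^(1/r) and q^((r-1)/r) have product q, so q + 1 - \<mu> is the product of
  their excesses over 1. Both excesses are positive because r > 1 and q > 1.\<close>

lemma mu_less: "\<mu> < q + 1" and mu_nonneg: "0 <= \<mu>"
proof -
 have "1 < q powr (1 / r)" "1 < q powr ((r - 1) / r)" using q3 r by (auto intro!: gr_one_powr divide_pos_pos)
 then have "0 < (q powr (1 / r) - 1) * (q powr ((r - 1) / r) - 1)" by simp
 also have "\<dots> = q powr (1 / r) * q powr ((r - 1) / r) + 1 - \<mu>" by (simp add: \<mu>_def algebra_simps)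
 also have "q powr (1 / r) * q powr ((r - 1) / r) = q"
  using q3 r by (simp add: powr_add[symmetric] add_divide_distrib[symmetric])
 finally show "\<mu> < q + 1" by simp
 show "0 <= \<mu>" by (simp add: \<mu>_def)
qed

lemma adj_le:
 assumes "lps r (carrier G) f"
 shows "lpn r (carrier G) (adj f) <= \<mu> * lpn r (carrier G) f"
  "lps r (carrier G) (adj f)"
 using adj_bound[OF r1 assms] n2 by (simp_all add: \<mu>_def q_def of_nat_diff)

text \<open>At length k > 0 the parent contributes q^(1-k) and the q children together q^(-k), a
  total of (q + 1) q^(-k). At \<one> the missing parent leaves the defect \<kappa>.\<close>

lemma adj_gam: "x \<in> carrier G ==> adj gam x = of_real (q + 1) * gam x - (if x = \<one> then of_real \<kappa> else 0)"
proof -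
 assume x: "x \<in> carrier G"
 have q0: "q ~= 0" "q + 1 = 2 * real n" using q3 by (auto simp: q_def)
 have "adj gam x = of_real (\<Sum>l\<in>letters. (1 / q) ^ len (x \<otimes> lt l))" by (simp add: adj_def gam_def)
 also have "(\<Sum>l\<in>letters. (1 / q) ^ len (x \<otimes> lt l)) = (q + 1) * (1 / q) ^ len x - (if x = \<one> then \<kappa> else 0)"
 proof (cases "x = \<one>")
  case True
  then show ?thesis using sum_letters_len[OF x, of "%k. (1 / q) ^ k"] q0 by (simp add: \<kappa>_def field_simps)
 next
  case False
  then obtain m where m: "len x = Suc m" using len_0_iff[OF x] by (metis not0_implies_Suc)
  have "(\<Sum>l\<in>letters. (1 / q) ^ len (x \<otimes> lt l)) = (1 / q) ^ m + q * (1 / q) ^ (m + 2)"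
   using sum_letters_len[OF x, of "%k. (1 / q) ^ k"] False m by (simp add: q_def)
  also have "\<dots> = (q + 1) * (1 / q) ^ Suc m" using q0 by (simp add: field_simps)
  finally show ?thesis using m False by simp
 qed
 finally show ?thesis by (simp add: gam_def[of x])
qed

text \<open>The sphere of radius k has at most (q + 1) q^k points, and there |gam|^r is q^(-k r).
  The resulting geometric series has ratio q^(1-r), which is below 1 because r > 1.\<close>

lemma gam_summable: "lps r (carrier G) gam"
proof -
 define t where "t = q powr (1 - r)"
 have t: "0 <= t" "t < 1" using q3 r powr_less_mono[of "1 - r" 0 q] by (auto simp: t_def)
 have sphere: "(\<Sum>x\<in>{x \<in> carrier G. len x = k}. cmod (gam x) powr r) <= (q + 1) * t ^ k" for k
 proof (cases k)
  case 0
  have e: "{x \<in> carrier G. len x = 0} = {\<one>}" using len_0_iff by auto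
  have "cmod (gam \<one>) powr r <= q + 1" using q3 by (simp add: gam_def)
  then show ?thesis unfolding 0 e by simp
 next
  case (Suc m)
  have inj: "inj_on nf {x \<in> carrier G. len x = k}" by (rule inj_on_inverseI[of _ val]) simp
  have "card {x \<in> carrier G. len x = k} = card (nf ` {x \<in> carrier G. len x = k})" by (rule card_image[OF inj, symmetric])
  also have "\<dots> <= card {w \<in> rwords. length w = Suc m}"
   using rwords_length_card[of m] Suc by (intro card_mono) (auto simp: len_def)
  also have "\<dots> <= 2 * n * (2 * n - 1) ^ m" using rwords_length_card[of m] by simp
  finally have "real (card {x \<in> carrier G. len x = k}) <= real (2 * n * (2 * n - 1) ^ m)" by linarith
  also have "\<dots> = (q + 1) * q ^ m" using n2 by (simp add: q_def of_nat_diff)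
  also have "\<dots> <= (q + 1) * q ^ k" using Suc q3 by (intro mult_left_mono power_increasing) auto
  finally have c: "real (card {x \<in> carrier G. len x = k}) <= (q + 1) * q ^ k" .
  have "(\<Sum>x\<in>{x \<in> carrier G. len x = k}. cmod (gam x) powr r) = real (card {x \<in> carrier G. len x = k}) * ((1 / q) ^ k) powr r"
   using q3 by (simp add: gam_def norm_power norm_divide)
  also have "\<dots> <= (q + 1) * q ^ k * ((1 / q) ^ k) powr r" by (intro mult_right_mono c) simp
  also have "\<dots> = (q + 1) * (q ^ k * ((1 / q) ^ k) powr r)" by (simp only: mult.assoc)
  also have "q ^ k * ((1 / q) ^ k) powr r = t ^ k"
  proof -
   have "(1 / q) ^ k = q powr - real k" using q3 by (simp add: powr_minus powr_realpow power_divide inverse_eq_divide)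
   then have "((1 / q) ^ k) powr r = q powr (- real k * r)" by (simp add: powr_powr)
   moreover have "q ^ k = q powr real k" using q3 by (simp add: powr_realpow)
   ultimately have "q ^ k * ((1 / q) ^ k) powr r = q powr ((1 - r) * real k)"
    by (simp add: powr_add[symmetric] algebra_simps)
   also have "\<dots> = t ^ k" using q3 by (simp add: t_def powr_powr[symmetric] powr_realpow)
   finally show ?thesis .
  qed
  finally show ?thesis .
 qed
 show ?thesis
  unfolding lp_summable_ereal
 proof (rule nonneg_bdd_above_summable_on)
  show "bdd_above (sum (%x. cmod (gam x) powr r) ` {F. F \<subseteq> carrier G & finite F})"
  proof (rule bdd_aboveI2)
   fix F assume "F \<in> {F. F \<subseteq> carrier G & finite F}"
   then have F: "F \<subseteq> carrier G" "finite F" by auto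
   define R where "R = Max (insert 0 (len ` F))"
   have fb: "finite {x \<in> carrier G. len x = k}" for k
    by (rule finite_subset[OF _ finite_ball[of k]]) auto
   have "F \<subseteq> (\<Union>k\<in>{..R}. {x \<in> carrier G. len x = k})" using F by (auto simp: R_def)
   then have "(\<Sum>x\<in>F. cmod (gam x) powr r) <= (\<Sum>x\<in>(\<Union>k\<in>{..R}. {x \<in> carrier G. len x = k}). cmod (gam x) powr r)"
    using fb by (intro sum_mono2) auto
   also have "\<dots> = (\<Sum>k\<in>{..R}. \<Sum>x\<in>{x \<in> carrier G. len x = k}. cmod (gam x) powr r)"
    using fb by (intro sum.UNION_disjoint) auto
   also have "\<dots> <= (\<Sum>k\<in>{..R}. (q + 1) * t ^ k)" by (intro sum_mono sphere)
   also have "\<dots> <= (q + 1) * (1 / (1 - t))"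
    unfolding sum_distrib_left[symmetric]
   proof (rule mult_left_mono)
    have "(\<Sum>k\<in>{..R}. t ^ k) <= (\<Sum>k. t ^ k)" using t by (intro sum_le_suminf summable_geometric) auto
    then show "(\<Sum>k\<in>{..R}. t ^ k) <= 1 / (1 - t)" using t by (simp add: suminf_geometric)
   qed (use q3 in simp)
   finally show "(\<Sum>x\<in>F. cmod (gam x) powr r) <= (q + 1) * (1 / (1 - t))" .
  qed
 qed simp
qed

definition Cg :: real where "Cg = \<kappa> / (q + 1 - \<mu>)"

lemma Cg_nonneg: "0 <= Cg" using kappa_pos mu_less by (simp add: Cg_def)

lemma gam_translate_summable: "y \<in> carrier G ==> lps r (carrier G) (%x. gam (inv y \<otimes> x))"
 using lp_reindex(1)[OF translate_bij[of "inv y"], of r gam] gam_summable by simp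

text \<open>An a priori estimate: g is a finite sum of translates of \<open>gam\<close>, so its norm
  is finite, and it solves (q + 1) g = adj g + \<kappa> f. As \<mu> < q + 1, the term adj g is
  absorbed on the left, which leaves the constant \<open>Cg\<close>.\<close>

lemma grn_finite:
 fixes f :: "'a => complex"
 assumes S: "finite S" "S \<subseteq> carrier G"
 defines "g \<equiv> %x. \<Sum>y\<in>S. gam (inv y \<otimes> x) * f y"
 shows "lps r (carrier G) g" "lpn r (carrier G) g <= Cg * lpn r S f"
proof -
 show gs: "lps r (carrier G) g"
 proof -
  have "lps r (carrier G) (%x. f y * gam (inv y \<otimes> x))" if "y \<in> S" for y
   using that S by (intro lp_scale(1)[OF r1] gam_translate_summable) auto
  then show ?thesis unfolding g_def
   using lp_norm_sum_le[OF r1 S(1), of "carrier G" "%y x. gam (inv y \<otimes> x) * f y"] by (simp add: mult.commute)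
 qed
 define f' where "f' = (%x. if x \<in> S then f x else 0)"
 have f': "lps r (carrier G) f'" "lpn r (carrier G) f' = lpn r S f"
 proof -
  have "((%y. cmod (f' y) powr r) summable_on carrier G) = ((%y. cmod (f y) powr r) summable_on S)"
   using S r by (intro summable_on_cong_neutral) (auto simp: f'_def)
  moreover have "infsum (%y. cmod (f' y) powr r) (carrier G) = infsum (%y. cmod (f y) powr r) S"
   using S r by (intro infsum_cong_neutral) (auto simp: f'_def)
  ultimately show "lps r (carrier G) f'" "lpn r (carrier G) f' = lpn r S f"
   using S by (auto simp: lp_summable_ereal lp_norm_ereal)
 qed
 have eq: "of_real (q + 1) * g x = adj g x + of_real \<kappa> * f' x" if x: "x \<in> carrier G" for x
 proof -
  have "adj g x = (\<Sum>y\<in>S. f y * adj gam (inv y \<otimes> x))"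
   unfolding adj_def g_def using S x
   by (subst sum.swap) (auto simp: sum_distrib_left m_assoc mult.commute intro!: sum.cong)
  also have "\<dots> = (\<Sum>y\<in>S. of_real (q + 1) * (gam (inv y \<otimes> x) * f y) - (if y = x then of_real \<kappa> * f y else 0))"
  proof (intro sum.cong refl)
   fix y assume "y \<in> S"
   then have y: "y \<in> carrier G" using S by auto
   then have "inv y \<otimes> x = \<one> \<longleftrightarrow> y = x" using x by (metis inv_equality inv_inv inv_closed l_inv)
   then show "f y * adj gam (inv y \<otimes> x) = of_real (q + 1) * (gam (inv y \<otimes> x) * f y) - (if y = x then of_real \<kappa> * f y else 0)"
    using x y by (simp add: adj_gam right_diff_distrib)
  qed
  also have "\<dots> = of_real (q + 1) * g x - of_real \<kappa> * f' x"
   using S by (simp add: sum_subtractf g_def sum_distrib_left f'_def sum.delta)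
  finally show ?thesis by simp
 qed
 have "(q + 1) * lpn r (carrier G) g = lpn r (carrier G) (%x. of_real (q + 1) * g x)"
  using lp_scale(2)[OF r1, of "carrier G" "of_real (q + 1)" g] q3 by (simp add: norm_of_real del: of_real_add)
 also have "\<dots> = lpn r (carrier G) (%x. adj g x + of_real \<kappa> * f' x)"
  by (intro lp_norm_cong) (simp only: eq)
 also have "\<dots> <= lpn r (carrier G) (adj g) + lpn r (carrier G) (%x. of_real \<kappa> * f' x)"
  by (intro lp_triangle(2)[OF r1] adj_le(2) gs lp_scale(1)[OF r1] f')
 also have "\<dots> <= \<mu> * lpn r (carrier G) g + \<kappa> * lpn r S f"
  using adj_le(1)[OF gs] kappa_pos by (simp add: lp_scale(2)[OF r1] f')
 finally have "(q + 1 - \<mu>) * lpn r (carrier G) g <= \<kappa> * lpn r S f" by (simp add: algebra_simps)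
 then show "lpn r (carrier G) g <= Cg * lpn r S f"
  using mu_less by (simp add: Cg_def field_simps)
qed

definition grn :: "('a => complex) => 'a => complex" where
 "grn f x = (\<Sum>\<^sub>\<infinity>y\<in>carrier G. gam (inv y \<otimes> x) * f y)"

text \<open>\<open>gam\<close> is positive, so the partial sums of absolute values are values of the
  finite convolution of \<open>gam\<close> with |f|.\<close>

lemma grn_summable:
 assumes f: "lps r (carrier G) f" and x: "x \<in> carrier G"
 shows "(%y. gam (inv y \<otimes> x) * f y) summable_on carrier G"
proof (rule abs_summable_summable, rule nonneg_bdd_above_summable_on)
 show "bdd_above (sum (%y. cmod (gam (inv y \<otimes> x) * f y)) ` {F. F \<subseteq> carrier G & finite F})"
 proof (rule bdd_aboveI2)
  fix S assume "S \<in> {F. F \<subseteq> carrier G & finite F}"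
  then have S: "finite S" "S \<subseteq> carrier G" by auto
  let ?g = "%x. \<Sum>y\<in>S. gam (inv y \<otimes> x) * of_real (cmod (f y))"
  have "(\<Sum>y\<in>S. cmod (gam (inv y \<otimes> x) * f y)) = cmod (?g x)"
  proof -
   have "?g x = of_real (\<Sum>y\<in>S. cmod (gam (inv y \<otimes> x) * f y))"
    using q3 by (simp add: norm_mult gam_def norm_power norm_divide)
   then show ?thesis by (simp only: norm_of_real) (simp add: sum_nonneg)
  qed
  also have "\<dots> <= lpn r (carrier G) ?g"
   by (rule lp_norm_point[OF r1 grn_finite(1)[OF S] x])
  also have "\<dots> <= Cg * lpn r S (%y. of_real (cmod (f y)))" by (rule grn_finite(2)[OF S])
  also have "lpn r S (%y. of_real (cmod (f y))) = lpn r S f" by (intro lp_norm_cong) simp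
  also have "Cg * \<dots> <= Cg * lpn r (carrier G) f"
   by (intro mult_left_mono lp_norm_mono_set[OF r1 f S(2)] Cg_nonneg)
  finally show "(\<Sum>y\<in>S. cmod (gam (inv y \<otimes> x) * f y)) <= Cg * lpn r (carrier G) f" .
 qed
qed simp

text \<open>A Fatou argument: on finitely many points the bound of \<open>grn_finite\<close> passes
  to the limit over the finite subsets of the domain.\<close>

lemma grn_bound:
 assumes f: "lps r (carrier G) f"
 shows "lps r (carrier G) (grn f)"
  "lpn r (carrier G) (grn f) <= Cg * lpn r (carrier G) f"
proof -
 have C: "0 <= Cg * lpn r (carrier G) f" using Cg_nonneg by simp
 have "lpn r K (grn f) <= Cg * lpn r (carrier G) f" if K: "finite K" "K \<subseteq> carrier G" for K
 proof -
  let ?F = "finite_subsets_at_top (carrier G)"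
  have lim: "((%S. \<Sum>y\<in>S. gam (inv y \<otimes> x) * f y) \<longlongrightarrow> grn f x) ?F" if "x \<in> K" for x
   using has_sum_infsum[OF grn_summable[OF f, of x]] that K by (auto simp: has_sum_def grn_def)
  have "((%S. \<Sum>x\<in>K. cmod (\<Sum>y\<in>S. gam (inv y \<otimes> x) * f y) powr r) \<longlongrightarrow> (\<Sum>x\<in>K. cmod (grn f x) powr r)) ?F"
   using r by (intro tendsto_sum tendsto_powr2 tendsto_norm lim tendsto_const) auto
  moreover have "\<forall>\<^sub>F S in ?F. (\<Sum>x\<in>K. cmod (\<Sum>y\<in>S. gam (inv y \<otimes> x) * f y) powr r) <= (Cg * lpn r (carrier G) f) powr r"
  proof (rule eventually_finite_subsets_at_top_weakI)
   fix S assume S: "finite S" "S \<subseteq> carrier G"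
   have "lpn r K (%x. \<Sum>y\<in>S. gam (inv y \<otimes> x) * f y) <= Cg * lpn r S f"
    using lp_norm_mono_set[OF r1 grn_finite(1)[OF S, of f] K(2)] grn_finite(2)[OF S, of f] by linarith
   also have "\<dots> <= Cg * lpn r (carrier G) f"
    by (intro mult_left_mono lp_norm_mono_set[OF r1 f S(2)] Cg_nonneg)
   finally show "(\<Sum>x\<in>K. cmod (\<Sum>y\<in>S. gam (inv y \<otimes> x) * f y) powr r) <= (Cg * lpn r (carrier G) f) powr r"
    using K C by (simp add: lp_norm_le_iff_powr[OF r1])
  qed
  ultimately have "(\<Sum>x\<in>K. cmod (grn f x) powr r) <= (Cg * lpn r (carrier G) f) powr r"
   by (rule tendsto_upperbound) simp
  then show ?thesis using K C by (simp add: lp_norm_le_iff_powr[OF r1])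
 qed
 from lp_finite_bound[OF r1 C this] show "lps r (carrier G) (grn f)"
  "lpn r (carrier G) (grn f) <= Cg * lpn r (carrier G) f" by auto
qed

lemma grn_add:
 assumes "lps r (carrier G) f" "lps r (carrier G) g" "x \<in> carrier G"
 shows "grn (%x. f x + g x) x = grn f x + grn g x"
 unfolding grn_def distrib_left by (intro infsum_add grn_summable assms)

lemma grn_scale: "grn (%x. c * f x) x = c * grn f x"
 unfolding grn_def by (simp add: mult.left_commute infsum_cmult_right')

lemma grn_cong: "(!!x. x \<in> carrier G ==> f x = g x) ==> grn f x = grn g x"
 unfolding grn_def by (intro infsum_cong) simp

lemma adj_grn:
 assumes f: "lps r (carrier G) f" and x: "x \<in> carrier G"
 shows "adj (grn f) x = of_real (q + 1) * grn f x - of_real \<kappa> * f x"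
proof -
 have s: "(%y. gam (inv y \<otimes> (x \<otimes> lt l)) * f y) summable_on carrier G" if "l \<in> letters" for l
  using that x by (intro grn_summable f) auto
 have "adj (grn f) x = (\<Sum>\<^sub>\<infinity>y\<in>carrier G. \<Sum>l\<in>letters. gam (inv y \<otimes> (x \<otimes> lt l)) * f y)"
  unfolding adj_def grn_def using s by (simp add: infsum_finite_sum(2))
 also have "\<dots> = (\<Sum>\<^sub>\<infinity>y\<in>carrier G. of_real (q + 1) * (gam (inv y \<otimes> x) * f y) + (if y = x then - of_real \<kappa> * f x else 0))"
 proof (rule infsum_cong)
  fix y assume y: "y \<in> carrier G"
  have "(\<Sum>l\<in>letters. gam (inv y \<otimes> (x \<otimes> lt l)) * f y) = adj gam (inv y \<otimes> x) * f y"
   using x y by (simp add: adj_def m_assoc sum_distrib_right)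
  moreover have "inv y \<otimes> x = \<one> \<longleftrightarrow> y = x" using x y by (metis inv_equality inv_inv inv_closed l_inv)
  ultimately show "(\<Sum>l\<in>letters. gam (inv y \<otimes> (x \<otimes> lt l)) * f y) =
   of_real (q + 1) * (gam (inv y \<otimes> x) * f y) + (if y = x then - of_real \<kappa> * f x else 0)"
   using x y by (simp add: adj_gam left_diff_distrib)
 qed
 also have "\<dots> = (\<Sum>\<^sub>\<infinity>y\<in>carrier G. of_real (q + 1) * (gam (inv y \<otimes> x) * f y)) + (\<Sum>\<^sub>\<infinity>y\<in>carrier G. if y = x then - of_real \<kappa> * f x else 0)"
 proof (rule infsum_add)
  show "(%y. of_real (q + 1) * (gam (inv y \<otimes> x) * f y)) summable_on carrier G"
   by (intro summable_on_cmult_right grn_summable f x)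
  have "(%y. if y = x then - of_real \<kappa> * f x else 0) summable_on {x}" by simp
  then show "(%y. if y = x then - of_real \<kappa> * f x else 0) summable_on carrier G"
   by (rule summable_on_cong_neutral[THEN iffD1, rotated -1]) (use x in auto)
 qed
 also have "(\<Sum>\<^sub>\<infinity>y\<in>carrier G. if y = x then - of_real \<kappa> * f x else 0) = (\<Sum>\<^sub>\<infinity>y\<in>{x}. - of_real \<kappa> * f x)"
  by (intro infsum_cong_neutral) (use x in auto)
 finally show ?thesis by (simp add: grn_def[of f x] infsum_cmult_right')
qed

text \<open>The two sides differ by a g in lr with adj g = (q + 1) g, and \<mu> < q + 1 leaves only
  g = 0. With \<open>adj_grn\<close> this makes \<open>grn\<close> a two-sided inverse of the
  Laplacian, up to \<kappa>.\<close>

lemma grn_laplace: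
 assumes f: "lps r (carrier G) f" and x: "x \<in> carrier G"
 shows "grn (%x. adj f x - of_real (q + 1) * f x) x = - of_real \<kappa> * f x"
proof -
 define h where "h = (%x. adj f x - of_real (q + 1) * f x)"
 have hs: "lps r (carrier G) h" unfolding h_def
  by (intro lp_minus(1)[OF r1] adj_le(2) f lp_scale(1)[OF r1])
 define g where "g = (%x. grn h x + of_real \<kappa> * f x)"
 have gs: "lps r (carrier G) g" unfolding g_def
  by (intro lp_triangle(1)[OF r1] grn_bound(1) hs f lp_scale(1)[OF r1])
 have "adj g x = of_real (q + 1) * g x" if x: "x \<in> carrier G" for x
 proof -
  have "adj g x = adj (grn h) x + of_real \<kappa> * adj f x"
   by (simp add: adj_def g_def sum.distrib sum_distrib_left)
  then show ?thesis unfolding adj_grn[OF hs x] by (simp add: g_def h_def algebra_simps)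
 qed
 then have "lpn r (carrier G) (adj g) = lpn r (carrier G) (%x. of_real (q + 1) * g x)"
  by (intro lp_norm_cong) simp
 also have "\<dots> = (q + 1) * lpn r (carrier G) g"
  using lp_scale(2)[OF r1, of "carrier G" "of_real (q + 1)" g] q3 by (simp add: norm_of_real del: of_real_add)
 finally have "(q + 1 - \<mu>) * lpn r (carrier G) g <= 0"
  using adj_le(1)[OF gs] by (simp add: algebra_simps)
 then have "lpn r (carrier G) g = 0"
  using mu_less lp_norm_nonneg[of r "carrier G" g] by (smt (verit) mult_pos_pos)
 then have "g x = 0" using lp_norm_eq_0[of "ereal r" "carrier G" g x] gs x r1 by simp
 then show ?thesis by (simp add: g_def h_def add_eq_0_iff)
qed

lemma grn_translate:
 assumes g: "g \<in> carrier G" and x: "x \<in> carrier G"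
 shows "grn (%x. if x \<in> carrier G then f (inv g \<otimes> x) else 0) x = grn f (inv g \<otimes> x)"
proof -
 have "grn f (inv g \<otimes> x) = (\<Sum>\<^sub>\<infinity>y\<in>carrier G. gam (inv (inv g \<otimes> y) \<otimes> (inv g \<otimes> x)) * f (inv g \<otimes> y))"
  unfolding grn_def by (rule infsum_reindex_bij_betw[OF translate_bij[of "inv g"], symmetric]) (use g in simp)
 also have "\<dots> = grn (%x. if x \<in> carrier G then f (inv g \<otimes> x) else 0) x"
  unfolding grn_def
 proof (rule infsum_cong)
  fix y assume y: "y \<in> carrier G"
  have "inv (inv g \<otimes> y) \<otimes> (inv g \<otimes> x) = inv y \<otimes> (g \<otimes> (inv g \<otimes> x))"
   using g x y by (simp add: inv_mult_group m_assoc)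
  also have "g \<otimes> (inv g \<otimes> x) = x" using g x by (simp add: m_assoc[symmetric])
  finally show "gam (inv (inv g \<otimes> y) \<otimes> (inv g \<otimes> x)) * f (inv g \<otimes> y) = gam (inv y \<otimes> x) * (if y \<in> carrier G then f (inv g \<otimes> y) else 0)"
   using y by simp
 qed
 finally show ?thesis ..
qed

text \<open>The projection onto the cycles along the coboundaries.\<close>

definition prj :: "('a \<times> nat => complex) => 'a \<times> nat => complex" where
 "prj h e = (if e \<in> edges then h e + of_real (1 / \<kappa>) * dl (grn (bd h)) e else 0)"

text \<open>The identity plus 1 / \<kappa> times the product of the bounds for \<open>dl\<close>,
  \<open>grn\<close> and \<open>bd\<close>.\<close>

definition Cp :: real where "Cp = 1 + 1 / \<kappa> * (2 * real n * (Cg * (2 * real n)))"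

lemma Cp_pos: "0 < Cp" unfolding Cp_def using Cg_nonneg kappa_pos
 by (intro add_pos_nonneg mult_nonneg_nonneg) auto

lemma prj_bound:
 assumes h: "lps r edges h"
 shows "lps r edges (prj h)" "lpn r edges (prj h) <= Cp * lpn r edges h"
proof -
 note b = bd_bound[OF r1 h]
 note g = grn_bound[OF b(1)]
 note d = dl_bound[OF r1 g(1)]
 have t: "lps r edges (%e. h e + of_real (1 / \<kappa>) * dl (grn (bd h)) e)"
  "lpn r edges (%e. h e + of_real (1 / \<kappa>) * dl (grn (bd h)) e) <= lpn r edges h + lpn r edges (%e. of_real (1 / \<kappa>) * dl (grn (bd h)) e)"
  by (intro lp_triangle[OF r1 h] lp_scale(1)[OF r1] d)+
 have "lpn r edges (%e. of_real (1 / \<kappa>) * dl (grn (bd h)) e) = 1 / \<kappa> * lpn r edges (dl (grn (bd h)))"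
  using kappa_pos lp_scale(2)[OF r1, of edges "of_real (1 / \<kappa>)" "dl (grn (bd h))"] by (simp only: norm_of_real) simp
 also have "\<dots> <= 1 / \<kappa> * (2 * real n * (Cg * (2 * real n * lpn r edges h)))"
  using d(2) g(2) b(2) kappa_pos Cg_nonneg
  by (intro mult_left_mono order_trans[OF d(2)] order_trans[OF g(2)]) auto
 finally have "lpn r edges (%e. h e + of_real (1 / \<kappa>) * dl (grn (bd h)) e) <= Cp * lpn r edges h"
  using t(2) by (simp add: Cp_def algebra_simps)
 moreover have "lpn r edges (prj h) = lpn r edges (%e. h e + of_real (1 / \<kappa>) * dl (grn (bd h)) e)"
  by (rule lp_norm_cong) (simp add: prj_def)
 moreover have "lps r edges (prj h) = lps r edges (%e. h e + of_real (1 / \<kappa>) * dl (grn (bd h)) e)"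
  by (rule lp_summable_cong) (simp add: prj_def)
 ultimately show "lps r edges (prj h)" "lpn r edges (prj h) <= Cp * lpn r edges h"
  using t(1) by auto
qed

lemma bd_add: "bd (%e. f e + g e) x = bd f x + bd g x"
 by (simp add: bd_def sum.distrib)

lemma bd_scale: "bd (%e. c * f e) x = c * bd f x"
 by (simp add: bd_def sum_distrib_left right_diff_distrib)

lemma bd_cong: "(!!e. e \<in> edges ==> f e = g e) ==> bd f x = bd g x"
 by (auto simp: bd_def intro!: sum.cong arg_cong2[of _ _ _ _ "(-)"])

text \<open>The composition of \<open>bd\<close> and \<open>dl\<close> is \<open>adj\<close> minus q
  + 1. It maps \<open>grn (bd h)\<close> to -\<kappa> times \<open>bd h\<close>, which after
  division by \<kappa> cancels \<open>bd h\<close>.\<close>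

lemma bd_prj:
 assumes h: "lps r edges h"
 shows "bd (prj h) x = 0"
proof (cases "x \<in> carrier G")
 case True
 note b = bd_bound(1)[OF r1 h]
 have "bd (prj h) x = bd (%e. h e + of_real (1 / \<kappa>) * dl (grn (bd h)) e) x"
  by (rule bd_cong) (simp add: prj_def)
 also have "\<dots> = bd h x + of_real (1 / \<kappa>) * (adj (grn (bd h)) x - 2 * of_nat n * grn (bd h) x)"
  by (simp only: bd_add bd_scale bd_dl[OF True])
 also have "\<dots> = 0" unfolding adj_grn[OF b True] using kappa_pos by (simp add: q_def)
 finally show ?thesis .
qed (simp add: bd_def)

lemma prj_cycle:
 assumes "!!x. x \<in> carrier G ==> bd h x = 0" "e \<in> edges"
 shows "prj h e = h e"
proof -
 have "grn (bd h) x = 0" for x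
  unfolding grn_def using assms(1) by (intro infsum_0) simp
 then show ?thesis using assms(2) by (auto simp: prj_def dl_def)
qed

text \<open>By \<open>grn_laplace\<close> the correction term equals minus the coboundary itself.
  This is what lets \<open>prj\<close> descend to cohomology.\<close>

lemma prj_dl:
 assumes f: "lps r (carrier G) f"
 shows "prj (dl f) e = 0"
proof (cases "e \<in> edges")
 case True
 then obtain x j where e: "e = (x, j)" "x \<in> carrier G" "j \<in> {1..n}" by auto
 have "grn (bd (dl f)) y = - of_real \<kappa> * f y" if y: "y \<in> carrier G" for y
 proof -
  have "grn (bd (dl f)) y = grn (%x. adj f x - of_real (q + 1) * f x) y"
   by (rule grn_cong) (simp add: bd_dl q_def)
  then show ?thesis using grn_laplace[OF f y] by simp
 qed
 then show ?thesis using e kappa_pos by (simp add: prj_def dl_def right_diff_distrib)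
qed (simp add: prj_def)

lemma prj_add:
 assumes "lps r edges f" "lps r edges g"
 shows "prj (%e. f e + g e) = (%e. prj f e + prj g e)"
proof
 fix e
 have "grn (bd (%e. f e + g e)) x = grn (bd f) x + grn (bd g) x" if "x \<in> carrier G" for x
  using grn_add[OF bd_bound(1)[OF r1 assms(1)] bd_bound(1)[OF r1 assms(2)] that]
  by (simp only: bd_add[abs_def])
 then show "prj (%e. f e + g e) e = prj f e + prj g e"
  by (auto simp: prj_def dl_def algebra_simps add_divide_distrib diff_divide_distrib)
qed

lemma prj_scale: "prj (%e. c * f e) = (%e. c * prj f e)"
proof
 fix e
 have "grn (bd (%e. c * f e)) x = c * grn (bd f) x" for x
  using grn_scale[of c "bd f" x] by (simp only: bd_scale[abs_def])
 then show "prj (%e. c * f e) e = c * prj f e"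
  by (auto simp: prj_def dl_def algebra_simps)
qed

lemma prj_shift:
 assumes g: "g \<in> carrier G"
 shows "prj (shift g h) = shift g (prj h)"
proof
 fix e :: "'a \<times> nat"
 obtain x j where e: "e = (x, j)" by (cases e)
 have "bd (shift g h) = (%x. if x \<in> carrier G then bd h (inv g \<otimes> x) else 0)"
  using bd_shift[OF g] by blast
 then have "grn (bd (shift g h)) x = grn (bd h) (inv g \<otimes> x)" if "x \<in> carrier G" for x
  using grn_translate[OF g that] by simp
 then show "prj (shift g h) e = shift g (prj h) e"
  using g by (auto simp: e prj_def dl_def shift_def m_assoc)
qed

lemma edge_summable: "lps r edges (edge k)"
proof -
 have "((%y. cmod (edge k y) powr r) summable_on edges) = ((%y. cmod (edge k y) powr r) summable_on (edges \<inter> {(\<one>, k)}))"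
  using r by (intro summable_on_cong_neutral) (auto simp: edge_def split: if_splits)
 then show ?thesis by (simp add: lp_summable_ereal)
qed

end

context green begin

text \<open>The boundary of the edge (\<one>, k) is the point mass at \<one> minus the point mass at
  a k, and \<open>grn\<close> turns point masses into translates of \<open>gam\<close>.\<close>

lemma grn_bd_edge:
 assumes k: "k \<in> {1..n}" and x: "x \<in> carrier G"
 shows "grn (bd (edge k)) x = gam x - gam (inv (a k) \<otimes> x)"
proof -
 have ak: "a k \<in> carrier G" "a k ~= \<one>"
  using k free_generators_distinct(1)[OF free k k] by auto
 have "bd (edge k) y = (if y = \<one> then 1 else 0) - (if y = a k then 1 else 0)" if y: "y \<in> carrier G" for y
 proof -
  have "(\<Sum>j=1..n. edge k (y, j)) = (if y = \<one> then 1 else 0)"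
   using k by (cases "y = \<one>") (auto simp: edge_def sum.delta)
  moreover have "(\<Sum>j=1..n. edge k (y \<otimes> inv (a j), j)) = (if y = a k then 1 else 0)"
  proof -
   have "(\<Sum>j=1..n. edge k (y \<otimes> inv (a j), j)) = (\<Sum>j=1..n. if j = k then (if y = a k then 1 else 0) else 0)"
   proof (intro sum.cong refl)
    fix j assume "j \<in> {1..n}"
    have "y \<otimes> inv (a k) = \<one> \<longleftrightarrow> y = a k" using right_cancel[of "inv (a k)" y "a k"] y ak by (simp del: right_cancel)
    then show "edge k (y \<otimes> inv (a j), j) = (if j = k then (if y = a k then 1 else 0) else 0)" by (auto simp: edge_def)
   qed
   then show ?thesis using k by (simp add: sum.delta)
  qed
  ultimately show ?thesis using y by (simp add: bd_def)
 qed
 then have "grn (bd (edge k)) x = (\<Sum>\<^sub>\<infinity>y\<in>{\<one>, a k}. gam (inv y \<otimes> x) * ((if y = \<one> then 1 else 0) - (if y = a k then 1 else 0)))"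
  unfolding grn_def using ak by (intro infsum_cong_neutral) auto
 also have "\<dots> = gam x - gam (inv (a k) \<otimes> x)" using ak x by simp
 finally show ?thesis .
qed

text \<open>The value is 1 - 2 / (q + 1) = 1 - 1 / n. Over the n edges leaving a vertex the diagonal
  sums to n - 1.\<close>

lemma prj_edge_diag:
 assumes k: "k \<in> {1..n}"
 shows "prj (edge k) (\<one>, k) = of_real ((real n - 1) / real n)"
proof -
 have l: "(k, True) \<in> letters" "(k, False) \<in> letters" using k by (auto simp: letters_def)
 have ak: "a k \<in> carrier G" using k by simp
 have "len (a k) = 1" "len (inv (a k)) = 1"
  using len_not_up[of \<one> "(k, True)"] len_not_up[of \<one> "(k, False)"] l ak by (simp_all add: lt_def)
 then have "dl (grn (bd (edge k))) (\<one>, k) = of_real (2 * (1 / q - 1))"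
  using k ak by (simp add: dl_def grn_bd_edge gam_def)
 then have "prj (edge k) (\<one>, k) = of_real (1 + 1 / \<kappa> * (2 * (1 / q - 1)))"
  using k by (simp add: prj_def edge_def)
 also have "1 + 1 / \<kappa> * (2 * (1 / q - 1)) = (real n - 1) / real n"
 proof -
  have "1 / \<kappa> * (2 * (1 / q - 1)) = - 2 / (q + 1)"
   using q3 by (simp add: \<kappa>_def divide_simps)
  then show ?thesis using n2 by (simp add: q_def field_simps)
 qed
 finally show ?thesis .
qed

text \<open>Put w = prj (edge k). As a cycle, w is orthogonal to the coboundary w - edge k, so its
  squared norm is its pairing with edge k, that is, the diagonal entry. In this sense
  \<open>prj\<close> is an orthogonal projection.\<close>

lemma prj_edge_norm:
 assumes k: "k \<in> {1..n}"
 shows "(%e. (cmod (prj (edge k) e))\<^sup>2) summable_on edges"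
  "(\<Sum>\<^sub>\<infinity>e\<in>edges. (cmod (prj (edge k) e))\<^sup>2) = (real n - 1) / real n"
proof -
 define w where "w = prj (edge k)"
 define u where "u = grn (bd (edge k))"
 have ws: "lps r edges w" unfolding w_def by (rule prj_bound(1)[OF edge_summable])
 have us: "lps r (carrier G) u" unfolding u_def
  by (rule grn_bound(1)[OF bd_bound(1)[OF r1 edge_summable]])
 note w2 = l2_le_lp(1)[OF r1 r(2) ws]
 show "(%e. (cmod (prj (edge k) e))\<^sup>2) summable_on edges" using w2 by (simp add: w_def)
 have ps: "(%e. w e * v e) summable_on edges" if v: "lps r edges v" for v
 proof (rule abs_summable_summable, rule summable_on_comparison_test)
  show "(%e. (cmod (w e))\<^sup>2 + (cmod (v e))\<^sup>2) summable_on edges"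
   by (rule summable_on_add[OF w2 l2_le_lp(1)[OF r1 r(2) v]])
  show "norm (w e * v e) <= (cmod (w e))\<^sup>2 + (cmod (v e))\<^sup>2" for e
  proof -
   have "2 * (cmod (w e) * cmod (v e)) <= (cmod (w e))\<^sup>2 + (cmod (v e))\<^sup>2"
    using sum_squares_bound[of "cmod (w e)" "cmod (v e)"] by (simp add: mult.assoc)
   moreover have "0 <= cmod (w e) * cmod (v e)" by simp
   ultimately show ?thesis unfolding norm_mult by linarith
  qed
 qed auto
 have u1: "lps r edges (%(x, j). u x)"
  unfolding lp_slices(1)[OF r1 finite_atLeastAtMost] using us by simp
 have u2: "lps r edges (%(x, j). u (x \<otimes> a j))"
  unfolding lp_slices(1)[OF r1 finite_atLeastAtMost]
 proof
  fix j assume "j \<in> {1..n}"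
  then show "lps r (carrier G) (%x. case (x, j) of (x, j) => u (x \<otimes> a j))"
   using lp_reindex(1)[OF right_bij[OF a_closed], of j r u] us by simp
 qed
 have parts: "(\<Sum>\<^sub>\<infinity>e\<in>edges. w e * dl u e) = - (\<Sum>\<^sub>\<infinity>x\<in>carrier G. bd w x * u x)"
 proof (rule summation_by_parts)
  show "(%(x, j). w (x, j) * u x) summable_on edges" using ps[OF u1] by (simp add: case_prod_unfold)
  show "(%(x, j). w (x, j) * u (x \<otimes> a j)) summable_on edges" using ps[OF u2] by (simp add: case_prod_unfold)
 qed
 have "(\<Sum>\<^sub>\<infinity>x\<in>carrier G. bd w x * u x) = 0"
  unfolding w_def using bd_prj[OF edge_summable] by (intro infsum_0) simp
 then have z: "(\<Sum>\<^sub>\<infinity>e\<in>edges. w e * dl u e) = 0" using parts by simp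
 \<comment> \<open>For real values the bilinear summation by parts computes the inner
   product.\<close>
 have real: "w e = of_real (Re (w e))" if eE: "e \<in> edges" for e
 proof -
  obtain x j where e: "e = (x, j)" "x \<in> carrier G" "j \<in> {1..n}" using eE by auto
  have "u y \<in> \<real>" if "y \<in> carrier G" for y unfolding u_def grn_bd_edge[OF k that] by (simp add: gam_def)
  then have "w e \<in> \<real>" using e unfolding w_def prj_def u_def[symmetric]
   by (auto simp: dl_def edge_def intro!: Reals_add Reals_mult Reals_diff)
  then show ?thesis by (simp add: of_real_Re)
 qed
 have "complex_of_real (\<Sum>\<^sub>\<infinity>e\<in>edges. (cmod (w e))\<^sup>2) = (\<Sum>\<^sub>\<infinity>e\<in>edges. of_real ((cmod (w e))\<^sup>2))"
  by (rule infsumI[OF has_sum_of_real[OF has_sum_infsum[OF w2]], symmetric])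
 also have "\<dots> = (\<Sum>\<^sub>\<infinity>e\<in>edges. w e * edge k e + of_real (1 / \<kappa>) * (w e * dl u e))"
 proof (rule infsum_cong)
  fix e assume e: "e \<in> edges"
  have "of_real ((cmod (w e))\<^sup>2) = w e * w e"
   using real[OF e] by (metis complex_norm_square complex_cnj_complex_of_real)
  also have "\<dots> = w e * (edge k e + of_real (1 / \<kappa>) * dl u e)"
   using e by (simp add: w_def u_def prj_def)
  finally show "of_real ((cmod (w e))\<^sup>2) = w e * edge k e + of_real (1 / \<kappa>) * (w e * dl u e)"
   by (simp only: distrib_left mult.left_commute)
 qed
 also have "\<dots> = (\<Sum>\<^sub>\<infinity>e\<in>edges. w e * edge k e) + (\<Sum>\<^sub>\<infinity>e\<in>edges. of_real (1 / \<kappa>) * (w e * dl u e))"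
  by (intro infsum_add ps edge_summable summable_on_cmult_right dl_bound(1)[OF r1 us])
 also have "(\<Sum>\<^sub>\<infinity>e\<in>edges. of_real (1 / \<kappa>) * (w e * dl u e)) = 0" using z by (simp only: infsum_cmult_right' mult_zero_right)
 also have "(\<Sum>\<^sub>\<infinity>e\<in>edges. w e * edge k e) = (\<Sum>\<^sub>\<infinity>e\<in>{(\<one>, k)}. w e)"
  by (intro infsum_cong_neutral) (use k in \<open>auto simp: edge_def split: if_splits\<close>)
 also have "\<dots> = of_real ((real n - 1) / real n)" using prj_edge_diag[OF k] by (simp add: w_def)
 finally have "complex_of_real (\<Sum>\<^sub>\<infinity>e\<in>edges. (cmod (w e))\<^sup>2) = of_real ((real n - 1) / real n)" by (simp only: add_0_right)
 then show "(\<Sum>\<^sub>\<infinity>e\<in>edges. (cmod (prj (edge k) e))\<^sup>2) = (real n - 1) / real n"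
  unfolding w_def of_real_eq_iff .
qed

end

section \<open>Formal combinations and normed representations\<close>

abbreviation (input) cs :: "complex => ('x => complex) => 'x => complex" where
 "cs c f \<equiv> (%x. c * f x)"

type_synonym 'g comb = "(complex \<times> 'g \<times> nat) list"

text \<open>A triple (c, g, l) stands for c times the translate by g of the l-th generator. Since
  the list is formal, it can be evaluated both with the group action on the space and with
  permutations of {1..d}.\<close>

definition lcomb :: "(complex \<times> 'g \<times> nat => 'x => complex) => 'g comb => 'x => complex" where
 "lcomb \<alpha> P x = (\<Sum>p\<leftarrow>P. fst p * \<alpha> p x)"

text \<open>The factor by which an error common to the single terms grows in the
  combination.\<close>

definition weight :: "'g comb => real" where "weight P = (\<Sum>p\<leftarrow>P. cmod (fst p))"

lemma lcomb_Nil [simp]: "lcomb \<alpha> [] = 0" by (simp add: lcomb_def fun_eq_iff)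
lemma lcomb_Cons: "lcomb \<alpha> (p # P) = cs (fst p) (\<alpha> p) + lcomb \<alpha> P" by (simp add: lcomb_def fun_eq_iff)
lemma weight_Nil [simp]: "weight [] = 0" by (simp add: weight_def)
lemma weight_Cons [simp]: "weight (p # P) = cmod (fst p) + weight P" by (simp add: weight_def)
lemma weight_nonneg [simp]: "0 <= weight P" by (induction P) auto

lemma lcomb_diff: "lcomb \<alpha> P - lcomb \<beta> P = lcomb (%p. \<alpha> p - \<beta> p) P"
 by (induction P) (auto simp: lcomb_Cons fun_eq_iff algebra_simps)

lemma lcomb_add: "lcomb (%p. \<alpha> p + \<beta> p) P = lcomb \<alpha> P + lcomb \<beta> P"
 by (induction P) (auto simp: lcomb_Cons fun_eq_iff algebra_simps)

lemma lcomb_scale: "lcomb (%p. cs c (\<alpha> p)) P = cs c (lcomb \<alpha> P)"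
 by (induction P) (auto simp: lcomb_Cons fun_eq_iff algebra_simps)

lemma lcomb_cong: "(!!p. p \<in> set P ==> \<alpha> p = \<beta> p) ==> lcomb \<alpha> P = lcomb \<beta> P"
 by (induction P) (auto simp: lcomb_Cons)

lemma lcomb_seminorm:
 assumes "!!f g. \<nu> (f + g) <= \<nu> f + \<nu> g" "!!c f. \<nu> (cs c f) = cmod c * \<nu> f"
  "!!p. p \<in> set P ==> \<nu> (\<alpha> p) <= \<theta>"
 shows "\<nu> (lcomb \<alpha> P) <= weight P * (\<theta> :: real)"
 using assms(3)
proof (induction P)
 case Nil
 show ?case using assms(2)[of 0 0] by (simp add: zero_fun_def)
next
 case (Cons p P)
 have "\<nu> (lcomb \<alpha> (p # P)) <= cmod (fst p) * \<nu> (\<alpha> p) + \<nu> (lcomb \<alpha> P)"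
  using assms(1)[of "cs (fst p) (\<alpha> p)" "lcomb \<alpha> P"] by (simp add: lcomb_Cons assms(2))
 also have "\<dots> <= cmod (fst p) * \<theta> + weight P * \<theta>"
  using Cons by (intro add_mono mult_left_mono) auto
 finally show ?case by (simp add: distrib_right)
qed

lemma perm_act_add: "perm_act s (u + v) = perm_act s u + perm_act s v" by (auto simp: perm_act_def)
lemma perm_act_diff: "perm_act s (u - v) = perm_act s u - perm_act s v" by (auto simp: perm_act_def)
lemma perm_act_scale: "perm_act s (cs c v) = cs c (perm_act s v)" by (auto simp: perm_act_def)

lemma perm_act_lcomb: "perm_act s (lcomb \<beta> P) = lcomb (%p. perm_act s (\<beta> p)) P"
 by (simp add: perm_act_def lcomb_def fun_eq_iff)

lemma perm_act_norm:
 assumes "s permutes {1..d}"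
 shows "lpn r {1..d} (perm_act s v) = lpn r {1..d} v"
 unfolding perm_act_def by (rule lp_reindex(2)[OF permutes_imp_bij[OF permutes_inv[OF assms]]])

context
 fixes r :: real and d :: nat
 assumes r: "1 <= r"
begin

lemma fin_norm_add: "lpn r {1..d} (u + v) <= lpn r {1..d} u + lpn r {1..d} v"
 using lp_norm_finite_triangle[OF r, of "{1..d}" u v] by (simp add: plus_fun_def)

lemma fin_norm_scale: "lpn r {1..d} (cs c u) = cmod c * lpn r {1..d} u"
 by (rule lp_scale(2)[OF r])

lemma fin_norm_commute: "lpn r {1..d} (u - v) = lpn r {1..d} (v - u)"
 by (intro lp_norm_cong) (simp add: norm_minus_commute)

lemma fin_norm_diff: "lpn r {1..d} (u - w) <= lpn r {1..d} (u - v) + lpn r {1..d} (v - w)"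
 using fin_norm_add[of "u - v" "v - w"] by simp

lemma fin_norm_sum: "finite I ==> lpn r {1..d} (\<Sum>i\<in>I. u i) <= (\<Sum>i\<in>I. lpn r {1..d} (u i))"
proof (induction I rule: finite_induct)
 case empty
 show ?case by (simp add: zero_fun_def)
next
 case (insert i I)
 then show ?case using fin_norm_add[of "u i" "\<Sum>i\<in>I. u i"] unfolding sum.insert[OF insert.hyps] by linarith
qed

end

text \<open>Approximate equivariance passes from generators to linear combinations.\<close>

lemma lcomb_approx:
 fixes d :: nat
 assumes r: "1 <= r"
  and OZ: "0 \<in> OZ" "!!f g. f \<in> OZ ==> g \<in> OZ ==> f + g \<in> OZ" "!!c f. f \<in> OZ ==> cs c f \<in> OZ"
  and \<tau>: "!!f g. f \<in> OZ ==> g \<in> OZ ==> \<tau> (f + g) = \<tau> f + \<tau> g" "!!c f. f \<in> OZ ==> \<tau> (cs c f) = cs c (\<tau> f)"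
  and P: "!!p. p \<in> set P ==> \<alpha> p \<in> OZ" "!!p. p \<in> set P ==> lpn r {1..d} (\<tau> (\<alpha> p) - \<beta> p) <= \<theta>"
 shows "lcomb \<alpha> P \<in> OZ" "lpn r {1..d} (\<tau> (lcomb \<alpha> P) - lcomb \<beta> P) <= weight P * \<theta>"
proof -
 have "lcomb \<alpha> P \<in> OZ & \<tau> (lcomb \<alpha> P) = lcomb (%p. \<tau> (\<alpha> p)) P"
  using P(1)
 proof (induction P)
  case Nil
  have "\<tau> 0 = 0" using \<tau>(2)[OF OZ(1), of 0] by (simp add: zero_fun_def fun_eq_iff)
  then show ?case using OZ(1) unfolding lcomb_Nil by blast
 next
  case (Cons p P)
  then have p: "\<alpha> p \<in> OZ" "lcomb \<alpha> P \<in> OZ" "\<tau> (lcomb \<alpha> P) = lcomb (%p. \<tau> (\<alpha> p)) P" by auto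
  show ?case unfolding lcomb_Cons
   using OZ(2)[OF OZ(3)[OF p(1)] p(2)] \<tau>(1)[OF OZ(3)[OF p(1)] p(2)] \<tau>(2)[OF p(1)] p(3) by metis
 qed
 then have 1: "lcomb \<alpha> P \<in> OZ" "\<tau> (lcomb \<alpha> P) = lcomb (%p. \<tau> (\<alpha> p)) P" by blast+
 have "lpn r {1..d} (lcomb (%p. \<tau> (\<alpha> p) - \<beta> p) P) <= weight P * \<theta>"
  by (rule lcomb_seminorm) (rule fin_norm_add[OF r] fin_norm_scale[OF r] P(2); assumption?)+
 then show "lpn r {1..d} (\<tau> (lcomb \<alpha> P) - lcomb \<beta> P) <= weight P * \<theta>"
  unfolding 1(2) lcomb_diff .
 show "lcomb \<alpha> P \<in> OZ" by (rule 1(1))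
qed

text \<open>The space V is presented as the image under Q of a function space \<open>Z\<close> with
  a seminorm N that becomes the norm of V. All work is done on representatives in \<open>Z\<close>;
  Q may identify functions at N-distance 0. Both the cohomology and the homology space are
  instances.\<close>

locale normed_rep = group G for G (structure) +
 fixes V :: "'v cspace" and act :: "'a => 'v => 'v" and Z :: "('e => complex) set"
  and N :: "('e => complex) => real" and Q :: "('e => complex) => 'v"
  and A :: "'a => ('e => complex) => 'e => complex"
 assumes Z0: "0 \<in> Z" and Zadd: "f \<in> Z ==> f' \<in> Z ==> f + f' \<in> Z" and Zscale: "f \<in> Z ==> cs c f \<in> Z"
  and car: "vcarrier V = Q ` Z" and Q0: "vzero V = Q 0"
  and Qadd: "f \<in> Z ==> f' \<in> Z ==> vadd V (Q f) (Q f') = Q (f + f')"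
  and Qscale: "f \<in> Z ==> vscale V c (Q f) = Q (cs c f)"
  and QN: "f \<in> Z ==> vnorm V (Q f) = N f"
  and Nadd: "f \<in> Z ==> f' \<in> Z ==> N (f + f') <= N f + N f'"
  and Nscale: "f \<in> Z ==> N (cs c f) = cmod c * N f"
  and AZ: "g \<in> carrier G ==> f \<in> Z ==> A g f \<in> Z"
  and Aadd: "g \<in> carrier G ==> A g (f + f') = A g f + A g f'"
  and Ascale: "g \<in> carrier G ==> A g (cs c f) = cs c (A g f)"
  and AN: "g \<in> carrier G ==> f \<in> Z ==> N (A g f) = N f"
  and Qact: "g \<in> carrier G ==> f \<in> Z ==> act g (Q f) = Q (A g f)"
  and Amult: "g \<in> carrier G ==> h \<in> carrier G ==> f \<in> Z ==> A g (A h f) = A (g \<otimes> h) f"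
  and Aone: "f \<in> Z ==> A \<one> f = f"
begin

lemma Zminus: "f \<in> Z ==> g \<in> Z ==> f - g \<in> Z"
 using Zadd[of f "cs (-1) g"] Zscale[of g "-1"] by (simp add: plus_fun_def fun_diff_def)

lemma N0: "N 0 = 0" using Nscale[OF Z0, of 0] by (simp add: zero_fun_def)

lemma Nminus: "f \<in> Z ==> g \<in> Z ==> N (f - g) <= N f + N g"
 using Nadd[of f "cs (-1) g"] Zscale[of g "-1"] Nscale[of g "-1"] by (simp add: plus_fun_def fun_diff_def)

lemma Nneg: "f \<in> Z ==> g \<in> Z ==> N (f - g) = N (g - f)"
 using Nscale[of "g - f" "-1"] Zminus[of g f] by (simp add: fun_diff_def)

lemma Ntri: "f \<in> Z ==> g \<in> Z ==> h \<in> Z ==> N (f - h) <= N (f - g) + N (g - h)"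
 using Nadd[of "f - g" "g - h"] Zminus by simp

lemma Aminus: "g \<in> carrier G ==> A g (f - f') = A g f - A g f'"
 using Aadd[of g f "cs (-1) f'"] Ascale[of g "-1" f'] by (simp add: plus_fun_def fun_diff_def)

lemma Azero: "g \<in> carrier G ==> A g 0 = 0"
 using Ascale[of g 0 0] by (simp add: zero_fun_def fun_eq_iff)

lemma Zlcomb: "(!!p. p \<in> set P ==> \<alpha> p \<in> Z) ==> lcomb \<alpha> P \<in> Z"
 by (induction P) (auto simp: lcomb_Cons Z0 Zadd Zscale)

lemma Alcomb: "g \<in> carrier G ==> A g (lcomb \<alpha> P) = lcomb (%p. A g (\<alpha> p)) P"
 by (induction P) (auto simp: lcomb_Cons Aadd Ascale Azero)

lemma Nlcomb:
 assumes "!!p. p \<in> set P ==> \<alpha> p \<in> Z" "!!p. p \<in> set P ==> N (\<alpha> p) <= \<theta>"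
 shows "N (lcomb \<alpha> P) <= weight P * \<theta>"
 using assms
proof (induction P)
 case (Cons p P)
 have "N (lcomb \<alpha> (p # P)) <= cmod (fst p) * N (\<alpha> p) + N (lcomb \<alpha> P)"
  using Nadd[of "cs (fst p) (\<alpha> p)" "lcomb \<alpha> P"] Cons.prems Zlcomb[of P \<alpha>] by (simp add: lcomb_Cons Nscale Zscale)
 also have "\<dots> <= cmod (fst p) * \<theta> + weight P * \<theta>"
  using Cons by (intro add_mono mult_left_mono) auto
 finally show ?case by (simp add: distrib_right)
qed (simp add: N0)

lemma Zsum: "finite I ==> (!!i. i \<in> I ==> f i \<in> Z) ==> (\<Sum>i\<in>I. f i) \<in> Z"
 by (induction I rule: finite_induct) (auto simp: Z0 Zadd)

lemma Nsum: "finite I ==> (!!i. i \<in> I ==> f i \<in> Z) ==> N (\<Sum>i\<in>I. f i) <= (\<Sum>i\<in>I. N (f i))"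
proof (induction I rule: finite_induct)
 case (insert i I)
 then have "N (f i + (\<Sum>i\<in>I. f i)) <= N (f i) + N (\<Sum>i\<in>I. f i)" by (intro Nadd Zsum) auto
 moreover have "N (\<Sum>i\<in>I. f i) <= (\<Sum>i\<in>I. N (f i))" using insert by simp
 ultimately show ?case unfolding sum.insert[OF insert.hyps] by linarith
qed (simp add: N0)

lemma QN_minus: "f \<in> Z ==> g \<in> Z ==> vdist V (Q f) (Q g) = N (f - g)"
 using Zminus[of f g] Zscale[of g "-1"]
 by (simp add: vdist_def Qscale Qadd QN plus_fun_def fun_diff_def)

lemma Q_eq_N0: "f \<in> Z ==> g \<in> Z ==> Q f = Q g ==> N (f - g) = 0"
 using QN_minus[of f g] QN_minus[of g g] N0 by simp

lemma foldr_act: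
 "set gs \<subseteq> carrier G ==> f \<in> Z ==> foldr act gs (Q f) = Q (foldr A gs f) & foldr A gs f \<in> Z & N (foldr A gs f) = N f"
 by (induction gs) (auto simp: Qact AZ AN)

lemma vspan_carrier:
 assumes X: "X \<subseteq> vcarrier V" and u: "u \<in> vspan V X"
 shows "u \<in> Q ` Z"
 using u
proof (induction rule: vspan.induct)
 case zero
 then show ?case using Q0 Z0 by auto
next
 case (step x v c)
 then obtain f g where "f \<in> Z" "x = Q f" "g \<in> Z" "v = Q g" using car X by blast
 then show ?case using Zadd Zscale by (auto simp: Qscale Qadd)
qed

lemma vspan_add:
 assumes X: "X \<subseteq> vcarrier V" and u: "u \<in> vspan V X" and v: "v \<in> vspan V X"
 shows "vadd V u v \<in> vspan V X"
 using u
proof (induction rule: vspan.induct)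
 case zero
 obtain g where "g \<in> Z" "v = Q g" using vspan_carrier[OF X v] by auto
 then show ?case using v by (simp add: Q0 Qadd Z0)
next
 case (step x w c)
 obtain f g h where f: "f \<in> Z" "x = Q f" "g \<in> Z" "w = Q g" "h \<in> Z" "v = Q h"
  using vspan_carrier[OF X v] vspan_carrier[OF X step(2)] step(1) X car by auto
 have "vadd V (vadd V (vscale V c x) w) v = vadd V (vscale V c x) (vadd V w v)"
  using f by (simp add: Qscale Qadd Zadd Zscale add.assoc)
 then show ?case using vspan.step[OF step(1,3), of c] by simp
qed

lemma vspan_scale:
 assumes X: "X \<subseteq> vcarrier V" and u: "u \<in> vspan V X"
 shows "vscale V c u \<in> vspan V X"
 using u
proof (induction rule: vspan.induct)
 case zero
 have "vscale V c (vzero V) = vzero V" using Z0 by (simp add: Q0 Qscale) (simp add: zero_fun_def)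
 then show ?case using vspan.zero[of V X] by simp
next
 case (step x w c')
 obtain f g where f: "f \<in> Z" "x = Q f" "g \<in> Z" "w = Q g"
  using vspan_carrier[OF X step(2)] step(1) X car by auto
 have "cs c (cs c' f + g) = cs (c * c') f + cs c g" by (simp add: fun_eq_iff distrib_left mult.assoc)
 then have "vscale V c (vadd V (vscale V c' x) w) = vadd V (vscale V (c * c') x) (vscale V c w)"
  using f by (simp add: Qscale Qadd Zadd Zscale)
 then show ?case using vspan.step[OF step(1,3), of "c * c'"] by simp
qed

lemma vspan_incl: "X \<subseteq> vcarrier V ==> x \<in> X ==> x \<in> vspan V X"
proof -
 assume X: "X \<subseteq> vcarrier V" "x \<in> X"
 then obtain f where "f \<in> Z" "x = Q f" using car by auto
 then have "vadd V (vscale V 1 x) (vzero V) = x" using Z0 by (simp add: Q0 Qscale Qadd)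
 then show ?thesis using vspan.step[OF X(2) vspan.zero, of V 1] by simp
qed

text \<open>Turns membership in a span into a formal combination that can be replayed on
  {1..d}.\<close>

lemma vspan_comb:
 assumes s: "!!l. s l \<in> Z"
 shows "u \<in> vspan V {act g (Q (s l)) | g l. g \<in> carrier G} ==>
  EX P. (\<forall>(c, g, l)\<in>set P. g \<in> carrier G) & u = Q (lcomb (%(c, g, l). A g (s l)) P)"
proof (induction rule: vspan.induct)
 case zero
 have "vzero V = Q (lcomb (%(c, g, l). A g (s l)) [])" unfolding Q0 lcomb_Nil ..
 then show ?case by (intro exI[of _ "[]"] conjI, simp, assumption)
next
 case (step x v c)
 then obtain g l P where x: "x = act g (Q (s l))" "g \<in> carrier G"
  and P: "\<forall>(c, g, l)\<in>set P. g \<in> carrier G" "v = Q (lcomb (%(c, g, l). A g (s l)) P)" by blast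
 have "lcomb (%(c, g, l). A g (s l)) P \<in> Z" using P s by (intro Zlcomb) (auto simp: AZ)
 then show ?case using x P s
  by (intro exI[of _ "(c, g, l) # P"]) (simp add: lcomb_Cons Qact Qscale Qadd AZ Zscale plus_fun_def)
qed

definition wgens :: "(nat => 'e => complex) => 'a set => nat => 'v set" where
 "wgens s F m = {foldr act gs (Q (s j)) | gs j. set gs \<subseteq> F & length gs \<in> {1..m} & j < m}"

end

section \<open>Almost equivariant maps and sparse exceptional sets\<close>

locale sofic_data = normed_rep G V act Z N Q A
 for G (structure) and V :: "'v cspace" and act and Z :: "('e => complex) set" and N Q A +
 fixes r :: real and S :: "nat => 'v" and \<rho> :: "(nat => complex) => real"
  and d :: "nat => nat" and \<sigma> :: "nat => 'a => nat => nat"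
 assumes r1: "1 <= r" and gen: "generating_sequence G V act S" and prod: "product_norm \<rho>"
  and sofic: "sofic_approximation G d \<sigma>"
begin

text \<open>The generating sequence lives in V, so representatives in \<open>Z\<close> are fixed
  once and for all.\<close>

definition s :: "nat => 'e => complex" where "s l = (SOME f. f \<in> Z & Q f = S l)"

lemma s: "s l \<in> Z" "Q (s l) = S l"
proof -
 have "S l \<in> Q ` Z" using gen car by (auto simp: generating_sequence_def)
 then have "EX f. f \<in> Z & Q f = S l" by auto
 from someI_ex[OF this] show "s l \<in> Z" "Q (s l) = S l" by (auto simp: s_def)
qed

lemma s_bounded: obtains C where "0 < C" "!!l. N (s l) <= C"
proof -
 obtain C where "!!l. vnorm V (S l) <= C" using gen by (auto simp: generating_sequence_def)
 then have "N (s l) <= max C 1" for l using QN[OF s(1), of l] s(2)[of l] by (metis max.coboundedI1)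
 then show thesis by (intro that[of "max C 1"]) auto
qed

lemma s_dense:
 assumes f: "f \<in> Z" and e: "0 < e"
 obtains P where "!!c g l. (c, g, l) \<in> set P ==> g \<in> carrier G" "N (f - lcomb (%(c, g, l). A g (s l)) P) < e"
proof -
 have "Q f \<in> vclosure V (vspan V {act g (Q (s l)) | g l. g \<in> carrier G})"
  using gen f by (simp add: generating_sequence_def s car)
 then obtain u where u: "u \<in> vspan V {act g (Q (s l)) | g l. g \<in> carrier G}" "vdist V (Q f) u < e"
  using e by (auto simp: vclosure_def)
 obtain P where P: "\<forall>(c, g, l)\<in>set P. g \<in> carrier G" "u = Q (lcomb (%(c, g, l). A g (s l)) P)"
  using vspan_comb[OF s(1) u(1)] by blast
 have "lcomb (%(c, g, l). A g (s l)) P \<in> Z" using P s by (intro Zlcomb) (auto simp: AZ)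
 then have "N (f - lcomb (%(c, g, l). A g (s l)) P) < e" using u(2) f P(2) by (simp add: QN_minus)
 then show thesis using that P(1) by blast
qed

lemma orbit_span_eq: "orbit_span V act S F m = vspan V (wgens s F m)"
 by (simp add: orbit_span_def wgens_def s)

lemma wgens_carrier: "F \<subseteq> carrier G ==> wgens s F m \<subseteq> vcarrier V"
proof
 fix x assume F: "F \<subseteq> carrier G" and "x \<in> wgens s F m"
 then obtain gs j where x: "x = foldr act gs (Q (s j))" "set gs \<subseteq> carrier G" by (auto simp: wgens_def)
 then show "x \<in> vcarrier V" using foldr_act[OF x(2) s(1)] car by auto
qed

text \<open>Representatives of the domain of an almost equivariant map. Outside this domain
  \<open>almost_hom\<close> gives no control over its values.\<close>

definition OZ :: "'a set => nat => ('e => complex) set" where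
 "OZ F m = {f \<in> Z. Q f \<in> orbit_span V act S F m}"

lemma OZ_subspace:
 assumes F: "F \<subseteq> carrier G"
 shows "0 \<in> OZ F m" "f \<in> OZ F m ==> g \<in> OZ F m ==> f + g \<in> OZ F m" "f \<in> OZ F m ==> cs c f \<in> OZ F m"
proof -
 note W = wgens_carrier[OF F, of m]
 show "0 \<in> OZ F m" using vspan.zero[of V "wgens s F m"] Z0 by (simp add: OZ_def orbit_span_eq Q0)
 show "f \<in> OZ F m ==> g \<in> OZ F m ==> f + g \<in> OZ F m"
  using vspan_add[OF W, of "Q f" "Q g"] by (simp add: OZ_def orbit_span_eq Qadd Zadd)
 show "f \<in> OZ F m ==> cs c f \<in> OZ F m"
  using vspan_scale[OF W, of "Q f" c] by (simp add: OZ_def orbit_span_eq Qscale Zscale)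
qed

lemma OZ_word:
 assumes F: "F \<subseteq> carrier G" "set gs \<subseteq> F" "length gs \<in> {1..m}" "j < m"
 shows "foldr A gs (s j) \<in> OZ F m"
proof -
 have gs: "set gs \<subseteq> carrier G" using F by auto
 have "Q (foldr A gs (s j)) \<in> wgens s F m" using foldr_act[OF gs s(1), of j] F unfolding wgens_def mem_Collect_eq by (intro exI[of _ gs] exI[of _ j]) simp
 then show ?thesis using foldr_act[OF gs s(1), of j] vspan_incl[OF wgens_carrier[OF F(1)]]
  by (simp add: OZ_def orbit_span_eq)
qed

lemma hom_props:
 assumes T: "T \<in> almost_hom (ereal r) V act D t S F m \<delta>" and F: "F \<subseteq> carrier G"
 shows "f \<in> OZ F m ==> T (Q f) \<in> fin_carrier D" "f \<in> OZ F m ==> lpn r {1..D} (T (Q f)) <= N f"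
  "f \<in> OZ F m ==> g \<in> OZ F m ==> T (Q (f + g)) = T (Q f) + T (Q g)"
  "f \<in> OZ F m ==> T (Q (cs c f)) = cs c (T (Q f))"
  "set gs \<subseteq> F ==> length gs \<in> {1..m} ==> j < m ==>
   lpn r {1..D} (T (Q (foldr A gs (s j))) - foldr (%g. perm_act (t g)) gs (T (Q (s j)))) < \<delta>"
proof -
 note T1 = T[unfolded almost_hom_def mem_Collect_eq, THEN conjunct1, rule_format]
 note T2 = T[unfolded almost_hom_def mem_Collect_eq, THEN conjunct2, rule_format]
 show "f \<in> OZ F m ==> T (Q f) \<in> fin_carrier D" "f \<in> OZ F m ==> lpn r {1..D} (T (Q f)) <= N f"
  using T1[of "Q f"] by (auto simp: OZ_def QN)
 show "f \<in> OZ F m ==> g \<in> OZ F m ==> T (Q (f + g)) = T (Q f) + T (Q g)"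
  using T1[of "Q f"] by (auto simp: OZ_def Qadd[symmetric])
 show "f \<in> OZ F m ==> T (Q (cs c f)) = cs c (T (Q f))"
  using T1[of "Q f"] by (auto simp: OZ_def Qscale[symmetric])
 show "lpn r {1..D} (T (Q (foldr A gs (s j))) - foldr (%g. perm_act (t g)) gs (T (Q (s j)))) < \<delta>"
  if gs: "set gs \<subseteq> F" "length gs \<in> {1..m}" "j < m"
 proof -
  have "set gs \<subseteq> carrier G" using gs F by auto
  then show ?thesis using T2[of gs j] gs foldr_act[of gs "s j"] s by simp
 qed
qed

end

text \<open>Density tending to 0 along the approximation. The points where finitely many instances
  of the sofic conditions fail form such a set.\<close>

definition rare :: "(nat => nat) => (nat => nat set) => bool" where
 "rare d B \<longleftrightarrow> (%i. real (card (B i \<inter> {1..d i})) / real (d i)) \<longlonglongrightarrow> 0"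

lemma rare_bound:
 assumes "rare d B" "!!i. card (C i \<inter> {1..d i}) <= card (B i \<inter> {1..d i})"
 shows "rare d C"
 unfolding rare_def
 by (rule tendsto_sandwich[OF _ _ tendsto_const assms(1)[unfolded rare_def]])
  (use assms(2) in \<open>auto intro!: always_eventually divide_right_mono\<close>)

lemma rare_subset: "rare d B ==> (!!i. C i \<inter> {1..d i} \<subseteq> B i) ==> rare d C"
 by (rule rare_bound[of d B]) (auto intro!: card_mono)

lemma rare_Un: "rare d B ==> rare d C ==> rare d (%i. B i \<union> C i)"
proof -
 assume "rare d B" "rare d C"
 then have l: "(%i. real (card (B i \<inter> {1..d i})) / real (d i) + real (card (C i \<inter> {1..d i})) / real (d i)) \<longlonglongrightarrow> 0"
  unfolding rare_def by (rule tendsto_add_zero)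
 have "real (card ((B i \<union> C i) \<inter> {1..d i})) / real (d i) <= real (card (B i \<inter> {1..d i})) / real (d i) + real (card (C i \<inter> {1..d i})) / real (d i)" for i
 proof -
  have "card ((B i \<union> C i) \<inter> {1..d i}) <= card (B i \<inter> {1..d i}) + card (C i \<inter> {1..d i})"
   unfolding Int_Un_distrib2 by (rule card_Un_le)
  then show ?thesis unfolding add_divide_distrib[symmetric] by (intro divide_right_mono) linarith+
 qed
 then show ?thesis unfolding rare_def
  by (intro tendsto_sandwich[OF _ _ tendsto_const l] always_eventually allI) auto
qed

lemma rare_UN: "finite I ==> (!!j. j \<in> I ==> rare d (B j)) ==> rare d (%i. \<Union>j\<in>I. B j i)"
proof (induction I rule: finite_induct)
 case empty
 show ?case by (simp add: rare_def)
next
 case (insert j I)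
 then show ?case using rare_Un[of d "B j" "%i. \<Union>j\<in>I. B j i"] by simp
qed

text \<open>Permutations preserve cardinalities.\<close>

lemma rare_vimage:
 assumes B: "rare d B" and p: "!!i. \<pi> i permutes {1..d i}"
 shows "rare d (%i. {x. \<pi> i x \<in> B i})"
proof (rule rare_bound[OF B])
 fix i
 have "card ({x. \<pi> i x \<in> B i} \<inter> {1..d i}) = card (\<pi> i ` ({x. \<pi> i x \<in> B i} \<inter> {1..d i}))"
  by (rule card_image[symmetric]) (rule inj_on_subset[OF permutes_inj[OF p]], simp)
 also have "\<dots> <= card (B i \<inter> {1..d i})"
 proof (intro card_mono subsetI)
  fix y assume "y \<in> \<pi> i ` ({x. \<pi> i x \<in> B i} \<inter> {1..d i})"
  then obtain x where "y = \<pi> i x" "\<pi> i x \<in> B i" "x \<in> {1..d i}" by blast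
  then show "y \<in> B i \<inter> {1..d i}" using permutes_in_image[OF p[of i], of x] by blast
 qed simp
 finally show "card ({x. \<pi> i x \<in> B i} \<inter> {1..d i}) <= card (B i \<inter> {1..d i})" .
qed

lemma eps_dim_le:
 assumes "finite B" "card B <= k" "seq.span B \<subseteq> linf_seqs p D"
  "!!x. x \<in> A ==> \<exists>w\<in>seq.span B. seq_norm p D \<rho> (x - w) < \<epsilon>"
 shows "eps_dim p D \<rho> \<epsilon> A <= ereal (real k)"
proof -
 have "eps_dim p D \<rho> \<epsilon> A <= ereal (real (seq.dim (seq.span B)))"
  unfolding eps_dim_def by (rule INF_lower) (use assms in auto)
 also have "seq.dim (seq.span B) <= k"
  using seq.dim_le_card[of "seq.span B" B] assms(1,2) by auto
 finally show ?thesis by (simp add: order_trans)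
qed

text \<open>Each subspace in the infimum has a finite basis, so a lower bound can be checked on
  finite spanning sets.\<close>

lemma le_eps_dim:
 assumes "!!B. finite B ==> seq.span B \<subseteq> linf_seqs p D ==>
  (!!x. x \<in> A ==> \<exists>w\<in>seq.span B. seq_norm p D \<rho> (x - w) < \<epsilon>) ==> c <= real (card B)"
 shows "ereal c <= eps_dim p D \<rho> \<epsilon> A"
 unfolding eps_dim_def
proof (rule INF_greatest)
 fix W assume W: "W \<in> {W. seq.subspace W & W \<subseteq> linf_seqs p D & (EX B. finite B & seq.span B = W) &
  (\<forall>x\<in>A. \<exists>w\<in>W. seq_norm p D \<rho> (x - w) < \<epsilon>)}"
 then obtain B0 where B0: "finite B0" "seq.span B0 = W" by blast
 obtain B where B: "B \<subseteq> W" "seq.independent B" "W \<subseteq> seq.span B" "card B = seq.dim W"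
  using seq.basis_exists by blast
 have "finite B" using seq.independent_span_bound[OF B0(1) B(2)] B(1) B0(2) by simp
 moreover have "seq.span B = W" using W B by (intro seq.span_subspace) auto
 ultimately have "c <= real (card B)" using W by (intro assms) auto
 then show "ereal c <= ereal (real (seq.dim W))" using B(4) by simp
qed

lemma seq_norm_less:
 assumes "!!l. lp_norm p {1..D} (f l) <= b" "!!l. l < L ==> lp_norm p {1..D} (f l) <= \<kappa>"
  "!!l. 0 <= lp_norm p {1..D} (f l)"
  "!!f. (!!l. cmod (f l) <= b) ==> (!!l. l < L ==> cmod (f l) <= \<kappa>) ==> \<rho> f < \<epsilon>"
 shows "seq_norm p D \<rho> f < \<epsilon>"
 unfolding seq_norm_def using assms(1-3) by (intro assms(4)) auto

context sofic_data begin

lemma sigma_perm: "g \<in> carrier G ==> \<sigma> i g permutes {1..d i}"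
 using sofic by (simp add: sofic_approximation_def)

lemma sigma_one: "\<sigma> i \<one> = id" using sofic by (simp add: sofic_approximation_def)

lemma rare_mult:
 assumes "g \<in> carrier G" "h \<in> carrier G"
 shows "rare d (%i. {x. \<sigma> i (g \<otimes> h) x ~= \<sigma> i g (\<sigma> i h x)})"
proof -
 have "(%i. hamming (d i) (\<sigma> i (g \<otimes> h)) (\<sigma> i g \<circ> \<sigma> i h)) \<longlonglongrightarrow> 0"
  using sofic assms by (simp add: sofic_approximation_def)
 moreover have "{x. \<sigma> i (g \<otimes> h) x ~= \<sigma> i g (\<sigma> i h x)} \<inter> {1..d i} = {j \<in> {1..d i}. \<sigma> i (g \<otimes> h) j ~= (\<sigma> i g \<circ> \<sigma> i h) j}" for i
  by auto
 ultimately show ?thesis by (simp add: rare_def hamming_def)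
qed

lemma hamming_one:
 assumes "g \<in> carrier G" "h \<in> carrier G" "g ~= h"
 shows "(%i. hamming (d i) (\<sigma> i g) (\<sigma> i h)) \<longlonglongrightarrow> 1" "\<forall>\<^sub>F i in sequentially. 0 < d i"
proof -
 show l: "(%i. hamming (d i) (\<sigma> i g) (\<sigma> i h)) \<longlonglongrightarrow> 1"
  using sofic assms by (simp add: sofic_approximation_def)
 \<comment> \<open>For d i = 0 the quotient in \<open>hamming\<close> is 0, so the limit 1 forces d
   i > 0 eventually.\<close>
 have "\<forall>\<^sub>F i in sequentially. 0 < hamming (d i) (\<sigma> i g) (\<sigma> i h)"
  by (rule order_tendstoD(1)[OF l]) simp
 then show "\<forall>\<^sub>F i in sequentially. 0 < d i"
  by eventually_elim (rule ccontr, simp add: hamming_def)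
qed

lemma rare_eq:
 assumes "g \<in> carrier G" "h \<in> carrier G" "g ~= h"
 shows "rare d (%i. {x. \<sigma> i g x = \<sigma> i h x})"
proof -
 note l = hamming_one[OF assms]
 have "(%i. 1 - hamming (d i) (\<sigma> i g) (\<sigma> i h)) \<longlonglongrightarrow> 0"
  using tendsto_diff[OF tendsto_const l(1), of 1] by simp
 moreover have "\<forall>\<^sub>F i in sequentially. 1 - hamming (d i) (\<sigma> i g) (\<sigma> i h) =
  real (card ({x. \<sigma> i g x = \<sigma> i h x} \<inter> {1..d i})) / real (d i)"
  using l(2)
 proof eventually_elim
  case (elim i)
  have "card {1..d i} = card (({x. \<sigma> i g x = \<sigma> i h x} \<inter> {1..d i}) \<union> {j \<in> {1..d i}. \<sigma> i g j ~= \<sigma> i h j})"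
   by (rule arg_cong[of _ _ card]) auto
  also have "\<dots> = card ({x. \<sigma> i g x = \<sigma> i h x} \<inter> {1..d i}) + card {j \<in> {1..d i}. \<sigma> i g j ~= \<sigma> i h j}"
   by (rule card_Un_disjoint) auto
  finally have "card {1..d i} = card ({x. \<sigma> i g x = \<sigma> i h x} \<inter> {1..d i}) + card {j \<in> {1..d i}. \<sigma> i g j ~= \<sigma> i h j}" .
  then have "real (d i) = real (card ({x. \<sigma> i g x = \<sigma> i h x} \<inter> {1..d i})) + real (card {j \<in> {1..d i}. \<sigma> i g j ~= \<sigma> i h j})" by simp
  then show ?case using elim by (simp add: hamming_def field_simps)
 qed
 ultimately show ?thesis unfolding rare_def by (rule Lim_transform_eventually)
qed

lemma rare_power:
 assumes g: "g \<in> carrier G"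
 shows "rare d (%i. {x. (\<sigma> i g ^^ k) x ~= \<sigma> i (g [^] k) x})"
proof (induction k)
 case 0
 show ?case by (simp add: sigma_one rare_def)
next
 case (Suc k)
 have e: "g [^] Suc k = g \<otimes> g [^] k" using nat_pow_Suc2[OF g] by simp
 have "rare d (%i. {x. (\<sigma> i g ^^ Suc k) x ~= \<sigma> i (g \<otimes> g [^] k) x})"
  by (rule rare_subset[OF rare_Un[OF Suc rare_mult[OF g nat_pow_closed[OF g, of k]]]]) auto
 then show ?case unfolding e .
qed

text \<open>Up to rare points the k-th power of the permutation of g is the permutation of g^k. As
  g^k differs from \<one>, it rarely agrees with the identity, and only k < L matter.\<close>

lemma rare_short_cycles:
 assumes g: "g \<in> carrier G" and ord: "!!k. 0 < k ==> g [^] (k::nat) ~= \<one>"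
 shows "rare d (%i. {x. EX k. 0 < k & k < L & (\<sigma> i g ^^ k) x = x})"
proof -
 have "rare d (%i. \<Union>k\<in>{0<..<L}. {x. (\<sigma> i g ^^ k) x ~= \<sigma> i (g [^] k) x} \<union> {x. \<sigma> i (g [^] k) x = \<sigma> i \<one> x})"
  using g ord by (intro rare_UN rare_Un rare_power rare_eq) auto
 then show ?thesis by (rule rare_subset) (auto simp: sigma_one)
qed

end

section \<open>The upper bound\<close>

context sofic_data begin

lemma hom_minus:
 assumes T: "T \<in> almost_hom (ereal r) V act D t S F m \<delta>" and F: "F \<subseteq> carrier G"
  and f: "f \<in> OZ F m" "g \<in> OZ F m"
 shows "f - g \<in> OZ F m" "T (Q (f - g)) = T (Q f) - T (Q g)"
proof -
 have e: "f - g = f + cs (-1) g" by (simp add: fun_eq_iff)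
 note g' = OZ_subspace(3)[OF F f(2), of "-1"]
 show "f - g \<in> OZ F m" unfolding e by (rule OZ_subspace(2)[OF F f(1) g'])
 have "T (Q (f - g)) = T (Q f) + T (Q (cs (-1) g))" unfolding e by (rule hom_props(3)[OF T F f(1) g'])
 also have "T (Q (cs (-1) g)) = cs (-1) (T (Q g))" by (rule hom_props(4)[OF T F f(2)])
 also have "T (Q f) + cs (-1) (T (Q g)) = T (Q f) - T (Q g)" by (rule ext) simp
 finally show "T (Q (f - g)) = T (Q f) - T (Q g)" .
qed

lemma hom_sum:
 assumes T: "T \<in> almost_hom (ereal r) V act D t S F m \<delta>" and F: "F \<subseteq> carrier G"
  and f: "finite I" "!!i. i \<in> I ==> f i \<in> OZ F m"
 shows "(\<Sum>i\<in>I. f i) \<in> OZ F m & T (Q (\<Sum>i\<in>I. f i)) = (\<Sum>i\<in>I. T (Q (f i)))"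
 using f
proof (induction I rule: finite_induct)
 case empty
 have c0: "cs 0 (0 :: 'e => complex) = 0" by (rule ext) simp
 have "T (Q (cs 0 0)) = cs 0 (T (Q 0))" by (rule hom_props(4)[OF T F OZ_subspace(1)[OF F]])
 also have "cs 0 (T (Q 0)) = 0" by (rule ext) simp
 finally have "T (Q 0) = 0" using c0 by metis
 then show ?case using OZ_subspace(1)[OF F] unfolding sum.empty by blast
next
 case (insert i I)
 then have "f i \<in> OZ F m" "(\<Sum>i\<in>I. f i) \<in> OZ F m" "T (Q (\<Sum>i\<in>I. f i)) = (\<Sum>i\<in>I. T (Q (f i)))" by auto
 then show ?case unfolding sum.insert[OF insert.hyps]
  using OZ_subspace(2)[OF F] hom_props(3)[OF T F] by metis
qed

lemma hom_lcomb:
 assumes T: "T \<in> almost_hom (ereal r) V act D t S F m \<delta>" and F: "F \<subseteq> carrier G"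
  and P1: "!!p. p \<in> set P ==> \<alpha> p \<in> OZ F m"
  and P2: "!!p. p \<in> set P ==> lpn r {1..D} (T (Q (\<alpha> p)) - \<beta> p) <= \<theta>"
 shows "lcomb \<alpha> P \<in> OZ F m" "lpn r {1..D} (T (Q (lcomb \<alpha> P)) - lcomb \<beta> P) <= weight P * \<theta>"
 by ((rule lcomb_approx[where \<tau> = "%f. T (Q f)" and OZ = "OZ F m" and \<beta> = \<beta> and \<theta> = \<theta> and d = D and r = r];
   (assumption | rule r1 OZ_subspace[OF F] hom_props(3)[OF T F] hom_props(4)[OF T F] P1 P2)+))+

text \<open>Replays a formal combination on {1..d}: group elements act through the permutations
  \<open>t g\<close>, and the generators become the vectors \<open>\<zeta> l\<close>.\<close>

definition push_forward :: "('a => nat => nat) => (nat => nat => complex) => 'a comb => nat => complex" where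
 "push_forward t \<zeta> = lcomb (%(c, g, l). perm_act (t g) (\<zeta> l))"

text \<open>The generators \<open>e j\<close> may lie outside the domain of T, so T is evaluated at
  combinations \<open>y j\<close> of the orbit of \<open>S\<close> close to them. \<open>P\<close>
  expresses \<open>s l\<close> through the \<open>e j\<close>, and \<open>P'\<close> expresses
  \<open>e j\<close> through the \<open>s l\<close>. The error is \<mu> from this replacement plus
  twice K \<delta> from equivariance, for the words g and h g.\<close>

lemma upper_core:
 fixes D :: nat
 assumes T: "T \<in> almost_hom (ereal r) V act D t S F m \<delta>" and F: "F \<subseteq> carrier G" "\<one> \<in> F"
  and t: "!!g. g \<in> carrier G ==> t g permutes {1..D}"
  and m: "2 <= m" and e: "!!j. j \<in> {1..n} ==> e j \<in> Z"
  and P: "!!l c g j. l < L ==> (c, g, j) \<in> set (P l) ==> g \<in> F & j \<in> {1..n}" "L <= m"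
   "!!l. l < L ==> N (s l - lcomb (%(c, g, j). A g (e j)) (P l)) <= \<epsilon>" "!!l. l < L ==> weight (P l) <= W"
  and P': "!!j c g l. j \<in> {1..n} ==> (c, g, l) \<in> set (P' j) ==> g \<in> F & l < m"
   "!!j. j \<in> {1..n} ==> N (e j - lcomb (%(c, g, l). A g (s l)) (P' j)) <= \<mu>" "!!j. j \<in> {1..n} ==> weight (P' j) <= K"
  and b: "!!j. j \<in> {1..n} ==> b j \<in> F" and rel: "N (\<Sum>j=1..n. A (b j) (e j) - e j) = 0"
  and pos: "0 <= \<delta>" "0 <= \<mu>" "0 <= K"
 defines "\<zeta> \<equiv> %j. T (Q (lcomb (%(c, g, l). A g (s l)) (P' j)))"
 shows "!!l. l < L ==> lpn r {1..D} (T (S l) - push_forward t \<zeta> (P l)) <= \<epsilon> + W * (\<mu> + 2 * K * \<delta>)"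
  "lpn r {1..D} (\<Sum>j=1..n. perm_act (t (b j)) (\<zeta> j) - \<zeta> j) <= 2 * real n * (\<mu> + 2 * K * \<delta>)"
  "!!j. j \<in> {1..n} ==> \<zeta> j \<in> fin_carrier D"
proof -
 let ?nd = "lpn r {1..D}"
 note add = fin_norm_add[OF r1, where d = D] and tri = fin_norm_diff[OF r1, where d = D]
 define y where "y = (%j. lcomb (%(c, g, l). A g (s l)) (P' j))"
 have zy: "\<zeta> j = T (Q (y j))" for j by (simp add: \<zeta>_def y_def)
 note app = hom_lcomb[OF T F(1)]
 have word1: "A g (s l) \<in> OZ F m & ?nd (T (Q (A g (s l))) - perm_act (t g) (T (S l))) <= \<delta>" if "g \<in> F" "l < m" for g l
  using OZ_word[OF F(1), of "[g]" m l] hom_props(5)[OF T F(1), of "[g]" l] that m unfolding s(2) by simp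
 \<comment> \<open>Words of two letters are available because m is at least 2.\<close>
 have word2: "A h (A g (s l)) \<in> OZ F m & ?nd (T (Q (A h (A g (s l)))) - perm_act (t h) (perm_act (t g) (T (S l)))) <= \<delta>"
  if "h \<in> F" "g \<in> F" "l < m" for g h l
  using OZ_word[OF F(1), of "[h, g]" m l] hom_props(5)[OF T F(1), of "[h, g]" l] that m unfolding s(2) by simp
 have inG: "g \<in> carrier G" if "g \<in> F" for g by (rule subsetD[OF F(1) that])
 have y: "y j \<in> OZ F m" "?nd (\<zeta> j - push_forward t (%l. T (S l)) (P' j)) <= K * \<delta>" if j: "j \<in> {1..n}" for j
 proof -
  have P1: "(case p of (c, g, l) => A g (s l)) \<in> OZ F m"
   "?nd (T (Q (case p of (c, g, l) => A g (s l))) - (case p of (c, g, l) => perm_act (t g) (T (S l)))) <= \<delta>" if p: "p \<in> set (P' j)" for p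
  proof -
   obtain c g l where pp: "p = (c, g, l)" by (metis surj_pair)
   have gl: "g \<in> F" "l < m" using P'(1)[OF j, of c g l] p pp by auto
   show "(case p of (c, g, l) => A g (s l)) \<in> OZ F m"
    "?nd (T (Q (case p of (c, g, l) => A g (s l))) - (case p of (c, g, l) => perm_act (t g) (T (S l)))) <= \<delta>"
    unfolding pp prod.case by (rule word1[OF gl, THEN conjunct1], rule word1[OF gl, THEN conjunct2])
  qed
  show "y j \<in> OZ F m" unfolding y_def by (rule app(1)[OF P1])
  have "?nd (\<zeta> j - push_forward t (%l. T (S l)) (P' j)) <= weight (P' j) * \<delta>"
   unfolding \<zeta>_def push_forward_def by (rule app(2)[OF P1])
  also have "\<dots> <= K * \<delta>" using P'(3)[OF j] pos by (intro mult_right_mono) auto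
  finally show "?nd (\<zeta> j - push_forward t (%l. T (S l)) (P' j)) <= K * \<delta>" .
 qed
 have Ay: "A h (y j) \<in> OZ F m" "?nd (T (Q (A h (y j))) - perm_act (t h) (\<zeta> j)) <= 2 * K * \<delta>" if h: "h \<in> F" and j: "j \<in> {1..n}" for h j
 proof -
  have P1: "A h (case p of (c, g, l) => A g (s l)) \<in> OZ F m"
   "?nd (T (Q (A h (case p of (c, g, l) => A g (s l)))) - perm_act (t h) (case p of (c, g, l) => perm_act (t g) (T (S l)))) <= \<delta>" if p: "p \<in> set (P' j)" for p
  proof -
   obtain c g l where pp: "p = (c, g, l)" by (metis surj_pair)
   have gl: "g \<in> F" "l < m" using P'(1)[OF j, of c g l] p pp by auto
   show "A h (case p of (c, g, l) => A g (s l)) \<in> OZ F m"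
    "?nd (T (Q (A h (case p of (c, g, l) => A g (s l)))) - perm_act (t h) (case p of (c, g, l) => perm_act (t g) (T (S l)))) <= \<delta>"
    unfolding pp prod.case by (rule word2[OF h gl, THEN conjunct1], rule word2[OF h gl, THEN conjunct2])
  qed
  have e: "A h (y j) = lcomb (%p. A h (case p of (c, g, l) => A g (s l))) (P' j)"
   unfolding y_def by (rule Alcomb[OF inG[OF h]])
  show "A h (y j) \<in> OZ F m" unfolding e by (rule app(1)[OF P1])
  have "?nd (T (Q (A h (y j))) - perm_act (t h) (push_forward t (%l. T (S l)) (P' j))) <= weight (P' j) * \<delta>"
   unfolding e push_forward_def perm_act_lcomb by (rule app(2)[OF P1])
  also have "\<dots> <= K * \<delta>" using P'(3)[OF j] pos by (intro mult_right_mono) auto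
  finally have 1: "?nd (T (Q (A h (y j))) - perm_act (t h) (push_forward t (%l. T (S l)) (P' j))) <= K * \<delta>" .
  have "?nd (perm_act (t h) (push_forward t (%l. T (S l)) (P' j)) - perm_act (t h) (\<zeta> j)) = ?nd (\<zeta> j - push_forward t (%l. T (S l)) (P' j))"
   unfolding perm_act_diff[symmetric] perm_act_norm[OF t[OF inG[OF h]]] by (rule fin_norm_commute[OF r1])
  then show "?nd (T (Q (A h (y j))) - perm_act (t h) (\<zeta> j)) <= 2 * K * \<delta>"
   using 1 y(2)[OF j] tri[where u = "T (Q (A h (y j)))" and v = "perm_act (t h) (push_forward t (%l. T (S l)) (P' j))" and w = "perm_act (t h) (\<zeta> j)"]
   by linarith
 qed
 have yZ: "y j \<in> Z" if "j \<in> {1..n}" for j using y(1)[OF that] by (simp add: OZ_def)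
 show "\<zeta> j \<in> fin_carrier D" if "j \<in> {1..n}" for j
  unfolding zy by (rule hom_props(1)[OF T F(1) y(1)[OF that]])
 show "?nd (T (S l) - push_forward t \<zeta> (P l)) <= \<epsilon> + W * (\<mu> + 2 * K * \<delta>)" if l: "l < L" for l
 proof -
  have P1: "(case p of (c, g, j) => A g (y j)) \<in> OZ F m"
   "?nd (T (Q (case p of (c, g, j) => A g (y j))) - (case p of (c, g, j) => perm_act (t g) (\<zeta> j))) <= 2 * K * \<delta>" if p: "p \<in> set (P l)" for p
  proof -
   obtain c g j where pp: "p = (c, g, j)" by (metis surj_pair)
   have gj: "g \<in> F" "j \<in> {1..n}" using P(1)[OF l, of c g j] p pp by auto
   show "(case p of (c, g, j) => A g (y j)) \<in> OZ F m"
    "?nd (T (Q (case p of (c, g, j) => A g (y j))) - (case p of (c, g, j) => perm_act (t g) (\<zeta> j))) <= 2 * K * \<delta>"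
    unfolding pp prod.case by (rule Ay(1)[OF gj], rule Ay(2)[OF gj])
  qed
  define f where "f = lcomb (%(c, g, j). A g (y j)) (P l)"
  have fO: "f \<in> OZ F m" unfolding f_def by (rule app(1)[OF P1])
  have "?nd (T (Q f) - push_forward t \<zeta> (P l)) <= weight (P l) * (2 * K * \<delta>)"
   unfolding f_def push_forward_def by (rule app(2)[OF P1])
  also have "\<dots> <= W * (2 * K * \<delta>)" using P(4)[OF l] pos by (intro mult_right_mono) auto
  finally have 1: "?nd (T (Q f) - push_forward t \<zeta> (P l)) <= W * (2 * K * \<delta>)" .
  have sO: "s l \<in> OZ F m" using word1[OF F(2), of l] l P(2) s(1) Aone by simp
  have "?nd (T (S l) - T (Q f)) = ?nd (T (Q (s l - f)))"
   using hom_minus(2)[OF T F(1) sO fO] s(2) by simp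
  also have "\<dots> <= N (s l - f)" by (rule hom_props(2)[OF T F(1) hom_minus(1)[OF T F(1) sO fO]])
  also have "\<dots> <= \<epsilon> + W * \<mu>"
  proof -
   define h where "h = lcomb (%(c, g, j). A g (e j)) (P l)"
   have eZ: "(case p of (c, g, j) => A g (e j)) \<in> Z" if "p \<in> set (P l)" for p
   proof -
    obtain c g j where pp: "p = (c, g, j)" by (metis surj_pair)
    have gj: "g \<in> F" "j \<in> {1..n}" using P(1)[OF l, of c g j] that pp by auto
    show ?thesis unfolding pp prod.case by (rule AZ[OF inG[OF gj(1)] e[OF gj(2)]])
   qed
   have hZ: "h \<in> Z" unfolding h_def by (rule Zlcomb) (rule eZ)
   have fZ: "f \<in> Z" using fO by (simp add: OZ_def)
   have "h - f = lcomb (%p. (case p of (c, g, j) => A g (e j)) - (case p of (c, g, j) => A g (y j))) (P l)"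
    unfolding h_def f_def by (rule lcomb_diff)
   also have "\<dots> = lcomb (%(c, g, j). A g (e j - y j)) (P l)"
   proof (rule lcomb_cong)
    fix p assume p: "p \<in> set (P l)"
    obtain c g j where pp: "p = (c, g, j)" by (metis surj_pair)
    have gj: "g \<in> F" "j \<in> {1..n}" using P(1)[OF l, of c g j] p pp by auto
    show "(case p of (c, g, j) => A g (e j)) - (case p of (c, g, j) => A g (y j)) = (case p of (c, g, j) => A g (e j - y j))"
     unfolding pp prod.case by (rule Aminus[OF inG[OF gj(1)], symmetric])
   qed
   finally have hf: "h - f = lcomb (%(c, g, j). A g (e j - y j)) (P l)" .
   have "N (h - f) <= weight (P l) * \<mu>" unfolding hf
   proof (rule Nlcomb)
    fix p assume p: "p \<in> set (P l)"
    obtain c g j where pp: "p = (c, g, j)" by (metis surj_pair)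
    have gj: "g \<in> carrier G" "j \<in> {1..n}" using P(1)[OF l, of c g j] p pp inG by auto
    then have z: "e j - y j \<in> Z" using e yZ Zminus by blast
    show "(case p of (c, g, j) => A g (e j - y j)) \<in> Z" using z gj by (simp add: pp AZ)
    show "N (case p of (c, g, j) => A g (e j - y j)) <= \<mu>" using z gj P'(2)[OF gj(2)] by (simp add: pp AN y_def)
   qed
   also have "\<dots> <= W * \<mu>" using P(4)[OF l] pos by (intro mult_right_mono) auto
   finally show ?thesis using Ntri[OF s(1) hZ fZ, of l] P(3)[OF l] unfolding h_def[symmetric] by linarith
  qed
  finally have 2: "?nd (T (S l) - T (Q f)) <= \<epsilon> + W * \<mu>" .
  show ?thesis using 1 2 tri[where u = "T (S l)" and v = "T (Q f)" and w = "push_forward t \<zeta> (P l)"] by (simp add: algebra_simps)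
 qed
 have uO: "A (b j) (y j) - y j \<in> OZ F m" "T (Q (A (b j) (y j) - y j)) = T (Q (A (b j) (y j))) - \<zeta> j" if j: "j \<in> {1..n}" for j
  unfolding zy using hom_minus[OF T F(1) Ay(1)[OF b[OF j] j] y(1)[OF j]] by auto
 define u where "u = (\<Sum>j=1..n. A (b j) (y j) - y j)"
 have hs: "(\<Sum>j=1..n. A (b j) (y j) - y j) \<in> OZ F m &
   T (Q (\<Sum>j=1..n. A (b j) (y j) - y j)) = (\<Sum>j=1..n. T (Q (A (b j) (y j) - y j)))"
  by (rule hom_sum[OF T F(1) finite_atLeastAtMost uO(1)])
 have u: "u \<in> OZ F m" "T (Q u) = (\<Sum>j=1..n. T (Q (A (b j) (y j))) - \<zeta> j)"
 proof -
  show "u \<in> OZ F m" unfolding u_def by (rule hs[THEN conjunct1])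
  have "T (Q u) = (\<Sum>j=1..n. T (Q (A (b j) (y j) - y j)))" unfolding u_def by (rule hs[THEN conjunct2])
  also have "\<dots> = (\<Sum>j=1..n. T (Q (A (b j) (y j))) - \<zeta> j)" by (intro sum.cong refl uO(2))
  finally show "T (Q u) = (\<Sum>j=1..n. T (Q (A (b j) (y j))) - \<zeta> j)" .
 qed
 \<comment> \<open>The relation holds exactly for the \<open>e j\<close>, in the sense of N;
   exchanging \<open>e j\<close> for \<open>y j\<close> costs at most 2 \<mu> per summand.\<close>
 have Nu: "N u <= 2 * real n * \<mu>"
 proof -
  define u0 where "u0 = (\<Sum>j=1..n. A (b j) (e j) - e j)"
  have bG: "b j \<in> carrier G" if "j \<in> {1..n}" for j using b[OF that] inG by blast
  have zz: "y j - e j \<in> Z" "A (b j) (y j - e j) \<in> Z" if "j \<in> {1..n}" for j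
   using that Zminus[OF yZ e] AZ[OF bG] by auto
  have "u - u0 = (\<Sum>j=1..n. (A (b j) (y j) - y j) - (A (b j) (e j) - e j))"
   unfolding u_def u0_def by (rule sum_subtractf[symmetric])
  also have "\<dots> = (\<Sum>j=1..n. A (b j) (y j - e j) - (y j - e j))"
   using bG by (intro sum.cong refl) (simp add: Aminus)
  finally have "N (u - u0) = N (\<Sum>j=1..n. A (b j) (y j - e j) - (y j - e j))" by simp
  also have "\<dots> <= (\<Sum>j=1..n. N (A (b j) (y j - e j) - (y j - e j)))"
   using zz Zminus by (intro Nsum) auto
  also have "\<dots> <= (\<Sum>j=1..n. 2 * \<mu>)"
  proof (rule sum_mono)
   fix j assume j: "j \<in> {1..n}"
   have "N (A (b j) (y j - e j) - (y j - e j)) <= N (y j - e j) + N (y j - e j)"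
    using Nminus[OF zz(2)[OF j] zz(1)[OF j]] AN[OF bG[OF j] zz(1)[OF j]] by simp
   moreover have "N (y j - e j) <= \<mu>" using P'(2)[OF j] Nneg[OF e[OF j] yZ[OF j]] by (simp add: y_def)
   ultimately show "N (A (b j) (y j - e j) - (y j - e j)) <= 2 * \<mu>" by linarith
  qed
  finally have 1: "N (u - u0) <= 2 * real n * \<mu>" by simp
  have u0Z: "u0 \<in> Z" unfolding u0_def using e bG by (intro Zsum Zminus AZ) auto
  have uZ: "u \<in> Z" using u(1) by (simp add: OZ_def)
  show ?thesis using 1 rel Nadd[OF Zminus[OF uZ u0Z] u0Z] unfolding u0_def[symmetric] by simp
 qed
 define v where "v = (\<Sum>j=1..n. perm_act (t (b j)) (\<zeta> j) - \<zeta> j)"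
 have "?nd (v - T (Q u)) <= (\<Sum>j=1..n. 2 * K * \<delta>)"
 proof -
  have "v - T (Q u) = (\<Sum>j=1..n. (perm_act (t (b j)) (\<zeta> j) - \<zeta> j) - (T (Q (A (b j) (y j))) - \<zeta> j))"
   unfolding v_def u(2) by (rule sum_subtractf[symmetric])
  also have "\<dots> = (\<Sum>j=1..n. perm_act (t (b j)) (\<zeta> j) - T (Q (A (b j) (y j))))" by simp
  finally have "?nd (v - T (Q u)) <= (\<Sum>j=1..n. ?nd (perm_act (t (b j)) (\<zeta> j) - T (Q (A (b j) (y j)))))"
   using fin_norm_sum[OF r1, of "{1..n}" D "%j. perm_act (t (b j)) (\<zeta> j) - T (Q (A (b j) (y j)))"] by simp
  also have "\<dots> <= (\<Sum>j=1..n. 2 * K * \<delta>)"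
  proof (rule sum_mono)
   fix j assume j: "j \<in> {1..n}"
   show "?nd (perm_act (t (b j)) (\<zeta> j) - T (Q (A (b j) (y j)))) <= 2 * K * \<delta>"
    by (rule order_trans[OF eq_refl[OF fin_norm_commute[OF r1]] Ay(2)[OF b[OF j] j]])
  qed
  finally show ?thesis .
 qed
 moreover have "?nd v <= ?nd (v - T (Q u)) + ?nd (T (Q u))" using add[of "v - T (Q u)" "T (Q u)"] by simp
 moreover have "?nd (T (Q u)) <= 2 * real n * \<mu>" using hom_props(2)[OF T F(1) u(1)] Nu by linarith
 moreover have "0 <= real n * (K * \<delta>)" using pos by simp
 ultimately have "?nd v <= 2 * real n * \<mu> + 4 * (real n * (K * \<delta>))" by simp
 then show "?nd (\<Sum>j=1..n. perm_act (t (b j)) (\<zeta> j) - \<zeta> j) <= 2 * real n * (\<mu> + 2 * K * \<delta>)"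
  unfolding v_def by (simp add: algebra_simps)
qed

end

lemma product_norm_tail':
 assumes "product_norm \<rho>" "0 < \<epsilon>" "0 < B"
 shows "\<exists>L \<kappa>. 0 < \<kappa> & (ALL f. (ALL l. cmod (f l) <= B) --> (\<forall>l<L. cmod (f l) <= \<kappa>) --> \<rho> f < \<epsilon>)"
proof (rule product_norm_tail[OF assms], goal_cases)
 case (1 L \<kappa>)
 note t = 1
 show ?case
 proof (intro exI[of _ L] exI[of _ \<kappa>] conjI allI impI)
  show "0 < \<kappa>" by (rule t(1))
  fix f assume "ALL l. cmod (f l) <= B" "\<forall>l<L. cmod (f l) <= \<kappa>"
  then show "\<rho> f < \<epsilon>" by (intro t(2)) auto
 qed
qed

lemma sum_apply:
 fixes f :: "'i => 'x => complex"
 shows "(\<Sum>i\<in>I. f i) x = (\<Sum>i\<in>I. f i x)"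
 by (induction I rule: infinite_finite_induct) auto

context sofic_data begin

lemma push_forward_add: "push_forward t (%l. z l + z' l) P = push_forward t z P + push_forward t z' P"
 unfolding push_forward_def lcomb_add[symmetric] by (rule lcomb_cong) (auto simp: perm_act_add)

lemma push_forward_scale: "push_forward t (%l. cs c (z l)) P = cs c (push_forward t z P)"
 unfolding push_forward_def lcomb_scale[symmetric] by (rule lcomb_cong) (auto simp: perm_act_scale)

lemma push_forward_diff_norm:
 assumes t: "!!g. g \<in> carrier G ==> t g permutes {1..D}"
  and P: "!!c g j. (c, g, j) \<in> set P ==> g \<in> carrier G & lpn r {1..D} (z j - z' j) <= \<theta>"
 shows "lpn r {1..D} (push_forward t z P - push_forward t z' P) <= weight P * \<theta>"
proof -
 have e: "push_forward t z P - push_forward t z' P = lcomb (%(c, g, j). perm_act (t g) (z j - z' j)) P"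
  unfolding push_forward_def lcomb_diff by (rule lcomb_cong) (auto simp: perm_act_diff)
 have b: "lpn r {1..D} (case p of (c, g, j) => perm_act (t g) (z j - z' j)) <= \<theta>" if "p \<in> set P" for p
 proof -
  obtain c g j where p: "p = (c, g, j)" by (metis surj_pair)
  show ?thesis unfolding p prod.case using P[of c g j] that p perm_act_norm[OF t, of g r "z j - z' j"] by simp
 qed
 show ?thesis unfolding e
  by (rule lcomb_seminorm) (rule fin_norm_add[OF r1] fin_norm_scale[OF r1] b; assumption?)+
qed

text \<open>One linear map \<Lambda> approximates all sequences \<open>alpha S m T\<close>. Its
  argument records \<zeta> j for j < n on all of {1..D}, but \<zeta> n only at the markers and at
  the bad points; the relation and \<open>Qo\<close> reconstruct the rest. Counting these
  coordinates gives the bound.\<close>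

lemma upper_step:
 fixes D n Lc :: nat and Qo :: "(nat => complex) => nat => complex"
 assumes F: "F \<subseteq> carrier G" "\<one> \<in> F"
  and t: "!!g. g \<in> carrier G ==> t g permutes {1..D}"
  and m: "2 <= m" and e: "!!j. j \<in> {1..n} ==> e j \<in> Z"
  and P: "!!l c g j. l < L ==> (c, g, j) \<in> set (P l) ==> g \<in> F & j \<in> {1..n}" "L <= m"
   "!!l. l < L ==> N (s l - lcomb (%(c, g, j). A g (e j)) (P l)) <= \<epsilon>'" "!!l. l < L ==> weight (P l) <= W"
  and P': "!!j c g l. j \<in> {1..n} ==> (c, g, l) \<in> set (P' j) ==> g \<in> F & l < m"
   "!!j. j \<in> {1..n} ==> N (e j - lcomb (%(c, g, l). A g (s l)) (P' j)) <= \<mu>" "!!j. j \<in> {1..n} ==> weight (P' j) <= K"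
  and b: "!!j. j \<in> {1..n} ==> b j \<in> F" and rel: "N (\<Sum>j=1..n. A (b j) (e j) - e j) = 0"
  and pos: "0 <= \<delta>" "0 <= \<mu>" "0 <= K" "0 <= W" and n: "1 <= n"
  and sb: "!!l. N (s l) <= C" "0 <= C"
  and tail: "!!f. (!!l. cmod (f l) <= C + 1) ==> (!!l. l < L ==> cmod (f l) <= \<kappa>) ==> \<rho> f < \<epsilon>"
  and tot: "\<epsilon>' + W * (1 + 4 * real Lc * real n) * (\<mu> + 2 * K * \<delta>) <= min \<kappa> 1"
  and B: "B \<subseteq> {1..D}" and mk: "!!x. x \<in> {1..D} - bad ==> mk x \<in> B"
  and Qo: "!!u v. Qo (u + v) = Qo u + Qo v" "!!c u. Qo (%x. c * u x) = (%x. c * Qo u x)"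
   "!!r u. 1 <= r ==> lpn r {1..D} (Qo u) <= 2 * real Lc * lpn r {1..D} u"
   "!!\<zeta> x. x \<in> {1..D} - bad ==> \<zeta> x = \<zeta> (mk x) + Qo (%x. \<zeta> (inv_into UNIV (t (b n)) x) - \<zeta> x) x"
   "!!u x. x \<in> bad ==> Qo u x = 0"
 shows "eps_dim (ereal r) D \<rho> \<epsilon> (alpha S m ` almost_hom (ereal r) V act D t S F m \<delta>)
  <= ereal (real ((n - 1) * D + card B + card (bad \<inter> {1..D})))"
proof -
 let ?nd = "lpn r {1..D}"
 \<comment> \<open>Solved for the last generator, the relation says that the increment of \<zeta> n
   under b n is U \<zeta> plus a small error.\<close>
 define U where "U = (%z :: nat => nat => complex. - (\<Sum>j=1..n-1. perm_act (t (b j)) (z j) - z j))"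
 \<comment> \<open>Slot n receives the reconstructed generator: marker values plus telescoped
   increments.\<close>
 define zz where "zz = (%z j. if j = n then z n + Qo (U z) else z j)"
 \<comment> \<open>Cut off at L, because \<open>tail\<close> takes care of the later
   coordinates.\<close>
 define \<Lambda> where "\<Lambda> = (%z l x. if l < L & x \<in> {1..D} then push_forward t (zz z) (P l) x else 0)"
 have Uadd: "U (z + z') = U z + U z'" for z z'
  by (simp add: U_def perm_act_add sum.distrib[symmetric] sum_negf[symmetric] del: sum_negf) (intro sum.cong; simp)
 have Uscale: "U (seq_scale c z) = (%x. c * U z x)" for c z
 proof -
  have "perm_act (t (b j)) (seq_scale c z j) - seq_scale c z j = (%x. c * (perm_act (t (b j)) (z j) - z j) x)" for j
   by (auto simp: seq_scale_def perm_act_def right_diff_distrib)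
  then show ?thesis by (simp add: U_def fun_eq_iff sum_distrib_left sum_apply)
 qed
 have zzadd: "zz (z + z') = (%l. zz z l + zz z' l)" for z z'
  by (auto simp: zz_def Uadd Qo(1) fun_eq_iff)
 have zzscale: "zz (seq_scale c z) = (%l. (%x. c * zz z l x))" for c z
  unfolding zz_def Uscale Qo(2) by (auto simp: fun_eq_iff seq_scale_def distrib_left)
 have lin: "module_hom seq_scale seq_scale \<Lambda>"
  unfolding module_hom_iff
 proof (intro conjI allI)
  show "\<Lambda> (z + z') = \<Lambda> z + \<Lambda> z'" for z z'
   by (auto simp: \<Lambda>_def fun_eq_iff zzadd push_forward_add)
  show "\<Lambda> (seq_scale c z) = seq_scale c (\<Lambda> z)" for c z
   unfolding \<Lambda>_def zzscale push_forward_scale by (auto simp: fun_eq_iff seq_scale_def)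
 qed (rule seq.module_axioms)+
 \<comment> \<open>Coordinate vectors: \<open>u1\<close> for a single point of a slot,
   \<open>u2\<close> for all good points attached to one marker in slot n, \<open>u3\<close> for a
   bad point in slot n.\<close>
 define u1 where "u1 = (%(j :: nat, x :: nat) l y. if l = j & y = x then 1 else 0 :: complex)"
 define u2 where "u2 = (%c l y. if l = n & y \<in> {1..D} - bad & mk y = c then 1 else 0 :: complex)"
 define u3 where "u3 = (%x :: nat. u1 (n, x))"
 define B0 where "B0 = u1 ` ({1..n-1} \<times> {1..D}) \<union> u2 ` B \<union> u3 ` (bad \<inter> {1..D})"
 have fB: "finite B" using B finite_subset by blast
 have fB0: "finite B0" using fB by (simp add: B0_def)
 have "card B0 <= card (u1 ` ({1..n-1} \<times> {1..D})) + card (u2 ` B) + card (u3 ` (bad \<inter> {1..D}))"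
  unfolding B0_def by (intro order_trans[OF card_Un_le] add_mono card_Un_le order_refl)
 also have "\<dots> <= card ({1..n-1} \<times> {1..D}) + card B + card (bad \<inter> {1..D})"
  by (intro add_mono card_image_le) (auto simp: fB)
 finally have cB0: "card B0 <= (n - 1) * D + card B + card (bad \<inter> {1..D})" by simp
 show ?thesis
 proof (rule eps_dim_le[of "\<Lambda> ` B0"])
  show "finite (\<Lambda> ` B0)" using fB0 by simp
  show "card (\<Lambda> ` B0) <= (n - 1) * D + card B + card (bad \<inter> {1..D})"
   using card_image_le[OF fB0, of \<Lambda>] cB0 by linarith
  have sp: "seq.span (\<Lambda> ` B0) = \<Lambda> ` seq.span B0" by (rule module_hom.span_image[OF lin])
  show "seq.span (\<Lambda> ` B0) \<subseteq> linf_seqs (ereal r) D"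
  proof
   fix w assume "w \<in> seq.span (\<Lambda> ` B0)"
   then obtain z where z: "w = \<Lambda> z" unfolding sp by (rule imageE)
   have "?nd (w l) <= (\<Sum>l<L. ?nd (w l))" for l
   proof (cases "l < L")
    case True
    then show ?thesis by (intro member_le_sum) auto
   next
    case False
    then have "w l = (%_. 0)" by (auto simp: z \<Lambda>_def)
    then show ?thesis by (simp add: sum_nonneg)
   qed
   then show "w \<in> linf_seqs (ereal r) D" unfolding linf_seqs_def fin_carrier_def by (auto simp: z \<Lambda>_def)
  qed
  fix x assume "x \<in> alpha S m ` almost_hom (ereal r) V act D t S F m \<delta>"
  then obtain T where T: "x = alpha S m T" "T \<in> almost_hom (ereal r) V act D t S F m \<delta>" by (rule imageE)
  define \<zeta> where "\<zeta> = (%j. T (Q (lcomb (%(c, g, l). A g (s l)) (P' j))))"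
  define E where "E = \<mu> + 2 * K * \<delta>"
  have E0: "0 <= E" using pos by (simp add: E_def)
  have core1: "?nd (T (S l) - push_forward t \<zeta> (P l)) <= \<epsilon>' + W * E" if "l < L" for l
   unfolding \<zeta>_def E_def by (rule upper_core(1)[OF T(2) F t m e P P' b rel pos(1-3)]) (assumption | rule that)+
  have core2: "?nd (\<Sum>j=1..n. perm_act (t (b j)) (\<zeta> j) - \<zeta> j) <= 2 * real n * E"
   unfolding \<zeta>_def E_def by (rule upper_core(2)[OF T(2) F t m e P P' b rel pos(1-3)]) assumption+
  have core3: "\<zeta> j \<in> fin_carrier D" if "j \<in> {1..n}" for j
   unfolding \<zeta>_def by (rule upper_core(3)[OF T(2) F t m e P P' b rel pos(1-3)]) (assumption | rule that)+
  \<comment> \<open>The argument of \<Lambda> that belongs to T: in slot n a good point carries the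
    value at its marker.\<close>
  define z where "z = (%l. if l \<in> {1..n-1} then \<zeta> l else if l = n then
   (%y. if y \<in> {1..D} then (if y \<in> bad then \<zeta> n y else \<zeta> n (mk y)) else 0) else (%_. 0))"
  have zspan: "z \<in> seq.span B0"
  proof -
   have i1: "u1 jx \<in> seq.span B0" if "jx \<in> {1..n-1} \<times> {1..D}" for jx
    using that by (intro seq.span_base) (simp add: B0_def)
   have i2: "u2 c \<in> seq.span B0" if "c \<in> B" for c using that by (intro seq.span_base) (simp add: B0_def)
   have i3: "u3 c \<in> seq.span B0" if "c \<in> bad \<inter> {1..D}" for c using that by (intro seq.span_base) (simp add: B0_def)
   have sa: "(\<Sum>i\<in>I. seq_scale (c i) (f i)) l y = (\<Sum>i\<in>I. c i * f i l y)" for I :: "'i set" and c f l y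
    by (induction I rule: infinite_finite_induct) (auto simp: seq_scale_def)
   have "z = (\<Sum>jx\<in>{1..n-1} \<times> {1..D}. seq_scale (\<zeta> (fst jx) (snd jx)) (u1 jx)) + (\<Sum>c\<in>B. seq_scale (\<zeta> n c) (u2 c))
     + (\<Sum>c\<in>bad \<inter> {1..D}. seq_scale (\<zeta> n c) (u3 c))" (is "z = ?r1 + ?r2 + ?r3")
   proof (intro ext)
    fix l y
    have 1: "?r1 l y = (if l \<in> {1..n-1} & y \<in> {1..D} then \<zeta> l y else 0)"
    proof -
     have "?r1 l y = (\<Sum>jx\<in>{1..n-1} \<times> {1..D}. if jx = (l, y) then \<zeta> l y else 0)"
      unfolding sa by (intro sum.cong refl) (auto simp: u1_def split: if_splits)
     then show ?thesis by (simp add: sum.delta)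
    qed
    have 2: "?r2 l y = (if l = n & y \<in> {1..D} - bad then \<zeta> n (mk y) else 0)"
    proof -
     have "?r2 l y = (\<Sum>c\<in>B. if c = mk y then (if l = n & y \<in> {1..D} - bad then \<zeta> n (mk y) else 0) else 0)"
      unfolding sa by (intro sum.cong refl) (auto simp: u2_def split: if_splits)
     then show ?thesis using fB mk[of y] by (auto simp: sum.delta)
    qed
    have 3: "?r3 l y = (if l = n & y \<in> bad \<inter> {1..D} then \<zeta> n y else 0)"
    proof -
     have "?r3 l y = (\<Sum>c\<in>bad \<inter> {1..D}. if c = y then (if l = n then \<zeta> n y else 0) else 0)"
      unfolding sa by (intro sum.cong refl) (auto simp: u3_def u1_def split: if_splits)
     then show ?thesis by (simp add: sum.delta)
    qed
    have fin: "\<zeta> l y = 0" if "l \<in> {1..n-1}" "y \<notin> {1..D}"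
     using core3[of l] that by (auto simp: fin_carrier_def)
    have "(?r1 + ?r2 + ?r3) l y = ?r1 l y + ?r2 l y + ?r3 l y" by simp
    then show "z l y = (?r1 + ?r2 + ?r3) l y" unfolding 1 2 3 using fin n by (auto simp: z_def)
   qed
   also have "\<dots> \<in> seq.span B0"
    using i1 i2 i3 by (intro seq.span_add seq.span_sum seq.span_scale) auto
   finally show ?thesis .
  qed
  have diff: "?nd (\<zeta> j - zz z j) <= 2 * real Lc * (2 * real n * E)" if j: "j \<in> {1..n}" for j
  proof (cases "j = n")
   case False
   then have "\<zeta> j - zz z j = (%_. 0)" using j by (auto simp: zz_def z_def)
   then show ?thesis using E0 by simp
  next
   case True
   define v where "v = (\<Sum>j=1..n. perm_act (t (b j)) (\<zeta> j) - \<zeta> j)"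
   \<comment> \<open>The relation with its error v; the terms with j < n sum to -U z because z
     agrees with \<zeta> in those slots. Applying \<open>Qo\<close> shows that the reconstruction is
     off by \<open>Qo v\<close> only.\<close>
   have dz: "perm_act (t (b n)) (\<zeta> n) - \<zeta> n = v + U z"
   proof -
    have ins: "{1..n} = insert n {1..n-1}" using n by auto
    have nin: "n \<notin> {1..n-1}" using n by auto
    have "v = (perm_act (t (b n)) (\<zeta> n) - \<zeta> n) + (\<Sum>j=1..n-1. perm_act (t (b j)) (\<zeta> j) - \<zeta> j)"
     unfolding v_def ins by (rule sum.insert[OF finite_atLeastAtMost nin])
    moreover have "(\<Sum>j=1..n-1. perm_act (t (b j)) (\<zeta> j) - \<zeta> j) = - U z"
     unfolding U_def minus_minus by (intro sum.cong refl) (simp add: z_def)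
    ultimately show ?thesis by simp
   qed
   have "?nd (\<zeta> j - zz z j) = ?nd (Qo v)"
   proof (rule lp_norm_cong)
    fix y assume y: "y \<in> {1..D}"
    have "\<zeta> n y = z n y + Qo (perm_act (t (b n)) (\<zeta> n) - \<zeta> n) y"
    proof (cases "y \<in> bad")
     case True
     then show ?thesis using y n Qo(5)[OF True] by (auto simp: z_def)
    next
     case False
     have "perm_act (t (b n)) (\<zeta> n) - \<zeta> n = (%x. \<zeta> n (inv_into UNIV (t (b n)) x) - \<zeta> n x)"
      by (auto simp: perm_act_def)
     then show ?thesis using y n Qo(4)[of y "\<zeta> n"] False by (auto simp: z_def)
    qed
    then have "(\<zeta> j - zz z j) y = Qo v y" unfolding dz Qo(1) using True by (simp add: zz_def)
    then show "cmod ((\<zeta> j - zz z j) y) = cmod (Qo v y)" by simp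
   qed
   also have "\<dots> <= 2 * real Lc * ?nd v" by (rule Qo(3)[OF r1])
   also have "\<dots> <= 2 * real Lc * (2 * real n * E)" using core2 unfolding v_def by (intro mult_left_mono) auto
   finally show ?thesis .
  qed
  have small: "?nd (T (S l) - push_forward t (zz z) (P l)) <= min \<kappa> 1" if l: "l < L" for l
  proof -
   have "?nd (push_forward t \<zeta> (P l) - push_forward t (zz z) (P l)) <= weight (P l) * (2 * real Lc * (2 * real n * E))"
    using P(1)[OF l] diff F(1) by (intro push_forward_diff_norm t) blast+
   also have "\<dots> <= W * (2 * real Lc * (2 * real n * E))"
    using P(4)[OF l] E0 by (intro mult_right_mono) auto
   finally have "?nd (T (S l) - push_forward t (zz z) (P l)) <= (\<epsilon>' + W * E) + W * (2 * real Lc * (2 * real n * E))"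
    using core1[OF l] fin_norm_diff[OF r1, where u = "T (S l)" and v = "push_forward t \<zeta> (P l)" and w = "push_forward t (zz z) (P l)" and d = D]
    by linarith
   also have "\<dots> = \<epsilon>' + W * (1 + 4 * real Lc * real n) * E" by (simp add: algebra_simps)
   finally show ?thesis using tot unfolding E_def by linarith
  qed
  have xw: "?nd ((x - \<Lambda> z) l) = (if l < L then ?nd (T (S l) - push_forward t (zz z) (P l)) else if l < m then ?nd (T (S l)) else 0)" for l
  proof -
   have "?nd ((x - \<Lambda> z) l) = ?nd (if l < L then T (S l) - push_forward t (zz z) (P l) else if l < m then T (S l) else (%_. 0))"
    using P(2) by (intro lp_norm_cong) (auto simp: T(1) alpha_def \<Lambda>_def)
   then show ?thesis by simp
  qed
  have TS: "?nd (T (S l)) <= C" if l: "l < m" for l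
  proof -
   have "s l \<in> OZ F m" using OZ_word[OF F(1), of "[\<one>]" m l] F(2) l m s(1) Aone by simp
   then show ?thesis using hom_props(2)[OF T(2) F(1), of "s l"] sb(1)[of l] s(2)[of l] by simp
  qed
  show "\<exists>w\<in>seq.span (\<Lambda> ` B0). seq_norm (ereal r) D \<rho> (x - w) < \<epsilon>"
  proof (rule bexI[of _ "\<Lambda> z"])
   show "\<Lambda> z \<in> seq.span (\<Lambda> ` B0)" unfolding sp using zspan by (rule imageI)
   show "seq_norm (ereal r) D \<rho> (x - \<Lambda> z) < \<epsilon>"
   proof (rule seq_norm_less[OF _ _ _ tail])
    show "?nd ((x - \<Lambda> z) l) <= C + 1" for l
     unfolding xw using small[of l] TS[of l] sb(2) by auto
    show "?nd ((x - \<Lambda> z) l) <= \<kappa>" if "l < L" for l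
     unfolding xw using small[OF that] that by simp
   qed simp_all
  qed
 qed
qed

text \<open>The element b n has infinite order, so cycles shorter than \<open>Lc\<close> are rare,
  and markers and bad points together cost less than \<eta> d dimensions beyond (n - 1) d.\<close>

theorem upper_bound:
 fixes n :: nat
 assumes n: "1 <= n" and e: "!!j. j \<in> {1..n} ==> e j \<in> Z" and b: "!!j. j \<in> {1..n} ==> b j \<in> carrier G"
  and dense: "!!f \<epsilon>. f \<in> Z ==> 0 < \<epsilon> ==> EX P. (\<forall>p\<in>set P. fst (snd p) \<in> carrier G & snd (snd p) \<in> {1..n}) &
   N (f - lcomb (%(c, g, j). A g (e j)) P) < \<epsilon>"
  and rel: "N (\<Sum>j=1..n. A (b j) (e j) - e j) = 0"
  and ord: "!!k. 0 < k ==> b n [^] (k :: nat) ~= \<one>"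
 shows "sofic_dim (ereal r) G V act d \<sigma> S \<rho> <= ereal (real n - 1)"
proof (rule sofic_dim_le)
 fix \<epsilon> \<eta> :: real assume eps: "0 < \<epsilon>" and eta: "0 < \<eta>"
 \<comment> \<open>There will be at most d / Lc markers, which is less than \<eta> d / 2.\<close>
 obtain Lc :: nat where Lc: "2 / \<eta> < real Lc" using reals_Archimedean2 by blast
 have Lc0: "0 < Lc" using Lc eta by (cases Lc) (auto simp: field_simps)
 have Lc1: "1 / real Lc < \<eta> / 2" using Lc eta Lc0 by (simp add: field_simps)
 obtain C where C: "0 < C" "!!l. N (s l) <= C" using s_bounded by blast
 obtain L \<kappa> where kap: "0 < \<kappa>" and tail0: "ALL f. (ALL l. cmod (f l) <= C + 1) --> (\<forall>l<L. cmod (f l) <= \<kappa>) --> \<rho> f < \<epsilon>"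
  using product_norm_tail'[OF prod eps, of "C + 1"] C(1) by auto
 have tail: "\<rho> f < \<epsilon>" if "!!l. cmod (f l) <= C + 1" "!!l. l < L ==> cmod (f l) <= \<kappa>" for f
  using tail0 that by simp
 define \<epsilon>1 where "\<epsilon>1 = min \<kappa> 1"
 have e1: "0 < \<epsilon>1" using kap by (simp add: \<epsilon>1_def)
 have "ALL l. EX P. (\<forall>p\<in>set P. fst (snd p) \<in> carrier G & snd (snd p) \<in> {1..n}) & N (s l - lcomb (%(c, g, j). A g (e j)) P) < \<epsilon>1 / 4"
  by (intro allI dense s) (use e1 in simp)
 from choice[OF this] obtain P where P: "ALL l. (\<forall>p\<in>set (P l). fst (snd p) \<in> carrier G & snd (snd p) \<in> {1..n}) & N (s l - lcomb (%(c, g, j). A g (e j)) (P l)) < \<epsilon>1 / 4" ..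
 have P1: "g \<in> carrier G" "j \<in> {1..n}" if "(c, g, j) \<in> set (P l)" for c g j l
  using P[rule_format, of l] that by force+
 define W where "W = 1 + (\<Sum>l<L. weight (P l))"
 have W: "1 <= W" by (simp add: W_def sum_nonneg)
 have PW: "weight (P l) <= W" if "l < L" for l
  using member_le_sum[of l "{..<L}" "%l. weight (P l)"] that by (simp add: W_def)
 \<comment> \<open>The total factor of the error \<mu> + 2 K \<delta> in
   \<open>upper_step\<close>.\<close>
 define D0 where "D0 = W * (1 + 4 * real Lc * real n)"
 have D0: "0 < D0" unfolding D0_def using W by (intro mult_pos_pos add_pos_nonneg) auto
 define \<mu> where "\<mu> = \<epsilon>1 / (4 * D0)"
 have mu: "0 < \<mu>" using e1 D0 by (simp add: \<mu>_def)
 have "ALL j. EX P. j \<in> {1..n} --> (\<forall>p\<in>set P. fst (snd p) \<in> carrier G) & N (e j - lcomb (%(c, g, l). A g (s l)) P) < \<mu>"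
 proof
  fix j
  show "EX P. j \<in> {1..n} --> (\<forall>p\<in>set P. fst (snd p) \<in> carrier G) & N (e j - lcomb (%(c, g, l). A g (s l)) P) < \<mu>"
  proof (cases "j \<in> {1..n}")
   case True
   show ?thesis
   proof (rule s_dense[OF e[OF True] mu], goal_cases)
    case (1 P)
    then have "\<forall>p\<in>set P. fst (snd p) \<in> carrier G" by auto
    then show ?case using 1(2) by blast
   qed
  next
   case False
   then show ?thesis by blast
  qed
 qed
 from choice[OF this] obtain P' where P': "ALL j. j \<in> {1..n} --> (\<forall>p\<in>set (P' j). fst (snd p) \<in> carrier G) & N (e j - lcomb (%(c, g, l). A g (s l)) (P' j)) < \<mu>" ..
 define K where "K = 1 + (\<Sum>j=1..n. weight (P' j))"
 have K: "1 <= K" by (simp add: K_def sum_nonneg)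
 have PK: "weight (P' j) <= K" if "j \<in> {1..n}" for j
  using member_le_sum[of j "{1..n}" "%j. weight (P' j)"] that by (simp add: K_def)
 \<comment> \<open>Makes 2 K \<delta> at most \<mu>, so that the errors add up to at most
   \<epsilon>1 / 4 + 2 D0 \<mu> = 3 \<epsilon>1 / 4.\<close>
 define \<delta>0 where "\<delta>0 = \<epsilon>1 / (8 * D0 * K)"
 have d0: "0 < \<delta>0" using e1 D0 K by (simp add: \<delta>0_def)
 define F0 where "F0 = {\<one>} \<union> b ` {1..n} \<union> (\<Union>l<L. (%p. fst (snd p)) ` set (P l)) \<union> (\<Union>j\<in>{1..n}. (%p. fst (snd p)) ` set (P' j))"
 define M where "M = (\<Union>j\<in>{1..n}. (%p. snd (snd p)) ` set (P' j))"
 have "finite M" by (simp add: M_def)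
 then obtain m1 where m1: "M \<subseteq> {..<m1}" using finite_nat_bounded by blast
 define m0 where "m0 = 2 + L + m1"
 have F0: "finite F0" "F0 \<subseteq> carrier G" "\<one> \<in> F0"
 proof -
  show "finite F0" by (simp add: F0_def)
  show "F0 \<subseteq> carrier G"
  proof
   fix g assume "g \<in> F0"
   then consider "g = \<one>" | j where "j \<in> {1..n}" "g = b j" | l p where "p \<in> set (P l)" "g = fst (snd p)"
    | j p where "j \<in> {1..n}" "p \<in> set (P' j)" "g = fst (snd p)"
    unfolding F0_def by blast
   then show "g \<in> carrier G"
   proof cases
    case 1 then show ?thesis by simp
   next
    case 2 then show ?thesis using b by simp
   next
    case 3 then show ?thesis using P by simp
   next
    case 4 then show ?thesis using P' by simp
   qed
  qed
  show "\<one> \<in> F0" by (simp add: F0_def)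
 qed
 have PF: "g \<in> F0 & j \<in> {1..n}" if l: "l < L" and p: "(c, g, j) \<in> set (P l)" for l c g j
 proof -
  have "fst (snd (c, g, j)) \<in> (%p. fst (snd p)) ` set (P l)" using p by (rule imageI)
  then have "g \<in> F0" unfolding F0_def using l by auto
  then show ?thesis using P1(2)[OF p] by simp
 qed
 have PF': "g \<in> F0 & l < m1" if j: "j \<in> {1..n}" and p: "(c, g, l) \<in> set (P' j)" for j c g l
 proof -
  have "fst (snd (c, g, l)) \<in> (%p. fst (snd p)) ` set (P' j)" "snd (snd (c, g, l)) \<in> (%p. snd (snd p)) ` set (P' j)"
   using p by (rule imageI)+
  then have "g \<in> F0" "l \<in> M" unfolding F0_def M_def using j by auto
  then show ?thesis using m1 by auto
 qed
 have bF: "b j \<in> F0" if "j \<in> {1..n}" for j using that by (auto simp: F0_def)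
 have bn: "b n \<in> carrier G" using b[of n] n by simp
 have "b n [^] (1 :: nat) ~= \<one>" by (rule ord) simp
 then have "b n ~= \<one>" using bn by (auto simp: nat_pow_def)
 then have dpos: "\<forall>\<^sub>F i in sequentially. 0 < d i" using hamming_one(2)[OF bn one_closed] by blast
 define bad where "bad = (%i. {x. EX k. 0 < k & k < Lc & (\<sigma> i (b n) ^^ k) x = x})"
 have "rare d bad" unfolding bad_def by (rule rare_short_cycles[OF bn ord])
 then have bad0: "(%i. real (card (bad i \<inter> {1..d i})) / real (d i)) \<longlonglongrightarrow> 0" unfolding rare_def .
 have bad_small: "\<forall>\<^sub>F i in sequentially. real (card (bad i \<inter> {1..d i})) / real (d i) < \<eta> / 2"
  by (rule order_tendstoD(2)[OF bad0]) (use eta in simp)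
 show "\<exists>t0\<in>sofic_triples G. \<forall>t\<in>sofic_triples G. triple_le t0 t -->
  (\<forall>\<^sub>F i in sequentially. norm_eps_dim (ereal r) V act d \<sigma> S \<rho> \<epsilon> t i <= ereal (real n - 1 + \<eta>))"
 proof (intro bexI ballI impI)
  show "(F0, m0, \<delta>0) \<in> sofic_triples G" using F0 d0 by (simp add: sofic_triples_def)
  fix tr assume tr: "tr \<in> sofic_triples G" "triple_le (F0, m0, \<delta>0) tr"
  obtain F m \<delta> where trd: "tr = (F, m, \<delta>)" by (metis surj_pair)
  have F: "F \<subseteq> carrier G" "\<one> \<in> F" "F0 \<subseteq> F" "m0 <= m" "\<delta> <= \<delta>0" "0 < \<delta>"
   using tr by (auto simp: trd sofic_triples_def triple_le_def)
  show "\<forall>\<^sub>F i in sequentially. norm_eps_dim (ereal r) V act d \<sigma> S \<rho> \<epsilon> tr i <= ereal (real n - 1 + \<eta>)"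
   using dpos bad_small
  proof eventually_elim
   case (elim i)
   define D where "D = d i"
   have t: "\<sigma> i g permutes {1..D}" if "g \<in> carrier G" for g unfolding D_def by (rule sigma_perm[OF that])
   note tb = t[OF bn]
   \<comment> \<open>\<open>perm_act\<close> composes with the inverse permutation, so the markers
     are taken for the inverse; it has the same short cycles.\<close>
   have sfix: "x \<in> bad i" if x: "0 < k" "k < Lc" "(inv_into UNIV (\<sigma> i (b n)) ^^ k) x = x" for x k
   proof -
    have "(\<sigma> i (b n) ^^ k) ((inv_into UNIV (\<sigma> i (b n)) ^^ k) x) = x" for x
    proof (induction k arbitrary: x)
     case (Suc k)
     have "(\<sigma> i (b n) ^^ Suc k) y = (\<sigma> i (b n) ^^ k) (\<sigma> i (b n) y)" for y by (simp add: funpow_swap1)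
     then show ?case using Suc permutes_inverses(1)[OF tb] by simp
    qed simp
    from this[of x] have "(\<sigma> i (b n) ^^ k) x = x" unfolding x(3) .
    then show ?thesis using x by (auto simp: bad_def)
   qed
   have main: "norm_eps_dim (ereal r) V act d \<sigma> S \<rho> \<epsilon> tr i <= ereal (real n - 1 + \<eta>)"
    if cB: "card B * Lc <= D" and
     eps: "eps_dim (ereal r) D \<rho> \<epsilon> (alpha S m ` almost_hom (ereal r) V act D (\<sigma> i) S F m \<delta>) <= ereal (real ((n - 1) * D + card B + card (bad i \<inter> {1..D})))"
    for B :: "nat set"
   proof -
    have D: "0 < real D" using elim by (simp add: D_def)
    have "norm_eps_dim (ereal r) V act d \<sigma> S \<rho> \<epsilon> tr i <= ereal (1 / real D) * ereal (real ((n - 1) * D + card B + card (bad i \<inter> {1..D})))"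
     unfolding norm_eps_dim_def trd prod.case D_def[symmetric] by (intro ereal_mult_left_mono eps) simp
    also have "\<dots> = ereal (real (n - 1) + real (card B) / real D + real (card (bad i \<inter> {1..D})) / real D)"
     using D by (simp add: field_simps)
    also have "\<dots> <= ereal (real n - 1 + \<eta>)"
    proof -
     have "real (card B) * real Lc <= real D" using cB by (metis of_nat_le_iff of_nat_mult)
     then have "real (card B) / real D <= 1 / real Lc" using D Lc0 by (simp add: field_simps)
     moreover have "real (n - 1) = real n - 1" using n by (simp add: of_nat_diff)
     ultimately show ?thesis using Lc1 elim(2) unfolding D_def[symmetric] ereal_less_eq(3) by linarith
    qed
    finally show ?thesis .
   qed
   have tot: "\<epsilon>1 / 4 + W * (1 + 4 * real Lc * real n) * (\<mu> + 2 * K * \<delta>) <= min \<kappa> 1"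
   proof -
    have "2 * K * \<delta> <= 2 * K * \<delta>0" using F(5) K by (intro mult_left_mono) auto
    also have "\<dots> = \<mu>" using K D0 by (simp add: \<delta>0_def \<mu>_def)
    finally have "D0 * (\<mu> + 2 * K * \<delta>) <= D0 * (2 * \<mu>)" using D0 by (intro mult_left_mono) auto
    also have "\<dots> = \<epsilon>1 / 2" using D0 by (simp add: \<mu>_def)
    finally show ?thesis using e1 unfolding D0_def[symmetric] \<epsilon>1_def[symmetric] by linarith
   qed
   show ?case
   proof (rule orbit_decomposition[OF permutes_inv[OF tb] Lc0, of "bad i"], goal_cases)
    case (1 x k)
    show ?case by (rule sfix[OF 1(2,3,4)])
   next
    case (2 B mk Qo)
    show ?case
    proof (rule main[OF 2(2)], rule upper_step)
     show "F \<subseteq> carrier G" "\<one> \<in> F" by (rule F)+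
     show "\<sigma> i g permutes {1..D}" if "g \<in> carrier G" for g by (rule t[OF that])
     show "2 <= m" "L <= m" using F(4) by (auto simp: m0_def)
     show "e j \<in> Z" if "j \<in> {1..n}" for j by (rule e[OF that])
     show "g \<in> F & j \<in> {1..n}" if "l < L" "(c, g, j) \<in> set (P l)" for l c g j
      using PF[OF that] F(3) by auto
     show "N (s l - lcomb (%(c, g, j). A g (e j)) (P l)) <= \<epsilon>1 / 4" if "l < L" for l using P[rule_format, of l] by simp
     show "weight (P l) <= W" if "l < L" for l by (rule PW[OF that])
     show "g \<in> F & l < m" if "j \<in> {1..n}" "(c, g, l) \<in> set (P' j)" for j c g l
      using PF'[OF that] F(3,4) by (auto simp: m0_def)
     show "N (e j - lcomb (%(c, g, l). A g (s l)) (P' j)) <= \<mu>" if "j \<in> {1..n}" for j using P'[rule_format, OF that] by simp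
     show "weight (P' j) <= K" if "j \<in> {1..n}" for j by (rule PK[OF that])
     show "b j \<in> F" if "j \<in> {1..n}" for j using bF[OF that] F(3) by auto
     show "N (\<Sum>j=1..n. A (b j) (e j) - e j) = 0" by (rule rel)
     show "0 <= \<delta>" "0 <= \<mu>" "0 <= K" "0 <= W" "0 <= C" using F(6) mu K W C by auto
     show "1 <= n" by (rule n)
     show "N (s l) <= C" for l by (rule C(2))
     show "\<rho> f < \<epsilon>" if "!!l. cmod (f l) <= C + 1" "!!l. l < L ==> cmod (f l) <= \<kappa>" for f by (rule tail[OF that])
     show "\<epsilon>1 / 4 + W * (1 + 4 * real Lc * real n) * (\<mu> + 2 * K * \<delta>) <= min \<kappa> 1" by (rule tot)
     show "B \<subseteq> {1..D}" by (rule 2(1))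
     show "mk x \<in> B" if "x \<in> {1..D} - bad i" for x by (rule 2(3)[OF that])
     show "Qo (u + v) = Qo u + Qo v" for u v by (rule 2(4))
     show "Qo (%x. c * u x) = (%x. c * Qo u x)" for c u by (rule 2(5))
     show "lpn r {1..D} (Qo u) <= 2 * real Lc * lpn r {1..D} u" if "1 <= r" for r u by (rule 2(7)[OF that])
     show "\<zeta> x = \<zeta> (mk x) + Qo (%x. \<zeta> (inv_into UNIV (\<sigma> i (b n)) x) - \<zeta> x) x" if "x \<in> {1..D} - bad i" for \<zeta> x
      by (rule 2(8)[OF that])
     show "Qo u x = 0" if "x \<in> bad i" for u x by (rule 2(9)[OF that])
    qed
   qed
  qed
 qed
qed

end

section \<open>From approximating subspaces to approximated vectors\<close>

text \<open>Moves point masses along words; this is how equivariance of the orbit maps is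
  checked.\<close>

lemma foldr_perm_act_delta:
 assumes "!!h. h \<in> set gs ==> bij (t h)"
 shows "foldr (%g. perm_act (t g)) gs (%x. \<Sum>g\<in>E. if y g = x then c g else 0) =
  (%x. \<Sum>g\<in>E. if foldr t gs (y g) = x then c g else (0 :: complex))"
 using assms
proof (induction gs)
 case (Cons h gs)
 have "bij (t h)" using Cons.prems by simp
 then have "z = inv_into UNIV (t h) x \<longleftrightarrow> t h z = x" for z x by (rule bij_inv_eq_iff)
 then show ?case using Cons by (simp add: perm_act_def)
qed simp

text \<open>Distinct points carry one coefficient each, so power sums of the function are power sums
  of the coefficients. Applied to norms and to Hilbert-Schmidt sums.\<close>

lemma delta_sum:
 fixes D :: nat and \<phi> :: "complex => real"
 assumes E: "finite E" and y: "inj_on y E" "!!g. g \<in> E ==> y g \<in> {1..D}" and \<phi>: "\<phi> 0 = 0"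
 shows "(\<Sum>x\<in>{1..D}. \<phi> (\<Sum>g\<in>E. if y g = x then c g else 0)) = (\<Sum>g\<in>E. \<phi> (c g))"
proof -
 have v: "(\<Sum>g\<in>E. if y g = x then c g else 0) = c g0" if "g0 \<in> E" "x = y g0" for x g0
 proof -
  have "(\<Sum>g\<in>E. if y g = x then c g else 0) = (\<Sum>g\<in>E. if g = g0 then c g else 0)"
   using that y(1) by (intro sum.cong refl) (auto simp: inj_on_def)
  then show ?thesis using E that by simp
 qed
 have "(\<Sum>x\<in>{1..D}. \<phi> (\<Sum>g\<in>E. if y g = x then c g else 0)) = (\<Sum>x\<in>y ` E. \<phi> (\<Sum>g\<in>E. if y g = x then c g else 0))"
 proof (rule sum.mono_neutral_right)
  show "\<forall>x\<in>{1..D} - y ` E. \<phi> (\<Sum>g\<in>E. if y g = x then c g else 0) = 0"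
  proof
   fix x assume "x \<in> {1..D} - y ` E"
   then have "(\<Sum>g\<in>E. if y g = x then c g else 0) = 0" by (intro sum.neutral) auto
   then show "\<phi> (\<Sum>g\<in>E. if y g = x then c g else 0) = 0" using \<phi> by simp
  qed
 qed (use y in auto)
 also have "\<dots> = (\<Sum>g\<in>E. \<phi> (c g))"
  unfolding sum.reindex[OF y(1)] o_def by (intro sum.cong refl) (simp add: v)
 finally show ?thesis .
qed

lemma delta_sum_norm:
 fixes D :: nat
 assumes r: "1 <= r" and E: "finite E" and y: "inj_on y E" "!!g. g \<in> E ==> y g \<in> {1..D}"
 shows "lpn r {1..D} (%x. \<Sum>g\<in>E. if y g = x then c g else 0) = lpn r E c"
 using delta_sum[OF E y, of "%z. cmod z powr r" c] E r unfolding lp_norm_ereal infsum_finite[OF finite_atLeastAtMost] by simp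

context sofic_data begin

text \<open>Being bounded by N, the map \<tau> agrees on representatives at N-distance 0, so it
  descends to V through an arbitrary choice of representatives.\<close>

lemma almost_hom_exists:
 fixes D :: nat
 assumes F: "F \<subseteq> carrier G" and t: "!!f g. f \<in> Z ==> g \<in> Z ==> \<tau> (f + g) = \<tau> f + \<tau> g"
  "!!c f. f \<in> Z ==> \<tau> (cs c f) = cs c (\<tau> f)" "!!f. f \<in> Z ==> \<tau> f \<in> fin_carrier D"
  "!!f. f \<in> Z ==> lpn r {1..D} (\<tau> f) <= N f"
  "!!gs j. set gs \<subseteq> F ==> length gs \<in> {1..m} ==> j < m ==>
   lpn r {1..D} (\<tau> (foldr A gs (s j)) - foldr (%g. perm_act (t g)) gs (\<tau> (s j))) < \<delta>"
 shows "EX T. T \<in> almost_hom (ereal r) V act D t S F m \<delta> & (\<forall>f\<in>Z. T (Q f) = \<tau> f)"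
proof -
 define T where "T = (%u. \<tau> (SOME f. f \<in> Z & Q f = u))"
 have TQ: "T (Q f) = \<tau> f" if f: "f \<in> Z" for f
 proof -
  define g where "g = (SOME g. g \<in> Z & Q g = Q f)"
  have g: "g \<in> Z" "Q g = Q f" using someI[of "%g. g \<in> Z & Q g = Q f" f] f by (auto simp: g_def)
  have h: "g - f \<in> Z" by (rule Zminus[OF g(1) f])
  have "lpn r {1..D} (\<tau> (g - f)) <= 0" using t(4)[OF h] Q_eq_N0[OF g(1) f g(2)] by simp
  then have n0: "lpn r {1..D} (\<tau> (g - f)) = 0" by (simp add: order_antisym)
  have "\<tau> (g - f) x = 0" for x
  proof (cases "x \<in> {1..D}")
   case True
   show ?thesis by (rule lp_norm_eq_0[OF _ _ n0 True]) (use r1 in auto)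
  next
   case False
   then show ?thesis using t(3)[OF h] by (auto simp: fin_carrier_def)
  qed
  then have z: "\<tau> (g - f) = 0" by (intro ext) simp
  have "\<tau> g = \<tau> (g - f) + \<tau> f" using t(1)[OF h f] by simp
  then show ?thesis unfolding z by (simp add: T_def g_def)
 qed
 have O: "u \<in> Q ` Z" if "u \<in> orbit_span V act S F m" for u
  using vspan_carrier[OF wgens_carrier[OF F]] that unfolding orbit_span_eq .
 have "T \<in> almost_hom (ereal r) V act D t S F m \<delta>"
  unfolding almost_hom_def mem_Collect_eq
 proof (intro conjI ballI allI impI)
  fix u assume "u \<in> orbit_span V act S F m"
  then obtain f where f: "f \<in> Z" "u = Q f" using O by blast
  show "T u \<in> fin_carrier D" using f TQ t(3) by simp
  show "lpn r {1..D} (T u) <= vnorm V u" using f TQ t(4) QN by simp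
  show "T (vscale V c u) = (%j. c * T u j)" for c
   using f TQ[OF Zscale[OF f(1)], of c] TQ[OF f(1)] t(2)[OF f(1), of c] by (simp add: Qscale)
  fix u' assume "u' \<in> orbit_span V act S F m"
  then obtain f' where f': "f' \<in> Z" "u' = Q f'" using O by blast
  show "T (vadd V u u') = T u + T u'" unfolding f(2) f'(2) Qadd[OF f(1) f'(1)]
   TQ[OF f(1)] TQ[OF f'(1)] TQ[OF Zadd[OF f(1) f'(1)]] by (rule t(1)[OF f(1) f'(1)])
 next
  fix gs j assume gs: "set gs \<subseteq> F & length gs \<in> {1..m} & j < m"
  have "set gs \<subseteq> carrier G" using gs F by auto
  note a = foldr_act[OF this s(1), of j]
  show "lpn r {1..D} (T (foldr act gs (S j)) - foldr (%g. perm_act (t g)) gs (T (S j))) < \<delta>"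
   using a t(5)[of gs j] gs TQ[OF s(1), of j] TQ[of "foldr A gs (s j)"] s(2)[of j] by simp
 qed
 then show ?thesis using TQ by blast
qed

text \<open>Transfers approximation from the generating sequence \<open>S\<close> to chosen vectors
  \<open>e k\<close>: fixed combinations \<open>P'\<close> express \<open>e k\<close> through the
  orbit of \<open>S\<close>, so T (e k) is close to the push forward of w. The parameters depend on
  neither D nor T.\<close>

lemma lower_approx:
 fixes n :: nat
 assumes eZ: "\<forall>k\<in>{1..n}. e k \<in> Z" and e2: "0 < \<epsilon>2"
 shows "\<exists>\<epsilon> F0 m0 \<delta>0 P'. 0 < \<epsilon> & (F0, m0, \<delta>0) \<in> sofic_triples G &
  (\<forall>D t F m \<delta> T w k. (\<forall>g\<in>carrier G. t g permutes {1..D}) & F0 \<subseteq> F & F \<subseteq> carrier G & m0 <= m & \<delta> <= \<delta>0 & 0 < \<delta> &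
   T \<in> almost_hom (ereal r) V act D t S F m \<delta> & (\<forall>f\<in>Z. lpn r {1..D} (T (Q f)) <= N f) &
   (\<forall>f\<in>Z. \<forall>g\<in>Z. T (Q (f - g)) = T (Q f) - T (Q g)) &
   w \<in> linf_seqs (ereal r) D & seq_norm (ereal r) D \<rho> (alpha S m T - w) < \<epsilon> & k \<in> {1..n} -->
   lpn r {1..D} (T (Q (e k)) - push_forward t w (P' k)) <= \<epsilon>2)"
proof -
 note e = eZ[rule_format]
 have "ALL j. EX P. j \<in> {1..n} --> (\<forall>p\<in>set P. fst (snd p) \<in> carrier G) & N (e j - lcomb (%(c, g, l). A g (s l)) P) < \<epsilon>2 / 4"
 proof
  fix j
  show "EX P. j \<in> {1..n} --> (\<forall>p\<in>set P. fst (snd p) \<in> carrier G) & N (e j - lcomb (%(c, g, l). A g (s l)) P) < \<epsilon>2 / 4"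
  proof (cases "j \<in> {1..n}")
   case True
   have "0 < \<epsilon>2 / 4" using e2 by simp
   show ?thesis
   proof (rule s_dense[OF e[OF True] \<open>0 < \<epsilon>2 / 4\<close>], goal_cases)
    case (1 P)
    then have "\<forall>p\<in>set P. fst (snd p) \<in> carrier G" by auto
    then show ?case using 1(2) by blast
   qed
  next
   case False
   then show ?thesis by blast
  qed
 qed
 from choice[OF this] obtain P' where P': "ALL j. j \<in> {1..n} --> (\<forall>p\<in>set (P' j). fst (snd p) \<in> carrier G) & N (e j - lcomb (%(c, g, l). A g (s l)) (P' j)) < \<epsilon>2 / 4" ..
 define K where "K = 1 + (\<Sum>j=1..n. weight (P' j))"
 have K: "1 <= K" by (simp add: K_def sum_nonneg)
 have PK: "weight (P' j) <= K" if "j \<in> {1..n}" for j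
  using member_le_sum[of j "{1..n}" "%j. weight (P' j)"] that by (simp add: K_def)
 define F0 where "F0 = {\<one>} \<union> (\<Union>j\<in>{1..n}. (%p. fst (snd p)) ` set (P' j))"
 define M where "M = (\<Union>j\<in>{1..n}. (%p. snd (snd p)) ` set (P' j))"
 have "finite M" by (simp add: M_def)
 then obtain m1 where m1: "M \<subseteq> {..<m1}" using finite_nat_bounded by blast
 \<comment> \<open>Equivariance and the replacement of T (S l) by w l each cost at most K \<delta>0
   = \<epsilon>2 / 4; density costs another \<epsilon>2 / 4.\<close>
 define \<delta>0 where "\<delta>0 = \<epsilon>2 / (4 * K)"
 have d0: "0 < \<delta>0" using e2 K by (simp add: \<delta>0_def)
 have PF': "g \<in> F0 & l < m1" if j: "j \<in> {1..n}" and p: "(c, g, l) \<in> set (P' j)" for j c g l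
 proof -
  have "fst (snd (c, g, l)) \<in> (%p. fst (snd p)) ` set (P' j)" "snd (snd (c, g, l)) \<in> (%p. snd (snd p)) ` set (P' j)"
   using p by (rule imageI)+
  then have "g \<in> F0" "l \<in> M" unfolding F0_def M_def using j by auto
  then show ?thesis using m1 by auto
 qed
 have tri0: "(F0, 1 + m1, \<delta>0) \<in> sofic_triples G"
  using P' d0 by (auto simp: sofic_triples_def F0_def)
 obtain Cs where Cs: "0 < Cs" "!!l. N (s l) <= Cs" using s_bounded by blast
 show ?thesis
 proof (rule product_norm_coord[OF prod d0, of m1], goal_cases)
  case (1 \<epsilon>)
  show ?case
  proof (intro exI conjI allI impI)
   show "0 < \<epsilon>" by (rule 1(1))
   show "(F0, 1 + m1, \<delta>0) \<in> sofic_triples G" by (rule tri0)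
   fix D t F m \<delta> T w k
   assume H: "(\<forall>g\<in>carrier G. t g permutes {1..D}) & F0 \<subseteq> F & F \<subseteq> carrier G & 1 + m1 <= m & \<delta> <= \<delta>0 & 0 < \<delta> &
    T \<in> almost_hom (ereal r) V act D t S F m \<delta> & (\<forall>f\<in>Z. lpn r {1..D} (T (Q f)) <= N f) &
    (\<forall>f\<in>Z. \<forall>g\<in>Z. T (Q (f - g)) = T (Q f) - T (Q g)) &
    w \<in> linf_seqs (ereal r) D & seq_norm (ereal r) D \<rho> (alpha S m T - w) < \<epsilon> & k \<in> {1..n}"
   then have t: "!!g. g \<in> carrier G ==> t g permutes {1..D}" and F: "F0 \<subseteq> F" "F \<subseteq> carrier G" "1 + m1 <= m" "\<delta> <= \<delta>0" "0 < \<delta>"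
    and T: "T \<in> almost_hom (ereal r) V act D t S F m \<delta>" and w: "w \<in> linf_seqs (ereal r) D"
    and sn: "seq_norm (ereal r) D \<rho> (alpha S m T - w) < \<epsilon>" and k: "k \<in> {1..n}"
    by blast+
   have Tb: "lpn r {1..D} (T (Q f)) <= N f" if "f \<in> Z" for f using H that by simp
   have Td: "T (Q (f - g)) = T (Q f) - T (Q g)" if "f \<in> Z" "g \<in> Z" for f g using H that by simp
   let ?nd = "lpn r {1..D}"
   obtain Cw where Cw: "!!l. ?nd (w l) <= Cw" using w by (auto simp: linf_seqs_def)
   have "bounded (range (%l. complex_of_real (?nd ((alpha S m T - w) l))))"
   proof (rule boundedI)
    fix y assume "y \<in> range (%l. complex_of_real (?nd ((alpha S m T - w) l)))"
    then obtain l where y: "y = complex_of_real (?nd ((alpha S m T - w) l))" by blast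
    have "?nd (alpha S m T l) <= Cs"
     using Tb[OF s(1), of l] Cs(1) Cs(2)[of l] s(2)[of l] by (simp add: alpha_def)
    moreover have "?nd ((alpha S m T - w) l) <= ?nd (alpha S m T l) + ?nd (w l)"
     using lp_minus(2)[OF r1, of "{1..D}" "alpha S m T l" "w l"] by (simp add: fun_diff_def)
    ultimately show "norm y <= Cs + Cw" using Cw[of l] unfolding y by simp
   qed
   then have "\<forall>l<m1. cmod (complex_of_real (?nd ((alpha S m T - w) l))) < \<delta>0"
    by (rule 1(2)) (use sn in \<open>simp add: seq_norm_def\<close>)
   then have close: "?nd (T (S l) - w l) <= \<delta>0" if l: "l < m1" for l
    using l F(3) by (auto simp: alpha_def less_imp_le)
   define f where "f = lcomb (%(c, g, l). A g (s l)) (P' k)"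
   have word1: "A g (s l) \<in> OZ F m & ?nd (T (Q (A g (s l))) - perm_act (t g) (T (S l))) <= \<delta>" if "g \<in> F" "l < m" for g l
    using OZ_word[OF F(2), of "[g]" m l] hom_props(5)[OF T F(2), of "[g]" l] that F(3) unfolding s(2) by simp
   have P1: "(case p of (c, g, l) => A g (s l)) \<in> OZ F m"
    "?nd (T (Q (case p of (c, g, l) => A g (s l))) - (case p of (c, g, l) => perm_act (t g) (T (S l)))) <= \<delta>" if p: "p \<in> set (P' k)" for p
   proof -
    obtain c g l where pp: "p = (c, g, l)" by (metis surj_pair)
    have gl: "g \<in> F" "l < m" using PF'[OF k, of c g l] p pp F(1,3) by auto
    show "(case p of (c, g, l) => A g (s l)) \<in> OZ F m"
     "?nd (T (Q (case p of (c, g, l) => A g (s l))) - (case p of (c, g, l) => perm_act (t g) (T (S l)))) <= \<delta>"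
     unfolding pp prod.case by (rule word1[OF gl, THEN conjunct1], rule word1[OF gl, THEN conjunct2])
   qed
   have "f \<in> OZ F m" unfolding f_def by (rule hom_lcomb(1)[OF T F(2) P1])
   then have fZ: "f \<in> Z" by (simp add: OZ_def)
   have "?nd (T (Q f) - push_forward t (%l. T (S l)) (P' k)) <= weight (P' k) * \<delta>"
    unfolding f_def push_forward_def by (rule hom_lcomb(2)[OF T F(2) P1])
   also have "\<dots> <= K * \<delta>0" using PK[OF k] F(4,5) K by (intro mult_mono) auto
   finally have 2: "?nd (T (Q f) - push_forward t (%l. T (S l)) (P' k)) <= K * \<delta>0" .
   have "?nd (push_forward t (%l. T (S l)) (P' k) - push_forward t w (P' k)) <= weight (P' k) * \<delta>0"
   proof (rule push_forward_diff_norm[OF t])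
    fix c g l assume "(c, g, l) \<in> set (P' k)"
    then show "g \<in> carrier G & ?nd (T (S l) - w l) <= \<delta>0" using PF'[OF k, of c g l] close[of l] F(1,2) by auto
   qed
   also have "\<dots> <= K * \<delta>0" using PK[OF k] d0 by (intro mult_right_mono) auto
   finally have 3: "?nd (push_forward t (%l. T (S l)) (P' k) - push_forward t w (P' k)) <= K * \<delta>0" .
   have "?nd (T (Q (e k)) - T (Q f)) <= N (e k - f)"
    using Td[OF e[OF k] fZ] Tb[OF Zminus[OF e[OF k] fZ]] by simp
   also have "\<dots> <= \<epsilon>2 / 4" using P'[rule_format, OF k] unfolding f_def by simp
   finally have 4: "?nd (T (Q (e k)) - T (Q f)) <= \<epsilon>2 / 4" .
   have "K * \<delta>0 = \<epsilon>2 / 4" using K by (simp add: \<delta>0_def)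
   then show "?nd (T (Q (e k)) - push_forward t w (P' k)) <= \<epsilon>2"
    using 2 3 4 e2 fin_norm_diff[OF r1, where d = D and u = "T (Q (e k))" and v = "T (Q f)" and w = "push_forward t w (P' k)"]
     fin_norm_diff[OF r1, where d = D and u = "T (Q f)" and v = "push_forward t (%l. T (S l)) (P' k)" and w = "push_forward t w (P' k)"]
    by linarith
  qed
 qed
qed

text \<open>One coefficient vector serves all combinations \<open>P\<close>. This bounds the rank of
  the matrices assembled from several of them.\<close>

lemma push_forward_span:
 assumes "finite B" "w \<in> seq.span B"
 shows "EX c. ALL P x. push_forward t w P x = (\<Sum>b\<in>B. c b * push_forward t b P x)"
proof -
 have "w \<in> range (%c. \<Sum>b\<in>B. seq_scale (c b) b)" using assms seq.span_finite[OF assms(1)] by simp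
 then obtain c where c: "w = (\<Sum>b\<in>B. seq_scale (c b) b)" by blast
 have z: "push_forward t (%_. 0) P = 0" for P
  using push_forward_scale[of t 0 "%_. 0" P] by (auto simp: fun_eq_iff zero_fun_def)
 have "push_forward t (\<Sum>b\<in>B. seq_scale (c b) b) P x = (\<Sum>b\<in>B. c b * push_forward t b P x)" for P x
  using assms(1)
 proof (induction B rule: finite_induct)
  case empty
  show ?case using z[of P] by (simp add: zero_fun_def)
 next
  case (insert b B)
  have "(\<Sum>b\<in>insert b B. seq_scale (c b) b) = (%l. (%x. c b * b l x) + (\<Sum>b\<in>B. seq_scale (c b) b) l)"
   unfolding sum.insert[OF insert.hyps] by (auto simp: fun_eq_iff seq_scale_def)
  then have "push_forward t (\<Sum>b\<in>insert b B. seq_scale (c b) b) P x = c b * push_forward t b P x + push_forward t (\<Sum>b\<in>B. seq_scale (c b) b) P x"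
   using push_forward_add[of t "%l x. c b * b l x" "\<Sum>b\<in>B. seq_scale (c b) b" P] push_forward_scale[of t "c b" b P] by simp
  then show ?case by (simp only: insert.IH sum.insert[OF insert.hyps])
 qed
 then show ?thesis unfolding c by blast
qed

text \<open>Each letter of the word contributes one failure set of multiplicativity.\<close>

lemma rare_word:
 "set gs \<subseteq> carrier G ==> g \<in> carrier G ==>
  rare d (%i. {v. foldr (\<sigma> i) gs (\<sigma> i g v) ~= \<sigma> i (foldr (\<otimes>) gs g) v})"
proof (induction gs)
 case Nil
 show ?case by (simp add: rare_def)
next
 case (Cons h gs)
 have c: "foldr (\<otimes>) gs g \<in> carrier G" using Cons.prems by (induction gs) auto
 have "rare d (%i. {v. foldr (\<sigma> i) gs (\<sigma> i g v) ~= \<sigma> i (foldr (\<otimes>) gs g) v} \<union>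
   {v. \<sigma> i (h \<otimes> foldr (\<otimes>) gs g) v ~= \<sigma> i h (\<sigma> i (foldr (\<otimes>) gs g) v)})"
  using Cons c by (intro rare_Un rare_mult) auto
 then show ?case by (rule rare_subset) auto
qed

end

section \<open>The trace argument\<close>

text \<open>The weighted form of the square of a sum: the slack is a square divided by x. A small x
  keeps the factor of the main term near 1.\<close>

lemma square_split:
 fixes u w :: complex
 assumes x: "0 < (x :: real)"
 shows "(cmod w)\<^sup>2 <= (1 + x) * (cmod u)\<^sup>2 + (1 + 1 / x) * (cmod (u - w))\<^sup>2"
proof -
 have "cmod w <= cmod u + cmod (u - w)" using norm_triangle_ineq4[of u "u - w"] by simp
 then have "(cmod w)\<^sup>2 <= (cmod u + cmod (u - w))\<^sup>2" by (intro power_mono) auto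
 moreover have "0 <= (x * cmod u - cmod (u - w))\<^sup>2 / x" using x by simp
 moreover have "(1 + x) * (cmod u)\<^sup>2 + (1 + 1 / x) * (cmod (u - w))\<^sup>2
   = (cmod u + cmod (u - w))\<^sup>2 + (x * cmod u - cmod (u - w))\<^sup>2 / x"
  using x by (simp add: field_simps power2_eq_square)
 ultimately show ?thesis by linarith
qed

text \<open>The rows of M at good y approximate those of T, the rows at bad y are 0, and all of them
  lie in a span of card B vectors. \<open>trace_le_rank\<close> compares the trace, about n \<alpha>
  D, with the squared Hilbert-Schmidt norm, at most about s D.\<close>

lemma trace_count:
 fixes D n :: nat and M T :: "nat \<times> nat => nat \<times> nat => complex" and x \<alpha> s :: real
 defines "I \<equiv> {1..D} \<times> {1..n}"
 assumes B: "finite B" and M: "!!i. i \<in> I ==> EX c. \<forall>i'\<in>I. M i i' = (\<Sum>b\<in>B. c b * v b i')"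
  and good: "good \<subseteq> {1..D}" "(1 - x) * real D <= real (card good)"
  and zero: "!!y j i'. y \<in> {1..D} - good ==> M (y, j) i' = 0"
  and app: "!!y j. y \<in> good ==> j \<in> {1..n} ==> (\<Sum>i'\<in>I. (cmod (T (y, j) i' - M (y, j) i'))\<^sup>2) <= real n * x\<^sup>2"
  and sq: "!!y. y \<in> good ==> (\<Sum>j=1..n. \<Sum>i'\<in>I. (cmod (T (y, j) i'))\<^sup>2) <= s"
  and diag: "!!y j. y \<in> good ==> j \<in> {1..n} ==> cmod (of_real \<alpha> - M (y, j) (y, j)) <= x"
  and x: "0 < x" "x < 1" "x <= \<alpha>" and s: "0 <= s" and D: "0 < D"
 shows "((1 - x) * real n * (\<alpha> - x))\<^sup>2 * real D <= real (card B) * ((1 + x) * s + (real n)\<^sup>2 * (x\<^sup>2 + x))"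
proof -
 have fin: "finite I" "finite good" using good(1) finite_subset by (auto simp: I_def)
 have cg: "real (card good) <= real D" using card_mono[OF _ good(1)] by simp
 have "(\<Sum>i\<in>I. M i i) = (\<Sum>y\<in>{1..D}. \<Sum>j=1..n. M (y, j) (y, j))" by (simp add: I_def sum.cartesian_product case_prod_unfold)
 also have "\<dots> = (\<Sum>y\<in>good. \<Sum>j=1..n. M (y, j) (y, j))"
  by (rule sum.mono_neutral_right) (use good zero in auto)
 finally have tr: "(\<Sum>i\<in>I. M i i) = (\<Sum>y\<in>good. \<Sum>j=1..n. M (y, j) (y, j))" .
 have "cmod ((\<Sum>y\<in>good. \<Sum>j=1..n. of_real \<alpha>) - (\<Sum>y\<in>good. \<Sum>j=1..n. M (y, j) (y, j))) <= (\<Sum>y\<in>good. \<Sum>j=1..n. x)"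
  unfolding sum_subtractf[symmetric] by (intro order_trans[OF norm_sum] sum_mono) (auto intro!: order_trans[OF norm_sum] sum_mono diag)
 then have d1: "cmod (of_real (real (card good) * real n * \<alpha>) - (\<Sum>i\<in>I. M i i)) <= real (card good) * real n * x"
  unfolding tr by (simp add: mult.assoc)
 have "real (card good) * real n * \<alpha> <= cmod (of_real (real (card good) * real n * \<alpha>))" unfolding norm_of_real by (rule abs_ge_self)
 also have "\<dots> <= cmod (\<Sum>i\<in>I. M i i) + real (card good) * real n * x"
  using norm_triangle_ineq2[of "of_real (real (card good) * real n * \<alpha>)" "\<Sum>i\<in>I. M i i"] d1 by linarith
 finally have "real (card good) * (real n * (\<alpha> - x)) <= cmod (\<Sum>i\<in>I. M i i)" by (simp add: algebra_simps)
 moreover have "(1 - x) * real D * (real n * (\<alpha> - x)) <= real (card good) * (real n * (\<alpha> - x))"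
  using good(2) x by (intro mult_right_mono) auto
 ultimately have "(1 - x) * real D * (real n * (\<alpha> - x)) <= cmod (\<Sum>i\<in>I. M i i)" by linarith
 then have "((1 - x) * real D * (real n * (\<alpha> - x)))\<^sup>2 <= (cmod (\<Sum>i\<in>I. M i i))\<^sup>2"
  using x by (intro power_mono) auto
 also have "\<dots> <= card B * (\<Sum>i\<in>I. \<Sum>i'\<in>I. (cmod (M i i'))\<^sup>2)"
  by (rule trace_le_rank[OF fin(1) B M])
 also have "\<dots> <= card B * (real D * ((1 + x) * s + (real n)\<^sup>2 * (x\<^sup>2 + x)))"
 proof (rule mult_left_mono)
  have gen: "(\<Sum>i\<in>I. h i) = (\<Sum>y\<in>{1..D}. \<Sum>j=1..n. h (y, j))" for h :: "nat \<times> nat => real"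
   by (simp add: I_def sum.cartesian_product)
  have "(\<Sum>i\<in>I. \<Sum>i'\<in>I. (cmod (M i i'))\<^sup>2) = (\<Sum>y\<in>{1..D}. \<Sum>j=1..n. \<Sum>i'\<in>I. (cmod (M (y, j) i'))\<^sup>2)"
   by (rule gen)
  also have "\<dots> = (\<Sum>y\<in>good. \<Sum>j=1..n. \<Sum>i'\<in>I. (cmod (M (y, j) i'))\<^sup>2)"
   by (rule sum.mono_neutral_right) (use good zero in auto)
  also have "\<dots> <= (\<Sum>y\<in>good. (1 + x) * s + (real n)\<^sup>2 * (x\<^sup>2 + x))"
  proof (rule sum_mono)
   fix y assume y: "y \<in> good"
   have "(\<Sum>j=1..n. \<Sum>i'\<in>I. (cmod (M (y, j) i'))\<^sup>2) <=
     (\<Sum>j=1..n. \<Sum>i'\<in>I. (1 + x) * (cmod (T (y, j) i'))\<^sup>2 + (1 + 1 / x) * (cmod (T (y, j) i' - M (y, j) i'))\<^sup>2)"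
    by (intro sum_mono square_split x(1))
   also have "\<dots> = (1 + x) * (\<Sum>j=1..n. \<Sum>i'\<in>I. (cmod (T (y, j) i'))\<^sup>2)
     + (1 + 1 / x) * (\<Sum>j=1..n. \<Sum>i'\<in>I. (cmod (T (y, j) i' - M (y, j) i'))\<^sup>2)"
    by (simp only: sum.distrib sum_distrib_left)
   also have "\<dots> <= (1 + x) * s + (1 + 1 / x) * (\<Sum>j=1..n. real n * x\<^sup>2)"
    using x by (intro add_mono mult_left_mono sq[OF y] sum_mono app[OF y]) auto
   also have "(1 + 1 / x) * (\<Sum>j=1..n. real n * x\<^sup>2) = (real n)\<^sup>2 * (x\<^sup>2 + x)"
    using x by (simp add: field_simps power2_eq_square)
   finally show "(\<Sum>j=1..n. \<Sum>i'\<in>I. (cmod (M (y, j) i'))\<^sup>2) <= (1 + x) * s + (real n)\<^sup>2 * (x\<^sup>2 + x)" .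
  qed
  also have "\<dots> <= real D * ((1 + x) * s + (real n)\<^sup>2 * (x\<^sup>2 + x))"
  proof -
   have "0 <= (1 + x) * s + (real n)\<^sup>2 * (x\<^sup>2 + x)" using x s by (intro add_nonneg_nonneg mult_nonneg_nonneg) auto
   then show ?thesis using cg unfolding sum_constant by (intro mult_right_mono)
  qed
  finally show "(\<Sum>i\<in>I. \<Sum>i'\<in>I. (cmod (M i i'))\<^sup>2) <= real D * ((1 + x) * s + (real n)\<^sup>2 * (x\<^sup>2 + x))" .
 qed simp
 finally have "(((1 - x) * real n * (\<alpha> - x))\<^sup>2 * real D) * real D <= (real (card B) * ((1 + x) * s + (real n)\<^sup>2 * (x\<^sup>2 + x))) * real D"
  by (simp add: power2_eq_square mult_ac)
 then show ?thesis using D by (simp only: mult_le_cancel_right_pos[of "real D"] of_nat_0_less_iff)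
qed

text \<open>With \<alpha> = (n - 1) / (n C) and s = (n - 1) / C^2 the quotient (n \<alpha>)^2 / s
  equals n - 1 for every C. By continuity a small x loses less than \<eta>.\<close>

lemma trace_count_limit:
 fixes C :: real and n :: nat
 assumes C: "0 < C" and n: "2 <= n" and eta: "0 < \<eta>"
 shows "EX x. 0 < x & x < 1 & x <= (real n - 1) / (real n * C) & (\<forall>\<beta> D. 0 <= D &
  ((1 - x) * real n * ((real n - 1) / (real n * C) - x))\<^sup>2 * D <= \<beta> * ((1 + x) * ((real n - 1) / C\<^sup>2) + (real n)\<^sup>2 * (x\<^sup>2 + x)) -->
  (real n - 1 - \<eta>) * D <= \<beta>)"
proof -
 define \<alpha> where "\<alpha> = (real n - 1) / (real n * C)"
 define s where "s = (real n - 1) / C\<^sup>2"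
 have pos: "0 < \<alpha>" "0 < s" using C n by (auto simp: \<alpha>_def s_def)
 define R where "R = (%x. ((1 - x) * real n * (\<alpha> - x))\<^sup>2 / ((1 + x) * s + (real n)\<^sup>2 * (x\<^sup>2 + x)))"
 have "isCont R 0" unfolding R_def using pos by (intro continuous_intros) auto
 then have "R \<midarrow>0\<rightarrow> R 0" by (simp add: isCont_def)
 then have "(R \<longlongrightarrow> R 0) (at_right 0)" by (rule filterlim_mono[OF _ order_refl at_le]) simp
 moreover have "R 0 = real n - 1"
  using C n by (simp add: R_def \<alpha>_def s_def field_simps power2_eq_square)
 ultimately have "(R \<longlongrightarrow> real n - 1) (at_right 0)" by simp
 then have "\<forall>\<^sub>F x in at_right 0. real n - 1 - \<eta> < R x" by (rule order_tendstoD(1)) (use eta in simp)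
 then obtain b where b: "0 < b" "!!x. 0 < x ==> x < b ==> real n - 1 - \<eta> < R x"
  unfolding eventually_at_right_field by blast
 define x where "x = min (b / 2) (min (1 / 2) \<alpha>)"
 have x: "0 < x" "x < 1" "x <= \<alpha>" "x < b" using b(1) pos by (auto simp: x_def)
 have den: "0 < (1 + x) * s + (real n)\<^sup>2 * (x\<^sup>2 + x)" using x pos by (intro add_pos_nonneg) auto
 have fin: "(real n - 1 - \<eta>) * D <= \<beta>"
  if "0 <= D" "((1 - x) * real n * (\<alpha> - x))\<^sup>2 * D <= \<beta> * ((1 + x) * s + (real n)\<^sup>2 * (x\<^sup>2 + x))" for D \<beta>
 proof -
  have "(real n - 1 - \<eta>) * D <= R x * D" using b(2)[OF x(1,4)] that(1) by (intro mult_right_mono) auto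
  also have "\<dots> <= \<beta>" using that(2) den by (simp add: R_def pos_divide_le_eq)
  finally show ?thesis .
 qed
 show ?thesis unfolding \<alpha>_def[symmetric] s_def[symmetric] using x fin by (intro exI[of _ x]) simp
qed

lemma lp_finite_squares:
 assumes "1 <= r" "r <= 2" "finite X"
 shows "(\<Sum>x\<in>X. (cmod (f x))\<^sup>2) <= (lpn r X f)\<^sup>2"
 using l2_le_lp(2)[OF assms(1,2), of X f] lp_summable_finite[of X r f] assms(3) by simp

context sofic_data begin

text \<open>The requirements of \<open>almost_hom_exists\<close> on a map defined on
  representatives.\<close>

definition hom_like :: "nat => 'a set => nat => real => (('e => complex) => nat => complex) => bool" where
 "hom_like i F m \<delta> \<tau> \<longleftrightarrow> (\<forall>f\<in>Z. \<forall>g\<in>Z. \<tau> (f + g) = \<tau> f + \<tau> g) & (ALL c. \<forall>f\<in>Z. \<tau> (cs c f) = cs c (\<tau> f)) &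
  (\<forall>f\<in>Z. \<tau> f \<in> fin_carrier (d i)) & (\<forall>f\<in>Z. lpn r {1..d i} (\<tau> f) <= N f) &
  (ALL gs j. set gs \<subseteq> F & length gs \<in> {1..m} & j < m -->
   lpn r {1..d i} (\<tau> (foldr A gs (s j)) - foldr (%g. perm_act (\<sigma> i g)) gs (\<tau> (s j))) < \<delta>)"

text \<open>Reduces a lower bound to a statement about finite families of vectors: one that
  approximates \<tau> (e k) for every \<open>hom_like\<close> map \<tau>, with coefficients common
  to all k, must be large. The tolerance \<epsilon>2 is fixed before F, m and \<delta>, as the order
  of the limits demands.\<close>

lemma lower_frame:
 fixes n :: nat and c :: real
 assumes e: "!!k. k \<in> {1..n} ==> e k \<in> Z" and dpos: "\<forall>\<^sub>F i in sequentially. 0 < d i"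
  and main: "!!\<eta>. 0 < \<eta> ==> \<exists>\<epsilon>2>0. \<forall>F m \<delta>. finite F & F \<subseteq> carrier G & 0 < \<delta> -->
   (\<forall>\<^sub>F i in sequentially. \<forall>(B :: (nat => nat => complex) set) v. finite B -->
    (\<forall>\<tau>. hom_like i F m \<delta> \<tau> --> (EX c. \<forall>k\<in>{1..n}. lpn r {1..d i} (%x. \<tau> (e k) x - (\<Sum>b\<in>B. c b * v b k x)) <= \<epsilon>2)) -->
    (c - \<eta>) * real (d i) <= real (card B))"
 shows "ereal c <= lower_sofic_dim (ereal r) G V act d \<sigma> S \<rho>"
proof (rule le_lower_sofic_dim)
 fix \<eta> :: real assume eta: "0 < \<eta>"
 from main[OF this] obtain \<epsilon>2 where e2: "0 < \<epsilon>2" and main': "\<forall>F m \<delta>. finite F & F \<subseteq> carrier G & 0 < \<delta> -->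
   (\<forall>\<^sub>F i in sequentially. \<forall>(B :: (nat => nat => complex) set) v. finite B -->
    (\<forall>\<tau>. hom_like i F m \<delta> \<tau> --> (EX c. \<forall>k\<in>{1..n}. lpn r {1..d i} (%x. \<tau> (e k) x - (\<Sum>b\<in>B. c b * v b k x)) <= \<epsilon>2)) -->
    (c - \<eta>) * real (d i) <= real (card B))"
  by (elim exE conjE) (rule that, assumption+)
 have eZ: "\<forall>k\<in>{1..n}. e k \<in> Z" using e by blast
 from lower_approx[OF eZ e2]
 obtain \<epsilon> F0 m0 \<delta>0 P' where ep: "0 < \<epsilon>" "(F0, m0, \<delta>0) \<in> sofic_triples G"
  and app: "\<forall>D t F m \<delta> T w k. (\<forall>g\<in>carrier G. t g permutes {1..D}) & F0 \<subseteq> F & F \<subseteq> carrier G & m0 <= m & \<delta> <= \<delta>0 & 0 < \<delta> &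
   T \<in> almost_hom (ereal r) V act D t S F m \<delta> & (\<forall>f\<in>Z. lpn r {1..D} (T (Q f)) <= N f) &
   (\<forall>f\<in>Z. \<forall>g\<in>Z. T (Q (f - g)) = T (Q f) - T (Q g)) &
   w \<in> linf_seqs (ereal r) D & seq_norm (ereal r) D \<rho> (alpha S m T - w) < \<epsilon> & k \<in> {1..n} -->
   lpn r {1..D} (T (Q (e k)) - push_forward t w (P' k)) <= \<epsilon>2"
  by (elim exE conjE) (rule that, assumption+)
 show "\<exists>\<epsilon>>0. \<forall>t0\<in>sofic_triples G. \<exists>t\<in>sofic_triples G. triple_le t0 t &
  (\<forall>\<^sub>F i in sequentially. ereal (c - \<eta>) <= norm_eps_dim (ereal r) V act d \<sigma> S \<rho> \<epsilon> t i)"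
 proof (intro exI conjI ballI)
  show "0 < \<epsilon>" by (rule ep(1))
  fix t0 assume t0: "t0 \<in> sofic_triples G"
  obtain F1 m1 \<delta>1 where t0d: "t0 = (F1, m1, \<delta>1)" by (metis surj_pair)
  define F where "F = F0 \<union> F1"
  define m where "m = max m0 m1"
  define \<delta> where "\<delta> = min \<delta>0 \<delta>1"
  have F: "finite F" "F \<subseteq> carrier G" "0 < \<delta>" "(F, m, \<delta>) \<in> sofic_triples G" "triple_le t0 (F, m, \<delta>)"
   using t0 ep(2) by (auto simp: t0d sofic_triples_def triple_le_def F_def m_def \<delta>_def)
  have ev: "\<forall>\<^sub>F i in sequentially. \<forall>(B :: (nat => nat => complex) set) v. finite B -->
    (\<forall>\<tau>. hom_like i F m \<delta> \<tau> --> (EX c. \<forall>k\<in>{1..n}. lpn r {1..d i} (%x. \<tau> (e k) x - (\<Sum>b\<in>B. c b * v b k x)) <= \<epsilon>2)) -->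
    (c - \<eta>) * real (d i) <= real (card B)"
   by (rule main'[rule_format]) (use F in simp)
  show "\<exists>t\<in>sofic_triples G. triple_le t0 t & (\<forall>\<^sub>F i in sequentially. ereal (c - \<eta>) <= norm_eps_dim (ereal r) V act d \<sigma> S \<rho> \<epsilon> t i)"
  proof (intro bexI[of _ "(F, m, \<delta>)"] conjI F(4,5))
   show "\<forall>\<^sub>F i in sequentially. ereal (c - \<eta>) <= norm_eps_dim (ereal r) V act d \<sigma> S \<rho> \<epsilon> (F, m, \<delta>) i"
    using ev dpos
   proof eventually_elim
    case (elim i)
    define D where "D = d i"
    have D: "0 < real D" using elim(2) by (simp add: D_def)
    have perm: "\<sigma> i g permutes {1..D}" if "g \<in> carrier G" for g unfolding D_def by (rule sigma_perm[OF that])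
    have "ereal ((c - \<eta>) * real D) <= eps_dim (ereal r) D \<rho> \<epsilon> (alpha S m ` almost_hom (ereal r) V act D (\<sigma> i) S F m \<delta>)"
    proof (rule le_eps_dim)
     fix B :: "(nat => nat => complex) set"
     assume B: "finite B" "seq.span B \<subseteq> linf_seqs (ereal r) D"
      and ap: "!!x. x \<in> alpha S m ` almost_hom (ereal r) V act D (\<sigma> i) S F m \<delta> ==> \<exists>w\<in>seq.span B. seq_norm (ereal r) D \<rho> (x - w) < \<epsilon>"
     have key: "EX c. \<forall>k\<in>{1..n}. lpn r {1..D} (%x. \<tau> (e k) x - (\<Sum>b\<in>B. c b * push_forward (\<sigma> i) b (P' k) x)) <= \<epsilon>2"
      if h: "hom_like i F m \<delta> \<tau>" for \<tau>
     proof -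
      have "EX T. T \<in> almost_hom (ereal r) V act D (\<sigma> i) S F m \<delta> & (\<forall>f\<in>Z. T (Q f) = \<tau> f)"
       by (rule almost_hom_exists[OF F(2)]) (use h in \<open>simp_all add: hom_like_def D_def\<close>)
      then obtain T where T: "T \<in> almost_hom (ereal r) V act D (\<sigma> i) S F m \<delta>" "!!f. f \<in> Z ==> T (Q f) = \<tau> f" by blast
      obtain w where w: "w \<in> seq.span B" "seq_norm (ereal r) D \<rho> (alpha S m T - w) < \<epsilon>" using ap[OF imageI[OF T(1)]] by blast
      obtain c where c: "!!P x. push_forward (\<sigma> i) w P x = (\<Sum>b\<in>B. c b * push_forward (\<sigma> i) b P x)"
       using push_forward_span[OF B(1) w(1)] by blast
      have dif: "\<tau> (f - g) = \<tau> f - \<tau> g" if "f \<in> Z" "g \<in> Z" for f g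
      proof -
       have "\<tau> ((f - g) + g) = \<tau> (f - g) + \<tau> g" using h Zminus[OF that] that(2) unfolding hom_like_def by blast
       then show ?thesis unfolding diff_add_cancel eq_diff_eq by (rule sym)
      qed
      have "lpn r {1..D} (T (Q (e k)) - push_forward (\<sigma> i) w (P' k)) <= \<epsilon>2" if k: "k \<in> {1..n}" for k
      proof (rule app[rule_format, of "\<sigma> i" D F m \<delta> T w k], intro conjI ballI)
       show "w \<in> linf_seqs (ereal r) D" using w(1) B(2) by blast
       show "lpn r {1..D} (T (Q f)) <= N f" if "f \<in> Z" for f
        using h that T(2)[OF that] by (simp add: hom_like_def D_def)
       show "T (Q (f - g)) = T (Q f) - T (Q g)" if "f \<in> Z" "g \<in> Z" for f g
        using that T(2) dif Zminus by simp
      qed (use perm F T(1) w(2) k in \<open>auto simp: F_def m_def \<delta>_def\<close>)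
      then show ?thesis using T(2)[OF e] by (intro exI[of _ c]) (simp add: c[symmetric] fun_diff_def)
     qed
     show "(c - \<eta>) * real D <= real (card B)"
      by (rule elim(1)[rule_format, OF B(1), folded D_def, of "%b k. push_forward (\<sigma> i) b (P' k)"]) (use key in blast)
    qed
    then have "ereal (1 / real D) * ereal ((c - \<eta>) * real D) <= norm_eps_dim (ereal r) V act d \<sigma> S \<rho> \<epsilon> (F, m, \<delta>) i"
     unfolding norm_eps_dim_def prod.case D_def[symmetric] by (intro ereal_mult_left_mono) auto
    then show ?case using D by simp
   qed
  qed
 qed
qed

lemma foldr_A: "set gs \<subseteq> carrier G ==> f \<in> Z ==> foldr A gs f = A (foldr (\<otimes>) gs \<one>) f & foldr (\<otimes>) gs \<one> \<in> carrier G"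
 by (induction gs) (auto simp: Aone Amult)

lemma foldr_mult: "set gs \<subseteq> carrier G ==> g \<in> carrier G ==> foldr (\<otimes>) gs g = foldr (\<otimes>) gs \<one> \<otimes> g & foldr (\<otimes>) gs \<one> \<in> carrier G"
 by (induction gs) (auto simp: m_assoc)

text \<open>The orbit map at v: the value of \<Phi> f at (g, j), for g in E, is placed at the point
  \<sigma> g v. E contains \<open>K0\<close> and its translates by words, so E and hE differ only
  where the translated function has little mass; each of the two differences costs at most \<delta>
  / 3.\<close>

lemma hom_like_translates:
 fixes \<Phi> :: "('e => complex) => 'a \<times> nat => complex" and n :: nat
 assumes C: "0 < C" and F: "F \<subseteq> carrier G" and d0: "0 < \<delta>"
  and \<Phi>: "!!f f'. f \<in> Z ==> f' \<in> Z ==> \<Phi> (f + f') = \<Phi> f + \<Phi> f'" "!!c f. f \<in> Z ==> \<Phi> (cs c f) = cs c (\<Phi> f)"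
   "!!f. f \<in> Z ==> lps r (carrier G \<times> {1..n}) (\<Phi> f)"
   "!!f. f \<in> Z ==> lpn r (carrier G \<times> {1..n}) (\<Phi> f) <= C * N f"
   "!!g f x j. g \<in> carrier G ==> f \<in> Z ==> x \<in> carrier G ==> \<Phi> (A g f) (x, j) = \<Phi> f (inv g \<otimes> x, j)"
  and K0: "!!l Y. l < m ==> Y \<subseteq> carrier G \<times> {1..n} ==> fst ` Y \<inter> K0 = {} ==> lpn r Y (\<Phi> (s l)) <= C * \<delta> / 3"
  and E: "finite E" "E \<subseteq> carrier G" "K0 \<subseteq> E" "!!gs g. set gs \<subseteq> F ==> length gs \<in> {1..m} ==> g \<in> K0 ==> foldr (\<otimes>) gs g \<in> E"
  and j: "j \<in> {1..n}" and v: "v \<in> {1..d i}"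
  and inj: "inj_on (%g. \<sigma> i g v) E" "!!gs. set gs \<subseteq> F ==> length gs \<in> {1..m} ==> inj_on (%g. \<sigma> i g v) (E \<union> foldr (\<otimes>) gs ` E)"
  and word: "!!gs g. set gs \<subseteq> F ==> length gs \<in> {1..m} ==> g \<in> E ==> foldr (\<sigma> i) gs (\<sigma> i g v) = \<sigma> i (foldr (\<otimes>) gs g) v"
 shows "hom_like i F m \<delta> (%f x. \<Sum>g\<in>E. if \<sigma> i g v = x then \<Phi> f (g, j) / of_real C else 0)" (is "hom_like i F m \<delta> ?\<tau>")
proof -
 let ?nd = "lpn r {1..d i}"
 let ?K = "carrier G \<times> {1..n}"
 have pe: "\<sigma> i g v \<in> {1..d i}" if "g \<in> carrier G" for g
  using permutes_in_image[OF sigma_perm[OF that, of i], of v] v by simp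
 have slice: "lpn r Y (%g. f (g, j) / of_real C) = lpn r (Y \<times> {j}) f / C" for Y and f :: "'a \<times> nat => complex"
 proof -
  have "bij_betw (%g. (g, j)) Y (Y \<times> {j})" by (auto simp: bij_betw_def inj_on_def)
  from lp_reindex(2)[OF this, of r f] show ?thesis
   using lp_scale(2)[OF r1, of Y "1 / of_real C" "%g. f (g, j)"] C by (simp add: norm_divide)
 qed
 show ?thesis
  unfolding hom_like_def
 proof (intro conjI ballI allI impI)
  show "?\<tau> (f + g) = ?\<tau> f + ?\<tau> g" if "f \<in> Z" "g \<in> Z" for f g
   unfolding \<Phi>(1)[OF that] by (auto simp: fun_eq_iff sum.distrib[symmetric] add_divide_distrib intro!: sum.cong)
  show "?\<tau> (cs c f) = cs c (?\<tau> f)" if "f \<in> Z" for c f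
   unfolding \<Phi>(2)[OF that] by (auto simp: fun_eq_iff sum_distrib_left intro!: sum.cong)
  show "?\<tau> f \<in> fin_carrier (d i)" for f
   unfolding fin_carrier_def mem_Collect_eq
  proof (intro allI impI sum.neutral ballI)
   fix z g assume "z \<notin> {1..d i}" "g \<in> E"
   then have "\<sigma> i g v ~= z" using pe[of g] E(2) by blast
   then show "(if \<sigma> i g v = z then \<Phi> f (g, j) / of_real C else 0) = 0" by simp
  qed
  show "?nd (?\<tau> f) <= N f" if f: "f \<in> Z" for f
  proof -
   have "?nd (?\<tau> f) = lpn r E (%g. \<Phi> f (g, j) / of_real C)"
    by (rule delta_sum_norm[OF r1 E(1) inj(1)]) (use pe E(2) in blast)
   also have "\<dots> <= lpn r ?K (\<Phi> f) / C"
    unfolding slice using C j E(2) by (intro divide_right_mono lp_norm_mono_set[OF r1 \<Phi>(3)[OF f]]) auto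
   also have "\<dots> <= N f" using \<Phi>(4)[OF f] C by (simp add: field_simps)
   finally show ?thesis .
  qed
  fix gs l assume a: "set gs \<subseteq> F & length gs \<in> {1..m} & l < m"
  then have gs: "set gs \<subseteq> carrier G" using F by auto
  define h where "h = foldr (\<otimes>) gs \<one>"
  have h: "h \<in> carrier G" "foldr A gs (s l) = A h (s l)" using foldr_A[OF gs s(1)] by (auto simp: h_def)
  have hm: "foldr (\<otimes>) gs g = h \<otimes> g" if "g \<in> carrier G" for g using foldr_mult[OF gs that] by (simp add: h_def)
  have img: "foldr (\<otimes>) gs ` E = (\<otimes>) h ` E" using hm E(2) by (intro image_cong) auto
  \<comment> \<open>The image of the translate of \<open>s l\<close> by h, restricted to group
    elements in Y.\<close>
  define \<psi> where "\<psi> = (%Y x. \<Sum>g\<in>Y. if \<sigma> i g v = x then \<Phi> (s l) (inv h \<otimes> g, j) / of_real C else 0)"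
  have psi: "?nd (\<psi> Y) <= \<delta> / 3" if Y: "Y \<subseteq> E \<union> (\<otimes>) h ` E" "!!g. g \<in> Y ==> inv h \<otimes> g \<notin> K0" for Y
  proof -
   have fY: "finite Y" using finite_subset[OF Y(1)] E(1) by simp
   have cY: "Y \<subseteq> carrier G" using Y(1) E(2) h(1) by auto
   have "?nd (\<psi> Y) = lpn r Y (%g. \<Phi> (s l) (inv h \<otimes> g, j) / of_real C)"
    unfolding \<psi>_def
   proof (rule delta_sum_norm[OF r1 fY])
    show "inj_on (%g. \<sigma> i g v) Y" by (rule inj_on_subset[OF inj(2)[of gs]]) (use a Y(1) img in auto)
   qed (use pe cY in blast)
   also have "\<dots> = lpn r ((\<otimes>) (inv h) ` Y) (%g. \<Phi> (s l) (g, j) / of_real C)"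
    by (rule lp_reindex(2)) (use cY h(1) in \<open>auto simp: bij_betw_def inj_on_def subset_eq\<close>)
   also have "\<dots> = lpn r (((\<otimes>) (inv h) ` Y) \<times> {j}) (\<Phi> (s l)) / C" by (rule slice)
   also have "\<dots> <= (C * \<delta> / 3) / C"
    by (intro divide_right_mono K0) (use a C cY h(1) j Y(2) in auto)
   finally show ?thesis using C by simp
  qed
  have 1: "?\<tau> (foldr A gs (s l)) = \<psi> E"
   unfolding h(2) \<psi>_def using E(2) h(1) by (auto simp: fun_eq_iff \<Phi>(5) s(1) subset_eq intro!: sum.cong)
  have "foldr (%g. perm_act (\<sigma> i g)) gs (?\<tau> (s l)) = (%x. \<Sum>g\<in>E. if foldr (\<sigma> i) gs (\<sigma> i g v) = x then \<Phi> (s l) (g, j) / of_real C else 0)"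
   by (rule foldr_perm_act_delta) (use sigma_perm gs permutes_bij in blast)
  also have "\<dots> = (%x. \<Sum>g\<in>E. if \<sigma> i (h \<otimes> g) v = x then \<Phi> (s l) (g, j) / of_real C else 0)"
   using word[of gs] a hm E(2) by (intro ext sum.cong refl) auto
  also have "\<dots> = \<psi> ((\<otimes>) h ` E)"
  proof -
   have "inj_on ((\<otimes>) h) E" using h(1) E(2) by (auto simp: inj_on_def subset_eq)
   then show ?thesis using h(1) E(2)
    by (auto simp: \<psi>_def fun_eq_iff sum.reindex m_assoc[symmetric] subset_eq intro!: sum.cong)
  qed
  finally have 2: "foldr (%g. perm_act (\<sigma> i g)) gs (?\<tau> (s l)) = \<psi> ((\<otimes>) h ` E)" .
  \<comment> \<open>The common part of E and hE cancels.\<close>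
  have dec: "\<psi> E - \<psi> ((\<otimes>) h ` E) = \<psi> (E - (\<otimes>) h ` E) - \<psi> ((\<otimes>) h ` E - E)"
  proof
   fix x
   show "(\<psi> E - \<psi> ((\<otimes>) h ` E)) x = (\<psi> (E - (\<otimes>) h ` E) - \<psi> ((\<otimes>) h ` E - E)) x"
    using sum.Int_Diff[OF E(1), of "%g. if \<sigma> i g v = x then \<Phi> (s l) (inv h \<otimes> g, j) / of_real C else 0" "(\<otimes>) h ` E"]
     sum.Int_Diff[OF finite_imageI[OF E(1)], of "%g. if \<sigma> i g v = x then \<Phi> (s l) (inv h \<otimes> g, j) / of_real C else 0" "(\<otimes>) h" E]
    by (simp add: \<psi>_def Int_commute)
  qed
  have "?nd (\<psi> E - \<psi> ((\<otimes>) h ` E)) <= ?nd (\<psi> (E - (\<otimes>) h ` E)) + ?nd (\<psi> ((\<otimes>) h ` E - E))"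
   using lp_minus(2)[OF r1, of "{1..d i}" "\<psi> (E - (\<otimes>) h ` E)" "\<psi> ((\<otimes>) h ` E - E)"] unfolding dec by (simp add: fun_diff_def)
  also have "\<dots> <= \<delta> / 3 + \<delta> / 3"
  proof (intro add_mono psi)
   fix g assume g: "g \<in> E - (\<otimes>) h ` E"
   then have "g \<in> carrier G" using E(2) by auto
   then have "g = h \<otimes> (inv h \<otimes> g)" using h(1) by (simp add: m_assoc[symmetric])
   then show "inv h \<otimes> g \<notin> K0" using g E(3) by blast
  next
   fix g assume g: "g \<in> (\<otimes>) h ` E - E"
   then obtain k where k: "k \<in> E" "g = h \<otimes> k" by blast
   have kc: "k \<in> carrier G" using k E(2) by auto
   then have "inv h \<otimes> g = k" using h(1) k(2) by (simp add: m_assoc[symmetric])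
   then show "inv h \<otimes> g \<notin> K0" using E(4)[of gs k] a hm[OF kc] k(2) g by auto
  qed auto
  also have "\<dots> < \<delta>" using d0 by simp
  finally show "?nd (?\<tau> (foldr A gs (s l)) - foldr (%g. perm_act (\<sigma> i g)) gs (?\<tau> (s l))) < \<delta>" unfolding 1 2 .
 qed
qed

text \<open>Copies of \<Phi>, divided by C, are placed at each good vertex y for each j. The
  diagonal entries are (n - 1) / (n C) and the squares belonging to one vertex sum to at most (n -
  1) / C^2, which are the values required by \<open>trace_count_limit\<close>.\<close>

theorem lower_trace:
 fixes \<Phi> :: "('e => complex) => 'a \<times> nat => complex" and n :: nat
 assumes n2: "2 <= n" and r2: "r <= 2" and C: "0 < C"
  and \<Phi>: "!!f f'. f \<in> Z ==> f' \<in> Z ==> \<Phi> (f + f') = \<Phi> f + \<Phi> f'" "!!c f. f \<in> Z ==> \<Phi> (cs c f) = cs c (\<Phi> f)"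
   "!!f. f \<in> Z ==> lps r (carrier G \<times> {1..n}) (\<Phi> f)"
   "!!f. f \<in> Z ==> lpn r (carrier G \<times> {1..n}) (\<Phi> f) <= C * N f"
   "!!g f x j. g \<in> carrier G ==> f \<in> Z ==> x \<in> carrier G ==> \<Phi> (A g f) (x, j) = \<Phi> f (inv g \<otimes> x, j)"
  and e: "!!k. k \<in> {1..n} ==> e k \<in> Z"
  and diag: "!!k. k \<in> {1..n} ==> \<Phi> (e k) (\<one>, k) = of_real ((real n - 1) / real n)"
  and sq: "!!k. k \<in> {1..n} ==> (%y. (cmod (\<Phi> (e k) y))\<^sup>2) summable_on carrier G \<times> {1..n}"
   "!!k. k \<in> {1..n} ==> (\<Sum>\<^sub>\<infinity>y\<in>carrier G \<times> {1..n}. (cmod (\<Phi> (e k) y))\<^sup>2) <= (real n - 1) / real n"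
  and g0: "g0 \<in> carrier G" "g0 ~= \<one>"
 shows "ereal (real n - 1) <= lower_sofic_dim (ereal r) G V act d \<sigma> S \<rho>"
proof (rule lower_frame[of n e, OF e hamming_one(2)[OF g0(1) one_closed g0(2)]])
 let ?K = "carrier G \<times> {1..n}"
 fix \<eta> :: real assume "0 < \<eta>"
 from trace_count_limit[OF C n2 this] obtain x where x: "0 < x" "x < 1" "x <= (real n - 1) / (real n * C)"
  and fin: "\<forall>\<beta> D. 0 <= D &
  ((1 - x) * real n * ((real n - 1) / (real n * C) - x))\<^sup>2 * D <= \<beta> * ((1 + x) * ((real n - 1) / C\<^sup>2) + (real n)\<^sup>2 * (x\<^sup>2 + x)) -->
  (real n - 1 - \<eta>) * D <= \<beta>" by (elim exE conjE) (rule that, assumption+)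
 show "\<exists>\<epsilon>2>0. \<forall>F m \<delta>. finite F & F \<subseteq> carrier G & 0 < \<delta> -->
   (\<forall>\<^sub>F i in sequentially. \<forall>(B :: (nat => nat => complex) set) v. finite B -->
    (\<forall>\<tau>. hom_like i F m \<delta> \<tau> --> (EX c. \<forall>k\<in>{1..n}. lpn r {1..d i} (%x. \<tau> (e k) x - (\<Sum>b\<in>B. c b * v b k x)) <= \<epsilon>2)) -->
    (real n - 1 - \<eta>) * real (d i) <= real (card B))"
 proof (rule exI[of _ x], rule conjI[OF x(1)], rule allI, rule allI)
  fix F m show "\<forall>\<delta>. finite F & F \<subseteq> carrier G & 0 < \<delta> -->
   (\<forall>\<^sub>F i in sequentially. \<forall>(B :: (nat => nat => complex) set) v. finite B -->
    (\<forall>\<tau>. hom_like i F m \<delta> \<tau> --> (EX c. \<forall>k\<in>{1..n}. lpn r {1..d i} (%y. \<tau> (e k) y - (\<Sum>b\<in>B. c b * v b k y)) <= x)) -->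
    (real n - 1 - \<eta>) * real (d i) <= real (card B))"
  proof (intro allI impI)
   fix \<delta> :: real assume F: "finite F & F \<subseteq> carrier G & 0 < \<delta>"
   have "ALL l. EX K. finite K & K \<subseteq> ?K & (ALL Y. Y \<subseteq> ?K --> Y \<inter> K = {} --> lpn r Y (\<Phi> (s l)) <= C * \<delta> / 3)"
   proof
    fix l
    have cd: "0 < C * \<delta> / 3" using C F by simp
    show "EX K. finite K & K \<subseteq> ?K & (ALL Y. Y \<subseteq> ?K --> Y \<inter> K = {} --> lpn r Y (\<Phi> (s l)) <= C * \<delta> / 3)"
    proof (rule lp_tail[OF r1 \<Phi>(3)[OF s(1)[of l]] cd], goal_cases)
     case (1 K)
     then show ?case by (intro exI[of _ K] conjI allI impI)
    qed
   qed
   from choice[OF this] obtain K where K: "ALL l. finite (K l) & K l \<subseteq> ?K & (ALL Y. Y \<subseteq> ?K --> Y \<inter> K l = {} --> lpn r Y (\<Phi> (s l)) <= C * \<delta> / 3)" ..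
   define K0 where "K0 = (\<Union>l<m. fst ` K l)"
   have K0: "finite K0" "K0 \<subseteq> carrier G" using K by (auto simp: K0_def) blast
   have tail: "lpn r Y (\<Phi> (s l)) <= C * \<delta> / 3" if "l < m" "Y \<subseteq> ?K" "fst ` Y \<inter> K0 = {}" for l Y
   proof -
    have "Y \<inter> K l = {}" using that(1,3) unfolding K0_def by blast
    then show ?thesis using K that(2) by blast
   qed
   define words where "words = {gs. set gs \<subseteq> F & length gs \<in> {1..m}}"
   have "words \<subseteq> {gs. set gs \<subseteq> F & length gs <= m}" by (auto simp: words_def)
   then have fw: "finite words" using finite_lists_length_le[of F m] F finite_subset by blast
   have wc: "set gs \<subseteq> carrier G" if "gs \<in> words" for gs using that F by (auto simp: words_def)
   have fc: "foldr (\<otimes>) gs g \<in> carrier G" if "gs \<in> words" "g \<in> carrier G" for gs g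
    using foldr_mult[OF wc[OF that(1)] that(2)] that(2) by simp
   \<comment> \<open>The element \<one> is added so that the diagonal entry is among the values
     kept.\<close>
   define E where "E = {\<one>} \<union> K0 \<union> (\<Union>gs\<in>words. foldr (\<otimes>) gs ` K0)"
   have E: "finite E" "E \<subseteq> carrier G" "K0 \<subseteq> E" "\<one> \<in> E" using K0 fw fc by (auto simp: E_def)
   \<comment> \<open>At good y the map from g to \<sigma> g y has to be injective on E together with
     each of its word translates.\<close>
   define E3 where "E3 = E \<union> (\<Union>gs\<in>words. foldr (\<otimes>) gs ` E)"
   have E3: "finite E3" "E3 \<subseteq> carrier G" using E fw fc by (auto simp: E3_def)
   define bad where "bad = (%i. (\<Union>p\<in>E3 \<times> E3 - Id. {v. \<sigma> i (fst p) v = \<sigma> i (snd p) v})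
    \<union> (\<Union>p\<in>words \<times> E. {v. foldr (\<sigma> i) (fst p) (\<sigma> i (snd p) v) ~= \<sigma> i (foldr (\<otimes>) (fst p) (snd p)) v}))"
   have "rare d bad" unfolding bad_def
    using E3 E(1) fw by (intro rare_Un rare_UN) (use E3 E(2) wc in \<open>auto intro!: rare_eq rare_word intro: subsetD[OF wc]\<close>)
   then have bl: "(%i. real (card (bad i \<inter> {1..d i})) / real (d i)) \<longlonglongrightarrow> 0" unfolding rare_def .
   have bsmall: "\<forall>\<^sub>F i in sequentially. real (card (bad i \<inter> {1..d i})) / real (d i) < x"
    by (rule order_tendstoD(2)[OF bl]) (use x in simp)
   show "\<forall>\<^sub>F i in sequentially. \<forall>(B :: (nat => nat => complex) set) v. finite B -->
    (\<forall>\<tau>. hom_like i F m \<delta> \<tau> --> (EX c. \<forall>k\<in>{1..n}. lpn r {1..d i} (%y. \<tau> (e k) y - (\<Sum>b\<in>B. c b * v b k y)) <= x)) -->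
    (real n - 1 - \<eta>) * real (d i) <= real (card B)"
    using bsmall hamming_one(2)[OF g0(1) one_closed g0(2)]
   proof (eventually_elim, intro allI impI)
    fix i and B :: "(nat => nat => complex) set" and v :: "(nat => nat => complex) => nat => nat => complex"
    assume bs: "real (card (bad i \<inter> {1..d i})) / real (d i) < x" and di: "0 < d i" and B: "finite B"
     and key: "\<forall>\<tau>. hom_like i F m \<delta> \<tau> --> (EX c. \<forall>k\<in>{1..n}. lpn r {1..d i} (%y. \<tau> (e k) y - (\<Sum>b\<in>B. c b * v b k y)) <= x)"
    let ?nd = "lpn r {1..d i}"
    define good where "good = {1..d i} - bad i"
    define \<tau> where "\<tau> = (%y j f z. \<Sum>g\<in>E. if \<sigma> i g y = z then \<Phi> f (g, j) / of_real C else 0)"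
    have inj3: "inj_on (%g. \<sigma> i g y) E3" if "y \<in> good" for y
    proof (rule inj_onI, rule ccontr)
     fix g h assume "g \<in> E3" "h \<in> E3" and eq: "\<sigma> i g y = \<sigma> i h y" and "g ~= h"
     then have "(g, h) \<in> E3 \<times> E3 - Id" by simp
     then have "y \<in> bad i" using eq unfolding bad_def by fastforce
     then show False using that by (simp add: good_def)
    qed
    have injE: "inj_on (%g. \<sigma> i g y) E" if "y \<in> good" for y
     by (rule inj_on_subset[OF inj3[OF that]]) (auto simp: E3_def)
    have hl: "hom_like i F m \<delta> (\<tau> y j)" if y: "y \<in> good" and j: "j \<in> {1..n}" for y j
     unfolding \<tau>_def
    proof (rule hom_like_translates[of C F \<delta> \<Phi> n m K0 E])
     show "lpn r Y (\<Phi> (s l)) <= C * \<delta> / 3" if "l < m" "Y \<subseteq> ?K" "fst ` Y \<inter> K0 = {}" for l Y by (rule tail[OF that])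
     show "foldr (\<otimes>) gs g \<in> E" if "set gs \<subseteq> F" "length gs \<in> {1..m}" "g \<in> K0" for gs g
      using that unfolding E_def words_def by blast
     show "inj_on (%g. \<sigma> i g y) (E \<union> foldr (\<otimes>) gs ` E)" if "set gs \<subseteq> F" "length gs \<in> {1..m}" for gs
      by (rule inj_on_subset[OF inj3[OF y]]) (use that in \<open>auto simp: E3_def words_def\<close>)
     show "foldr (\<sigma> i) gs (\<sigma> i g y) = \<sigma> i (foldr (\<otimes>) gs g) y" if "set gs \<subseteq> F" "length gs \<in> {1..m}" "g \<in> E" for gs g
     proof -
      have "(gs, g) \<in> words \<times> E" using that by (simp add: words_def)
      then show ?thesis using y unfolding good_def bad_def by fastforce
     qed
     show "y \<in> {1..d i}" using y by (simp add: good_def)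
    qed (use C F \<Phi> E j injE[OF y] in blast)+
    \<comment> \<open>The coefficients depend on the row (y, j) but serve all columns k at
      once.\<close>
    define cc where "cc = (%y j. SOME c. \<forall>k\<in>{1..n}. ?nd (%z. \<tau> y j (e k) z - (\<Sum>b\<in>B. c b * v b k z)) <= x)"
    have cc: "?nd (%z. \<tau> y j (e k) z - (\<Sum>b\<in>B. cc y j b * v b k z)) <= x" if "y \<in> good" "j \<in> {1..n}" "k \<in> {1..n}" for y j k
     using someI_ex[OF key[rule_format, OF hl[OF that(1,2)]]] that(3) unfolding cc_def by blast
    \<comment> \<open>Rows at bad vertices are set to 0, which keeps them in the span.\<close>
    define M where "M = (%(y, j) (z, k). if y \<in> good then \<Sum>b\<in>B. cc y j b * v b k z else 0)"
    define T where "T = (%(y, j) (z, k). \<tau> y j (e k) z)"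
    have ps: "(\<Sum>i'\<in>{1..d i} \<times> {1..n}. h i') = (\<Sum>k=1..n. \<Sum>z\<in>{1..d i}. h (z, k))" for h :: "nat \<times> nat => real"
     by (subst sum.swap) (simp add: sum.cartesian_product)
    have "((1 - x) * real n * ((real n - 1) / (real n * C) - x))\<^sup>2 * real (d i) <=
     real (card B) * ((1 + x) * ((real n - 1) / C\<^sup>2) + (real n)\<^sup>2 * (x\<^sup>2 + x))"
    proof (rule trace_count[where M = M and T = T and v = "%b (z, k). v b k z" and good = good])
     show "finite B" by (rule B)
     show "good \<subseteq> {1..d i}" by (auto simp: good_def)
     have cu: "(bad i \<inter> {1..d i}) \<union> good = {1..d i}" "(bad i \<inter> {1..d i}) \<inter> good = {}" "finite (bad i \<inter> {1..d i})" "finite good"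
      by (auto simp: good_def)
     have "card {1..d i} = card (bad i \<inter> {1..d i}) + card good"
      using card_Un_disjoint[OF cu(3,4,2)] unfolding cu(1) .
     then have "real (card good) = real (d i) - real (card (bad i \<inter> {1..d i}))" by simp
     moreover have "real (card (bad i \<inter> {1..d i})) <= x * real (d i)" using bs di by (simp only: pos_divide_less_eq of_nat_0_less_iff less_imp_le)
     ultimately show "(1 - x) * real (d i) <= real (card good)" unfolding left_diff_distrib by linarith
     show "EX c. \<forall>i'\<in>{1..d i} \<times> {1..n}. M q i' = (\<Sum>b\<in>B. c b * (case i' of (z, k) => v b k z))" for q
      by (rule exI[of _ "%b. if fst q \<in> good then cc (fst q) (snd q) b else 0"]) (auto simp: M_def case_prod_unfold)
     show "M (y, j) i' = 0" if "y \<in> {1..d i} - good" for y j i' using that by (auto simp: M_def split: prod.splits)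
     show "(\<Sum>i'\<in>{1..d i} \<times> {1..n}. (cmod (T (y, j) i' - M (y, j) i'))\<^sup>2) <= real n * x\<^sup>2" if y: "y \<in> good" and j: "j \<in> {1..n}" for y j
     proof -
      have "(\<Sum>i'\<in>{1..d i} \<times> {1..n}. (cmod (T (y, j) i' - M (y, j) i'))\<^sup>2) <= (\<Sum>k=1..n. x\<^sup>2)"
       unfolding ps
      proof (rule sum_mono)
       fix k assume k: "k \<in> {1..n}"
       have "(\<Sum>z\<in>{1..d i}. (cmod (T (y, j) (z, k) - M (y, j) (z, k)))\<^sup>2) <= (?nd (%z. \<tau> y j (e k) z - (\<Sum>b\<in>B. cc y j b * v b k z)))\<^sup>2"
        using lp_finite_squares[OF r1 r2, of "{1..d i}" "%z. \<tau> y j (e k) z - (\<Sum>b\<in>B. cc y j b * v b k z)"] y by (simp add: T_def M_def)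
       also have "\<dots> <= x\<^sup>2" by (rule power_mono[OF cc[OF y j k] lp_norm_nonneg])
       finally show "(\<Sum>z\<in>{1..d i}. (cmod (T (y, j) (z, k) - M (y, j) (z, k)))\<^sup>2) <= x\<^sup>2" .
      qed
      then show ?thesis by simp
     qed
     show "(\<Sum>j=1..n. \<Sum>i'\<in>{1..d i} \<times> {1..n}. (cmod (T (y, j) i'))\<^sup>2) <= (real n - 1) / C\<^sup>2" if y: "y \<in> good" for y
     proof -
      have pe: "\<sigma> i g y \<in> {1..d i}" if "g \<in> E" for g
       using permutes_in_image[OF sigma_perm[of g i], of y] that y E(2) by (auto simp: good_def)
      have "(\<Sum>j=1..n. \<Sum>i'\<in>{1..d i} \<times> {1..n}. (cmod (T (y, j) i'))\<^sup>2) = (\<Sum>j=1..n. \<Sum>k=1..n. \<Sum>g\<in>E. (cmod (\<Phi> (e k) (g, j) / of_real C))\<^sup>2)"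
       unfolding ps T_def \<tau>_def prod.case
       by (intro sum.cong refl delta_sum[OF E(1) injE[OF y], of "d i" "%z. (cmod z)\<^sup>2"]) (use pe in auto)
      also have "\<dots> = (\<Sum>k=1..n. \<Sum>j=1..n. \<Sum>g\<in>E. (cmod (\<Phi> (e k) (g, j) / of_real C))\<^sup>2)" by (rule sum.swap)
      also have "\<dots> = (\<Sum>k=1..n. (\<Sum>q\<in>E \<times> {1..n}. (cmod (\<Phi> (e k) q))\<^sup>2) / C\<^sup>2)"
      proof (intro sum.cong refl)
       fix k
       have "(\<Sum>j=1..n. \<Sum>g\<in>E. (cmod (\<Phi> (e k) (g, j) / of_real C))\<^sup>2) = (\<Sum>g\<in>E. \<Sum>j=1..n. (cmod (\<Phi> (e k) (g, j)))\<^sup>2 / C\<^sup>2)"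
        by (subst sum.swap) (simp add: norm_divide power_divide)
       also have "\<dots> = (\<Sum>q\<in>E \<times> {1..n}. (cmod (\<Phi> (e k) q))\<^sup>2) / C\<^sup>2"
        by (simp only: sum_divide_distrib sum.cartesian_product case_prod_unfold prod.collapse)
       finally show "(\<Sum>j=1..n. \<Sum>g\<in>E. (cmod (\<Phi> (e k) (g, j) / of_real C))\<^sup>2) = (\<Sum>q\<in>E \<times> {1..n}. (cmod (\<Phi> (e k) q))\<^sup>2) / C\<^sup>2" .
      qed
      also have "\<dots> <= (\<Sum>k=1..n. ((real n - 1) / real n) / C\<^sup>2)"
      proof (intro sum_mono divide_right_mono)
       fix k assume k: "k \<in> {1..n}"
       have "(\<Sum>q\<in>E \<times> {1..n}. (cmod (\<Phi> (e k) q))\<^sup>2) <= (\<Sum>\<^sub>\<infinity>q\<in>?K. (cmod (\<Phi> (e k) q))\<^sup>2)"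
        using E(1,2) by (intro finite_sum_le_infsum sq(1)[OF k]) auto
       also note sq(2)[OF k]
       finally show "(\<Sum>q\<in>E \<times> {1..n}. (cmod (\<Phi> (e k) q))\<^sup>2) <= (real n - 1) / real n" .
      qed simp
      finally show ?thesis using n2 by simp
     qed
     show "cmod (of_real ((real n - 1) / (real n * C)) - M (y, j) (y, j)) <= x" if y: "y \<in> good" and j: "j \<in> {1..n}" for y j
     proof -
      \<comment> \<open>E contains \<one> and is embedded injectively, so only g = \<one> returns to
        y.\<close>
      have "\<sigma> i g y = y \<longleftrightarrow> g = \<one>" if "g \<in> E" for g
       using inj_onD[OF injE[OF y], of g \<one>] that E(4) by (auto simp: sigma_one)
      then have "\<tau> y j (e j) y = (\<Sum>g\<in>E. if g = \<one> then \<Phi> (e j) (g, j) / of_real C else 0)"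
       unfolding \<tau>_def by (intro sum.cong) auto
      also have "\<dots> = of_real ((real n - 1) / (real n * C))"
       using E(1,4) diag[OF j] by (simp add: sum.delta)
      finally have t: "\<tau> y j (e j) y = of_real ((real n - 1) / (real n * C))" .
      have "cmod (\<tau> y j (e j) y - (\<Sum>b\<in>B. cc y j b * v b j y)) <= ?nd (%z. \<tau> y j (e j) z - (\<Sum>b\<in>B. cc y j b * v b j z))"
       by (rule lp_norm_point[OF r1, of "{1..d i}" "%z. \<tau> y j (e j) z - (\<Sum>b\<in>B. cc y j b * v b j z)" y])
        (use y in \<open>auto simp: good_def intro!: lp_summable_finite\<close>)
      then show ?thesis using cc[OF y j j] y unfolding t by (simp add: M_def)
     qed
     show "0 < x" "x < 1" "x <= (real n - 1) / (real n * C)" by (rule x)+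
     show "0 <= (real n - 1) / C\<^sup>2" using n2 by simp
     show "0 < d i" by (rule di)
    qed
    then show "(real n - 1 - \<eta>) * real (d i) <= real (card B)"
     by (intro fin[rule_format]) simp
   qed
  qed
 qed
qed

end

section \<open>The l1 lower bound through flows\<close>

lemma l1_norm:
 assumes "r = (1 :: real)"
 shows "lps r X f \<longleftrightarrow> (%x. cmod (f x)) summable_on X" "lpn r X f = (\<Sum>\<^sub>\<infinity>x\<in>X. cmod (f x))"
proof -
 show "lps r X f \<longleftrightarrow> (%x. cmod (f x)) summable_on X" using assms by (simp add: lp_summable_ereal)
 have "0 <= (\<Sum>\<^sub>\<infinity>x\<in>X. cmod (f x))" by (rule infsum_nonneg) simp
 then show "lpn r X f = (\<Sum>\<^sub>\<infinity>x\<in>X. cmod (f x))" using assms by (simp add: lp_norm_ereal)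
qed

lemma weighted_summable:
 assumes h: "(%e. cmod (h e)) summable_on Y" and w: "!!e. e \<in> Y ==> cmod (w e) <= \<kappa>"
 shows "(%e. norm (h e * w e)) summable_on Y"
proof (rule summable_on_comparison_test[OF summable_on_cmult_right[OF h, of \<kappa>]])
 show "norm (h e * w e) <= \<kappa> * cmod (h e)" if "e \<in> Y" for e
  using mult_right_mono[OF w[OF that] norm_ge_zero[of "h e"]] by (simp add: norm_mult mult.commute)
qed simp

text \<open>An operator on l1 is controlled by its column sums; the weight \<kappa> lets the columns
  have different bounds.\<close>

lemma l1_transfer:
 fixes D :: nat
 assumes h: "(%e. cmod (h e)) summable_on Y" and w: "!!e. e \<in> Y ==> (\<Sum>x\<in>{1..D}. cmod (w x e)) <= \<kappa> e"
  and \<kappa>: "!!e. e \<in> Y ==> \<kappa> e <= \<kappa>0"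
 shows "(\<Sum>x\<in>{1..D}. cmod (\<Sum>\<^sub>\<infinity>e\<in>Y. h e * w x e)) <= (\<Sum>\<^sub>\<infinity>e\<in>Y. cmod (h e) * \<kappa> e)"
proof -
 have wk: "cmod (w x e) <= \<kappa>0" if "x \<in> {1..D}" "e \<in> Y" for x e
  using member_le_sum[of x "{1..D}" "%x. cmod (w x e)"] w[OF that(2)] \<kappa>[OF that(2)] that(1) by simp
 have s: "(%e. norm (h e * w x e)) summable_on Y" if "x \<in> {1..D}" for x
  by (rule weighted_summable[OF h wk[OF that]])
 have k0: "0 <= \<kappa> e" if "e \<in> Y" for e by (rule order_trans[OF sum_nonneg w[OF that]]) simp
 have ks: "(%e. cmod (h e) * \<kappa> e) summable_on Y"
  by (rule summable_on_comparison_test[OF summable_on_cmult_left[OF h, of \<kappa>0]]) (use \<kappa> k0 in \<open>auto intro: mult_left_mono\<close>)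
 have "(\<Sum>x\<in>{1..D}. cmod (\<Sum>\<^sub>\<infinity>e\<in>Y. h e * w x e)) <= (\<Sum>x\<in>{1..D}. \<Sum>\<^sub>\<infinity>e\<in>Y. norm (h e * w x e))"
  by (intro sum_mono norm_infsum_bound s)
 also have "\<dots> = (\<Sum>\<^sub>\<infinity>e\<in>Y. \<Sum>x\<in>{1..D}. norm (h e * w x e))"
  by (rule infsum_finite_sum(2)[symmetric]) (use s in auto)
 also have "\<dots> <= (\<Sum>\<^sub>\<infinity>e\<in>Y. cmod (h e) * \<kappa> e)"
 proof (rule infsum_mono[OF infsum_finite_sum(1) ks])
  show "(%e. norm (h e * w x e)) summable_on Y" if "x \<in> {1..D}" for x by (rule s[OF that])
  show "(\<Sum>x\<in>{1..D}. norm (h e * w x e)) <= cmod (h e) * \<kappa> e" if "e \<in> Y" for e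
   using mult_left_mono[OF w[OF that] norm_ge_zero[of "h e"]] by (simp add: norm_mult sum_distrib_left)
 qed simp
 finally show ?thesis .
qed

lemma foldr_perm_act:
 assumes "!!h. h \<in> set gs ==> bij (t h)"
 shows "bij (foldr t gs) & foldr (%g. perm_act (t g)) gs v = perm_act (foldr t gs) v"
 using assms
proof (induction gs)
 case (Cons h gs)
 then have b: "bij (t h)" "bij (foldr t gs)" "foldr (%g. perm_act (t g)) gs v = perm_act (foldr t gs) v" by auto
 have e: "foldr t (h # gs) = t h \<circ> foldr t gs" by auto
 have i: "inv_into UNIV (t h \<circ> foldr t gs) = inv_into UNIV (foldr t gs) \<circ> inv_into UNIV (t h)"
  using b by (intro o_inv_distrib)
 have "foldr (%g. perm_act (t g)) (h # gs) v = perm_act (t h) (perm_act (foldr t gs) v)"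
  unfolding b(3)[symmetric] by (simp only: foldr.simps o_apply)
 also have "\<dots> = perm_act (t h \<circ> foldr t gs) v" unfolding perm_act_def i by (simp only: o_apply)
 finally show ?case using bij_comp[OF b(2,1)] unfolding e by blast
qed (auto simp: perm_act_def inv_id[unfolded id_def] bij_id[unfolded id_def] id_def)

text \<open>The order of composition follows \<open>val\<close>: right multiplication by a letter
  becomes precomposition with its permutation.\<close>

primrec wact :: "(nat => nat => nat) => (nat \<times> bool) list => nat => nat" where
 "wact p [] = id"
| "wact p (l # w) = wact p w \<circ> (if snd l then p (fst l) else inv_into UNIV (p (fst l)))"

lemma wact_permutes:
 assumes "!!j. j \<in> J ==> p j permutes X" "set w \<subseteq> J \<times> UNIV"
 shows "wact p w permutes X"
 using assms(2)
proof (induction w)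
 case (Cons l w)
 have "fst l \<in> J" using Cons.prems by (cases l) auto
 then have q: "(if snd l then p (fst l) else inv_into UNIV (p (fst l))) permutes X"
  using assms(1) permutes_inv by auto
 show ?case unfolding wact.simps by (rule permutes_compose[OF q Cons.IH]) (use Cons.prems in auto)
qed (simp add: permutes_id)

text \<open>A cancellation in the normal form corresponds to a permutation meeting its
  inverse.\<close>

lemma (in free_gens) wact_mult:
 assumes p: "!!j. j \<in> {1..n} ==> bij (p j)" and g: "g \<in> carrier G" and l: "l \<in> letters"
 shows "wact p (nf (g \<otimes> lt l)) = wact p (nf g) \<circ> (if snd l then p (fst l) else inv_into UNIV (p (fst l)))"
proof (cases "nf g ~= [] & hd (nf g) = flip l")
 case True
 then obtain w where w: "nf g = flip l # w" by (cases "nf g") auto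
 have b: "bij (p (fst l))" using p l by (auto simp: letters_def)
 have "nf (g \<otimes> lt l) = w" using w by (simp add: nf_mult[OF g l] push_def)
 moreover have "wact p (nf g) \<circ> (if snd l then p (fst l) else inv_into UNIV (p (fst l))) = wact p w"
  using b by (auto simp: w flip_def fun_eq_iff bij_is_inj bij_is_surj surj_f_inv_f)
 ultimately show ?thesis by simp
next
 case False
 then show ?thesis by (auto simp: nf_mult[OF g l] push_def)
qed

text \<open>\<open>Napprox\<close> says that N is at least the distance to the coboundaries, so maps
  that annihilate coboundaries and are contractive in l1 are contractive for N.\<close>

locale l1_data = free_gens G n a + sofic_data G V act Z N Q A r S \<rho> d \<sigma>
 for G :: "('a, 'b) monoid_scheme" (structure) and n a V act and Z :: "('a \<times> nat => complex) set" and N Q A r S \<rho> d \<sigma> +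
 assumes r_eq: "r = 1" and n2: "2 <= n"
  and Zl1: "h \<in> Z ==> lps r (carrier G \<times> {1..n}) h"
  and Aapp: "g \<in> carrier G ==> h \<in> Z ==> x \<in> carrier G ==> A g h (x, j) = h (inv g \<otimes> x, j)"
  and Napprox: "h \<in> Z ==> 0 < \<eta> ==> EX u. lps r (carrier G) u &
   lpn r (carrier G \<times> {1..n}) (%e. h e - dl u e) <= N h + \<eta>"
  and edgeZ: "k \<in> {1..n} ==> edge k \<in> Z"
begin

text \<open>An exact action of the free group, given by the permutations of its generators. Its
  exact identities are what make flows annihilate coboundaries.\<close>

definition \<theta> :: "nat => 'a => nat => nat" where "\<theta> i g = wact (%j. \<sigma> i (a j)) (nf g)"

lemma theta_perm: "g \<in> carrier G ==> \<theta> i g permutes {1..d i}"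
 unfolding \<theta>_def
proof (rule wact_permutes[of "{1..n}"])
 show "\<sigma> i (a j) permutes {1..d i}" if "j \<in> {1..n}" for j by (rule sigma_perm[OF a_closed[OF that]])
 show "set (nf g) \<subseteq> {1..n} \<times> UNIV" if "g \<in> carrier G"
  using nf_rwords[OF that] by (auto simp: rwords_def letters_def)
qed

lemma theta_mult:
 assumes "g \<in> carrier G" "l \<in> letters"
 shows "\<theta> i (g \<otimes> lt l) = \<theta> i g \<circ> (if snd l then \<sigma> i (a (fst l)) else inv_into UNIV (\<sigma> i (a (fst l))))"
 unfolding \<theta>_def by (rule wact_mult[OF _ assms]) (rule permutes_bij[OF sigma_perm[OF a_closed]])

text \<open>Induction along the normal form. For an inverse letter, the permutation of the inverse
  agrees with the inverse permutation wherever \<sigma> respects the product of the generator with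
  its inverse, because \<sigma> sends \<one> to \<open>id\<close>.\<close>

lemma rare_theta: "g \<in> carrier G ==> rare d (%i. {y. \<theta> i g y ~= \<sigma> i g y})"
proof (induction "nf g" arbitrary: g)
 case Nil
 then have "g = \<one>" using nf_Nil_iff[OF Nil(2)] by simp
 then show ?case by (simp add: \<theta>_def sigma_one rare_def)
next
 case (Cons l w)
 have lw: "l \<in> letters" "w \<in> rwords"
  using nf_rwords[OF Cons.prems] unfolding Cons(2)[symmetric] by (auto simp: rwords_def reduced_word_Cons)
 define g' where "g' = val w"
 have g': "g' \<in> carrier G" "nf g' = w" using lw(2) nf_val[OF lw(2)] by (auto simp: g'_def rwords_def)
 have g: "g = g' \<otimes> lt l" using val_nf[OF Cons.prems] unfolding Cons(2)[symmetric] by (simp add: g'_def)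
 define pl where "pl = (%i. if snd l then \<sigma> i (a (fst l)) else inv_into UNIV (\<sigma> i (a (fst l))))"
 have al: "a (fst l) \<in> carrier G" using lw(1) by (auto simp: letters_def)
 have pl: "pl i permutes {1..d i}" for i
  using sigma_perm[OF al] permutes_inv by (auto simp: pl_def)
 have sl: "\<sigma> i (lt l) y = pl i y" if "\<sigma> i (a (fst l) \<otimes> inv (a (fst l))) y = \<sigma> i (a (fst l)) (\<sigma> i (inv (a (fst l))) y)" for i y
 proof (cases "snd l")
  case True
  then show ?thesis by (simp add: lt_def pl_def)
 next
  case False
  have "y = \<sigma> i (a (fst l)) (\<sigma> i (inv (a (fst l))) y)" using that al by (simp add: sigma_one)
  then have "inv_into UNIV (\<sigma> i (a (fst l))) y = \<sigma> i (inv (a (fst l))) y"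
   using permutes_inverses(2)[OF sigma_perm[OF al, of i]] by metis
  then show ?thesis using False by (simp add: lt_def pl_def)
 qed
 have "rare d (%i. {y. pl i y \<in> {y. \<theta> i g' y ~= \<sigma> i g' y}} \<union> {y. \<sigma> i (g' \<otimes> lt l) y ~= \<sigma> i g' (\<sigma> i (lt l) y)}
   \<union> {y. \<sigma> i (a (fst l) \<otimes> inv (a (fst l))) y ~= \<sigma> i (a (fst l)) (\<sigma> i (inv (a (fst l))) y)})"
  using al g' lw(1) by (intro rare_Un rare_vimage[OF _ pl] rare_mult Cons(1)) auto
 then show ?case
 proof (rule rare_subset)
  fix i
  have th: "\<theta> i g y = \<theta> i g' (pl i y)" for y unfolding g using theta_mult[OF g'(1) lw(1)] by (simp add: pl_def)
  show "{y. \<theta> i g y ~= \<sigma> i g y} \<inter> {1..d i} \<subseteq> {y. pl i y \<in> {y. \<theta> i g' y ~= \<sigma> i g' y}} \<union> {y. \<sigma> i (g' \<otimes> lt l) y ~= \<sigma> i g' (\<sigma> i (lt l) y)}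
   \<union> {y. \<sigma> i (a (fst l) \<otimes> inv (a (fst l))) y ~= \<sigma> i (a (fst l)) (\<sigma> i (inv (a (fst l))) y)}"
  proof (rule subsetI)
   fix y assume y: "y \<in> {y. \<theta> i g y ~= \<sigma> i g y} \<inter> {1..d i}"
   show "y \<in> {y. pl i y \<in> {y. \<theta> i g' y ~= \<sigma> i g' y}} \<union> {y. \<sigma> i (g' \<otimes> lt l) y ~= \<sigma> i g' (\<sigma> i (lt l) y)}
    \<union> {y. \<sigma> i (a (fst l) \<otimes> inv (a (fst l))) y ~= \<sigma> i (a (fst l)) (\<sigma> i (inv (a (fst l))) y)}"
   proof (rule ccontr)
    assume "\<not> ?thesis"
    then have c: "\<theta> i g' (pl i y) = \<sigma> i g' (pl i y)" "\<sigma> i (g' \<otimes> lt l) y = \<sigma> i g' (\<sigma> i (lt l) y)"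
     "\<sigma> i (a (fst l) \<otimes> inv (a (fst l))) y = \<sigma> i (a (fst l)) (\<sigma> i (inv (a (fst l))) y)"
     unfolding Un_iff mem_Collect_eq de_Morgan_disj not_not by blast+
    have "\<theta> i g y = \<sigma> i g y" unfolding th c(1) by (simp only: g c(2) sl[OF c(3)])
    then show False using y by blast
   qed
  qed
 qed
qed

text \<open>The \<theta>-equivariant map that sends the edge (\<one>, k) to the vector
  \<open>\<xi> k\<close>.\<close>

definition flow :: "nat => (nat => nat => complex) => ('a \<times> nat => complex) => nat => complex" where
 "flow i \<xi> h x = (\<Sum>\<^sub>\<infinity>e\<in>edges. h e * \<xi> (snd e) (inv_into UNIV (\<theta> i (fst e)) x))"

context
 fixes i :: nat and \<xi> :: "nat => nat => complex"
 assumes supp: "!!j x. x \<notin> {1..d i} ==> \<xi> j x = 0"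
  and bound: "!!j. j \<in> {1..n} ==> (\<Sum>x\<in>{1..d i}. cmod (\<xi> j x)) <= 1"
  and flow_eq: "!!x. (\<Sum>j=1..n. \<xi> j (\<sigma> i (a j) x)) = (\<Sum>j=1..n. \<xi> j x)"
begin

lemma xi_le: "j \<in> {1..n} ==> cmod (\<xi> j x) <= 1"
 using member_le_sum[of x "{1..d i}" "%x. cmod (\<xi> j x)"] bound[of j] supp[of x j] by (cases "x \<in> {1..d i}") force+

lemma xi_sum:
 assumes j: "j \<in> {1..n}" and q: "q permutes {1..d i}"
 shows "(\<Sum>x\<in>{1..d i}. cmod (\<xi> j (q x))) <= 1"
proof -
 have "(\<Sum>x\<in>{1..d i}. cmod (\<xi> j (q x))) = (\<Sum>x\<in>{1..d i}. cmod (\<xi> j x))"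
  using sum.permute[OF q, of "%x. cmod (\<xi> j x)"] unfolding o_def by (rule sym)
 then show ?thesis using bound[OF j] by (rule ord_eq_le_trans)
qed

lemma flow_summable:
 assumes "lps r edges h"
 shows "(%e. h e * \<xi> (snd e) (inv_into UNIV (\<theta> i (fst e)) x)) summable_on edges"
 by (rule abs_summable_summable, rule weighted_summable[where \<kappa> = 1, OF assms[unfolded l1_norm[OF r_eq]]]) (auto intro: xi_le)

lemma flow_add:
 assumes "lps r edges h" "lps r edges h'"
 shows "flow i \<xi> (%e. h e + h' e) x = flow i \<xi> h x + flow i \<xi> h' x"
 unfolding flow_def infsum_add[OF flow_summable[OF assms(1)] flow_summable[OF assms(2)], symmetric]
 by (intro infsum_cong) (simp add: distrib_right)

lemma flow_diff:
 assumes "lps r edges h" "lps r edges h'"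
 shows "flow i \<xi> (%e. h e - h' e) x = flow i \<xi> h x - flow i \<xi> h' x"
 unfolding flow_def infsum_minus[OF flow_summable[OF assms(1)] flow_summable[OF assms(2)], symmetric]
 by (intro infsum_cong) (simp add: left_diff_distrib)

lemma flow_scale: "flow i \<xi> (%e. c * h e) x = c * flow i \<xi> h x"
 unfolding flow_def by (simp add: mult.assoc infsum_cmult_right')

lemma flow_edge:
 assumes k: "k \<in> {1..n}"
 shows "flow i \<xi> (edge k) x = \<xi> k x"
proof -
 have "flow i \<xi> (edge k) x = (\<Sum>\<^sub>\<infinity>e\<in>{(\<one>, k)}. edge k e * \<xi> (snd e) (inv_into UNIV (\<theta> i (fst e)) x))"
  unfolding flow_def using k by (intro infsum_cong_neutral) (auto simp: edge_def split: if_splits)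
 then show ?thesis by (simp add: edge_def \<theta>_def)
qed

text \<open>Summation by parts pairs u with the boundary of the edge function that takes
  \<open>\<xi> j\<close> at the \<theta>-preimage of x under g. This boundary vanishes exactly,
  since \<xi> is conserved at every vertex and \<theta> is an action.\<close>

lemma flow_dl:
 assumes u: "lps r (carrier G) u"
 shows "flow i \<xi> (dl u) x = 0"
proof -
 define w where "w = (%(g, j). \<xi> j (inv_into UNIV (\<theta> i g) x))"
 have us: "(%x. cmod (u x)) summable_on carrier G" using u by (simp add: l1_norm[OF r_eq])
 have u1: "lps r edges (%(x, j). u x)"
  by (rule lp_slices(1)[OF r1 _, THEN iffD2]) (use u in auto)
 have u2: "lps r edges (%(x, j). u (x \<otimes> a j))"
  by (rule lp_slices(1)[OF r1 _, THEN iffD2]) (use u lp_reindex(1)[OF right_bij[OF a_closed], of _ r u] in auto)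
 have wb: "cmod (w e) <= 1" if "e \<in> edges" for e using that xi_le by (auto simp: w_def)
 have "flow i \<xi> (dl u) x = (\<Sum>\<^sub>\<infinity>e\<in>edges. w e * dl u e)"
  unfolding flow_def by (intro infsum_cong) (auto simp: w_def)
 also have "\<dots> = - (\<Sum>\<^sub>\<infinity>x\<in>carrier G. bd w x * u x)"
 proof (rule summation_by_parts)
  have "(%e. (case e of (x, j) => u x) * w e) summable_on edges"
   by (rule abs_summable_summable, rule weighted_summable[where \<kappa> = 1, OF u1[unfolded l1_norm[OF r_eq]]], rule wb)
  then show "(%(x, j). w (x, j) * u x) summable_on edges" by (simp add: case_prod_unfold mult.commute)
  have "(%e. (case e of (x, j) => u (x \<otimes> a j)) * w e) summable_on edges"
   by (rule abs_summable_summable, rule weighted_summable[where \<kappa> = 1, OF u2[unfolded l1_norm[OF r_eq]]], rule wb)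
  then show "(%(x, j). w (x, j) * u (x \<otimes> a j)) summable_on edges" by (simp add: case_prod_unfold mult.commute)
 qed
 finally have fl: "flow i \<xi> (dl u) x = - (\<Sum>\<^sub>\<infinity>x\<in>carrier G. bd w x * u x)" .
 have "bd w g = 0" for g
 proof (cases "g \<in> carrier G")
  case True
  define y where "y = inv_into UNIV (\<theta> i g) x"
  have "w (g \<otimes> inv (a j), j) = \<xi> j (\<sigma> i (a j) y)" if j: "j \<in> {1..n}" for j
  proof -
   have l: "(j, False) \<in> letters" using j by (simp add: letters_def)
   have b: "bij (\<sigma> i (a j))" by (rule permutes_bij[OF sigma_perm[OF a_closed[OF j]]])
   have "\<theta> i (g \<otimes> inv (a j)) = \<theta> i g \<circ> inv_into UNIV (\<sigma> i (a j))" using theta_mult[OF True l, of i] by (simp add: lt_def)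
   moreover have "inv_into UNIV (\<theta> i g \<circ> inv_into UNIV (\<sigma> i (a j))) = inv_into UNIV (inv_into UNIV (\<sigma> i (a j))) \<circ> inv_into UNIV (\<theta> i g)"
    using permutes_bij[OF theta_perm[OF True]] bij_imp_bij_inv[OF b] by (intro o_inv_distrib)
   ultimately show ?thesis using inv_inv_eq[OF b] by (simp add: w_def y_def)
  qed
  then have "bd w g = (\<Sum>j=1..n. \<xi> j y) - (\<Sum>j=1..n. \<xi> j (\<sigma> i (a j) y))"
   using True by (simp add: bd_def w_def y_def)
  then show ?thesis using flow_eq[of y] by simp
 qed (simp add: bd_def)
 then show ?thesis unfolding fl by simp
qed

lemma flow_norm_l1:
 assumes h: "lps r edges h"
 shows "lpn r {1..d i} (flow i \<xi> h) <= lpn r edges h"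
proof -
 have hs: "(%e. cmod (h e)) summable_on edges" using h by (simp add: l1_norm[OF r_eq])
 have "(\<Sum>x\<in>{1..d i}. cmod (flow i \<xi> h x)) <= (\<Sum>\<^sub>\<infinity>e\<in>edges. cmod (h e) * 1)"
  unfolding flow_def
 proof (rule l1_transfer[OF hs _ order_refl])
  fix e assume e: "e \<in> edges"
  show "(\<Sum>x\<in>{1..d i}. cmod (\<xi> (snd e) (inv_into UNIV (\<theta> i (fst e)) x))) <= 1"
   by (rule xi_sum[OF _ permutes_inv[OF theta_perm]]) (use e in auto)
 qed
 then show ?thesis unfolding l1_norm[OF r_eq] by simp
qed

text \<open>Coboundaries contribute nothing, so h may be replaced by a nearly shortest function in
  its class.\<close>

lemma flow_norm:
 assumes h: "h \<in> Z"
 shows "lpn r {1..d i} (flow i \<xi> h) <= N h"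
proof (rule field_le_epsilon)
 fix \<eta> :: real assume "0 < \<eta>"
 then obtain u where u: "lps r (carrier G) u" "lpn r edges (%e. h e - dl u e) <= N h + \<eta>"
  using Napprox[OF h] by blast
 note du = dl_bound(1)[OF r1 u(1)]
 have "flow i \<xi> h = flow i \<xi> (%e. h e - dl u e)"
  using flow_diff[OF Zl1[OF h] du] flow_dl[OF u(1)] by (intro ext) simp
 then show "lpn r {1..d i} (flow i \<xi> h) <= N h + \<eta>"
  using flow_norm_l1[OF lp_minus(1)[OF r1 Zl1[OF h] du]] u(2) by simp
qed

text \<open>Equivariance is exact under \<theta>; under \<sigma> it can fail only where the two
  disagree along words. For edges in \<open>K0\<close> the flow vanishes at those points; off
  \<open>K0\<close> the trivial bound 2 meets a tail of at most \<delta> / 3.\<close>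

lemma hom_like_flow:
 assumes F: "F \<subseteq> carrier G" and d0: "0 < \<delta>"
  and K0: "K0 \<subseteq> edges" "!!l Y. l < m ==> Y \<subseteq> edges ==> Y \<inter> K0 = {} ==> lpn r Y (s l) <= \<delta> / 3"
  and zero: "!!gs g j y. set gs \<subseteq> F ==> length gs \<in> {1..m} ==> (g, j) \<in> K0 ==> y \<in> {1..d i} ==>
   \<theta> i (foldr (\<otimes>) gs g) y ~= foldr (\<sigma> i) gs (\<theta> i g y) ==> \<xi> j y = 0"
 shows "hom_like i F m \<delta> (flow i \<xi>)"
 unfolding hom_like_def
proof (intro conjI ballI allI impI)
 show "flow i \<xi> (f + g) = flow i \<xi> f + flow i \<xi> g" if "f \<in> Z" "g \<in> Z" for f g
  using flow_add[OF Zl1 Zl1] that by (auto simp: fun_eq_iff plus_fun_def)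
 show "flow i \<xi> (cs c f) = cs c (flow i \<xi> f)" for c f by (rule ext) (rule flow_scale)
 show "flow i \<xi> f \<in> fin_carrier (d i)" for f
  unfolding fin_carrier_def mem_Collect_eq flow_def
 proof (intro allI impI infsum_0)
  fix x e assume x: "x \<notin> {1..d i}" and e: "e \<in> edges"
  have "inv_into UNIV (\<theta> i (fst e)) x = x"
   by (rule permutes_not_in[OF permutes_inv[OF theta_perm] x]) (use e in auto)
  then show "f e * \<xi> (snd e) (inv_into UNIV (\<theta> i (fst e)) x) = 0" using supp[OF x] by simp
 qed
 show "lpn r {1..d i} (flow i \<xi> f) <= N f" if "f \<in> Z" for f by (rule flow_norm[OF that])
 fix gs l assume a: "set gs \<subseteq> F & length gs \<in> {1..m} & l < m"
 then have gs: "set gs \<subseteq> carrier G" using F by auto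
 define h where "h = foldr (\<otimes>) gs \<one>"
 have h: "h \<in> carrier G" "foldr A gs (s l) = A h (s l)" using foldr_A[OF gs s(1)] by (auto simp: h_def)
 have hm: "foldr (\<otimes>) gs g = h \<otimes> g" if "g \<in> carrier G" for g using foldr_mult[OF gs that] by (simp add: h_def)
 define \<pi> where "\<pi> = foldr (\<sigma> i) gs"
 have \<pi>: "bij \<pi>" "foldr (%g. perm_act (\<sigma> i g)) gs v = perm_act \<pi> v" for v
  using foldr_perm_act[of gs "\<sigma> i" v] gs permutes_bij[OF sigma_perm] unfolding \<pi>_def by blast+
 have \<pi>p: "\<pi> permutes {1..d i}" unfolding \<pi>_def using gs
 proof (induction gs)
  case (Cons g gs)
  have eq: "foldr (\<sigma> i) (g # gs) = \<sigma> i g \<circ> foldr (\<sigma> i) gs" by auto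
  show ?case unfolding eq by (rule permutes_compose[OF Cons.IH sigma_perm]) (use Cons.prems in auto)
 qed (simp add: permutes_id[unfolded id_def] id_def)
 define w1 where "w1 = (%x e. \<xi> (snd e) (inv_into UNIV (\<theta> i (h \<otimes> fst e)) x))"
 define w2 where "w2 = (%x e. \<xi> (snd e) (inv_into UNIV (\<theta> i (fst e)) (inv_into UNIV \<pi> x)))"
 have slS: "(%e. cmod (s l e)) summable_on edges" using Zl1[OF s(1)] by (simp add: l1_norm[OF r_eq])
 have bij: "bij_betw (%e. (h \<otimes> fst e, snd e)) edges edges"
  by (rule bij_betw_byWitness[where f' = "%e. (inv h \<otimes> fst e, snd e)"]) (use h(1) in \<open>auto simp: m_assoc[symmetric]\<close>)
 have 1: "flow i \<xi> (A h (s l)) x = (\<Sum>\<^sub>\<infinity>e\<in>edges. s l e * w1 x e)" for x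
  unfolding flow_def infsum_reindex_bij_betw[OF bij, of "%e. A h (s l) e * \<xi> (snd e) (inv_into UNIV (\<theta> i (fst e)) x)", symmetric]
  using h(1) by (intro infsum_cong) (auto simp: w1_def Aapp s(1) m_assoc[symmetric])
 have 2: "perm_act \<pi> (flow i \<xi> (s l)) x = (\<Sum>\<^sub>\<infinity>e\<in>edges. s l e * w2 x e)" for x
  by (simp add: perm_act_def flow_def w2_def)
 have s1: "(%e. s l e * w1 x e) summable_on edges" for x
  by (rule abs_summable_summable, rule weighted_summable[where \<kappa> = 1, OF slS]) (auto simp: w1_def intro!: xi_le)
 have s2: "(%e. s l e * w2 x e) summable_on edges" for x
  by (rule abs_summable_summable, rule weighted_summable[where \<kappa> = 1, OF slS]) (auto simp: w2_def intro!: xi_le)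
 define \<kappa> where "\<kappa> = (%e. if e \<in> K0 then 0 else 2 :: real)"
 have w: "(\<Sum>x\<in>{1..d i}. cmod (w1 x e - w2 x e)) <= \<kappa> e" if e: "e \<in> edges" for e
 proof (cases "e \<in> K0")
  case True
  obtain g j where gj: "e = (g, j)" by (cases e)
  have g: "g \<in> carrier G" "h \<otimes> g \<in> carrier G" using e gj h(1) by auto
  note tp = theta_perm[OF g(1), of i] and tp' = theta_perm[OF g(2), of i]
  have "w1 x e = w2 x e" if x: "x \<in> {1..d i}" for x
  proof -
   define y where "y = inv_into UNIV (\<theta> i (h \<otimes> g)) x"
   define y' where "y' = inv_into UNIV (\<theta> i g) (inv_into UNIV \<pi> x)"
   have y: "\<theta> i (h \<otimes> g) y = x" "y \<in> {1..d i}" using permutes_inverses(1)[OF tp'] permutes_in_image[OF permutes_inv[OF tp']] x by (auto simp: y_def)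
   have y': "\<pi> (\<theta> i g y') = x" "y' \<in> {1..d i}"
    using permutes_inverses(1)[OF tp] permutes_inverses(1)[OF \<pi>p] permutes_in_image[OF permutes_inv[OF tp]] permutes_in_image[OF permutes_inv[OF \<pi>p]] x
    by (auto simp: y'_def)
   note z = zero[of gs g j, unfolded hm[OF g(1)], folded \<pi>_def]
   \<comment> \<open>If the two preimages of x differ, both are points of disagreement, and the flow
     is 0 at both.\<close>
   have "\<xi> j y = \<xi> j y'"
   proof (cases "y = y'")
    case False
    have "\<theta> i (h \<otimes> g) y ~= \<pi> (\<theta> i g y)"
    proof
     assume "\<theta> i (h \<otimes> g) y = \<pi> (\<theta> i g y)"
     then have "\<pi> (\<theta> i g y) = \<pi> (\<theta> i g y')" using y y' by simp
     then have "y = y'" using permutes_inj[OF \<pi>p] permutes_inj[OF tp] by (simp add: inj_eq)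
     then show False using False by simp
    qed
    then have "\<xi> j y = 0" using z[of y] a True gj y(2) by blast
    moreover have "\<theta> i (h \<otimes> g) y' ~= \<pi> (\<theta> i g y')"
    proof
     assume "\<theta> i (h \<otimes> g) y' = \<pi> (\<theta> i g y')"
     then have "\<theta> i (h \<otimes> g) y' = \<theta> i (h \<otimes> g) y" using y y' by simp
     then have "y = y'" using permutes_inj[OF tp'] by (simp add: inj_eq)
     then show False using False by simp
    qed
    then have "\<xi> j y' = 0" using z[of y'] a True gj y'(2) by blast
    ultimately show ?thesis by simp
   qed simp
   then show ?thesis by (simp add: w1_def w2_def gj y_def y'_def)
  qed
  then show ?thesis using True by (simp add: \<kappa>_def)
 next
  case False
  have "(\<Sum>x\<in>{1..d i}. cmod (w1 x e - w2 x e)) <= (\<Sum>x\<in>{1..d i}. cmod (w1 x e)) + (\<Sum>x\<in>{1..d i}. cmod (w2 x e))"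
   unfolding sum.distrib[symmetric] by (intro sum_mono norm_triangle_ineq4)
  also have "\<dots> <= 1 + 1"
  proof (rule add_mono)
   show "(\<Sum>x\<in>{1..d i}. cmod (w1 x e)) <= 1" unfolding w1_def
    by (rule xi_sum[OF _ permutes_inv[OF theta_perm]]) (use e h(1) in auto)
   have "inv_into UNIV (\<theta> i (fst e)) \<circ> inv_into UNIV \<pi> permutes {1..d i}"
    by (rule permutes_compose[OF permutes_inv[OF \<pi>p] permutes_inv[OF theta_perm]]) (use e in auto)
   from xi_sum[OF _ this, of "snd e"] show "(\<Sum>x\<in>{1..d i}. cmod (w2 x e)) <= 1" using e by (auto simp: w2_def)
  qed
  finally show ?thesis using False by (simp add: \<kappa>_def)
 qed
 have "lpn r {1..d i} (flow i \<xi> (foldr A gs (s l)) - foldr (%g. perm_act (\<sigma> i g)) gs (flow i \<xi> (s l)))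
   = (\<Sum>x\<in>{1..d i}. cmod (\<Sum>\<^sub>\<infinity>e\<in>edges. s l e * (w1 x e - w2 x e)))"
  unfolding l1_norm[OF r_eq] h(2) \<pi>(2) infsum_finite[OF finite_atLeastAtMost]
 proof (intro sum.cong refl)
  fix x
  show "cmod ((flow i \<xi> (A h (s l)) - perm_act \<pi> (flow i \<xi> (s l))) x) = cmod (\<Sum>\<^sub>\<infinity>e\<in>edges. s l e * (w1 x e - w2 x e))"
   unfolding fun_diff_def 1 2 infsum_minus[OF s1 s2, symmetric] right_diff_distrib ..
 qed
 also have "\<dots> <= (\<Sum>\<^sub>\<infinity>e\<in>edges. cmod (s l e) * \<kappa> e)"
  by (rule l1_transfer[OF slS w, of _ "2"]) (auto simp: \<kappa>_def)
 also have "\<dots> = (\<Sum>\<^sub>\<infinity>e\<in>edges - K0. 2 * cmod (s l e))"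
  by (rule infsum_cong_neutral) (auto simp: \<kappa>_def)
 also have "\<dots> = 2 * lpn r (edges - K0) (s l)"
  unfolding l1_norm[OF r_eq] by (rule infsum_cmult_right')
 also have "\<dots> <= 2 * (\<delta> / 3)"
 proof -
  have dj: "(edges - K0) \<inter> K0 = {}" by blast
  have "lpn r (edges - K0) (s l) <= \<delta> / 3" by (rule K0(2)[OF _ Diff_subset dj]) (use a in simp)
  then show ?thesis by linarith
 qed
 also have "\<dots> < \<delta>" using d0 by simp
 finally show "lpn r {1..d i} (flow i \<xi> (foldr A gs (s l)) - foldr (%g. perm_act (\<sigma> i g)) gs (flow i \<xi> (s l))) < \<delta>" .
qed

end

text \<open>The admissible flows are the kernel of an integer matrix with n d unknowns and d + n
  card bb equations. With P the difference of these numbers and \<epsilon> = 16 exp (-L),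
  \<open>kernel_width_lower\<close> yields P (L - ln 48) <= L card B. A large L makes the loss
  negligible.\<close>

theorem lower_l1: "ereal (real n - 1) <= lower_sofic_dim (ereal r) G V act d \<sigma> S \<rho>"
proof -
 have one_n: "1 \<in> {1..n}" using n2 by simp
 note a1 = a_closed[OF one_n] free_generators_distinct(1)[OF free one_n one_n]
 note dpos = hamming_one(2)[OF a1(1) one_closed a1(2)]
 show ?thesis
 proof (rule lower_frame[of n edge, OF edgeZ dpos])
  fix \<eta> :: real assume eta: "0 < \<eta>"
  \<comment> \<open>48 = 3 * 16 compares the two bases: 1 / (3 \<epsilon>) is 16 / \<epsilon>
    divided by 48.\<close>
  define c48 where "c48 = ln (48 :: real)"
  have c48: "0 < c48" "exp c48 = 48" by (auto simp: c48_def)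
  \<comment> \<open>Large enough that n \<open>c48\<close> / L is at most \<eta> / 2; the summand 1
    + \<open>c48\<close> secures 3 \<epsilon> < 1.\<close>
  define L where "L = 1 + c48 + 2 * real n * c48 / \<eta>"
  have L: "c48 < L" "0 < L" "2 * real n * c48 <= \<eta> * L"
  proof -
   have "0 <= 2 * real n * c48 / \<eta>" using c48 eta by simp
   then show "c48 < L" "0 < L" using c48(1) by (simp_all add: L_def)
   have "\<eta> * L = \<eta> * (1 + c48) + 2 * real n * c48" using eta by (simp add: L_def distrib_left)
   then show "2 * real n * c48 <= \<eta> * L" using eta c48 by simp
  qed
  define \<epsilon> where "\<epsilon> = 16 * exp (- L)"
  have e0: "0 < \<epsilon>" by (simp add: \<epsilon>_def)
  have "\<epsilon> * exp L = 16" by (simp add: \<epsilon>_def mult.assoc exp_add[symmetric])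
  then have e16: "16 / \<epsilon> = exp L" using e0 by (simp add: divide_eq_eq mult.commute)
  have e3: "1 / (3 * \<epsilon>) = exp (L - c48)"
   unfolding exp_diff c48(2) e16[symmetric] using e0 by (simp add: field_simps)
  have "1 < 1 / (3 * \<epsilon>)" unfolding e3 using L(1) by simp
  then have e31: "3 * \<epsilon> < 1" using e0 by (simp add: field_simps)
  \<comment> \<open>The first bound keeps n card bb below \<eta> d / 2, the second keeps the
    equations from outnumbering the unknowns.\<close>
  define x where "x = min (\<eta> / (2 * real n)) (1 / 2)"
  have x: "0 < x" "real n * x <= \<eta> / 2" "x <= 1 / 2"
  proof -
   have "real n * x <= real n * (\<eta> / (2 * real n))" unfolding x_def by (intro mult_left_mono) auto
   then show "real n * x <= \<eta> / 2" using n2 by simp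
  qed (use eta n2 in \<open>auto simp: x_def\<close>)
  show "\<exists>\<epsilon>2>0. \<forall>F m \<delta>. finite F & F \<subseteq> carrier G & 0 < \<delta> -->
   (\<forall>\<^sub>F i in sequentially. \<forall>(B :: (nat => nat => complex) set) v. finite B -->
    (\<forall>\<tau>. hom_like i F m \<delta> \<tau> --> (EX c. \<forall>k\<in>{1..n}. lpn r {1..d i} (%x. \<tau> (edge k) x - (\<Sum>b\<in>B. c b * v b k x)) <= \<epsilon>2)) -->
    (real n - 1 - \<eta>) * real (d i) <= real (card B))"
  \<comment> \<open>The l1 norm on the unknowns sums over n vectors, each approximated up to
    \<epsilon> / n.\<close>
  proof (rule exI[of _ "\<epsilon> / real n"], rule conjI)
   show "0 < \<epsilon> / real n" using e0 n2 by simp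
   show "\<forall>F m \<delta>. finite F & F \<subseteq> carrier G & 0 < \<delta> -->
   (\<forall>\<^sub>F i in sequentially. \<forall>(B :: (nat => nat => complex) set) v. finite B -->
    (\<forall>\<tau>. hom_like i F m \<delta> \<tau> --> (EX c. \<forall>k\<in>{1..n}. lpn r {1..d i} (%x. \<tau> (edge k) x - (\<Sum>b\<in>B. c b * v b k x)) <= \<epsilon> / real n)) -->
    (real n - 1 - \<eta>) * real (d i) <= real (card B))"
   proof (rule allI, rule allI, rule allI, rule impI)
    fix F m and \<delta> :: real assume F: "finite F & F \<subseteq> carrier G & 0 < \<delta>"
    have "ALL l. EX K. finite K & K \<subseteq> edges & (ALL Y. Y \<subseteq> edges --> Y \<inter> K = {} --> lpn r Y (s l) <= \<delta> / 3)"
    proof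
     fix l
     have cd: "0 < \<delta> / 3" using F by simp
     show "EX K. finite K & K \<subseteq> edges & (ALL Y. Y \<subseteq> edges --> Y \<inter> K = {} --> lpn r Y (s l) <= \<delta> / 3)"
     proof (rule lp_tail[OF r1 Zl1[OF s(1)[of l]] cd], goal_cases)
      case (1 K)
      then show ?case by (intro exI[of _ K] conjI allI impI)
     qed
    qed
    from choice[OF this] obtain K where K: "ALL l. finite (K l) & K l \<subseteq> edges & (ALL Y. Y \<subseteq> edges --> Y \<inter> K l = {} --> lpn r Y (s l) <= \<delta> / 3)" ..
    define K0 where "K0 = (\<Union>l<m. K l)"
    have K0: "finite K0" "K0 \<subseteq> edges" using K by (auto simp: K0_def)
    have tail: "lpn r Y (s l) <= \<delta> / 3" if "l < m" "Y \<subseteq> edges" "Y \<inter> K0 = {}" for l Y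
    proof -
     have "Y \<inter> K l = {}" using that(1,3) unfolding K0_def by blast
     then show ?thesis using K that(2) by blast
    qed
    define words where "words = {gs. set gs \<subseteq> F & length gs \<in> {1..m}}"
    have "words \<subseteq> {gs. set gs \<subseteq> F & length gs <= m}" by (auto simp: words_def)
    then have fw: "finite words" using finite_lists_length_le[of F m] F finite_subset by blast
    have wc: "set gs \<subseteq> carrier G" if "gs \<in> words" for gs using that F by (auto simp: words_def)
    define bad where "bad = (%i. \<Union>p\<in>words \<times> fst ` K0. {y. \<theta> i (foldr (\<otimes>) (fst p) (snd p)) y ~= foldr (\<sigma> i) (fst p) (\<theta> i (snd p) y)})"
    have "rare d bad" unfolding bad_def
    proof (rule rare_UN)
     show "finite (words \<times> fst ` K0)" using fw K0(1) by simp
     fix p assume "p \<in> words \<times> fst ` K0"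
     then obtain gs g where p: "p = (gs, g)" "set gs \<subseteq> carrier G" "g \<in> carrier G" using wc K0(2) by auto
     have u: "foldr (\<otimes>) gs g \<in> carrier G" using foldr_mult[OF p(2,3)] p(3) by simp
     have "rare d (%i. {y. \<theta> i (foldr (\<otimes>) gs g) y ~= \<sigma> i (foldr (\<otimes>) gs g) y} \<union> {y. \<theta> i g y ~= \<sigma> i g y}
       \<union> {v. foldr (\<sigma> i) gs (\<sigma> i g v) ~= \<sigma> i (foldr (\<otimes>) gs g) v})"
      by (intro rare_Un rare_theta rare_word u p)
     then show "rare d (%i. {y. \<theta> i (foldr (\<otimes>) (fst p) (snd p)) y ~= foldr (\<sigma> i) (fst p) (\<theta> i (snd p) y)})"
      by (rule rare_subset) (auto simp: p(1))
    qed
    then have bl: "(%i. real (card (bad i \<inter> {1..d i})) / real (d i)) \<longlonglongrightarrow> 0" unfolding rare_def .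
    have bsmall: "\<forall>\<^sub>F i in sequentially. real (card (bad i \<inter> {1..d i})) / real (d i) < x"
     by (rule order_tendstoD(2)[OF bl x(1)])
    show "\<forall>\<^sub>F i in sequentially. \<forall>(B :: (nat => nat => complex) set) v. finite B -->
     (\<forall>\<tau>. hom_like i F m \<delta> \<tau> --> (EX c. \<forall>k\<in>{1..n}. lpn r {1..d i} (%x. \<tau> (edge k) x - (\<Sum>b\<in>B. c b * v b k x)) <= \<epsilon> / real n)) -->
     (real n - 1 - \<eta>) * real (d i) <= real (card B)"
     using bsmall dpos
    proof (eventually_elim, intro allI impI)
     fix i and B :: "(nat => nat => complex) set" and v :: "(nat => nat => complex) => nat => nat => complex"
     assume bs: "real (card (bad i \<inter> {1..d i})) / real (d i) < x" and di: "0 < d i" and B: "finite B"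
      and key: "\<forall>\<tau>. hom_like i F m \<delta> \<tau> --> (EX c. \<forall>k\<in>{1..n}. lpn r {1..d i} (%y. \<tau> (edge k) y - (\<Sum>b\<in>B. c b * v b k y)) <= \<epsilon> / real n)"
     define bb where "bb = bad i \<inter> {1..d i}"
     define I where "I = {1..d i} \<times> {1..n}"
     \<comment> \<open>\<open>Inl x\<close> is conservation at the vertex x, and
       \<open>Inr (y, j)\<close> makes the flow through edge j vanish at the bad point y.\<close>
     define E where "E = {1..d i} <+> (bb \<times> {1..n})"
     define k :: "nat + nat \<times> nat => nat \<times> nat => int" where "k = (%e q. case e of Inl x => (if \<sigma> i (a (snd q)) x = fst q then 1 else 0) - (if x = fst q then 1 else 0)
      | Inr q0 => if q0 = q then 1 else 0)"
     have fin: "finite I" "finite E" "finite bb" by (auto simp: I_def E_def bb_def)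
     have cI: "card I = n * d i" by (simp add: I_def)
     have cE: "card E = d i + card bb * n" using fin(3) by (simp add: E_def card_Plus)
     have cb: "real (card bb) <= x * real (d i)"
      using bs di unfolding bb_def[symmetric] by (simp only: pos_divide_less_eq of_nat_0_less_iff less_imp_le)
     have "real n * real (card bb) <= real n * (x * real (d i))" using cb by (intro mult_left_mono) auto
     then have ncb: "real n * real (card bb) <= (real n * x) * real (d i)" by (simp add: mult.assoc)
     \<comment> \<open>Here n \<ge> 2 enters, through n / 2 <= n - 1.\<close>
     have "real n * x <= real n * (1 / 2)" using x(3) by (intro mult_left_mono) auto
     also have "\<dots> <= real n - 1" using n2 by simp
     finally have "(real n * x) * real (d i) <= (real n - 1) * real (d i)" by (intro mult_right_mono) auto
     then have "real (card E) <= real (card I)" using ncb unfolding cE cI by (simp add: algebra_simps)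
     then have EI: "card E <= card I" by simp
     have ps: "(\<Sum>q\<in>I. h q) = (\<Sum>j=1..n. \<Sum>y\<in>{1..d i}. h (y, j))" for h :: "nat \<times> nat => 'x :: comm_monoid_add"
      unfolding I_def by (subst sum.swap) (simp add: sum.cartesian_product)
     have main: "(1 / (3 * \<epsilon>)) ^ (card I - card E) <= (16 / \<epsilon>) ^ card B"
     proof (rule kernel_width_lower[OF fin(1,2) EI B e0 e31, of k "%b q. v b (snd q) (fst q)"])
      fix z assume ker: "\<forall>e\<in>E. (\<Sum>q\<in>I. of_int (k e q) * z q) = 0" and z1: "l1n I z <= 1"
      define \<xi> where "\<xi> = (%j y. if y \<in> {1..d i} & j \<in> {1..n} then z (y, j) else 0)"
      have sup: "\<xi> j y = 0" if "y \<notin> {1..d i}" for j y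
      proof -
       have "\<not> (y \<in> {1..d i} & j \<in> {1..n})" using that by blast
       then show ?thesis unfolding \<xi>_def by (rule if_not_P)
      qed
      have bnd: "(\<Sum>y\<in>{1..d i}. cmod (\<xi> j y)) <= 1" if j: "j \<in> {1..n}" for j
      proof -
       have "(\<Sum>y\<in>{1..d i}. cmod (\<xi> j y)) = (\<Sum>y\<in>{1..d i}. cmod (z (y, j)))" using j by (intro sum.cong) (auto simp: \<xi>_def)
       also have "\<dots> <= (\<Sum>j=1..n. \<Sum>y\<in>{1..d i}. cmod (z (y, j)))"
        by (rule member_le_sum[OF j, of "%j. \<Sum>y\<in>{1..d i}. cmod (z (y, j))"]) (auto intro: sum_nonneg)
       also have "\<dots> <= 1" using z1 unfolding l1n_def ps .
       finally show ?thesis .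
      qed
      have fl: "(\<Sum>j=1..n. \<xi> j (\<sigma> i (a j) y)) = (\<Sum>j=1..n. \<xi> j y)" for y
      proof (cases "y \<in> {1..d i}")
       case True
       then have "Inl y \<in> E" unfolding E_def by (rule InlI)
       then have "(\<Sum>j=1..n. \<Sum>y'\<in>{1..d i}. of_int (k (Inl y) (y', j)) * z (y', j)) = 0" using ker unfolding ps by blast
       moreover have "(\<Sum>y'\<in>{1..d i}. of_int (k (Inl y) (y', j)) * z (y', j)) = \<xi> j (\<sigma> i (a j) y) - \<xi> j y" if j: "j \<in> {1..n}" for j
       proof -
        have sy: "\<sigma> i (a j) y \<in> {1..d i}" using permutes_in_image[OF sigma_perm[OF a_closed[OF j], of i], of y] True by simp
        have "(\<Sum>y'\<in>{1..d i}. of_int (k (Inl y) (y', j)) * z (y', j)) =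
         (\<Sum>y'\<in>{1..d i}. (if \<sigma> i (a j) y = y' then z (y', j) else 0) - (if y = y' then z (y', j) else 0))"
         by (intro sum.cong) (auto simp: k_def)
        also have "\<dots> = z (\<sigma> i (a j) y, j) - z (y, j)"
         unfolding sum_subtractf using sy True by (simp add: sum.delta')
        finally show ?thesis using sy True j by (simp add: \<xi>_def)
       qed
       ultimately have "(\<Sum>j=1..n. \<xi> j (\<sigma> i (a j) y) - \<xi> j y) = 0" by simp
       then show ?thesis by (simp add: sum_subtractf)
      next
       case False
       then show ?thesis using permutes_not_in[OF sigma_perm[OF a_closed, of _ i] False] by (intro sum.cong) auto
      qed
      have zer: "\<xi> j y = 0" if g: "set gs \<subseteq> F" "length gs \<in> {1..m}" "(g, j) \<in> K0" "y \<in> {1..d i}"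
       "\<theta> i (foldr (\<otimes>) gs g) y ~= foldr (\<sigma> i) gs (\<theta> i g y)" for gs g j y
      proof -
       have j: "j \<in> {1..n}" using g(3) K0(2) by auto
       have "(gs, g) \<in> words \<times> fst ` K0" using g by (force simp: words_def)
       then have "y \<in> bb" using g(4,5) unfolding bb_def bad_def by fastforce
       then have "(y, j) \<in> bb \<times> {1..n}" using j by blast
       then have "Inr (y, j) \<in> E" unfolding E_def by (rule InrI)
       then have "(\<Sum>q\<in>I. of_int (k (Inr (y, j)) q) * z q) = 0" using ker by blast
       moreover have "(\<Sum>q\<in>I. of_int (k (Inr (y, j)) q) * z q) = (\<Sum>q\<in>I. if (y, j) = q then z q else 0)"
        by (intro sum.cong) (auto simp: k_def)
       moreover have "(y, j) \<in> I" using g(4) j by (simp add: I_def)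
       ultimately have "z (y, j) = 0" using fin(1) by (simp add: sum.delta')
       then show ?thesis by (simp add: \<xi>_def)
      qed
      have hl: "hom_like i F m \<delta> (flow i \<xi>)"
      proof (rule hom_like_flow[of i \<xi> F \<delta> K0 m, OF sup bnd fl])
       show "F \<subseteq> carrier G" "0 < \<delta>" using F by auto
       show "K0 \<subseteq> edges" by (rule K0)
       show "lpn r Y (s l) <= \<delta> / 3" if "l < m" "Y \<subseteq> edges" "Y \<inter> K0 = {}" for l Y by (rule tail[OF that])
       show "\<xi> j y = 0" if "set gs \<subseteq> F" "length gs \<in> {1..m}" "(g, j) \<in> K0" "y \<in> {1..d i}"
        "\<theta> i (foldr (\<otimes>) gs g) y ~= foldr (\<sigma> i) gs (\<theta> i g y)" for gs g j y by (rule zer[OF that])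
      qed
      from key[rule_format, OF hl] obtain c where c: "\<forall>k\<in>{1..n}. lpn r {1..d i} (%y. flow i \<xi> (edge k) y - (\<Sum>b\<in>B. c b * v b k y)) <= \<epsilon> / real n" ..
      have "l1n I (%q. z q - (\<Sum>b\<in>B. c b * v b (snd q) (fst q))) <= (\<Sum>j=1..n. \<epsilon> / real n)"
       unfolding l1n_def ps
      proof (rule sum_mono)
       fix j assume j: "j \<in> {1..n}"
       have fe: "flow i \<xi> (edge j) y = \<xi> j y" for y by (rule flow_edge) (use sup bnd fl j in blast)+
       have "(\<Sum>y\<in>{1..d i}. cmod (z (y, j) - (\<Sum>b\<in>B. c b * v b (snd (y, j)) (fst (y, j)))))
        = lpn r {1..d i} (%y. flow i \<xi> (edge j) y - (\<Sum>b\<in>B. c b * v b j y))"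
        unfolding l1_norm[OF r_eq] infsum_finite[OF finite_atLeastAtMost]
        using fe j by (intro sum.cong refl) (simp add: \<xi>_def)
       then show "(\<Sum>y\<in>{1..d i}. cmod (z (y, j) - (\<Sum>b\<in>B. c b * v b (snd (y, j)) (fst (y, j))))) <= \<epsilon> / real n"
        using c j by simp
      qed
      also have "\<dots> = \<epsilon>" using n2 by simp
      finally show "EX c. l1n I (%q. z q - (\<Sum>b\<in>B. c b * v b (snd q) (fst q))) <= \<epsilon>" by blast
     qed
     define P where "P = real n * real (d i) - real (d i) - real n * real (card bb)"
     have P: "real (card I - card E) = P" using EI by (simp add: of_nat_diff cI cE P_def mult.commute)
     have "exp (P * (L - c48)) <= exp (real (card B) * L)"
      using main unfolding e3 e16 P[symmetric] exp_of_nat_mult .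
     then have "P * (L - c48) <= real (card B) * L" by simp
     moreover have "P * c48 <= (\<eta> / 2 * real (d i)) * L"
     proof -
      have nn: "0 <= real n * real (card bb)" by (rule mult_nonneg_nonneg) simp_all
      have dd: "0 <= real (d i)" by simp
      have "P <= real n * real (d i)" unfolding P_def using nn dd by linarith
      then have "P * c48 <= real n * real (d i) * c48" using c48 by (intro mult_right_mono) auto
      also have "\<dots> = (2 * real n * c48) * (real (d i) / 2)" by simp
      also have "\<dots> <= (\<eta> * L) * (real (d i) / 2)" by (rule mult_right_mono[OF L(3)]) simp
      finally show ?thesis by (simp add: mult_ac)
     qed
     ultimately have "(P - \<eta> / 2 * real (d i)) * L <= real (card B) * L" by (simp add: algebra_simps)
     then have W: "P - \<eta> / 2 * real (d i) <= real (card B)" using L(2) by simp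
     have "(real n * x) * real (d i) <= \<eta> / 2 * real (d i)" using x(2) by (intro mult_right_mono) auto
     then show "(real n - 1 - \<eta>) * real (d i) <= real (card B)"
      using W ncb unfolding P_def by (simp add: algebra_simps)
    qed
   qed
  qed
 qed
qed

end

lemma (in free_gens) len_power_gen:
 assumes j: "j \<in> {1..n}"
 shows "len (a j [^] k) = k"
proof -
 have "replicate k (j, True) \<in> rwords" using j
  by (induction k) (auto simp: rwords_def reduced_word_Cons letters_def, simp add: reduced_word_def)
 moreover have "val (replicate k (j, True)) = a j [^] k"
  by (induction k) (auto simp: lt_def)
 ultimately show ?thesis by (metis len_def length_replicate nf_val)
qed

lemma (in free_gens) inv_power_not_one:
 assumes j: "j \<in> {1..n}" and k: "0 < k"
 shows "inv (a j) [^] (k :: nat) ~= \<one>"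
proof
 have c: "a j \<in> carrier G" using j by simp
 assume "inv (a j) [^] k = \<one>"
 then have "inv (a j [^] k) = \<one>" using c by (simp add: nat_pow_inv)
 then have "a j [^] k = \<one>" using c by (metis inv_inv inv_one nat_pow_closed)
 then have "len \<one> = k" using len_power_gen[OF j, of k] by simp
 then show False using k by (simp add: len_def)
qed

section \<open>Edge coordinates for chains and quotient norms\<close>

locale edge_chains = free_gens +
 fixes r :: real
 assumes r: "1 <= r"
begin

abbreviation X :: "'a set set" where "X \<equiv> cayley_complex G n a"
abbreviation CC :: "('a list => complex) cspace" where "CC \<equiv> lp_chains (ereal r) X 2"
abbreviation nrm :: "('a \<times> nat => complex) => real" where "nrm \<equiv> lpn r edges"

definition Zl :: "('a \<times> nat => complex) set" where
 "Zl = {h. (ALL e. e \<notin> edges --> h e = 0) & lps r edges h}"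

text \<open>Summing over j avoids choosing the generator that joins x to y; at most one summand is
  nonzero.\<close>

definition arc :: "('a \<times> nat => complex) => 'a => 'a => complex" where
 "arc h x y = (\<Sum>j=1..n. if y = x \<otimes> a j then h (x, j) else 0)"

text \<open>Extends an edge function antisymmetrically to ordered pairs. On \<open>Zl\<close> this
  is an isometry onto the 1-chains.\<close>

definition J :: "('a \<times> nat => complex) => 'a list => complex" where
 "J h xs = (if length xs = 2 & set xs \<subseteq> carrier G then arc h (xs ! 0) (xs ! 1) - arc h (xs ! 1) (xs ! 0) else 0)"

text \<open>No two vertices are joined by generators in both directions, so in \<open>J\<close> one
  of the two arcs is always 0.\<close>

lemma a_mult_neq: "x \<in> carrier G ==> i \<in> {1..n} ==> j \<in> {1..n} ==> x ~= x \<otimes> a i \<otimes> a j"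
proof
 assume x: "x \<in> carrier G" and ij: "i \<in> {1..n}" "j \<in> {1..n}" and e: "x = x \<otimes> a i \<otimes> a j"
 have "a i \<otimes> a j = \<one>" using e x ij by (metis a_closed m_assoc m_closed l_cancel_one')
 then have "a i = inv (a j)" using ij by (simp add: inv_equality)
 then show False using free_generators_distinct(2)[OF free ij] by simp
qed

lemma J_edge:
 assumes x: "x \<in> carrier G" and k: "k \<in> {1..n}"
 shows "J h [x, x \<otimes> a k] = h (x, k)" "J h [x \<otimes> a k, x] = - h (x, k)"
proof -
 have inj: "x \<otimes> a k = x \<otimes> a j \<longleftrightarrow> j = k" if "j \<in> {1..n}" for j
  using free_generators_distinct(3)[OF free k that] x k that by auto
 have "arc h x (x \<otimes> a k) = (\<Sum>j=1..n. if j = k then h (x, j) else 0)"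
  unfolding arc_def using inj by (intro sum.cong) auto
 then have 1: "arc h x (x \<otimes> a k) = h (x, k)" using k by (simp add: sum.delta)
 have 2: "arc h (x \<otimes> a k) x = 0"
  unfolding arc_def using a_mult_neq[OF x k] by (intro sum.neutral) auto
 show "J h [x, x \<otimes> a k] = h (x, k)" "J h [x \<otimes> a k, x] = - h (x, k)" using x k 1 2 by (simp_all add: J_def)
qed

lemma osimp2:
 "osimp X 2 = (%e. [fst e, fst e \<otimes> a (snd e)]) ` edges \<union> (%e. [fst e \<otimes> a (snd e), fst e]) ` edges"
 unfolding osimp_cayley_2[OF free] by (simp add: case_prod_unfold)

lemma osimp2_cases:
 assumes "xs \<in> osimp X 2"
 obtains x k where "x \<in> carrier G" "k \<in> {1..n}" "xs = [x, x \<otimes> a k]"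
 | x k where "x \<in> carrier G" "k \<in> {1..n}" "xs = [x \<otimes> a k, x]"
 using assms unfolding osimp2 by auto

lemma J_off: "xs \<notin> osimp X 2 ==> J h xs = 0"
proof (rule ccontr)
 assume xs: "xs \<notin> osimp X 2" and J: "J h xs ~= 0"
 then have l: "length xs = 2" "set xs \<subseteq> carrier G" by (auto simp: J_def split: if_splits)
 then obtain u v where uv: "xs = [u, v]" "u \<in> carrier G" "v \<in> carrier G" by (auto simp: numeral_2_eq_2 length_Suc_conv)
 have "v ~= u \<otimes> a j" "u ~= v \<otimes> a j" if "j \<in> {1..n}" for j
  using xs that uv unfolding osimp2 by (force simp: image_iff)+
 then have "arc h u v = 0" "arc h v u = 0" unfolding arc_def by (auto intro!: sum.neutral)
 then show False using J uv by (simp add: J_def)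
qed

lemma J_swap: "J h [v, u] = - J h [u, v]" by (auto simp: J_def)

lemma J_add: "J (h + h') = (%xs. J h xs + J h' xs)"
proof -
 have "arc (h + h') x y = arc h x y + arc h' x y" for x y
  unfolding arc_def sum.distrib[symmetric] by (intro sum.cong) auto
 then show ?thesis by (auto simp: J_def fun_eq_iff)
qed

lemma J_scale: "J (cs c h) = (%xs. c * J h xs)"
proof -
 have "arc (cs c h) x y = c * arc h x y" for x y
  unfolding arc_def sum_distrib_left by (intro sum.cong) auto
 then show ?thesis by (auto simp: J_def fun_eq_iff right_diff_distrib)
qed

lemma J_0: "J 0 = (%_. 0)" by (auto simp: J_def arc_def fun_eq_iff zero_fun_def)

lemma edge_maps: "inj_on (%e. [fst e, fst e \<otimes> a (snd e)]) edges" "inj_on (%e. [fst e \<otimes> a (snd e), fst e]) edges"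
 using free_generators_distinct(3)[OF free] by (auto simp: inj_on_def)

lemma J_chain:
 assumes h: "h \<in> Zl"
 shows "J h \<in> vcarrier CC"
proof -
 have hs: "(%e. cmod (h e) powr r) summable_on edges" using h by (simp add: Zl_def lp_summable_ereal)
 have "(%xs. cmod (J h xs) powr r) summable_on (%e. [fst e, fst e \<otimes> a (snd e)]) ` edges"
  unfolding summable_on_reindex[OF edge_maps(1)] o_def
  by (rule summable_on_cong[THEN iffD1, OF _ hs]) (auto simp: J_edge)
 moreover have "(%xs. cmod (J h xs) powr r) summable_on (%e. [fst e \<otimes> a (snd e), fst e]) ` edges"
  unfolding summable_on_reindex[OF edge_maps(2)] o_def
  by (rule summable_on_cong[THEN iffD1, OF _ hs]) (auto simp: J_edge)
 ultimately have s: "lps r (osimp X 2) (J h)"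
  unfolding lp_summable_ereal osimp2 by (rule summable_on_union)
 have "antisymmetric X 2 (J h)"
  unfolding antisymmetric_def
 proof (intro ballI allI impI)
  fix xs q assume xs: "xs \<in> osimp X 2" and q: "q permutes {..<2 :: nat}"
  obtain u v where uv: "xs = [u, v]" using xs by (auto simp: osimp_def numeral_2_eq_2 length_Suc_conv)
  have "{..<2 :: nat} = {0, 1}" by auto
  then have "q = id \<or> q = Transposition.transpose 0 1" using q by (simp add: permutes_doubleton_iff)
  then show "J h (permute_list q xs) = of_int (sign q) * J h xs"
  proof
   assume "q = id"
   then show ?thesis by simp
  next
   assume "q = Transposition.transpose 0 1"
   then show ?thesis using J_swap[of h v u]
    by (simp add: uv permute_list_def sign_swap_id upt_rec Transposition.transpose_def)
  qed
 qed
 then show ?thesis using J_off s by (auto simp: lp_chains_def)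
qed

lemma J_norm: "h \<in> Zl ==> vnorm CC (J h) = nrm h"
proof -
 assume h: "h \<in> Zl"
 have "vnorm CC (J h) = (\<Sum>\<^sub>\<infinity>(x, j)\<in>edges. cmod (J h [x, x \<otimes> a j]) powr real_of_ereal (ereal r)) powr (1 / real_of_ereal (ereal r))"
  by (rule edge_norm[OF free _ _ J_chain[OF h]]) (use r in auto)
 also have "(\<Sum>\<^sub>\<infinity>(x, j)\<in>edges. cmod (J h [x, x \<otimes> a j]) powr real_of_ereal (ereal r)) = (\<Sum>\<^sub>\<infinity>e\<in>edges. cmod (h e) powr r)"
  by (intro infsum_cong) (auto simp: J_edge)
 finally show ?thesis by (simp add: lp_norm_ereal)
qed

lemma J_surj:
 assumes f: "f \<in> vcarrier CC"
 shows "\<exists>h\<in>Zl. f = J h & (\<forall>x\<in>carrier G. \<forall>j\<in>{1..n}. h (x, j) = f [x, x \<otimes> a j])"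
proof -
 define h where "h = (%(x, j). if (x, j) \<in> edges then f [x, x \<otimes> a j] else 0)"
 have as: "antisymmetric X 2 f" and fs: "(%xs. cmod (f xs) powr r) summable_on osimp X 2" and off: "!!xs. xs \<notin> osimp X 2 ==> f xs = 0"
  using f by (auto simp: lp_chains_def lp_summable_ereal)
 have "(%xs. cmod (f xs) powr r) summable_on (%e. [fst e, fst e \<otimes> a (snd e)]) ` edges"
  by (rule summable_on_subset_banach[OF fs]) (auto simp: osimp2)
 then have "(%e. cmod (f [fst e, fst e \<otimes> a (snd e)]) powr r) summable_on edges"
  unfolding summable_on_reindex[OF edge_maps(1)] o_def .
 then have "(%e. cmod (h e) powr r) summable_on edges"
  by (rule summable_on_cong[THEN iffD1, rotated]) (auto simp: h_def)
 then have hZ: "h \<in> Zl" by (auto simp: Zl_def lp_summable_ereal h_def)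
 have "f xs = J h xs" for xs
 proof (cases "xs \<in> osimp X 2")
  case True
  then show ?thesis
  proof (cases rule: osimp2_cases)
   case (1 x k)
   then show ?thesis by (simp add: J_edge h_def)
  next
   case (2 x k)
   have "[x, x \<otimes> a k] \<in> osimp X 2" using 2 unfolding osimp2 by force
   then have "f [x \<otimes> a k, x] = - f [x, x \<otimes> a k]" by (rule antisymmetric_swap[OF as])
   then show ?thesis using 2 by (simp add: J_edge h_def)
  qed
 qed (simp add: off J_off)
 then show ?thesis using hZ by (intro bexI[of _ h]) (auto simp: h_def)
qed

lemma J_shift:
 assumes g: "g \<in> carrier G"
 shows "chain_act G g (J h) = J (shift g h)"
proof
 fix xs
 have arc: "arc (shift g h) x y = arc h (inv g \<otimes> x) (inv g \<otimes> y)" if "x \<in> carrier G" "y \<in> carrier G" for x y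
  unfolding arc_def
 proof (intro sum.cong refl)
  fix j assume "j \<in> {1..n}"
  then have "inv g \<otimes> y = inv g \<otimes> x \<otimes> a j \<longleftrightarrow> y = x \<otimes> a j" using that g by (simp add: m_assoc)
  then show "(if y = x \<otimes> a j then shift g h (x, j) else 0) = (if inv g \<otimes> y = inv g \<otimes> x \<otimes> a j then h (inv g \<otimes> x, j) else 0)"
   using that by (simp add: shift_def)
 qed
 show "chain_act G g (J h) xs = J (shift g h) xs"
 proof (cases "length xs = 2 & set xs \<subseteq> carrier G")
  case True
  then obtain u v where "xs = [u, v]" "u \<in> carrier G" "v \<in> carrier G" by (auto simp: numeral_2_eq_2 length_Suc_conv)
  then show ?thesis using g by (simp add: chain_act_def J_def arc)
 next
  case False
  then show ?thesis by (auto simp: chain_act_def J_def)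
 qed
qed

lemma Zl_add: "h \<in> Zl ==> h' \<in> Zl ==> h + h' \<in> Zl"
 using lp_triangle(1)[OF r, of edges h h'] by (auto simp: Zl_def plus_fun_def)
lemma Zl_scale: "h \<in> Zl ==> cs c h \<in> Zl"
 using lp_scale(1)[OF r, of edges h c] by (auto simp: Zl_def)
lemma Zl_0: "0 \<in> Zl" by (simp add: Zl_def lp_summable_ereal)
lemma Zl_shift: "g \<in> carrier G ==> h \<in> Zl ==> shift g h \<in> Zl"
 using shift_norm(1)[OF r, of g h] by (auto simp: Zl_def shift_def)
lemma Zl_minus: "h \<in> Zl ==> h' \<in> Zl ==> h - h' \<in> Zl"
 using lp_minus(1)[OF r, of edges h h'] by (auto simp: Zl_def fun_diff_def)
lemma nrm_add: "h \<in> Zl ==> h' \<in> Zl ==> nrm (h + h') <= nrm h + nrm h'"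
 using lp_triangle(2)[OF r, of edges h h'] by (auto simp: Zl_def plus_fun_def)
lemma nrm_minus: "h \<in> Zl ==> h' \<in> Zl ==> nrm (h - h') <= nrm h + nrm h'"
 using lp_minus(2)[OF r, of edges h h'] by (auto simp: Zl_def fun_diff_def)
lemma nrm_scale: "nrm (cs c h) = cmod c * nrm h" by (rule lp_scale(2)[OF r])
lemma shift_add: "shift g (h + h') = shift g h + shift g h'" by (auto simp: shift_def fun_eq_iff)
lemma shift_diff: "shift g (h - h') = shift g h - shift g h'" by (auto simp: shift_def fun_eq_iff)
lemma shift_scale: "shift g (cs c h) = cs c (shift g h)" by (auto simp: shift_def fun_eq_iff)
lemma shift_shift: "g \<in> carrier G ==> g' \<in> carrier G ==> shift g (shift g' h) = shift (g \<otimes> g') h"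
 by (auto simp: shift_def fun_eq_iff inv_mult_group m_assoc)
lemma shift_one: "h \<in> Zl ==> shift \<one> h = h" by (auto simp: shift_def fun_eq_iff Zl_def)
lemma dl_Zl: "lps r (carrier G) u ==> dl u \<in> Zl"
 using dl_bound(1)[OF r] by (auto simp: Zl_def dl_def)

definition cl :: "('a \<times> nat => complex) set => ('a \<times> nat => complex) set" where
 "cl U = {k \<in> Zl. \<forall>e>0. \<exists>u\<in>U. nrm (k - u) < e}"

text \<open>The quotient norm by the closure of U, in edge coordinates.\<close>

definition quo :: "('a \<times> nat => complex) set => ('a \<times> nat => complex) => real" where
 "quo U h = Inf ((%k. nrm (h + k)) ` cl U)"

definition sub :: "('a \<times> nat => complex) set => bool" where
 "sub U \<longleftrightarrow> U \<subseteq> Zl & 0 \<in> U & (\<forall>u\<in>U. \<forall>v\<in>U. u + v \<in> U) & (ALL c. \<forall>u\<in>U. cs c u \<in> U) & (\<forall>g\<in>carrier G. \<forall>u\<in>U. shift g u \<in> U)"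

lemma sub_cl:
 assumes U: "sub U"
 shows "sub (cl U)" "U \<subseteq> cl U"
proof -
 have UZ: "u \<in> Zl" if "u \<in> U" for u using U that by (auto simp: sub_def)
 have n0: "nrm (u - u) = 0" for u :: "'a \<times> nat => complex" by (simp add: lp_norm_ereal)
 show i: "U \<subseteq> cl U"
 proof
  fix u assume u: "u \<in> U"
  have "\<exists>v\<in>U. nrm (u - v) < e" if "0 < e" for e by (rule bexI[OF _ u]) (subst n0, rule that)
  then show "u \<in> cl U" using UZ[OF u] unfolding cl_def by blast
 qed
 show "sub (cl U)" unfolding sub_def
 proof (intro conjI ballI allI)
  show "cl U \<subseteq> Zl" by (auto simp: cl_def)
  show "0 \<in> cl U" using i U by (auto simp: sub_def)
  show "k + k' \<in> cl U" if k: "k \<in> cl U" "k' \<in> cl U" for k k'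
   unfolding cl_def mem_Collect_eq
  proof (intro conjI allI impI)
   show "k + k' \<in> Zl" using k by (auto simp: cl_def Zl_add)
   fix e :: real assume "0 < e"
   then have "0 < e / 2" by simp
   then obtain u u' where u: "u \<in> U" "nrm (k - u) < e / 2" "u' \<in> U" "nrm (k' - u') < e / 2" using k unfolding cl_def by blast
   have eq: "k + k' - (u + u') = (k - u) + (k' - u')" by simp
   have "nrm ((k - u) + (k' - u')) <= nrm (k - u) + nrm (k' - u')"
    using k u UZ by (intro nrm_add Zl_minus) (auto simp: cl_def)
   then have "nrm (k + k' - (u + u')) < e" unfolding eq using u by linarith
   then show "\<exists>v\<in>U. nrm (k + k' - v) < e" using u U by (auto simp: sub_def)
  qed
  show "cs c k \<in> cl U" if k: "k \<in> cl U" for c k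
   unfolding cl_def mem_Collect_eq
  proof (intro conjI allI impI)
   show "cs c k \<in> Zl" using k by (auto simp: cl_def Zl_scale)
   fix e :: real assume e: "0 < e"
   then have e2: "0 < e / (cmod c + 1)" by (intro divide_pos_pos add_nonneg_pos) auto
   then obtain u where u: "u \<in> U" "nrm (k - u) < e / (cmod c + 1)" using k unfolding cl_def by blast
   have "cs c k - cs c u = cs c (k - u)" by (auto simp: fun_eq_iff right_diff_distrib)
   then have "nrm (cs c k - cs c u) = cmod c * nrm (k - u)" using nrm_scale by metis
   also have "\<dots> <= cmod c * (e / (cmod c + 1))" using u by (intro mult_left_mono) auto
   also have "\<dots> < e" using e by (simp add: pos_divide_less_eq add_nonneg_pos)
   finally show "\<exists>v\<in>U. nrm (cs c k - v) < e" using u U unfolding sub_def by blast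
  qed
  show "shift g k \<in> cl U" if g: "g \<in> carrier G" and k: "k \<in> cl U" for g k
   unfolding cl_def mem_Collect_eq
  proof (intro conjI allI impI)
   show "shift g k \<in> Zl" using k g by (auto simp: cl_def Zl_shift)
   fix e :: real assume "0 < e"
   then obtain u where u: "u \<in> U" "nrm (k - u) < e" using k unfolding cl_def by blast
   have "nrm (shift g k - shift g u) < e" unfolding shift_diff[symmetric] shift_norm(2)[OF r g] by (rule u)
   then show "\<exists>v\<in>U. nrm (shift g k - v) < e" using u g U unfolding sub_def by blast
  qed
 qed
qed

text \<open>As an isometry onto the chains, \<open>J\<close> allows closures to be taken in edge
  coordinates.\<close>

lemma vclosure_J:
 assumes U: "U \<subseteq> Zl"
 shows "vclosure CC (J ` U) = J ` cl U"
proof -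
 have d: "vdist CC (J k) (J u) = nrm (k - u)" if "k \<in> Zl" "u \<in> Zl" for k u
 proof -
  have e: "k - u = k + cs (-1) u" by (auto simp: fun_eq_iff)
  have "vdist CC (J k) (J u) = vnorm CC (J (k + cs (-1) u))"
   unfolding J_add J_scale by (simp add: vdist_def lp_chains_def)
  then show ?thesis using J_norm[OF Zl_minus[OF that]] unfolding e by simp
 qed
 show ?thesis
 proof (intro equalityI subsetI)
  fix f assume f: "f \<in> vclosure CC (J ` U)"
  then obtain h where h: "h \<in> Zl" "f = J h" using J_surj[of f] by (auto simp: vclosure_def)
  have "\<exists>u\<in>U. nrm (h - u) < e" if "0 < e" for e
   using f that d[OF h(1)] U unfolding vclosure_def h(2) by fastforce
  then show "f \<in> J ` cl U" using h by (auto simp: cl_def)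
 next
  fix f assume "f \<in> J ` cl U"
  then obtain h where h: "h \<in> cl U" "f = J h" by blast
  have hZ: "h \<in> Zl" using h by (simp add: cl_def)
  have "\<exists>u\<in>J ` U. vdist CC (J h) u < e" if e: "0 < e" for e
  proof -
   obtain u where u: "u \<in> U" "nrm (h - u) < e" using h(1) e unfolding cl_def by blast
   then show ?thesis using d[OF hZ, of u] U by (intro bexI[of _ "J u"]) auto
  qed
  then show "f \<in> vclosure CC (J ` U)" using J_chain[OF hZ] by (simp add: vclosure_def h(2))
 qed
qed

lemma quo_props:
 assumes U: "sub U"
 shows "h \<in> Zl ==> k \<in> cl U ==> quo U h <= nrm (h + k)" "h \<in> Zl ==> quo U h <= nrm h"
  "(!!k. k \<in> cl U ==> x <= nrm (h + k)) ==> x <= quo U h"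
  "0 < e ==> \<exists>k\<in>cl U. nrm (h + k) < quo U h + e"
  "0 <= quo U h" "u \<in> U ==> quo U u = 0"
proof -
 have bdd: "bdd_below ((%k. nrm (h + k)) ` cl U)" for h by (rule bdd_belowI[of _ 0]) auto
 have z: "0 \<in> cl U" using sub_cl[OF U] by (auto simp: sub_def)
 show 1: "quo U h <= nrm (h + k)" if "k \<in> cl U" for h k
  unfolding quo_def by (rule cINF_lower[OF bdd that])
 show "quo U h <= nrm h" using 1[OF z, of h] by simp
 show 3: "x <= quo U h" if "!!k. k \<in> cl U ==> x <= nrm (h + k)" for x h
  unfolding quo_def by (rule cINF_greatest) (use z that in auto)
 show "\<exists>k\<in>cl U. nrm (h + k) < quo U h + e" if e: "0 < e"
 proof (rule ccontr)
  assume "\<not> ?thesis"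
  then have "quo U h + e <= quo U h" by (intro 3) (auto simp: not_less)
  then show False using e by simp
 qed
 show 5: "0 <= quo U h" for h by (rule 3) simp
 show "quo U u = 0" if u: "u \<in> U"
 proof -
  have "cs (-1) u \<in> U" using u U unfolding sub_def by blast
  then have "cs (-1) u \<in> cl U" by (rule subsetD[OF sub_cl(2)[OF U]])
  from 1[OF this, of u] have "quo U u <= nrm (u + cs (-1) u)" .
  also have "u + cs (-1) u = 0" by (auto simp: fun_eq_iff)
  finally show ?thesis using 5[of u] by (simp add: lp_norm_ereal)
 qed
qed

definition Qm :: "('a \<times> nat => complex) set => ('a \<times> nat => complex) => ('a list => complex) set" where
 "Qm U h = J ` ((%k. h + k) ` cl U)"

text \<open>One representation for both theories: Y = \<open>Zl\<close> with U = \<open>Ub\<close>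
  gives cohomology, Y = \<open>Yc\<close> with U = {0} gives homology.\<close>

lemma quotient_rep:
 assumes U: "sub U" and Y: "sub Y"
 shows "normed_rep G (vquotient (CC\<lparr>vcarrier := J ` Y\<rparr>) (vclosure CC (J ` U))) (quotient_act (chain_act G)) Y (quo U) (Qm U) shift"
proof -
 have UZ: "U \<subseteq> Zl" and YZ: "Y \<subseteq> Zl" using U Y by (auto simp: sub_def)
 note c = sub_cl(1)[OF U, unfolded sub_def]
 have cZ: "k \<in> Zl" if "k \<in> cl U" for k using that by (simp add: cl_def)
 have z: "0 \<in> cl U" using c by blast
 have cadd: "k + k' \<in> cl U" if "k \<in> cl U" "k' \<in> cl U" for k k' using c that by blast
 have csc: "cs x k \<in> cl U" if "k \<in> cl U" for x k using c that by blast
 have csh: "shift g k \<in> cl U" if "g \<in> carrier G" "k \<in> cl U" for g k using c that by blast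
 have cmi: "k - k' \<in> cl U" if "k \<in> cl U" "k' \<in> cl U" for k k'
  using cadd[OF that(1) csc[OF that(2), of "-1"]] by (simp add: plus_fun_def fun_diff_def)
 let ?V = "vquotient (CC\<lparr>vcarrier := J ` Y\<rparr>) (vclosure CC (J ` U))"
 have co: "vcoset (CC\<lparr>vcarrier := J ` Y\<rparr>) (vclosure CC (J ` U)) (J h) = Qm U h" for h
  unfolding vclosure_J[OF UZ] vcoset_def Qm_def image_image J_add by (simp add: lp_chains_def)
 have shinv: "shift g (shift (inv g) k) = k" if "g \<in> carrier G" "k \<in> Zl" for g k
  using shift_shift[OF that(1) inv_closed[OF that(1)], of k] shift_one[OF that(2)] that(1) by simp
 show ?thesis
 proof unfold_locales
  show "0 \<in> Y" "!!f f'. f \<in> Y ==> f' \<in> Y ==> f + f' \<in> Y" "!!f c. f \<in> Y ==> cs c f \<in> Y"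
   "!!g f. g \<in> carrier G ==> f \<in> Y ==> shift g f \<in> Y" using Y unfolding sub_def by blast+
  show "vcarrier ?V = Qm U ` Y" unfolding vquotient_def by (simp add: image_image co)
  have "vzero (CC\<lparr>vcarrier := J ` Y\<rparr>) = J 0" unfolding J_0 by (simp add: lp_chains_def)
  then show "vzero ?V = Qm U 0" unfolding vquotient_def by (simp add: co)
  show "vadd ?V (Qm U f) (Qm U f') = Qm U (f + f')" for f f'
  proof -
   have "vadd ?V (Qm U f) (Qm U f') = {J (u + v) | u v. u \<in> (%k. f + k) ` cl U & v \<in> (%k. f' + k) ` cl U}"
    unfolding vquotient_def Qm_def J_add by (auto simp: lp_chains_def)
   also have "\<dots> = J ` ((%k. f + f' + k) ` cl U)"
   proof (intro equalityI subsetI)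
    fix w assume "w \<in> {J (u + v) | u v. u \<in> (%k. f + k) ` cl U & v \<in> (%k. f' + k) ` cl U}"
    then obtain k k' where k: "k \<in> cl U" "k' \<in> cl U" "w = J ((f + k) + (f' + k'))" by blast
    have "(f + k) + (f' + k') = f + f' + (k + k')" by (simp add: ac_simps)
    then show "w \<in> J ` ((%k. f + f' + k) ` cl U)" unfolding k(3) using cadd[OF k(1,2)] by blast
   next
    fix w assume "w \<in> J ` ((%k. f + f' + k) ` cl U)"
    then obtain k where k: "k \<in> cl U" "w = J (f + f' + k)" by blast
    have e: "f + f' + k = (f + k) + (f' + 0)" by (simp add: ac_simps)
    show "w \<in> {J (u + v) | u v. u \<in> (%k. f + k) ` cl U & v \<in> (%k. f' + k) ` cl U}" unfolding k(2) e using k(1) z by blast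
   qed
   finally show ?thesis unfolding Qm_def .
  qed
  show "vscale ?V x (Qm U f) = Qm U (cs x f)" for x f
  proof -
   have "vscale ?V x (Qm U f) = {J (cs x u + v) | u v. u \<in> (%k. f + k) ` cl U & v \<in> cl U}"
    unfolding vquotient_def Qm_def vclosure_J[OF UZ] J_add J_scale by (auto simp: lp_chains_def)
   also have "\<dots> = J ` ((%k. cs x f + k) ` cl U)"
   proof (intro equalityI subsetI)
    fix w assume "w \<in> {J (cs x u + v) | u v. u \<in> (%k. f + k) ` cl U & v \<in> cl U}"
    then obtain k k' where k: "k \<in> cl U" "k' \<in> cl U" "w = J (cs x (f + k) + k')" by blast
    have "cs x (f + k) + k' = cs x f + (cs x k + k')" by (auto simp: fun_eq_iff distrib_left)
    then show "w \<in> J ` ((%k. cs x f + k) ` cl U)" unfolding k(3) using cadd[OF csc[OF k(1)] k(2)] by blast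
   next
    fix w assume "w \<in> J ` ((%k. cs x f + k) ` cl U)"
    then obtain k where k: "k \<in> cl U" "w = J (cs x f + k)" by blast
    have "w = J (cs x (f + 0) + k)" using k(2) by simp
    then show "w \<in> {J (cs x u + v) | u v. u \<in> (%k. f + k) ` cl U & v \<in> cl U}"
     by (intro CollectI exI[of _ "f + 0"] exI[of _ k] conjI imageI z k(1))
   qed
   finally show ?thesis unfolding Qm_def .
  qed
  show "vnorm ?V (Qm U f) = quo U f" if f: "f \<in> Y" for f
  proof -
   have "vnorm ?V (Qm U f) = Inf ((%k. vnorm CC (J (f + k))) ` cl U)"
    unfolding vquotient_def Qm_def by (simp add: image_image)
   also have "(%k. vnorm CC (J (f + k))) ` cl U = (%k. nrm (f + k)) ` cl U"
    using f YZ cZ by (intro image_cong refl J_norm Zl_add) auto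
   finally show ?thesis unfolding quo_def .
  qed
  show "quo U (f + f') <= quo U f + quo U f'" if f: "f \<in> Y" "f' \<in> Y" for f f'
  proof (rule field_le_epsilon)
   fix e :: real assume "0 < e"
   then have "0 < e / 2" by simp
   then obtain k k' where k: "k \<in> cl U" "nrm (f + k) < quo U f + e / 2" "k' \<in> cl U" "nrm (f' + k') < quo U f' + e / 2"
    using quo_props(4)[OF U] by metis
   have "quo U (f + f') <= nrm (f + f' + (k + k'))" using f YZ by (intro quo_props(1)[OF U] Zl_add cadd k) auto
   also have "f + f' + (k + k') = (f + k) + (f' + k')" by (simp add: ac_simps)
   also have "nrm \<dots> <= nrm (f + k) + nrm (f' + k')" using f YZ k cZ by (intro nrm_add Zl_add) auto
   finally show "quo U (f + f') <= quo U f + quo U f' + e" using k by linarith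
  qed
  show "quo U (cs x f) = cmod x * quo U f" if f: "f \<in> Y" for x f
  proof -
   \<comment> \<open>One inequality for all scalars; the reverse one follows by applying it to 1 /
     x.\<close>
   have le: "quo U (cs x f) <= cmod x * quo U f" if f: "f \<in> Zl" for x f
   proof (cases "x = 0")
    case True
    have "(%_. 0) = (0 :: 'a \<times> nat => complex)" by (rule ext) simp
    then show ?thesis using quo_props(6)[OF U, of 0] U True by (simp add: sub_def)
   next
    case False
    have dv: "q / cmod x <= t" if "q <= cmod x * t" for q t :: real using that False by (simp add: field_simps)
    have "quo U (cs x f) / cmod x <= quo U f"
    proof (rule quo_props(3)[OF U])
     fix k assume k: "k \<in> cl U"
     have "quo U (cs x f) <= nrm (cs x f + cs x k)" by (rule quo_props(1)[OF U Zl_scale[OF f] csc[OF k]])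
     also have "cs x f + cs x k = cs x (f + k)" by (auto simp: fun_eq_iff distrib_left)
     finally have "quo U (cs x f) <= nrm (cs x (f + k))" .
     also have "\<dots> = cmod x * nrm (f + k)" by (rule nrm_scale)
     finally show "quo U (cs x f) / cmod x <= nrm (f + k)" by (rule dv)
    qed
    then show ?thesis using False by (simp add: field_simps)
   qed
   have fZ: "f \<in> Zl" using f YZ by blast
   show ?thesis
   proof (cases "x = 0")
    case True
    have "0 <= quo U (cs x f)" by (rule quo_props(5)[OF U])
    then show ?thesis using le[OF fZ, of x] True by simp
   next
    case False
    have "cs (1 / x) (cs x f) = f" using False by (auto simp: fun_eq_iff)
    then have "quo U f <= cmod (1 / x) * quo U (cs x f)" using le[OF Zl_scale[OF fZ], of "1 / x" x] by simp
    then have "cmod x * quo U f <= quo U (cs x f)" using False by (simp add: norm_divide field_simps)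
    then show ?thesis using le[OF fZ, of x] by simp
   qed
  qed
  show "shift g (f + f') = shift g f + shift g f'" for g f f' by (rule shift_add)
  show "shift g (cs x f) = cs x (shift g f)" for g x f by (rule shift_scale)
  show "quo U (shift g f) = quo U f" if g: "g \<in> carrier G" and f: "f \<in> Y" for g f
  proof -
   have le: "quo U (shift g f) <= quo U f" if g: "g \<in> carrier G" and f: "f \<in> Zl" for g f
   proof (rule quo_props(3)[OF U])
    fix k assume k: "k \<in> cl U"
    have "quo U (shift g f) <= nrm (shift g f + shift g k)" by (rule quo_props(1)[OF U Zl_shift[OF g f] csh[OF g k]])
    then show "quo U (shift g f) <= nrm (f + k)" unfolding shift_add[symmetric] shift_norm(2)[OF r g] .
   qed
   have fZ: "f \<in> Zl" using f YZ by blast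
   have "shift (inv g) (shift g f) = f" using shinv[of "inv g" f] g fZ by simp
   then show ?thesis using le[OF g fZ] le[OF inv_closed[OF g] Zl_shift[OF g fZ]] by simp
  qed
  show "quotient_act (chain_act G) g (Qm U f) = Qm U (shift g f)" if g: "g \<in> carrier G" for g f
  proof -
   have "quotient_act (chain_act G) g (Qm U f) = J ` ((%k. shift g f + shift g k) ` cl U)"
    unfolding quotient_act_def Qm_def image_image J_shift[OF g] shift_add ..
   also have "(%k. shift g f + shift g k) ` cl U = (%k. shift g f + k) ` (shift g ` cl U)" by (simp only: image_image)
   also have "shift g ` cl U = cl U"
   proof
    show "shift g ` cl U \<subseteq> cl U" using csh[OF g] by blast
    show "cl U \<subseteq> shift g ` cl U"
    proof
     fix k assume k: "k \<in> cl U"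
     show "k \<in> shift g ` cl U" by (rule image_eqI[of _ _ "shift (inv g) k"]) (use shinv[OF g cZ[OF k]] csh[OF inv_closed[OF g] k] in auto)
    qed
   qed
   finally show ?thesis unfolding Qm_def .
  qed
  show "shift g (shift h f) = shift (g \<otimes> h) f" if "g \<in> carrier G" "h \<in> carrier G" for g h f by (rule shift_shift[OF that])
  show "shift \<one> f = f" if "f \<in> Y" for f using that YZ by (intro shift_one) blast
 qed
qed

text \<open>The relation between the edge generators: edges ending at \<one> minus edges starting at
  \<one> form the coboundary of the point mass at \<one>.\<close>

lemma chi_dl:
 shows "lps r (carrier G) (%x. if x = \<one> then 1 else 0)"
  "(\<Sum>j=1..n. shift (inv (a j)) (edge j) - edge j) = dl (%x. if x = \<one> then 1 else 0)"
proof -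
 have "((%x. cmod (if x = \<one> then 1 else 0) powr r) summable_on carrier G) = ((%x. cmod (if x = \<one> then 1 else 0) powr r) summable_on {\<one>})"
  by (intro summable_on_cong_neutral) auto
 then show "lps r (carrier G) (%x. if x = \<one> then 1 else 0)" by (simp add: lp_summable_ereal)
 show "(\<Sum>j=1..n. shift (inv (a j)) (edge j) - edge j) = dl (%x. if x = \<one> then 1 else 0)"
 proof
  fix e :: "'a \<times> nat"
  obtain x i where e: "e = (x, i)" by (cases e)
  have "(\<Sum>j=1..n. shift (inv (a j)) (edge j) - edge j) e = (\<Sum>j=1..n. (shift (inv (a j)) (edge j) - edge j) e)" by (rule sum_apply)
  also have "\<dots> = (\<Sum>j=1..n. if j = i then dl (%x. if x = \<one> then 1 else 0) (x, j) else 0)"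
  proof (intro sum.cong refl)
   fix j assume j: "j \<in> {1..n}"
   have "a j \<otimes> x = \<one> \<longleftrightarrow> x \<otimes> a j = \<one>" if "x \<in> carrier G" using that j by (auto simp: inv_comm)
   then show "(shift (inv (a j)) (edge j) - edge j) e = (if j = i then dl (%x. if x = \<one> then 1 else 0) (x, j) else 0)"
    using j by (auto simp: e shift_def edge_def dl_def)
  qed
  also have "\<dots> = dl (%x. if x = \<one> then 1 else 0) e" by (auto simp: e dl_def sum.delta)
  finally show "(\<Sum>j=1..n. shift (inv (a j)) (edge j) - edge j) e = dl (%x. if x = \<one> then 1 else 0) e" .
 qed
qed

lemma edge_Zl: "k \<in> {1..n} ==> edge k \<in> Zl"
proof -
 assume k: "k \<in> {1..n}"
 have "((%y. cmod (edge k y) powr r) summable_on edges) = ((%y. cmod (edge k y) powr r) summable_on {(\<one>, k)})"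
  using k by (intro summable_on_cong_neutral) (auto simp: edge_def split: if_splits)
 then show ?thesis using k by (auto simp: Zl_def lp_summable_ereal edge_def)
qed

lemma finite_comb:
 assumes "finite K" "K \<subseteq> edges"
 shows "EX P. (\<forall>p\<in>set P. fst (snd p) \<in> carrier G & snd (snd p) \<in> {1..n}) &
  lcomb (%(c, g, j). shift g (edge j)) P = (%e. if e \<in> K then f e else 0)"
 using assms
proof (induction K rule: finite_induct)
 case empty
 show ?case by (rule exI[of _ "[]"]) (auto simp: fun_eq_iff)
next
 case (insert q K)
 then obtain P where P: "\<forall>p\<in>set P. fst (snd p) \<in> carrier G & snd (snd p) \<in> {1..n}"
  "lcomb (%(c, g, j). shift g (edge j)) P = (%e. if e \<in> K then f e else 0)" by auto
 obtain g j where q: "q = (g, j)" "g \<in> carrier G" "j \<in> {1..n}" using insert.prems by (cases q) auto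
 have sh: "shift g (edge j) e = (if e = q then 1 else 0)" for e
 proof -
  obtain x i where e: "e = (x, i)" by (cases e)
  have "inv g \<otimes> x = \<one> \<longleftrightarrow> x = g" if "x \<in> carrier G"
   using q(2) that by (metis inv_closed inv_inv inv_equality l_inv inv_comm)
  then show ?thesis using q by (auto simp: e shift_def edge_def)
 qed
 show ?case
 proof (intro exI[of _ "(f q, g, j) # P"] conjI)
  show "\<forall>p\<in>set ((f q, g, j) # P). fst (snd p) \<in> carrier G & snd (snd p) \<in> {1..n}" using P(1) q by simp
  show "lcomb (%(c, g, j). shift g (edge j)) ((f q, g, j) # P) = (%e. if e \<in> insert q K then f e else 0)"
   unfolding lcomb_Cons P(2) using insert.hyps(2) by (auto simp: fun_eq_iff sh)
 qed
qed

text \<open>Truncation to a finite set gives a finite combination of translates of the n edges at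
  \<one>, and \<open>lp_tail\<close> bounds the rest.\<close>

lemma finite_approx:
 assumes f: "f \<in> Zl" and e: "0 < e"
 shows "EX P. (\<forall>p\<in>set P. fst (snd p) \<in> carrier G & snd (snd p) \<in> {1..n}) &
  lcomb (%(c, g, j). shift g (edge j)) P \<in> Zl & nrm (f - lcomb (%(c, g, j). shift g (edge j)) P) < e"
proof -
 have fs: "lps r edges f" and e2: "0 < e / 2" using f e by (auto simp: Zl_def)
 show ?thesis
 proof (rule lp_tail[OF r fs e2], goal_cases)
  case (1 K)
  from finite_comb[OF 1(1,2), of f] obtain P where P: "\<forall>p\<in>set P. fst (snd p) \<in> carrier G & snd (snd p) \<in> {1..n}"
   "lcomb (%(c, g, j). shift g (edge j)) P = (%e. if e \<in> K then f e else 0)" by (elim exE conjE) (rule that)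
  have Z: "(%e. if e \<in> K then f e else 0) \<in> Zl"
   using 1(2) lp_mono(1)[OF r fs, of "%e. if e \<in> K then f e else 0"] f by (auto simp: Zl_def)
  have "nrm (f - (%e. if e \<in> K then f e else 0)) = lpn r (edges - K) f"
   unfolding lp_norm_ereal by (intro arg_cong[where f = "%x. x powr (1 / r)"] infsum_cong_neutral) auto
  also have "\<dots> <= e / 2" by (rule 1(3)) auto
  finally have "nrm (f - (%e. if e \<in> K then f e else 0)) < e" using e by simp
  then show ?case using P Z by (intro exI[of _ P]) simp
 qed
qed

text \<open>Antisymmetry is vacuous on lists of length one, so 0-cochains are plain functions on the
  group.\<close>

lemma coboundary_image:
 "coboundary X 1 ` vcarrier (lp_chains (ereal r) X 1) = J ` dl ` {u. lps r (carrier G) u}"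
proof -
 have o1: "osimp X 1 = (%x. [x]) ` carrier G"
  by (auto simp: osimp_def cayley_complex_def length_Suc_conv image_iff doubleton_eq_iff)
 have cob: "coboundary X 1 f = J (dl (%x. f [x]))" for f
 proof
  fix xs
  show "coboundary X 1 f xs = J (dl (%x. f [x])) xs"
  proof (cases "xs \<in> osimp X 2")
   case True
   from True show ?thesis
   proof (cases rule: osimp2_cases)
    case (1 x k)
    then show ?thesis using coboundary_edge[of x "x \<otimes> a k" X f] True by (simp add: J_edge dl_def)
   next
    case (2 x k)
    then show ?thesis using coboundary_edge[of "x \<otimes> a k" x X f] True by (simp add: J_edge dl_def)
   qed
  next
   case False
   then show ?thesis using J_off[OF False] by (simp add: coboundary_def numeral_2_eq_2)
  qed
 qed
 have inj: "inj_on (%x. [x]) (carrier G)" by (auto simp: inj_on_def)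
 have summ: "lps r (osimp X 1) f \<longleftrightarrow> lps r (carrier G) (%x. f [x])" for f
  unfolding o1 lp_summable_ereal summable_on_reindex[OF inj] o_def ..
 have anti: "antisymmetric X 1 f" for f :: "'a list => complex"
  unfolding antisymmetric_def
 proof (intro ballI allI impI)
  fix xs q assume "q permutes {..<1 :: nat}"
  then have "q = id" using permutes_subset by (simp add: lessThan_Suc permutes_sing)
  then show "f (permute_list q xs) = of_int (sign q) * f xs" by simp
 qed
 show ?thesis
 proof (intro equalityI subsetI)
  fix w assume "w \<in> coboundary X 1 ` vcarrier (lp_chains (ereal r) X 1)"
  then obtain f where f: "w = coboundary X 1 f" "lps r (osimp X 1) f" by (auto simp: lp_chains_def)
  show "w \<in> J ` dl ` {u. lps r (carrier G) u}"
   unfolding f(1) cob by (intro imageI) (use f(2) summ[of f] in simp)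
 next
  fix w assume "w \<in> J ` dl ` {u. lps r (carrier G) u}"
  then obtain u where u: "lps r (carrier G) u" "w = J (dl u)" by blast
  define f where "f = (%xs. if xs \<in> osimp X 1 then u (hd xs) else 0)"
  have fu: "f [x] = u x" if "x \<in> carrier G" for x unfolding f_def o1 using that by simp
  have s: "lps r (carrier G) (%x. f [x])"
   using u(1) fu lp_summable_cong[of "carrier G" "%x. f [x]" u r] by simp
  have "dl (%x. f [x]) = dl u" using fu by (auto simp: dl_def fun_eq_iff)
  then have "w = coboundary X 1 f" unfolding cob u(2) by simp
  moreover have "f \<in> vcarrier (lp_chains (ereal r) X 1)" using s summ[of f] anti[of f] by (simp add: lp_chains_def f_def)
  ultimately show "w \<in> coboundary X 1 ` vcarrier (lp_chains (ereal r) X 1)" by blast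
 qed
qed

lemma cycles_image: "cycles (ereal r) X 1 = J ` {h \<in> Zl. ALL x. bd h x = 0}"
proof -
 have bdJ: "boundary X 1 (J h) = (%_. 0) \<longleftrightarrow> (ALL x. bd h x = 0)" if h: "h \<in> Zl" for h
 proof -
  have as: "antisymmetric X 2 (J h)" using J_chain[OF h] by (simp add: lp_chains_def)
  have b: "boundary X 1 (J h) [x] = bd h x" if x: "x \<in> carrier G" for x
  proof -
   have "J h [x \<otimes> inv (a j), x] = h (x \<otimes> inv (a j), j)" if "j \<in> {1..n}" for j
    using J_edge(1)[of "x \<otimes> inv (a j)" j h] x that by (simp add: m_assoc)
   then show ?thesis unfolding boundary_vertex[OF free as x] using x by (simp add: bd_def J_edge)
  qed
  have off: "boundary X 1 (J h) xs = 0" if "xs \<notin> (%x. [x]) ` carrier G" for xs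
   using that by (auto simp: boundary_def osimp_def cayley_complex_def length_Suc_conv image_iff doubleton_eq_iff)
  have bo: "bd h x = 0" if "x \<notin> carrier G" for x using that by (simp add: bd_def)
  show ?thesis
  proof
   assume L: "boundary X 1 (J h) = (%_. 0)"
   show "ALL x. bd h x = 0" using b L bo by metis
  next
   assume R: "ALL x. bd h x = 0"
   show "boundary X 1 (J h) = (%_. 0)" using off b R by (intro ext) (metis (no_types, lifting) imageE)
  qed
 qed
 have S: "Suc 1 = 2" by simp
 show ?thesis
 proof (intro equalityI subsetI)
  fix f assume "f \<in> cycles (ereal r) X 1"
  then have f: "f \<in> vcarrier CC" "boundary X 1 f = (%_. 0)" unfolding cycles_def S by auto
  obtain h where "h \<in> Zl" "f = J h" using J_surj[OF f(1)] by blast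
  then show "f \<in> J ` {h \<in> Zl. ALL x. bd h x = 0}" using bdJ f(2) by blast
 next
  fix f assume "f \<in> J ` {h \<in> Zl. ALL x. bd h x = 0}"
  then obtain h where h: "f = J h" "h \<in> Zl" "ALL x. bd h x = 0" by blast
  then show "f \<in> cycles (ereal r) X 1" unfolding cycles_def S using bdJ[OF h(2)] J_chain[OF h(2)] by simp
 qed
qed

lemma zero_chains: "3 <= k ==> vcarrier (lp_chains p X k) = {%_. 0}"
 by (auto simp: lp_chains_def osimp_cayley_empty antisymmetric_def lp_summable_def)

definition Ub :: "('a \<times> nat => complex) set" where "Ub = dl ` {u. lps r (carrier G) u}"
definition Yc :: "('a \<times> nat => complex) set" where "Yc = {h \<in> Zl. ALL x. bd h x = 0}"

lemma cohomology_eq: "lp_cohomology (ereal r) X 1 = vquotient (CC\<lparr>vcarrier := J ` Zl\<rparr>) (vclosure CC (J ` Ub))"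
proof -
 have S: "Suc 1 = 2" by simp
 have "cocycles (ereal r) X 1 = vcarrier CC"
  unfolding cocycles_def S by (auto simp: coboundary_def osimp_cayley_empty numeral_2_eq_2 numeral_3_eq_3)
 also have "\<dots> = J ` Zl" using J_surj J_chain by blast
 finally have c: "cocycles (ereal r) X 1 = J ` Zl" .
 show ?thesis unfolding lp_cohomology_def S c coboundary_image Ub_def ..
qed

lemma homology_eq: "lp_homology (ereal r) X 1 = vquotient (CC\<lparr>vcarrier := J ` Yc\<rparr>) (vclosure CC (J ` {0}))"
proof -
 have S: "Suc 1 = 2" "Suc 2 = 3" by simp_all
 have "boundary X 2 (%_. 0) = (%_. 0 :: complex)" by (auto simp: boundary_def)
 then have b: "boundary X 2 ` vcarrier (lp_chains (ereal r) X 3) = J ` {0}" by (simp add: zero_chains J_0)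
 show ?thesis unfolding lp_homology_def S cycles_image b Yc_def ..
qed

lemma dl_linear: "dl u + dl v = dl (%x. u x + v x)" "cs c (dl u) = dl (%x. c * u x)"
 "g \<in> carrier G ==> shift g (dl u) = dl (%x. if x \<in> carrier G then u (inv g \<otimes> x) else 0)"
 by (auto simp: dl_def shift_def fun_eq_iff m_assoc right_diff_distrib)

lemma sub_Zl: "sub Zl" unfolding sub_def using Zl_0 Zl_add Zl_scale Zl_shift by blast

lemma sub_zero: "sub {0}" using Zl_0 by (auto simp: sub_def shift_def fun_eq_iff)

lemma sub_Ub: "sub Ub"
 unfolding sub_def
proof (intro conjI ballI allI)
 show "Ub \<subseteq> Zl" using dl_Zl by (auto simp: Ub_def)
 have "dl (%_. 0) = 0" by (auto simp: dl_def fun_eq_iff)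
 moreover have "lps r (carrier G) (%_. 0)" by (simp add: lp_summable_ereal)
 ultimately show "0 \<in> Ub" unfolding Ub_def by (metis image_eqI mem_Collect_eq)
 show "h + h' \<in> Ub" if h: "h \<in> Ub" "h' \<in> Ub" for h h'
 proof -
  obtain u u' where u: "lps r (carrier G) u" "lps r (carrier G) u'" "h = dl u" "h' = dl u'"
   using h by (auto simp: Ub_def)
  show ?thesis unfolding u(3,4) dl_linear(1) Ub_def using lp_triangle(1)[OF r u(1,2)] by blast
 qed
 show "cs c h \<in> Ub" if h: "h \<in> Ub" for c h
 proof -
  obtain u where u: "lps r (carrier G) u" "h = dl u" using h by (auto simp: Ub_def)
  show ?thesis unfolding u(2) dl_linear(2) Ub_def using lp_scale(1)[OF r u(1)] by blast
 qed
 show "shift g h \<in> Ub" if g: "g \<in> carrier G" and h: "h \<in> Ub" for g h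
 proof -
  obtain u where u: "lps r (carrier G) u" "h = dl u" using h by (auto simp: Ub_def)
  have "bij_betw (%x. inv g \<otimes> x) (carrier G) (carrier G)"
   by (rule bij_betw_byWitness[where f' = "%x. g \<otimes> x"]) (use g in \<open>auto simp: m_assoc[symmetric]\<close>)
  from lp_reindex(1)[OF this, of r u] have "lps r (carrier G) (%x. u (inv g \<otimes> x))" using u(1) by simp
  then have "lps r (carrier G) (%x. if x \<in> carrier G then u (inv g \<otimes> x) else 0)"
   using lp_summable_cong[of "carrier G" "%x. if x \<in> carrier G then u (inv g \<otimes> x) else 0" "%x. u (inv g \<otimes> x)" r] by simp
  then show ?thesis unfolding u(2) dl_linear(3)[OF g] Ub_def by blast
 qed
qed

lemma sub_Yc: "sub Yc"
proof -
 have "bd (h + h') x = bd h x + bd h' x" for h h' x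
  by (auto simp: bd_def sum.distrib)
 moreover have "bd (cs c h) x = c * bd h x" for c h x
  by (auto simp: bd_def sum_distrib_left right_diff_distrib)
 moreover have "bd 0 x = 0" for x by (simp add: bd_def)
 ultimately show ?thesis using Zl_0 Zl_add Zl_scale Zl_shift bd_shift by (auto simp: sub_def Yc_def)
qed

end

text \<open>The case of \<open>lower_frame\<close> without test vectors; it provides the lower bound
  when n = 1.\<close>

lemma (in sofic_data) lower_zero:
 assumes g: "g \<in> carrier G" "g ~= \<one>"
 shows "ereal 0 <= lower_sofic_dim (ereal r) G V act d \<sigma> S \<rho>"
proof (rule lower_frame[where n = 0 and e = "%_. 0"])
 show "\<forall>\<^sub>F i in sequentially. 0 < d i" by (rule hamming_one(2)[OF g(1) one_closed g(2)])
 fix \<eta> :: real assume "0 < \<eta>"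
 then have le: "(0 - \<eta>) * real (d i) <= real (card B)" for i and B :: "(nat => nat => complex) set"
  using mult_nonneg_nonneg[of \<eta> "real (d i)"] by (simp add: order_trans[of "- (\<eta> * real (d i))" 0])
 show "\<exists>\<epsilon>2>0. \<forall>F m \<delta>. finite F & F \<subseteq> carrier G & 0 < \<delta> -->
   (\<forall>\<^sub>F i in sequentially. \<forall>(B :: (nat => nat => complex) set) v. finite B -->
    (\<forall>\<tau>. hom_like i F m \<delta> \<tau> --> (EX c. \<forall>k\<in>{1..0}. lpn r {1..d i} (%x. \<tau> 0 x - (\<Sum>b\<in>B. c b * v b k x)) <= \<epsilon>2)) -->
    (0 - \<eta>) * real (d i) <= real (card B))"
  by (rule exI[of _ 1]) (intro conjI allI impI always_eventually zero_less_one le)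
qed (rule Z0)

section \<open>Cohomology and homology in degree one and above\<close>

context edge_chains begin

abbreviation ac :: "'a => ('a list => complex) set => ('a list => complex) set" where
 "ac \<equiv> quotient_act (chain_act G)"

lemma one_n: "1 \<in> {1..n}" "n \<in> {1..n}" using n_pos by auto

lemma a1: "a 1 \<in> carrier G" "a 1 ~= \<one>"
 using free_generators_distinct(1)[OF free one_n(1) one_n(1)] a_closed[OF one_n(1)] by auto

context
 fixes S :: "nat => ('a list => complex) set" and \<rho> d \<sigma>
 assumes prod: "product_norm \<rho>" and sof: "sofic_approximation G d \<sigma>"
begin

lemma coh_data:
 assumes gen: "generating_sequence G (lp_cohomology (ereal r) X 1) ac S"
 shows "sofic_data G (lp_cohomology (ereal r) X 1) ac Zl (quo Ub) (Qm Ub) shift r S \<rho> d \<sigma>"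
 by (rule sofic_data.intro[OF quotient_rep[OF sub_Ub sub_Zl, folded cohomology_eq] sofic_data_axioms.intro[OF r gen prod sof]])

lemma hom_data:
 assumes gen: "generating_sequence G (lp_homology (ereal r) X 1) ac S"
 shows "sofic_data G (lp_homology (ereal r) X 1) ac Yc (quo {0}) (Qm {0}) shift r S \<rho> d \<sigma>"
 by (rule sofic_data.intro[OF quotient_rep[OF sub_zero sub_Yc, folded homology_eq] sofic_data_axioms.intro[OF r gen prod sof]])

text \<open>The n edges at \<one> generate, and modulo coboundaries they satisfy the relation
  \<open>chi_dl\<close>. The inverse generators appear as b j because they move the edge (\<one>, j)
  to the one ending at \<one>.\<close>

lemma coh_upper:
 assumes gen: "generating_sequence G (lp_cohomology (ereal r) X 1) ac S"
 shows "sofic_dim (ereal r) G (lp_cohomology (ereal r) X 1) ac d \<sigma> S \<rho> <= ereal (real n - 1)"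
proof (rule sofic_data.upper_bound[OF coh_data[OF gen] n_pos, where e = edge and b = "%j. inv (a j)"])
 show "edge j \<in> Zl" if "j \<in> {1..n}" for j by (rule edge_Zl[OF that])
 show "inv (a j) \<in> carrier G" if "j \<in> {1..n}" for j using that by simp
 show "EX P. (\<forall>p\<in>set P. fst (snd p) \<in> carrier G & snd (snd p) \<in> {1..n}) & quo Ub (f - lcomb (%(c, g, j). shift g (edge j)) P) < \<epsilon>"
  if f: "f \<in> Zl" "0 < \<epsilon>" for f \<epsilon>
 proof -
  obtain P where P: "\<forall>p\<in>set P. fst (snd p) \<in> carrier G & snd (snd p) \<in> {1..n}" "lcomb (%(c, g, j). shift g (edge j)) P \<in> Zl"
   "nrm (f - lcomb (%(c, g, j). shift g (edge j)) P) < \<epsilon>" using finite_approx[OF f] by (elim exE conjE) (rule that)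
  show ?thesis using P(1) order_le_less_trans[OF quo_props(2)[OF sub_Ub Zl_minus[OF f(1) P(2)]] P(3)] by blast
 qed
 show "quo Ub (\<Sum>j=1..n. shift (inv (a j)) (edge j) - edge j) = 0"
  unfolding chi_dl(2) by (rule quo_props(6)[OF sub_Ub]) (unfold Ub_def, intro imageI CollectI chi_dl(1))
 show "inv (a n) [^] k ~= \<one>" if "0 < k" for k :: nat by (rule inv_power_not_one[OF one_n(2) that])
qed

text \<open>Serves cohomology and homology alike: U consists of coboundaries, so \<open>prj\<close>
  annihilates its closure and is bounded for the quotient norm.\<close>

lemma lower_general:
 assumes data: "sofic_data G V ac Y (quo U) (Qm U) shift r S \<rho> d \<sigma>" and n2: "2 <= n" and r2: "1 < r" "r <= 2"
  and U: "sub U" "U \<subseteq> Ub" and Y: "Y \<subseteq> Zl" and e: "!!k. k \<in> {1..n} ==> e k \<in> Y"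
  and pe: "!!k. k \<in> {1..n} ==> green.prj G n a (e k) = green.prj G n a (edge k)"
 shows "ereal (real n - 1) <= lower_sofic_dim (ereal r) G V ac d \<sigma> S \<rho>"
proof -
 interpret gr: green G n a r by (intro green.intro free_gens_axioms green_axioms.intro n2 r2)
 have sm: "lps r edges h" if "h \<in> Zl" for h using that by (simp add: Zl_def)
 have padd: "gr.prj (f + f') = gr.prj f + gr.prj f'" if "f \<in> Zl" "f' \<in> Zl" for f f'
  using gr.prj_add[OF sm[OF that(1)] sm[OF that(2)]] by (simp add: plus_fun_def)
 \<comment> \<open>\<open>prj_dl\<close> covers the coboundaries themselves; boundedness of
   \<open>prj\<close> extends the vanishing to their limits.\<close>
 have pk: "nrm (gr.prj k) <= 0" if k: "k \<in> cl U" for k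
 proof (rule field_le_epsilon)
  fix \<eta> :: real assume "0 < \<eta>"
  then have "0 < \<eta> / gr.Cp" using gr.Cp_pos by simp
  then obtain u where u: "u \<in> U" "nrm (k - u) < \<eta> / gr.Cp" using k unfolding cl_def by blast
  obtain w where w: "lps r (carrier G) w" "u = dl w" using u(1) U(2) by (auto simp: Ub_def)
  have Z: "k \<in> Zl" "u \<in> Zl" using k u(1) U(1) by (auto simp: cl_def sub_def)
  have "gr.prj k = gr.prj ((k - u) + u)" by simp
  also have "\<dots> = gr.prj (k - u) + gr.prj u" by (rule padd[OF Zl_minus[OF Z] Z(2)])
  finally have "nrm (gr.prj k) = nrm (gr.prj (k - u))"
   using gr.prj_dl[OF w(1)] unfolding w(2) by (intro lp_norm_cong) simp
  also have "\<dots> <= gr.Cp * nrm (k - u)" by (rule gr.prj_bound(2)[OF sm[OF Zl_minus[OF Z]]])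
  also have "\<dots> <= gr.Cp * (\<eta> / gr.Cp)" using u(2) gr.Cp_pos by (intro mult_left_mono) auto
  finally show "nrm (gr.prj k) <= 0 + \<eta>" using gr.Cp_pos by simp
 qed
 have key: "nrm (gr.prj h) <= gr.Cp * quo U h" if h: "h \<in> Zl" for h
 proof -
  have "nrm (gr.prj h) / gr.Cp <= quo U h"
  proof (rule quo_props(3)[OF U(1)])
   fix k assume k: "k \<in> cl U"
   have kZ: "k \<in> Zl" using k by (simp add: cl_def)
   have "nrm (gr.prj h) = nrm (%e. gr.prj (h + k) e - gr.prj k e)"
    unfolding padd[OF h kZ] by (intro lp_norm_cong) simp
   also have "\<dots> <= nrm (gr.prj (h + k)) + nrm (gr.prj k)"
    by (rule lp_minus(2)[OF r gr.prj_bound(1)[OF sm[OF Zl_add[OF h kZ]]] gr.prj_bound(1)[OF sm[OF kZ]]])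
   also have "\<dots> <= gr.Cp * nrm (h + k)" using gr.prj_bound(2)[OF sm[OF Zl_add[OF h kZ]]] pk[OF k] by linarith
   finally have c: "nrm (gr.prj h) <= gr.Cp * nrm (h + k)" .
   have dv: "q / gr.Cp <= t" if "q <= gr.Cp * t" for q t :: real using that gr.Cp_pos by (simp add: pos_divide_le_eq mult.commute)
   show "nrm (gr.prj h) / gr.Cp <= nrm (h + k)" by (rule dv[OF c])
  qed
  then show ?thesis using gr.Cp_pos by (simp add: pos_divide_le_eq mult.commute)
 qed
 show ?thesis
 proof (rule sofic_data.lower_trace[OF data n2 r2(2) gr.Cp_pos, where \<Phi> = gr.prj and e = e and ?g0.0 = "a 1"])
  show "gr.prj (f + f') = gr.prj f + gr.prj f'" if "f \<in> Y" "f' \<in> Y" for f f' by (rule padd) (use that Y in auto)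
  show "gr.prj (cs c f) = cs c (gr.prj f)" for c f by (rule gr.prj_scale)
  show "lps r edges (gr.prj f)" if "f \<in> Y" for f by (rule gr.prj_bound(1)[OF sm]) (use that Y in auto)
  show "nrm (gr.prj f) <= gr.Cp * quo U f" if "f \<in> Y" for f by (rule key) (use that Y in auto)
  show "gr.prj (shift g f) (x, j) = gr.prj f (inv g \<otimes> x, j)" if "g \<in> carrier G" "x \<in> carrier G" for g f x j
   using gr.prj_shift[OF that(1), of f] that(2) by (simp add: shift_def)
  show "e k \<in> Y" if "k \<in> {1..n}" for k by (rule e[OF that])
  show "gr.prj (e k) (\<one>, k) = of_real ((real n - 1) / real n)" if "k \<in> {1..n}" for k
   unfolding pe[OF that] by (rule gr.prj_edge_diag[OF that])
  show "(%y. (cmod (gr.prj (e k) y))\<^sup>2) summable_on edges" if "k \<in> {1..n}" for k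
   unfolding pe[OF that] by (rule gr.prj_edge_norm(1)[OF that])
  show "(\<Sum>\<^sub>\<infinity>y\<in>edges. (cmod (gr.prj (e k) y))\<^sup>2) <= (real n - 1) / real n" if "k \<in> {1..n}" for k
   unfolding pe[OF that] gr.prj_edge_norm(2)[OF that] by (rule order_refl)
  show "a 1 \<in> carrier G" "a 1 ~= \<one>" by (rule a1)+
 qed
qed

text \<open>Three regimes: the bound is 0 for n = 1, the projection serves r > 1, and flows serve r
  = 1.\<close>

lemma coh_lower:
 assumes gen: "generating_sequence G (lp_cohomology (ereal r) X 1) ac S" and r2: "r <= 2"
 shows "ereal (real n - 1) <= lower_sofic_dim (ereal r) G (lp_cohomology (ereal r) X 1) ac d \<sigma> S \<rho>"
proof (cases "n = 1")
 case True
 then show ?thesis using sofic_data.lower_zero[OF coh_data[OF gen] a1] by simp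
next
 case False
 then have n2: "2 <= n" using n_pos by simp
 show ?thesis
 proof (cases "r = 1")
  case False
  then have "1 < r" using r by simp
  then show ?thesis
   by (rule lower_general[OF coh_data[OF gen] n2 _ r2 sub_Ub order_refl order_refl, where e = edge]) (auto intro: edge_Zl)
 next
  case True
  have "l1_data G n a (lp_cohomology (ereal r) X 1) ac Zl (quo Ub) (Qm Ub) shift r S \<rho> d \<sigma>"
  proof (intro l1_data.intro l1_data_axioms.intro free_gens_axioms coh_data[OF gen])
   show "r = 1" "2 <= n" by (rule True, rule n2)
   show "lps r edges h" if "h \<in> Zl" for h using that by (simp add: Zl_def)
   show "shift g h (x, j) = h (inv g \<otimes> x, j)" if "x \<in> carrier G" for g h x j using that by (simp add: shift_def)
   show "edge k \<in> Zl" if "k \<in> {1..n}" for k by (rule edge_Zl[OF that])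
   \<comment> \<open>One half of \<eta> pays for the infimum in \<open>quo\<close>, the other for
     replacing a limit of coboundaries by a coboundary.\<close>
   show "EX u. lps r (carrier G) u & nrm (%e. h e - dl u e) <= quo Ub h + \<eta>" if h: "h \<in> Zl" and eta: "0 < \<eta>" for h \<eta>
   proof -
    have "0 < \<eta> / 2" using eta by simp
    from quo_props(4)[OF sub_Ub this, of h] obtain k where k: "k \<in> cl Ub" "nrm (h + k) < quo Ub h + \<eta> / 2" by blast
    from k(1) \<open>0 < \<eta> / 2\<close> obtain u where u: "u \<in> Ub" "nrm (k - u) < \<eta> / 2" unfolding cl_def by blast
    obtain w where w: "lps r (carrier G) w" "u = dl w" using u(1) by (auto simp: Ub_def)
    have Z: "k \<in> Zl" "u \<in> Zl" using k(1) u(1) sub_Ub by (auto simp: cl_def sub_def)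
    have "(%e. h e - dl (%x. -1 * w x) e) = (h + k) - (k - u)"
     unfolding w(2) dl_linear(2)[symmetric] by (auto simp: fun_eq_iff)
    then have "nrm (%e. h e - dl (%x. -1 * w x) e) <= nrm (h + k) + nrm (k - u)"
     using nrm_minus[OF Zl_add[OF h Z(1)] Zl_minus[OF Z]] by (simp only:)
    then have "nrm (%e. h e - dl (%x. -1 * w x) e) <= quo Ub h + \<eta>" using k(2) u(2) by linarith
    then show ?thesis using lp_scale(1)[OF r w(1), of "-1"] by blast
   qed
  qed
  then show ?thesis by (rule l1_data.lower_l1)
 qed
qed

text \<open>The projected edges generate the cycles: \<open>prj\<close> is bounded, equivariant and
  the identity on cycles, so density carries over from the edges. The relation becomes exact because
  \<open>prj\<close> annihilates the coboundary in \<open>chi_dl\<close>.\<close>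

lemma hom_upper_lower:
 assumes gen: "generating_sequence G (lp_homology (ereal r) X 1) ac S" and n2: "2 <= n" and r2: "1 < r" "r <= 2"
 shows "sofic_dim (ereal r) G (lp_homology (ereal r) X 1) ac d \<sigma> S \<rho> <= ereal (real n - 1)"
  "ereal (real n - 1) <= lower_sofic_dim (ereal r) G (lp_homology (ereal r) X 1) ac d \<sigma> S \<rho>"
proof -
 interpret gr: green G n a r by (intro green.intro free_gens_axioms green_axioms.intro n2 r2)
 have sm: "lps r edges h" if "h \<in> Zl" for h using that by (simp add: Zl_def)
 have padd: "gr.prj (f + f') = gr.prj f + gr.prj f'" if "f \<in> Zl" "f' \<in> Zl" for f f'
  using gr.prj_add[OF sm[OF that(1)] sm[OF that(2)]] by (simp add: plus_fun_def)
 have pdiff: "gr.prj (f - f') = gr.prj f - gr.prj f'" if "f \<in> Zl" "f' \<in> Zl" for f f'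
 proof -
  have "gr.prj ((f - f') + f') = gr.prj (f - f') + gr.prj f'" by (rule padd[OF Zl_minus[OF that] that(2)])
  then show ?thesis unfolding diff_add_cancel eq_diff_eq by (rule sym)
 qed
 have p0: "gr.prj 0 = 0" using pdiff[OF Zl_0 Zl_0] by simp
 have pZ: "gr.prj f \<in> Zl" if "f \<in> Zl" for f
  using gr.prj_bound(1)[OF sm[OF that]] by (auto simp: Zl_def gr.prj_def)
 have pY: "gr.prj f \<in> Yc" if "f \<in> Zl" for f
  using pZ[OF that] gr.bd_prj[OF sm[OF that]] by (simp add: Yc_def)
 have pid: "gr.prj f = f" if f: "f \<in> Yc" for f
 proof
  fix e
  show "gr.prj f e = f e"
  proof (cases "e \<in> edges")
   case True
   show ?thesis by (rule gr.prj_cycle[OF _ True]) (use f in \<open>simp add: Yc_def\<close>)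
  next
   case False
   then have "f e = 0" using f unfolding Yc_def Zl_def by blast
   then show ?thesis unfolding gr.prj_def if_not_P[OF False] by (rule sym)
  qed
 qed
 define w where "w = (%j. gr.prj (edge j))"
 have wY: "w j \<in> Yc" if "j \<in> {1..n}" for j unfolding w_def by (rule pY[OF edge_Zl[OF that]])
 have comb: "lcomb (%(c, g, j). shift g (edge j)) P \<in> Zl &
   lcomb (%(c, g, j). shift g (w j)) P = gr.prj (lcomb (%(c, g, j). shift g (edge j)) P)"
  if "\<forall>p\<in>set P. fst (snd p) \<in> carrier G & snd (snd p) \<in> {1..n}" for P :: "'a comb"
  using that
 proof (induction P)
  case Nil
  show ?case unfolding lcomb_Nil p0 using Zl_0 by blast
 next
  case (Cons p P)
  obtain c g j where p: "p = (c, g, j)" by (metis surj_pair)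
  have gj: "g \<in> carrier G" "j \<in> {1..n}" using Cons.prems p by auto
  note sZ = Zl_shift[OF gj(1) edge_Zl[OF gj(2)]]
  have ih: "lcomb (%(c, g, j). shift g (edge j)) P \<in> Zl"
   "lcomb (%(c, g, j). shift g (w j)) P = gr.prj (lcomb (%(c, g, j). shift g (edge j)) P)" using Cons by auto
  have q: "gr.prj (cs c (shift g (edge j))) = cs c (shift g (w j))"
   unfolding w_def gr.prj_shift[OF gj(1), symmetric] by (rule gr.prj_scale)
  show ?case unfolding lcomb_Cons p fst_conv prod.case padd[OF Zl_scale[OF sZ] ih(1)] q ih(2)
   using Zl_add[OF Zl_scale[OF sZ] ih(1)] by blast
 qed
 have psum: "finite I ==> (!!i. i \<in> I ==> f i \<in> Zl) ==> (\<Sum>i\<in>I. f i) \<in> Zl & gr.prj (\<Sum>i\<in>I. f i) = (\<Sum>i\<in>I. gr.prj (f i))" for I :: "nat set" and f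
 proof (induction I rule: finite_induct)
  case empty
  show ?case unfolding sum.empty using Zl_0 p0 by blast
 next
  case (insert i I)
  then have "(\<Sum>i\<in>I. f i) \<in> Zl" "gr.prj (\<Sum>i\<in>I. f i) = (\<Sum>i\<in>I. gr.prj (f i))" "f i \<in> Zl" by auto
  then show ?case unfolding sum.insert[OF insert.hyps] using Zl_add padd by metis
 qed
 have rel: "(\<Sum>j=1..n. shift (inv (a j)) (w j) - w j) = 0"
 proof -
  have s: "shift (inv (a j)) (edge j) - edge j \<in> Zl" if "j \<in> {1..n}" for j
   using that by (intro Zl_minus Zl_shift edge_Zl) auto
  have "(\<Sum>j=1..n. shift (inv (a j)) (w j) - w j) = (\<Sum>j=1..n. gr.prj (shift (inv (a j)) (edge j) - edge j))"
  proof (intro sum.cong refl)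
   fix j assume j: "j \<in> {1..n}"
   then have ia: "inv (a j) \<in> carrier G" by simp
   show "shift (inv (a j)) (w j) - w j = gr.prj (shift (inv (a j)) (edge j) - edge j)"
    unfolding pdiff[OF Zl_shift[OF ia edge_Zl[OF j]] edge_Zl[OF j]] gr.prj_shift[OF ia] w_def ..
  qed
  also have "\<dots> = gr.prj (\<Sum>j=1..n. shift (inv (a j)) (edge j) - edge j)"
   using psum[of "{1..n}" "%j. shift (inv (a j)) (edge j) - edge j"] s by simp
  also have "\<dots> = 0" unfolding chi_dl(2) by (rule ext) (simp add: gr.prj_dl[OF chi_dl(1)])
  finally show ?thesis .
 qed
 show "sofic_dim (ereal r) G (lp_homology (ereal r) X 1) ac d \<sigma> S \<rho> <= ereal (real n - 1)"
 proof (rule sofic_data.upper_bound[OF hom_data[OF gen] n_pos, where e = w and b = "%j. inv (a j)"])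
  show "w j \<in> Yc" if "j \<in> {1..n}" for j by (rule wY[OF that])
  show "inv (a j) \<in> carrier G" if "j \<in> {1..n}" for j using that by simp
  show "EX P. (\<forall>p\<in>set P. fst (snd p) \<in> carrier G & snd (snd p) \<in> {1..n}) & quo {0} (f - lcomb (%(c, g, j). shift g (w j)) P) < \<epsilon>"
   if f: "f \<in> Yc" "0 < \<epsilon>" for f \<epsilon>
  proof -
   have fZ: "f \<in> Zl" using f by (simp add: Yc_def)
   have "0 < \<epsilon> / gr.Cp" using f(2) gr.Cp_pos by simp
   from finite_approx[OF fZ this] obtain P where P: "\<forall>p\<in>set P. fst (snd p) \<in> carrier G & snd (snd p) \<in> {1..n}" "lcomb (%(c, g, j). shift g (edge j)) P \<in> Zl"
    "nrm (f - lcomb (%(c, g, j). shift g (edge j)) P) < \<epsilon> / gr.Cp" by (elim exE conjE) (rule that)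
   define y where "y = lcomb (%(c, g, j). shift g (edge j)) P"
   have y: "y \<in> Zl" "nrm (f - y) < \<epsilon> / gr.Cp" using P(2,3) by (simp_all add: y_def)
   have e: "f - lcomb (%(c, g, j). shift g (w j)) P = gr.prj (f - y)"
    unfolding pdiff[OF fZ y(1)] pid[OF f(1)] using comb[OF P(1)] by (simp add: y_def)
   have "quo {0} (gr.prj (f - y)) <= nrm (gr.prj (f - y))" by (rule quo_props(2)[OF sub_zero pZ[OF Zl_minus[OF fZ y(1)]]])
   also have "\<dots> <= gr.Cp * nrm (f - y)" by (rule gr.prj_bound(2)[OF sm[OF Zl_minus[OF fZ y(1)]]])
   also have "\<dots> < gr.Cp * (\<epsilon> / gr.Cp)" by (rule mult_strict_left_mono[OF y(2) gr.Cp_pos])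
   also have "\<dots> = \<epsilon>" using gr.Cp_pos by simp
   finally show ?thesis using P(1) unfolding e[symmetric] by blast
  qed
  show "quo {0} (\<Sum>j=1..n. shift (inv (a j)) (w j) - w j) = 0"
   unfolding rel by (rule quo_props(6)[OF sub_zero]) simp
  show "inv (a n) [^] k ~= \<one>" if "0 < k" for k :: nat by (rule inv_power_not_one[OF one_n(2) that])
 qed
 show "ereal (real n - 1) <= lower_sofic_dim (ereal r) G (lp_homology (ereal r) X 1) ac d \<sigma> S \<rho>"
 proof (rule lower_general[OF hom_data[OF gen] n2 r2 sub_zero, where e = w])
  have "0 \<in> Ub" using sub_Ub unfolding sub_def by blast
  then show "{0} \<subseteq> Ub" by simp
  show "Yc \<subseteq> Zl" by (auto simp: Yc_def)
  show "w k \<in> Yc" if "k \<in> {1..n}" for k by (rule wY[OF that])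
  show "gr.prj (w k) = gr.prj (edge k)" if "k \<in> {1..n}" for k
   unfolding w_def by (rule pid[OF wY[OF that], unfolded w_def])
 qed
qed

text \<open>For n = 1 the tree is a line; a cycle is constant along it, and a nonzero constant is
  not summable.\<close>

lemma cyclic_cycles_zero:
 assumes n1: "n = 1"
 shows "Yc = {0}"
proof -
 have "h = 0" if h: "h \<in> Yc" for h
 proof
  fix e :: "'a \<times> nat"
  have hs: "(%e. cmod (h e) powr r) summable_on edges" and off: "!!e. e \<notin> edges ==> h e = 0" and bd0: "!!x. bd h x = 0"
   using h unfolding Yc_def Zl_def lp_summable_ereal by blast+
  show "h e = 0 e"
  proof (cases "e \<in> edges")
   case True
   then obtain x where e: "e = (x, 1)" and x: "x \<in> carrier G" using n1 by (cases e) auto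
   have pc: "a 1 [^] k \<in> carrier G" for k :: nat by (rule nat_pow_closed[OF a1(1)])
   have const: "h (x \<otimes> a 1 [^] k, 1) = h e" for k :: nat
   proof (induction k)
    case (Suc k)
    have "bd h (x \<otimes> a 1 [^] Suc k) = h (x \<otimes> a 1 [^] Suc k, 1) - h (x \<otimes> a 1 [^] k, 1)"
    proof -
     have "x \<otimes> a 1 [^] Suc k \<otimes> inv (a 1) = x \<otimes> a 1 [^] k" using x a1(1) pc by (simp add: m_assoc)
     moreover have "{1..n} = {1 :: nat}" using n1 by simp
     moreover have "x \<otimes> a 1 [^] Suc k \<in> carrier G" using x pc by (rule m_closed)
     ultimately show ?thesis unfolding bd_def by (simp only: if_True sum.insert sum.empty finite.emptyI empty_iff not_False_eq_True add_0_right)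
    qed
    then show ?case using bd0 Suc by simp
   qed (use x e in simp)
   have inj: "inj_on (%k. (x \<otimes> a 1 [^] k, 1 :: nat)) {..<m}" for m :: nat
   proof (rule inj_onI)
    fix k l :: nat assume "(x \<otimes> a 1 [^] k, 1 :: nat) = (x \<otimes> a 1 [^] l, 1)"
    then have "a 1 [^] k = a 1 [^] l" using x pc by simp
    then show "k = l" using len_power_gen[OF one_n(1)] by metis
   qed
   have le: "real m * cmod (h e) powr r <= (\<Sum>\<^sub>\<infinity>e\<in>edges. cmod (h e) powr r)" for m
   proof -
    have "real m * cmod (h e) powr r = (\<Sum>q\<in>(%k. (x \<otimes> a 1 [^] k, 1)) ` {..<m}. cmod (h q) powr r)"
     unfolding sum.reindex[OF inj] o_def const by simp
    also have "\<dots> <= (\<Sum>\<^sub>\<infinity>e\<in>edges. cmod (h e) powr r)"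
     by (rule finite_sum_le_infsum[OF hs]) (use x pc one_n(1) in auto)
    finally show ?thesis .
   qed
   have "cmod (h e) powr r = 0"
   proof (rule ccontr)
    assume "cmod (h e) powr r ~= 0"
    then have "0 < cmod (h e) powr r" by simp
    then obtain m where "(\<Sum>\<^sub>\<infinity>e\<in>edges. cmod (h e) powr r) < real m * cmod (h e) powr r"
     using ex_less_of_nat_mult by blast
    then show False using le[of m] by linarith
   qed
   then show ?thesis by simp
  qed (simp add: off)
 qed
 then show ?thesis using sub_Yc unfolding sub_def by blast
qed

text \<open>All cycles vanish, so 0 serves as the single generator.\<close>

lemma hom_cyclic:
 assumes gen: "generating_sequence G (lp_homology (ereal r) X 1) ac S" and n1: "n = 1"
 shows "sofic_dim (ereal r) G (lp_homology (ereal r) X 1) ac d \<sigma> S \<rho> <= ereal (real n - 1)"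
proof (rule sofic_data.upper_bound[OF hom_data[OF gen] n_pos, where e = "%_. 0" and b = "%j. inv (a j)"])
 have s0: "shift g 0 = 0" for g by (auto simp: shift_def fun_eq_iff)
 have q0: "quo {0} 0 = 0" by (rule quo_props(6)[OF sub_zero]) simp
 show "0 \<in> Yc" using sub_Yc unfolding sub_def by blast
 show "inv (a j) \<in> carrier G" if "j \<in> {1..n}" for j using that by simp
 show "EX P. (\<forall>p\<in>set P. fst (snd p) \<in> carrier G & snd (snd p) \<in> {1..n}) & quo {0} (f - lcomb (%(c, g, j). shift g 0) P) < \<epsilon>"
  if f: "f \<in> Yc" "0 < \<epsilon>" for f \<epsilon>
 proof (rule exI[of _ "[]"], rule conjI)
  have f0: "f = 0" using f(1) unfolding cyclic_cycles_zero[OF n1] by simp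
  show "quo {0} (f - lcomb (%(c, g, j). shift g 0) []) < \<epsilon>" unfolding lcomb_Nil f0 diff_zero q0 by (rule f(2))
 qed simp
 have "(\<Sum>j=1..n. shift (inv (a j)) 0 - (0 :: 'a \<times> nat => complex)) = 0" unfolding s0 diff_zero by (rule sum.neutral_const)
 then show "quo {0} (\<Sum>j=1..n. shift (inv (a j)) 0 - 0) = 0" using q0 by (simp only:)
 show "inv (a n) [^] k ~= \<one>" if "0 < k" for k :: nat by (rule inv_power_not_one[OF one_n(2) that])
qed

end

lemma hom_one:
 assumes r_eq: "r = 1"
 shows "vcarrier (lp_homology (ereal r) X 1) = {vzero (lp_homology (ereal r) X 1)}" "cycles (ereal r) X 1 = {%_. 0}"
proof -
 have "h = 0" if "h \<in> Yc" for h
 proof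
  fix e
  show "h e = 0 e"
  proof (cases "e \<in> edges")
   case True
   have hY: "lps r edges h" "ALL x. bd h x = 0" using that unfolding Yc_def Zl_def by blast+
   have "h e = 0" by (rule l1_cycle_zero[OF hY(1)[unfolded r_eq] _ True]) (use hY(2) in blast)
   then show ?thesis by simp
  next
   case False
   then have "h e = 0" using that unfolding Yc_def Zl_def by blast
   then show ?thesis by simp
  qed
 qed
 then have Y: "Yc = {0}" using sub_Yc unfolding sub_def by blast
 note rp = quotient_rep[OF sub_zero sub_Yc, folded homology_eq]
 show "vcarrier (lp_homology (ereal r) X 1) = {vzero (lp_homology (ereal r) X 1)}"
  unfolding normed_rep.car[OF rp] normed_rep.Q0[OF rp] Y by simp
 show "cycles (ereal r) X 1 = {%_. 0}" unfolding cycles_image Yc_def[symmetric] Y by (simp add: J_0)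
qed

text \<open>The tree has no simplices with three or more vertices, so the chain spaces in degree at
  least 2 are zero.\<close>

lemma higher_trivial:
 assumes m: "2 <= m"
 shows "vcarrier (lp_cohomology p X m) = {vzero (lp_cohomology p X m)}" "vcarrier (lp_homology p X m) = {vzero (lp_homology p X m)}"
proof -
 have z: "vcarrier (lp_chains p X (Suc m)) = {%_. 0}" using m by (intro zero_chains) simp
 have v: "vzero (lp_chains p X (Suc m)) = (%_. 0)" by (simp add: lp_chains_def)
 have c: "cocycles p X m = {%_. 0}" unfolding cocycles_def z by (auto simp: coboundary_def)
 have h: "cycles p X m = {%_. 0}" unfolding cycles_def z by (auto simp: boundary_def)
 show "vcarrier (lp_cohomology p X m) = {vzero (lp_cohomology p X m)}"
  unfolding lp_cohomology_def vquotient_def c by (simp add: v)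
 show "vcarrier (lp_homology p X m) = {vzero (lp_homology p X m)}"
  unfolding lp_homology_def vquotient_def h by (simp add: v)
qed

end

theorem theorem5p7:
  fixes G :: "('g, 'b) monoid_scheme" and a :: "nat \<Rightarrow> 'g" and n :: nat
    and d :: "nat \<Rightarrow> nat" and \<sigma> :: "nat \<Rightarrow> 'g \<Rightarrow> nat \<Rightarrow> nat"
  defines "X \<equiv> cayley_complex G n a"
    and "act \<equiv> quotient_act (chain_act G)"
  assumes "n \<ge> 1"
    and "free_generators G n a"
    and "sofic_approximation G d \<sigma>"
  shows
    "(\<forall>p S \<rho>. 1 \<le> p \<and> p \<le> 2 \<and>
        generating_sequence G (lp_cohomology p X 1) act S \<and> product_norm \<rho> \<longrightarrow>
        sofic_dim p G (lp_cohomology p X 1) act d \<sigma> S \<rho> = ereal (real n - 1) \<and>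
        lower_sofic_dim p G (lp_cohomology p X 1) act d \<sigma> S \<rho> = ereal (real n - 1))
     \<and> (\<forall>p m. 1 \<le> p \<and> 2 \<le> m \<longrightarrow>
        vcarrier (lp_cohomology p X m) = {vzero (lp_cohomology p X m)})
     \<and> (\<forall>p S \<rho>. 1 < p \<and> p < 2 \<and>
        generating_sequence G (lp_homology p X 1) act S \<and> product_norm \<rho> \<longrightarrow>
        sofic_dim p G (lp_homology p X 1) act d \<sigma> S \<rho> = ereal (real n - 1) \<and>
        lower_sofic_dim p G (lp_homology p X 1) act d \<sigma> S \<rho> = ereal (real n - 1))
     \<and> (vcarrier (lp_homology 1 X 1) = {vzero (lp_homology 1 X 1)} \<and> cycles 1 X 1 = {\<lambda>_. 0})
     \<and> (\<forall>p m. 1 \<le> p \<and> 2 \<le> m \<longrightarrow>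
        vcarrier (lp_homology p X m) = {vzero (lp_homology p X m)})"
proof -
 have G: "group G" using assms(4) by (simp add: free_generators_def)
 have fg: "free_gens G n a" by (intro free_gens.intro free_gens_axioms.intro G assms(3,4))
 have ec: "edge_chains G n a r" if "1 <= r" for r by (intro edge_chains.intro edge_chains_axioms.intro fg that)
 have fin: "EX r. p = ereal r" if "1 <= p" "p <= 2" for p :: ereal using that by (cases p) auto
 \<comment> \<open>The lower dimension never exceeds the upper one, so an upper bound for the latter
   and a lower bound for the former determine both.\<close>
 have squeeze: "x = c & y = c" if "x <= c" "c <= y" "y <= x" for x y c :: ereal using that by (auto intro: order_antisym)
 show ?thesis
  unfolding X_def act_def
 proof (rule conjI[OF _ conjI[OF _ conjI[OF _ conjI[OF conjI]]]])
  show "\<forall>p S \<rho>. 1 <= p & p <= 2 &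
    generating_sequence G (lp_cohomology p (cayley_complex G n a) 1) (quotient_act (chain_act G)) S & product_norm \<rho> -->
    sofic_dim p G (lp_cohomology p (cayley_complex G n a) 1) (quotient_act (chain_act G)) d \<sigma> S \<rho> = ereal (real n - 1) &
    lower_sofic_dim p G (lp_cohomology p (cayley_complex G n a) 1) (quotient_act (chain_act G)) d \<sigma> S \<rho> = ereal (real n - 1)"
  proof (intro allI impI, elim conjE)
   fix p :: ereal and S \<rho>
   assume p: "1 <= p" "p <= 2" and gen: "generating_sequence G (lp_cohomology p (cayley_complex G n a) 1) (quotient_act (chain_act G)) S"
    and prod: "product_norm \<rho>"
   obtain r where pr: "p = ereal r" using fin[OF p] by blast
   have r: "1 <= r" "r <= 2" using p by (simp_all add: pr)
   note c = gen[unfolded pr]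
   show "sofic_dim p G (lp_cohomology p (cayley_complex G n a) 1) (quotient_act (chain_act G)) d \<sigma> S \<rho> = ereal (real n - 1) &
    lower_sofic_dim p G (lp_cohomology p (cayley_complex G n a) 1) (quotient_act (chain_act G)) d \<sigma> S \<rho> = ereal (real n - 1)"
    unfolding pr by (rule squeeze[OF edge_chains.coh_upper[OF ec[OF r(1)] prod assms(5) c]
     edge_chains.coh_lower[OF ec[OF r(1)] prod assms(5) c r(2)] lower_le_sofic_dim])
  qed
  show "ALL p m. 1 <= p & 2 <= m -->
    vcarrier (lp_cohomology p (cayley_complex G n a) m) = {vzero (lp_cohomology p (cayley_complex G n a) m)}"
   using edge_chains.higher_trivial(1)[OF ec[OF order_refl]] by blast
  show "\<forall>p S \<rho>. 1 < p & p < 2 &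
    generating_sequence G (lp_homology p (cayley_complex G n a) 1) (quotient_act (chain_act G)) S & product_norm \<rho> -->
    sofic_dim p G (lp_homology p (cayley_complex G n a) 1) (quotient_act (chain_act G)) d \<sigma> S \<rho> = ereal (real n - 1) &
    lower_sofic_dim p G (lp_homology p (cayley_complex G n a) 1) (quotient_act (chain_act G)) d \<sigma> S \<rho> = ereal (real n - 1)"
  proof (intro allI impI, elim conjE)
   fix p :: ereal and S \<rho>
   assume p: "1 < p" "p < 2" and gen: "generating_sequence G (lp_homology p (cayley_complex G n a) 1) (quotient_act (chain_act G)) S"
    and prod: "product_norm \<rho>"
   obtain r where pr: "p = ereal r" using fin[OF less_imp_le[OF p(1)] less_imp_le[OF p(2)]] by blast
   have r: "1 < r" "r <= 2" using p by (simp_all add: pr)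
   note e = ec[OF less_imp_le[OF r(1)]]
   note c = gen[unfolded pr]
   show "sofic_dim p G (lp_homology p (cayley_complex G n a) 1) (quotient_act (chain_act G)) d \<sigma> S \<rho> = ereal (real n - 1) &
    lower_sofic_dim p G (lp_homology p (cayley_complex G n a) 1) (quotient_act (chain_act G)) d \<sigma> S \<rho> = ereal (real n - 1)"
   proof (cases "n = 1")
    case True
    have "ereal 0 <= lower_sofic_dim (ereal r) G (lp_homology (ereal r) (cayley_complex G n a) 1) (quotient_act (chain_act G)) d \<sigma> S \<rho>"
     by (rule sofic_data.lower_zero[OF edge_chains.hom_data[OF e prod assms(5) c] edge_chains.a1[OF e]])
    moreover have "ereal 0 = ereal (real n - 1)" using True by simp
    ultimately have l: "ereal (real n - 1) <= lower_sofic_dim (ereal r) G (lp_homology (ereal r) (cayley_complex G n a) 1) (quotient_act (chain_act G)) d \<sigma> S \<rho>"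
     by simp
    show ?thesis unfolding pr by (rule squeeze[OF edge_chains.hom_cyclic[OF e prod assms(5) c True] l lower_le_sofic_dim])
   next
    case False
    then have n2: "2 <= n" using assms(3) by simp
    show ?thesis unfolding pr
     by (rule squeeze[OF edge_chains.hom_upper_lower[OF e prod assms(5) c n2 r] lower_le_sofic_dim])
   qed
  qed
  show "vcarrier (lp_homology 1 (cayley_complex G n a) 1) = {vzero (lp_homology 1 (cayley_complex G n a) 1)}"
   "cycles 1 (cayley_complex G n a) 1 = {%_. 0}"
   using edge_chains.hom_one[OF ec[OF order_refl] refl] unfolding one_ereal_def[symmetric] .
  show "ALL p m. 1 <= p & 2 <= m -->
    vcarrier (lp_homology p (cayley_complex G n a) m) = {vzero (lp_homology p (cayley_complex G n a) m)}"
   using edge_chains.higher_trivial(2)[OF ec[OF order_refl]] by blast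
 qed
qed

end
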